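(* Let $d\ge2$. For $k=2,\dots,d-1$ let $$E_k(t) := -\sum_{i=1}^{d} i p_i\, T\bigl(\operatorname{KP}_{i,k}(\mathcal{G}^{\pi_d})\bigr) + t\, \partial_tF^{\pi_d}_k(t) - k F^{\pi_d}_k(t),$$ and let $$E_1(t) := -d p_d \sum_{i=1}^{d} i p_i\, T\bigl(\operatorname{KP}_{i,d}(\mathcal{G}^{\pi_d})\bigr) + \partial_tF^{\pi_d}_1(t) - (d+1)t^{-1}F^{\pi_d}_1(t) + \sum_{i=1}^{d-1} i p_i \bigl(dF^{\pi_d}_i(t)-t\,\partial_tF^{\pi_d}_i(t)\bigr) + d\,uv .$$ Then the equations $E_k(t)=0$, $k=1,\dots,d-1$, form a system of $d-1$ coupled ordinary differential equations in the variable $t$ satisfied by $F^{\pi_d}_1(t),F^{\pi_d}_2(t),\dots,F^{\pi_d}_{d-1}(t)$.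
   Context: **Maps.** A bipartite map with $n$ labeled edges (connected or not) is equivalently a pair of permutations $(\sigma_\bullet,\sigma_\circ)$ of $\{1,\dots,n\}$; black vertices, white vertices and faces are the cycles of $\sigma_\bullet,\sigma_\circ,\sigma_\bullet\sigma_\circ$, and face degrees are the cycle lengths of the product. Let $M_{V_\bullet,V_\circ,\lambda}(n)$ be the number of those with $V_\bullet$ black vertices, $V_\circ$ white vertices and face degrees $\lambda\vdash n$, and $$\tau(t,u,v,\mathbf p)=\sum_{n\ge0}\frac{t^n}{n!}\sum_{V_\bullet,V_\circ,\lambda\vdash n}M_{V_\bullet,V_\circ,\lambda}(n)u^{V_\bullet}v^{V_\circ}p_{\lambda_1}p_{\lambda_2}\cdots,\qquad F=\ln\tau,\qquad F_{i_1,i_2,\dots}=\tfrac{\partial}{\partial p_{i_1}}\tfrac{\partial}{\partial p_{i_2}}\cdots F.$$ Fix $d\ge2$; $\pi_d$ sets $p_i=0$ for $i>d$, $\pi_d(\mathbf p)=(p_1,\dots,p_d,0,\dots)$, and $F^{\pi_d}_\lambda=\pi_dF_\lambda\in\mathbb Q[u,v,p_1,\dots,p_d][[t]]$; the dependence on $t$ is displayed as $F^{\pi_d}_k(t)$. **KP polynomials.** Let $H_\lambda$ be formal variables indexed by partitions $\lambda$, $H_\lambda$ having degree $|\lambda|$. A hook is a partition $(i,1^a)$, $i\ge1$, $a\ge0$; $\mathcal H_{\rm hook}=\{H_\lambda:\lambda\text{ hook}\}$. Let $h_k(\mathbf p)$ be defined by $\exp(\sum_{i\ge1}\frac{p_i}{i}z^i)=\sum_kh_k(\mathbf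 p)z^k$. The Hirota derivatives are $D_{i_1}\cdots D_{i_r}(\tau\cdot\tau)=\sum_{I\sqcup J=\{1,\dots,r\}}(-1)^{|J|}\tau_{i_I}\tau_{i_J}$ (subscripts on $\tau$ being partial derivatives); with $F=\ln\tau$, $\tau^{-2}D_{i_1}\cdots D_{i_r}(\tau\cdot\tau)$ is the sum over set partitions of $\{1,\dots,r\}$ into blocks $B$ of even size of $\prod_B2F_{i_B}$. Let $\check D=(D_1,2D_2,3D_3,\dots)$. A KP tau function is a series $\tau(\mathbf p)$ with $\sum_{j\ge0}h_j(-2\mathbf q)h_{j+1}(\check D)e^{\sum_iq_iD_i}(\tau\cdot\tau)=0$ identically in $\mathbf q$; it then satisfies, for $k\ge l\ge2$, $$(\star)\quad\bigl(k\,h_l(\check D)D_k+(l-1)h_{k+1}(\check D)D_{l-1}-(k+l-1)D_{k+l-1}D_1\bigr)(\tau\cdot\tau)=0.$$ By Dubrovin–Natanzon, for each $\lambda$ there is $\operatorname{KP}_\lambda\in\mathbb Q[\mathcal H_{\rm hook}]$, homogeneous of degree $|\lambda|$, such that for every KP tau function $F_\lambda$ is the evaluation of $\operatorname{KP}_\lambda$ at $H_\mu=F_\mu$; every hook $(i,1^j)$ occurring in $\operatorname{KP}_\lambda$ has $i\le|\lambda|-\ell(\lambda)+1$; and for $k,l\ge2$, $\operatorname{KP}_{(k,l)}=H_{k+l-1,1}+(\text{a polynomial not containing }H_{k+l-1,1})$. They are constructed as follows: $\operatorname{KP}_\lambda=H_\lambda$ for hooks; for non-hooks proceed by induction on $|\lambda|-\ell(\lambda)$.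 For $\lambda=(k,l)$, $k\ge l\ge2$ (by increasing $l$), divide $(\star)$ by $\tau^2$, solve for $F_{k,l}$, and substitute the already known hook expressions for $F_{k+1,l-1}$ and the other non-hook derivatives. For longer $\lambda$, differentiate the expression of $F_{\lambda_1,\dots,\lambda_{\ell-1}}$ with respect to $p_{\lambda_\ell}$, and replace each resulting $F_{i,1^a,\lambda_\ell}$ by $\partial_{p_1}^a$ of the hook expression of $F_{i,\lambda_\ell}$. Indices of $\operatorname{KP}$ may be written in any order. The series $\tau$ of bipartite maps is a KP tau function (Goulden–Jackson). **$d$-admissible expressions.** Let $\mathcal F_{d\text{-adm}}=\{F^{\pi_d}_{m,1^l}:1\le m\le d-1,\ l\ge0\}$; $d$-admissible expressions are the elements of $\mathbb Q[t,t^{-1},u,v,p_1,\dots,p_d,p_d^{-1}][\mathcal F_{d\text{-adm}}]$. For $l\ge0$ define $G_{m,1^l}=F^{\pi_d}_{m,1^l}$ for $m=1,\dots,d-1$ and, inductively for $k=0,\dots,d-1$, $$\begin{aligned}G_{d+k,1^l}=\frac1{(d+k)p_d}\Bigl[&-\sum_{\substack{i,j\ge1\\i+j=k}}ij\Bigl(\sum_{\substack{r,s\ge0\\ r+s=l}}\tbinom lrF^{\pi_d}_{i,1^r}F^{\pi_d}_{j,1^s}+\operatorname{KP}_{i,j,1^l}\big|_{H_\mu=F^{\pi_d}_\mu}\Bigr)+(k+1)t^{-1}G_{k+1,1^l}\\&-(u+v)kF^{\pi_d}_{k,1^l}-l(k+1)G_{k+1,1^{l-1}}-uv\,\delta_{k,0}\delta_{l,0}\\&-\sum_{i=1}^{d-k-1}(i+k)p_iF^{\pi_d}_{i+k,1^l}-\sum_{m=0}^{k-1}(d+m)p_{d+m-k}G_{d+m,1^l}\Bigr]\end{aligned}$$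 (terms with coefficient $k=0$ or $l=0$ are zero). Each $G_{m,1^l}$, $1\le m\le2d-1$, is $d$-admissible; $\mathcal G^{\pi_d}$ is the collection of these. $\operatorname{KP}_{i,k}(\mathcal G^{\pi_d})$ denotes $\operatorname{KP}_{i,k}$ with each $H_{m,1^l}$ replaced by $G_{m,1^l}$ (only $m\le2d-1$ occurs when $i,k\le d$). **Operator $T$.** $T$ replaces, in a $d$-admissible expression, every $F^{\pi_d}_{k,1^l}$ ($1\le k\le d-1$, $l\ge0$) by $(t^2\partial_t)^lF^{\pi_d}_k(t)$. *)

theory Defs
  imports
    "HOL-Library.Poly_Mapping"
    "HOL-Library.Multiset"
    "HOL-Library.Disjoint_Sets"
    "HOL-Computational_Algebra.Formal_Power_Series"
    "HOL-Computational_Algebra.Formal_Laurent_Series"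
    "HOL-Combinatorics.Permutations"
    "HOL-Combinatorics.Orbits"
begin

section \<open>Polynomials in arbitrarily many variables\<close>

text \<open>
  A polynomial over \<open>'c\<close> in variables indexed by \<open>'a\<close> is a finitely supported map from
  monomials, i.e. finitely supported exponent vectors \<open>'a \<Rightarrow>\<^sub>0 nat\<close>, to coefficients.
\<close>

type_synonym 'a rpoly = "('a \<Rightarrow>\<^sub>0 nat) \<Rightarrow>\<^sub>0 rat"

definition cst :: "'c::zero \<Rightarrow> 'm::zero \<Rightarrow>\<^sub>0 'c" where
  "cst c = Poly_Mapping.single 0 c"

definition pvar :: "'a \<Rightarrow> ('a \<Rightarrow>\<^sub>0 'e::{zero,one}) \<Rightarrow>\<^sub>0 'c::{zero,one}" where
  "pvar x = Poly_Mapping.single (Poly_Mapping.single x 1) 1"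

text \<open>\<open>subst_poly \<phi> f P\<close> applies \<open>\<phi>\<close> to the coefficients of \<open>P\<close> and replaces each variable \<open>x\<close>
  by \<open>f x\<close>.\<close>

definition subst_poly ::
  "('c::zero \<Rightarrow> 'b::comm_ring_1) \<Rightarrow> ('a \<Rightarrow> 'b) \<Rightarrow> (('a \<Rightarrow>\<^sub>0 nat) \<Rightarrow>\<^sub>0 'c) \<Rightarrow> 'b" where
  "subst_poly \<phi> f P = (\<Sum>m\<in>Poly_Mapping.keys P. \<phi> (Poly_Mapping.lookup P m) *
      (\<Prod>x\<in>Poly_Mapping.keys m. f x ^ Poly_Mapping.lookup m x))"

text \<open>The derivation that vanishes on constants and maps each variable \<open>x\<close> to \<open>\<delta> x\<close>.\<close>

definition derivation :: "('a \<Rightarrow> 'a rpoly) \<Rightarrow> 'a rpoly \<Rightarrow> 'a rpoly" where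
  "derivation \<delta> P = (\<Sum>m\<in>Poly_Mapping.keys P. \<Sum>x\<in>Poly_Mapping.keys m.
      Poly_Mapping.single (m - Poly_Mapping.single x 1)
        (of_nat (Poly_Mapping.lookup m x) * Poly_Mapping.lookup P m) * \<delta> x)"

text \<open>A power series with rational coefficients, read over a ring containing the rationals.\<close>

definition fps_cst :: "rat fps \<Rightarrow> ('m::comm_monoid_add \<Rightarrow>\<^sub>0 rat) fps" where
  "fps_cst f = Abs_fps (\<lambda>n. cst (fps_nth f n))"


section \<open>Bipartite maps\<close>

definition perm_cycles :: "(nat \<Rightarrow> nat) \<Rightarrow> nat \<Rightarrow> nat set set" where
  "perm_cycles \<sigma> n = orbit \<sigma> ` {1..n}"

definition num_maps :: "nat \<Rightarrow> nat \<Rightarrow> nat multiset \<Rightarrow> nat \<Rightarrow> nat" where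
  "num_maps Vb Vw \<mu> n = card {(\<sigma>, \<rho>). \<sigma> permutes {1..n} \<and> \<rho> permutes {1..n} \<and>
      card (perm_cycles \<sigma> n) = Vb \<and> card (perm_cycles \<rho> n) = Vw \<and>
      image_mset card (mset_set (perm_cycles (\<sigma> \<circ> \<rho>) n)) = \<mu>}"

definition partitions_of :: "nat \<Rightarrow> nat multiset set" where
  "partitions_of n = {\<mu>. 0 \<notin># \<mu> \<and> sum_mset \<mu> = n}"

text \<open>\<open>VarP i\<close> is the variable \<open>p\<^sub>i\<close>; it is used for \<open>i \<ge> 1\<close> only.\<close>

datatype var = VarU | VarV | VarP nat

text \<open>A permutation of an \<open>n\<close>-element set has at most \<open>n\<close> cycles, so that the ranges of the numbers
  of vertices below are no restriction.\<close>

definition map_tau :: "var rpoly fps" where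
  "map_tau = Abs_fps (\<lambda>n. cst (1 / fact n) *
      (\<Sum>Vb\<le>n. \<Sum>Vw\<le>n. \<Sum>\<mu>\<in>partitions_of n.
        of_nat (num_maps Vb Vw \<mu> n) * pvar VarU ^ Vb * pvar VarV ^ Vw *
        prod_mset (image_mset (\<lambda>i. pvar (VarP i)) \<mu>)))"

text \<open>\<open>fps_ln 1\<close> is the series of \<open>ln (1 + X)\<close>, and \<open>map_tau\<close> has constant term 1.\<close>

definition map_F :: "var rpoly fps" where
  "map_F = fps_compose (fps_cst (fps_ln 1)) (map_tau - 1)"

definition partial_p :: "nat \<Rightarrow> var rpoly \<Rightarrow> var rpoly" where
  "partial_p k = derivation (\<lambda>x. if x = VarP k then 1 else 0)"


section \<open>The ring containing the specialised series\<close>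

text \<open>
  Everything specialised by \<open>\<pi>\<^sub>d\<close> lives in the ring of Laurent series in \<open>t\<close> whose coefficients are
  Laurent polynomials in \<open>u, v, p\<^sub>1, p\<^sub>2, \<dots>\<close>; there \<open>p\<^sub>d\<close> is invertible.
\<close>

type_synonym laurent = "(var \<Rightarrow>\<^sub>0 int) \<Rightarrow>\<^sub>0 rat"
type_synonym tseries = "laurent fls"

definition proj :: "nat \<Rightarrow> var rpoly \<Rightarrow> laurent" where
  "proj d = subst_poly cst
     (\<lambda>x. case x of VarP i \<Rightarrow> if i \<le> d then pvar (VarP i) else 0 | _ \<Rightarrow> pvar x)"

text \<open>The series \<open>F\<^sub>k\<close> with \<open>p\<^sub>i = 0\<close> for \<open>i > d\<close>.\<close>

definition F_proj :: "nat \<Rightarrow> nat \<Rightarrow> tseries" where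
  "F_proj d k = fps_to_fls (Abs_fps (\<lambda>n. proj d (partial_p k (fps_nth map_F n))))"

definition tu :: tseries where "tu = fls_const (pvar VarU)"
definition tv :: tseries where "tv = fls_const (pvar VarV)"
definition tp :: "nat \<Rightarrow> tseries" where "tp i = fls_const (pvar (VarP i))"

definition tp_inv :: "nat \<Rightarrow> tseries" where
  "tp_inv i = fls_const (Poly_Mapping.single (Poly_Mapping.single (VarP i) (-1)) 1)"

definition trat :: "rat \<Rightarrow> tseries" where "trat c = fls_const (cst c)"


section \<open>The KP polynomials\<close>

text \<open>\<open>H i a\<close> is the formal variable of the hook \<open>(i, 1\<^sup>a)\<close>, \<open>i \<ge> 1\<close>.\<close>

type_synonym hook_poly = "(nat \<times> nat) rpoly"

definition H :: "nat \<Rightarrow> nat \<Rightarrow> hook_poly" where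
  "H i a = pvar (i, a)"

text \<open>The action of \<open>\<partial>/\<partial>p\<^sub>1\<close> on hook expressions.\<close>

definition hook_d1 :: "hook_poly \<Rightarrow> hook_poly" where
  "hook_d1 = derivation (\<lambda>(i, a). H i (Suc a))"

text \<open>
  In what follows \<open>K i j\<close> stands for a hook expression of \<open>F\<^sub>i\<^sub>,\<^sub>j\<close>. Differentiating a hook expression
  with respect to \<open>p\<^sub>c\<close> turns \<open>F\<close> with index \<open>(i, 1\<^sup>a)\<close> into \<open>F\<close> with index \<open>(i, 1\<^sup>a, c)\<close>, which is
  replaced by the \<open>a\<close>-th \<open>p\<^sub>1\<close>-derivative of \<open>K i c\<close>.
\<close>

definition hook_d :: "(nat \<Rightarrow> nat \<Rightarrow> hook_poly) \<Rightarrow> nat \<Rightarrow> hook_poly \<Rightarrow> hook_poly" where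
  "hook_d K c = derivation (\<lambda>(i, a). (hook_d1 ^^ a) (K i c))"

text \<open>The expression of \<open>F\<close> indexed by a partition, written as a weakly decreasing list. If
  \<open>K i 1 = K 1 i = H i 1\<close>, this is \<open>H k a\<close> for the hook \<open>(k, 1\<^sup>a)\<close> and \<open>K k l\<close> for \<open>(k, l)\<close>.\<close>

fun hook_expr :: "(nat \<Rightarrow> nat \<Rightarrow> hook_poly) \<Rightarrow> nat list \<Rightarrow> hook_poly" where
  "hook_expr K [] = 0"
| "hook_expr K (k # cs) = foldl (\<lambda>f c. hook_d K c f) (H k 0) cs"

text \<open>\<open>h\<^sub>n\<close> evaluated at the sequence \<open>p\<close>: the coefficient of \<open>z\<^sup>n\<close> in
  \<open>exp (\<Sum>i\<ge>1. p\<^sub>i / i * z\<^sup>i)\<close>.\<close>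

definition h_poly :: "(nat \<Rightarrow> 'a rpoly) \<Rightarrow> nat \<Rightarrow> 'a rpoly" where
  "h_poly p n = fps_nth (fps_compose (fps_cst (fps_exp 1))
      (Abs_fps (\<lambda>i. if i = 0 then 0 else cst (1 / of_nat i) * p i))) n"

text \<open>Polynomials in the commuting symbols \<open>D\<^sub>1, D\<^sub>2, \<dots>\<close>, and the operator in \<open>(\<star>)\<close>.\<close>

definition D :: "nat \<Rightarrow> nat rpoly" where
  "D i = pvar i"

definition D_check :: "nat \<Rightarrow> nat rpoly" where
  "D_check i = of_nat i * D i"

definition kp_star :: "nat \<Rightarrow> nat \<Rightarrow> nat rpoly" where
  "kp_star k l = of_nat k * h_poly D_check l * D k + of_nat (l - 1) * h_poly D_check (k + 1) * D (l - 1)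
     - of_nat (k + l - 1) * D (k + l - 1) * D 1"

definition indices :: "(nat \<Rightarrow>\<^sub>0 nat) \<Rightarrow> nat list" where
  "indices m = concat (map (\<lambda>i. replicate (Poly_Mapping.lookup m i) i)
      (sorted_list_of_set (Poly_Mapping.keys m)))"

text \<open>\<open>\<tau>\<^sup>-\<^sup>2 P(\<tau> \<cdot> \<tau>)\<close> for a polynomial \<open>P\<close> in the Hirota derivatives, with each derivative of
  \<open>F = ln \<tau>\<close> replaced by its hook expression.\<close>

definition hirota_monom :: "(nat \<Rightarrow> nat \<Rightarrow> hook_poly) \<Rightarrow> nat list \<Rightarrow> hook_poly" where
  "hirota_monom K xs =
     (\<Sum>P\<in>{P. partition_on {..<length xs} P \<and> (\<forall>B\<in>P. even (card B))}.
        \<Prod>B\<in>P. 2 * hook_expr K (rev (sort (nths xs B))))"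

definition hirota :: "(nat \<Rightarrow> nat \<Rightarrow> hook_poly) \<Rightarrow> nat rpoly \<Rightarrow> hook_poly" where
  "hirota K P = (\<Sum>m\<in>Poly_Mapping.keys P. cst (Poly_Mapping.lookup P m) * hirota_monom K (indices m))"

text \<open>
  \<open>KP_two k l\<close>, for \<open>k \<ge> l \<ge> 1\<close>, is the polynomial of the partition \<open>(k, l)\<close>. For \<open>l \<ge> 2\<close>, the only
  contribution of \<open>F\<^sub>k\<^sub>,\<^sub>l\<close> to \<open>\<tau>\<^sup>-\<^sup>2\<close> times the left-hand side of \<open>(\<star>)\<close> is \<open>2 k F\<^sub>k\<^sub>,\<^sub>l\<close>, coming from the
  summand \<open>k D\<^sub>l D\<^sub>k\<close>; so \<open>(\<star>)\<close> is solved for \<open>F\<^sub>k\<^sub>,\<^sub>l\<close> by removing this summand and dividing by \<open>-2 k\<close>.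
  The condition on \<open>max i j\<close> and \<open>min i j\<close> is needed for termination only: as every hook \<open>(i, 1\<^sup>a)\<close>
  in the expression of \<open>F\<close> indexed by \<open>\<lambda>\<close> satisfies \<open>i \<le> |\<lambda>| - \<ell>(\<lambda>) + 1\<close>, all pairs that are
  looked up satisfy it.
\<close>

function KP_two :: "nat \<Rightarrow> nat \<Rightarrow> hook_poly" where
  "KP_two k l = (if l \<le> 1 then H k 1 else
     - cst (1 / of_nat (2 * k)) *
       hirota
         (\<lambda>i j. if max i j + min i j < k + l \<or> (max i j + min i j = k + l \<and> min i j < l)
            then KP_two (max i j) (min i j) else 0)
         (kp_star k l - of_nat k * D l * D k))"
  by pat_completeness auto
termination
  by (relation "measures [\<lambda>(k, l). k + l, \<lambda>(k, l). l]") auto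

declare KP_two.simps [simp del]

definition KP :: "nat list \<Rightarrow> hook_poly" where
  "KP xs = hook_expr (\<lambda>i j. KP_two (max i j) (min i j)) (rev (sort xs))"


lemma derivation_pvar: "derivation \<delta> (pvar x) = \<delta> x"
proof -
  have k: "Poly_Mapping.keys (pvar x :: 'a rpoly) = {Poly_Mapping.single x 1}"
    by (simp add: pvar_def)
  have "derivation \<delta> (pvar x) = Poly_Mapping.single 0 1 * \<delta> x"
    by (simp add: derivation_def k) (simp add: pvar_def)
  then show ?thesis by (metis mult_1 single_one)
qed

lemma KP_pair: "1 \<le> l \<Longrightarrow> l \<le> k \<Longrightarrow> KP [k, l] = KP_two k l"
  by (auto simp: KP_def hook_d_def H_def derivation_pvar max_def min_def)

lemma KP_hook:
  assumes "1 \<le> k"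
  shows "KP (k # replicate a 1) = H k a"
proof -
  define K where "K = (\<lambda>i j. KP_two (max i j) (min i j))"
  have d1: "(hook_d1 ^^ b) (H i c) = H i (b + c)" for b i c
    by (induction b) (simp_all add: hook_d1_def H_def derivation_pvar)
  have K1: "K i 1 = H i 1" if "1 \<le> i" for i
    using that by (simp add: K_def KP_two.simps max_def min_def)
  have step: "hook_d K 1 (H k b) = H k (Suc b)" for b
  proof -
    have "hook_d K 1 (H k b) = (hook_d1 ^^ b) (K k 1)"
      by (simp add: hook_d_def H_def derivation_pvar)
    then show ?thesis using d1 K1[OF assms] by simp
  qed
  have fold: "foldl (\<lambda>f c. hook_d K c f) (H k b) (replicate n 1) = H k (b + n)" for b n
    by (induction n arbitrary: b) (use step in simp_all)
  have "rev (sort (k # replicate a 1)) = k # replicate a 1"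
  proof -
    have "sort (k # replicate a 1) = replicate a 1 @ [k]"
      by (rule properties_for_sort)
         (use assms in \<open>auto simp: sorted_append sorted_replicate\<close>)
    then show ?thesis by simp
  qed
  then show ?thesis using fold[of 0 a] by (simp add: KP_def K_def)
qed


section \<open>Admissible expressions\<close>

text \<open>
  Expressions are formal polynomials, with coefficients in \<open>tseries\<close>, in symbols indexed by pairs.
  In a \<open>d\<close>-admissible expression the pair \<open>(k, l)\<close> stands for \<open>F\<close> indexed by \<open>(k, 1\<^sup>l)\<close>; in a
  differential polynomial it stands for the \<open>l\<close>-th \<open>t\<close>-derivative of the \<open>k\<close>-th unknown.
\<close>

type_synonym expr = "(nat \<times> nat \<Rightarrow>\<^sub>0 nat) \<Rightarrow>\<^sub>0 tseries"

definition Fsym :: "nat \<Rightarrow> nat \<Rightarrow> expr" where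
  "Fsym k l = pvar (k, l)"

text \<open>The subring \<open>\<rat>[t, t\<^sup>-\<^sup>1, u, v, p\<^sub>1, \<dots>, p\<^sub>d, p\<^sub>d\<^sup>-\<^sup>1]\<close>.\<close>

definition coeff_ring :: "nat \<Rightarrow> tseries set" where
  "coeff_ring d = {c. finite {n. fls_nth c n \<noteq> 0} \<and>
     (\<forall>n. \<forall>m\<in>Poly_Mapping.keys (fls_nth c n).
        Poly_Mapping.keys m \<subseteq> {VarU, VarV} \<union> VarP ` {1..d} \<and>
        (\<forall>x. x \<noteq> VarP d \<longrightarrow> 0 \<le> Poly_Mapping.lookup m x))}"

definition admissible :: "nat \<Rightarrow> expr set" where
  "admissible d = {P. (\<forall>m. Poly_Mapping.lookup P m \<in> coeff_ring d) \<and>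
     (\<forall>m\<in>Poly_Mapping.keys P. Poly_Mapping.keys m \<subseteq> {1..d - 1} \<times> UNIV)}"

definition hook_subst :: "(nat \<Rightarrow> nat \<Rightarrow> expr) \<Rightarrow> hook_poly \<Rightarrow> expr" where
  "hook_subst g = subst_poly (\<lambda>c. cst (trat c)) (\<lambda>(m, l). g m l)"

text \<open>The first case is that of the \<open>F\<close> with index \<open>(m, 1\<^sup>l)\<close>, \<open>1 \<le> m \<le> d - 1\<close>; the recursion applies
  for \<open>d \<le> m \<le> 2 d - 1\<close>, with \<open>k = m - d\<close>. The remaining values are irrelevant.\<close>

function G :: "nat \<Rightarrow> nat \<Rightarrow> nat \<Rightarrow> expr" where
  "G d m l = (if m < d then Fsym m l
     else if 2 \<le> d \<and> m \<le> 2 * d - 1 then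
       cst (trat (1 / of_nat m) * tp_inv d) *
       (- (\<Sum>i\<in>{1..<m - d}. of_nat (i * (m - d - i)) *
             ((\<Sum>r\<le>l. of_nat (l choose r) * Fsym i r * Fsym (m - d - i) (l - r)) +
              hook_subst Fsym (KP (i # (m - d - i) # replicate l 1))))
        + of_nat (m - d + 1) * cst fls_X_inv * G d (m - d + 1) l
        - cst (tu + tv) * of_nat (m - d) * Fsym (m - d) l
        - (if l = 0 then 0 else of_nat (l * (m - d + 1)) * G d (m - d + 1) (l - 1))
        - (if m = d \<and> l = 0 then cst (tu * tv) else 0)
        - (\<Sum>i\<in>{1..<d - (m - d)}. of_nat (i + (m - d)) * cst (tp i) * Fsym (i + (m - d)) l)
        - (\<Sum>j\<in>{..<m - d}. of_nat (d + j) * cst (tp (d + j - (m - d))) * G d (d + j) l))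
     else 0)"
  by pat_completeness auto
termination
  by (relation "measure (\<lambda>(d, m, l). m)") auto

declare G.simps [simp del]


section \<open>The operator T and the equations\<close>

text \<open>\<open>T f\<close> replaces the symbol of \<open>(k, 1\<^sup>l)\<close> by \<open>(t\<^sup>2 \<partial>\<^sub>t)\<^sup>l\<close> applied to \<open>f k\<close>. Here \<open>f\<close> is a tuple
  of unknown functions; the operator of the paper is the case of \<open>f = F_proj d\<close>.\<close>

definition T :: "(nat \<Rightarrow> tseries) \<Rightarrow> expr \<Rightarrow> tseries" where
  "T f = subst_poly (\<lambda>c. c) (\<lambda>(k, l). ((\<lambda>g. fls_X ^ 2 * fls_deriv g) ^^ l) (f k))"

definition E_eq :: "nat \<Rightarrow> nat \<Rightarrow> (nat \<Rightarrow> tseries) \<Rightarrow> tseries" where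
  "E_eq d k f =
     (if k = 1 then
        - (of_nat d * tp d * (\<Sum>i=1..d. of_nat i * tp i * T f (hook_subst (G d) (KP [i, d]))))
        + fls_deriv (f 1) - of_nat (d + 1) * fls_X_inv * f 1
        + (\<Sum>i=1..d - 1. of_nat i * tp i * (of_nat d * f i - fls_X * fls_deriv (f i)))
        + of_nat d * tu * tv
      else
        - (\<Sum>i=1..d. of_nat i * tp i * T f (hook_subst (G d) (KP [i, k])))
        + fls_X * fls_deriv (f k) - of_nat k * f k)"

text \<open>\<open>\<Phi> f = 0\<close> is an ordinary differential equation in \<open>t\<close> for the unknowns \<open>f 1, \<dots>, f (d - 1)\<close>:
  \<open>\<Phi>\<close> is given by a differential polynomial in these unknowns with coefficients in \<open>coeff_ring d\<close>.\<close>

definition is_ode :: "nat \<Rightarrow> ((nat \<Rightarrow> tseries) \<Rightarrow> tseries) \<Rightarrow> bool" where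
  "is_ode d \<Phi> \<longleftrightarrow> (\<exists>P\<in>admissible d. \<forall>f.
     \<Phi> f = subst_poly (\<lambda>c. c) (\<lambda>(k, j). (fls_deriv ^^ j) (f k)) P)"

end

(*
  Deleting a root edge of a bipartite map gives (k + 1) d/dp_{k+1} tau = t L_k tau for Virasoro operators
  L_k, k >= 0, and hence the evolution equation d/dt tau = A tau with A = sum_k p_{k+1} L_k. A vertex operator
  intertwines A with the same operator at (u + 1, v + 1) or (u - 1, v - 1), up to a term involving the spectral
  parameter only, and these terms cancel in the residue of the product of two opposite vertex operators. The
  residue pairing of two copies of tau is therefore preserved by the evolution; as it vanishes at t = 0, tau
  satisfies the bilinear KP identity. Its second-order expansion on the diagonal gives the equations (star), so
  that the KP polynomials, evaluated at the hook derivatives of F, give all the derivatives of F.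

  Virasoro constraint k, divided by tau, differentiated l times in p_1 and specialised by pi_d, is the recursion
  defining G_{d+k,1^l}, so that G evaluates to F. The constraint k = 0 combined with the Euler relation
  sum_i i p_i F_i = t dF/dt gives F_{m,1^l} = (t^2 d/dt)^l F_m, which is what T does. Now E_k = 0 is the
  derivative in p_k of the Euler relation; for k = 1 it is the one in p_d, where constraint 0 eliminates F_d.
*)

theory Submission imports Defs begin

section \<open>Ring homomorphisms and derivations on polynomials\<close>

text \<open>Everything takes place at a fixed power of t, where coefficients are polynomials, so the
  infinite sums in A and in the vertex operators act by finitely many terms. The pairing is the
  coefficient of 1/z in exp(sum (p_i - p'_i) z^i / i) tau(p - [1/z]) tau(p' + [1/z]). Moving A
  through a vertex operator at the coefficient of z^n leaves eps (n + 1 + eps u)(n + 1 + eps v)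
  times the next coefficient; for eps = 1 and eps = -1 these leftovers are W(i + 1) and -W(i), and
  they telescope. For (star) the identity is differentiated by p'_b - p_b, b = l - 1, and then by
  p'_k - p_k before setting p' = p. The second obstacle is that the lookup inside
  \<open>KP_two\<close> and the function \<open>G\<close> return 0 outside their range. Evaluation
  is therefore proved together with the bound on the hooks (i, 1^a) that occur, so that no default
  value is read.\<close>

locale rhom =
  fixes \<phi> :: "'a::comm_ring_1 \<Rightarrow> 'b::comm_ring_1"
  assumes one: "\<phi> 1 = 1"
    and add: "\<phi> (x + y) = \<phi> x + \<phi> y"
    and mult: "\<phi> (x * y) = \<phi> x * \<phi> y"

locale additive_map =
  fixes d :: "'a::comm_ring_1 \<Rightarrow> 'b::comm_ring_1"
  assumes add: "d (x + y) = d x + d y"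
begin

lemma zero: "d 0 = 0"
  using add[of 0 0] by simp

lemma uminus: "d (- x) = - d x"
  using add[of x "- x"] zero by (simp add: eq_neg_iff_add_eq_0 add.commute)

lemma diff: "d (x - y) = d x - d y"
  using add[of x "- y"] uminus by simp

lemma sum: "d (sum f S) = (\<Sum>x\<in>S. d (f x))"
  by (induction S rule: infinite_finite_induct) (simp_all add: zero add)

lemma of_nat_mult: "d (of_nat n * x) = of_nat n * d x"
  by (induction n) (simp_all add: zero add distrib_right)

end

sublocale rhom \<subseteq> additive_map \<phi>
  by unfold_locales (rule add)

context rhom
begin

lemma of_nat: "\<phi> (of_nat n) = of_nat n"
  using of_nat_mult[of n 1] by (simp add: one)

lemma prod: "\<phi> (prod f S) = (\<Prod>x\<in>S. \<phi> (f x))"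
  by (induction S rule: infinite_finite_induct) (simp_all add: one mult)

lemma power: "\<phi> (x ^ n) = \<phi> x ^ n"
  by (induction n) (simp_all add: one mult)

end

text \<open>The Leibniz rule is taken along \<open>\<phi>\<close>, so that the notion also covers a
  derivation composed with a ring homomorphism, such as \<open>bi_der\<close> after
  \<open>bi_copy\<close>.\<close>

locale der = additive_map d for \<phi> :: "'a::comm_ring_1 \<Rightarrow> 'b::comm_ring_1" and d :: "'a \<Rightarrow> 'b" +
  assumes leibniz: "d (x * y) = d x * \<phi> y + \<phi> x * d y"

lemma rhom_additive: "rhom \<phi> \<Longrightarrow> additive_map \<phi>"
  by (simp add: rhom_def additive_map_def)

lemma rhom_id [simp]: "rhom (\<lambda>x. x)"
  by unfold_locales auto

lemma rhom_comp: "rhom \<phi> \<Longrightarrow> rhom \<psi> \<Longrightarrow> rhom (\<lambda>x. \<psi> (\<phi> x))"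
  by (simp add: rhom_def)

lemma der_comp_right: "der \<phi> d \<Longrightarrow> rhom \<psi> \<Longrightarrow> der (\<lambda>x. \<phi> (\<psi> x)) (\<lambda>x. d (\<psi> x))"
  by (simp add: rhom_def der_def additive_map_def der_axioms_def)

lemma der_power:
  fixes d :: "'a::comm_ring_1 \<Rightarrow> 'a"
  assumes "der (\<lambda>x. x) d" shows "d (x ^ n) = of_nat n * x ^ (n - 1) * d x"
proof (induction n)
  case 0
  interpret der "\<lambda>x. x" d by fact
  show ?case using leibniz[of 1 1] by simp
next
  case (Suc n)
  interpret der "\<lambda>x. x" d by fact
  show ?case using Suc by (cases n) (simp_all add: leibniz algebra_simps)
qed

lemma der_prod:
  fixes d :: "'a::comm_ring_1 \<Rightarrow> 'a"
  assumes "der (\<lambda>x. x) d" "finite S"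
  shows "d (prod f S) = (\<Sum>c\<in>S. d (f c) * prod f (S - {c}))"
  using assms(2)
proof (induction S rule: finite_induct)
  case empty
  interpret der "\<lambda>x. x" d by fact
  show ?case using leibniz[of 1 1] by simp
next
  case (insert a S)
  interpret der "\<lambda>x. x" d by fact
  have "insert a S - {c} = insert a (S - {c})" if "c \<in> S" for c using insert that by auto
  then have "(\<Sum>c\<in>S. d (f c) * prod f (insert a S - {c})) = (\<Sum>c\<in>S. d (f c) * (f a * prod f (S - {c})))"
    using insert by (intro sum.cong) auto
  then show ?case using insert by (simp add: leibniz sum_distrib_left algebra_simps)
qed


section \<open>Constants, monomials and induction on polynomials\<close>

lemma cst_0 [simp]: "cst 0 = 0" by (simp add: cst_def)
lemma cst_1 [simp]: "cst 1 = 1" by (simp add: cst_def)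
lemma cst_add: "cst (a + b) = cst a + cst b" by (simp add: cst_def single_add)
lemma cst_uminus: "cst (- a) = - cst a" by (simp add: cst_def single_uminus)
lemma cst_mult: "cst (a * b) = (cst a * cst b :: 'm::comm_monoid_add \<Rightarrow>\<^sub>0 'c::comm_ring_1)"
  by (simp add: cst_def mult_single)
lemma cst_of_nat [simp]: "cst (of_nat n) = (of_nat n :: 'm::comm_monoid_add \<Rightarrow>\<^sub>0 'c::comm_ring_1)"
  by (simp add: cst_def)
lemma rhom_cst: "rhom (cst :: 'c::comm_ring_1 \<Rightarrow> 'm::comm_monoid_add \<Rightarrow>\<^sub>0 'c)"
  by unfold_locales (simp_all add: cst_add cst_mult)

lemma of_nat_mult_cst_inverse:
  "n \<noteq> 0 \<Longrightarrow> of_nat n * (cst (1 / of_nat n) :: 'm::comm_monoid_add \<Rightarrow>\<^sub>0 rat) = 1"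
  using cst_mult[of "of_nat n" "1 / of_nat n :: rat", symmetric] by simp

lemma of_nat_mult_cancel:
  fixes x y :: "'m::comm_monoid_add \<Rightarrow>\<^sub>0 rat"
  assumes "n \<noteq> 0" "of_nat n * x = of_nat n * y" shows "x = y"
proof -
  have "(cst (1 / of_nat n) * of_nat n) * x = (cst (1 / of_nat n) * of_nat n) * y"
    using assms(2) by (simp add: mult.assoc)
  moreover have "cst (1 / of_nat n) * of_nat n = (1 :: 'm \<Rightarrow>\<^sub>0 rat)"
    using of_nat_mult_cst_inverse[OF assms(1)] by (metis mult.commute)
  ultimately show ?thesis by (metis mult_1_left)
qed

lemma poly_mapping_sum_single:
  fixes P :: "'m \<Rightarrow>\<^sub>0 'c::comm_monoid_add"
  shows "P = (\<Sum>m\<in>Poly_Mapping.keys P. Poly_Mapping.single m (Poly_Mapping.lookup P m))"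
proof (rule poly_mapping_eqI)
  fix k
  have "(\<Sum>m\<in>Poly_Mapping.keys P. Poly_Mapping.lookup (Poly_Mapping.single m (Poly_Mapping.lookup P m)) k)
     = (\<Sum>m\<in>Poly_Mapping.keys P. if m = k then Poly_Mapping.lookup P k else 0)"
    by (rule sum.cong) (auto simp: lookup_single when_def)
  then show "Poly_Mapping.lookup P k =
    Poly_Mapping.lookup (\<Sum>m\<in>Poly_Mapping.keys P. Poly_Mapping.single m (Poly_Mapping.lookup P m)) k"
    by (simp add: lookup_sum in_keys_iff)
qed

lemma poly_mapping_additive_induct [case_names null mono plus]:
  fixes P :: "'m \<Rightarrow>\<^sub>0 'c::comm_monoid_add"
  assumes "Q 0" and s: "\<And>m c. m \<in> Poly_Mapping.keys P \<Longrightarrow> Q (Poly_Mapping.single m c)"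
    and "\<And>f g. Q f \<Longrightarrow> Q g \<Longrightarrow> Q (f + g)"
  shows "Q P"
proof -
  note a = assms(3)
  have "Q (\<Sum>m\<in>S. Poly_Mapping.single m (Poly_Mapping.lookup P m))" if "S \<subseteq> Poly_Mapping.keys P" for S
    using finite_subset[OF that finite_keys] that by (induction S rule: finite_induct) (auto intro: assms)
  then show ?thesis using poly_mapping_sum_single[of P] by fastforce
qed

lemma pvar_times_single:
  "pvar x * Poly_Mapping.single m c = (Poly_Mapping.single (Poly_Mapping.single x 1 + m) c :: ('a \<Rightarrow>\<^sub>0 'e::comm_semiring_1) \<Rightarrow>\<^sub>0 'c::comm_ring_1)"
  by (simp add: pvar_def mult_single)

definition pvars :: "(('a \<Rightarrow>\<^sub>0 nat) \<Rightarrow>\<^sub>0 'c::zero) \<Rightarrow> 'a set" where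
  "pvars P = (\<Union>m\<in>Poly_Mapping.keys P. Poly_Mapping.keys m)"

lemma exponent_split:
  fixes m :: "'a \<Rightarrow>\<^sub>0 nat"
  assumes "x \<in> Poly_Mapping.keys m"
  shows "m = Poly_Mapping.single x 1 + (m - Poly_Mapping.single x 1)"
  using assms by (intro poly_mapping_eqI) (auto simp: lookup_add lookup_minus lookup_single when_def in_keys_iff)

lemma exponent_induct [case_names null step]:
  fixes m :: "'a \<Rightarrow>\<^sub>0 nat"
  assumes "Q 0" and "\<And>x m. Q m \<Longrightarrow> Q (Poly_Mapping.single x 1 + m)"
  shows "Q m"
proof (induction "\<Sum>x\<in>Poly_Mapping.keys m. Poly_Mapping.lookup m x" arbitrary: m rule: less_induct)
  case less
  show ?case
  proof (cases "m = 0")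
    case False
    then obtain x where x: "x \<in> Poly_Mapping.keys m" by fastforce
    define m' where "m' = m - Poly_Mapping.single x 1"
    have m: "m = Poly_Mapping.single x 1 + m'" using exponent_split[OF x] by (simp add: m'_def)
    have l: "Poly_Mapping.lookup m y = (if y = x then 1 else 0) + Poly_Mapping.lookup m' y" for y
      by (subst m) (simp add: lookup_add lookup_single when_def)
    have "(\<Sum>y\<in>Poly_Mapping.keys m'. Poly_Mapping.lookup m' y) = (\<Sum>y\<in>Poly_Mapping.keys m. Poly_Mapping.lookup m' y)"
      using l by (intro sum.mono_neutral_left) (auto simp: in_keys_iff)
    also have "\<dots> < (\<Sum>y\<in>Poly_Mapping.keys m. Poly_Mapping.lookup m y)"
      using x l by (intro sum_strict_mono_ex1) auto
    finally have "Q m'" using less by blast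
    then show ?thesis using assms(2) m by metis
  qed (use assms(1) in simp)
qed

text \<open>Constants, sums and multiplication by one variable generate the polynomial ring; hence
  homomorphisms and derivations need to be compared only on constants and variables.\<close>

lemma mpoly_induct [case_names const plus var]:
  fixes P :: "('a \<Rightarrow>\<^sub>0 nat) \<Rightarrow>\<^sub>0 'c::comm_ring_1"
  assumes c: "\<And>c. Q (cst c)" and "\<And>f g. Q f \<Longrightarrow> Q g \<Longrightarrow> Q (f + g)"
    and v: "\<And>x f. Q f \<Longrightarrow> Q (pvar x * f)"
  shows "Q P"
proof (induction P rule: poly_mapping_additive_induct)
  case null
  show ?case using c[of 0] by simp
next
  case (mono m a)
  show ?case
  proof (induction m rule: exponent_induct)
    case null
    show ?case using c[of a] by (simp add: cst_def)
  next
    case (step x m)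
    then show ?case using v[OF step, of x] by (simp add: pvar_times_single)
  qed
qed (rule assms)

lemma rhom_ext:
  fixes \<phi> \<psi> :: "(('a \<Rightarrow>\<^sub>0 nat) \<Rightarrow>\<^sub>0 'c::comm_ring_1) \<Rightarrow> 'b::comm_ring_1"
  assumes "rhom \<phi>" "rhom \<psi>" "\<And>c. \<phi> (cst c) = \<psi> (cst c)" "\<And>x. \<phi> (pvar x) = \<psi> (pvar x)"
  shows "\<phi> P = \<psi> P"
  by (induction P rule: mpoly_induct)
    (simp_all add: assms(3,4) rhom.add[OF assms(1)] rhom.add[OF assms(2)] rhom.mult[OF assms(1)] rhom.mult[OF assms(2)])

lemma der_ext:
  fixes d e :: "(('a \<Rightarrow>\<^sub>0 nat) \<Rightarrow>\<^sub>0 'c::comm_ring_1) \<Rightarrow> 'b::comm_ring_1"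
  assumes "der \<phi> d" "der \<phi> e" "\<And>c. d (cst c) = e (cst c)" "\<And>x. d (pvar x) = e (pvar x)"
  shows "d P = e P"
proof -
  interpret d: der \<phi> d by fact
  interpret e: der \<phi> e by fact
  show ?thesis
    by (induction P rule: mpoly_induct) (simp_all add: assms(3,4) d.add e.add d.leibniz e.leibniz)
qed

subsection \<open>Substitution\<close>

definition monom_val :: "('a \<Rightarrow> 'b::comm_ring_1) \<Rightarrow> ('a \<Rightarrow>\<^sub>0 nat) \<Rightarrow> 'b" where
  "monom_val f m = (\<Prod>x\<in>Poly_Mapping.keys m. f x ^ Poly_Mapping.lookup m x)"

lemma monom_val_step: "monom_val f (Poly_Mapping.single x 1 + m) = f x * monom_val f m"
proof -
  let ?S = "insert x (Poly_Mapping.keys m)"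
  have *: "monom_val f k = (\<Prod>y\<in>?S. f y ^ Poly_Mapping.lookup k y)" if "Poly_Mapping.keys k \<subseteq> ?S" for k
    unfolding monom_val_def using that by (intro prod.mono_neutral_left) (auto simp: in_keys_iff)
  have "monom_val f (Poly_Mapping.single x 1 + m) = (\<Prod>y\<in>?S. f y ^ Poly_Mapping.lookup (Poly_Mapping.single x 1 + m) y)"
    using keys_add[of "Poly_Mapping.single x (1::nat)" m] by (intro *) auto
  also have "\<dots> = (\<Prod>y\<in>?S. (if y = x then f x else 1) * f y ^ Poly_Mapping.lookup m y)"
    by (intro prod.cong) (auto simp: lookup_add lookup_single when_def)
  also have "\<dots> = f x * monom_val f m"
    by (subst *[of m]) (auto simp: prod.distrib)
  finally show ?thesis .
qed

lemma subst_poly_alt: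
  "subst_poly \<phi> f P = (\<Sum>m\<in>Poly_Mapping.keys P. \<phi> (Poly_Mapping.lookup P m) * monom_val f m)"
  by (simp add: subst_poly_def monom_val_def)

context
  fixes \<phi> :: "'c::comm_ring_1 \<Rightarrow> 'b::comm_ring_1" and f :: "'a \<Rightarrow> 'b"
  assumes \<phi>: "rhom \<phi>"
begin

interpretation rhom \<phi> by (rule \<phi>)

lemma subst_poly_single: "subst_poly \<phi> f (Poly_Mapping.single m c) = \<phi> c * monom_val f m"
  by (simp add: subst_poly_alt zero)

lemma subst_poly_add: "subst_poly \<phi> f (P + Q) = subst_poly \<phi> f P + subst_poly \<phi> f Q"
  unfolding subst_poly_alt
  by (rule setsum_keys_plus_distrib) (simp_all add: zero add distrib_right)

lemma subst_poly_cst [simp]: "subst_poly \<phi> f (cst c) = \<phi> c"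
  by (simp add: cst_def subst_poly_single monom_val_def)

lemma subst_poly_pvar_mult: "subst_poly \<phi> f (pvar x * P) = f x * subst_poly \<phi> f P"
proof (induction P rule: poly_mapping_additive_induct)
  case null
  show ?case using subst_poly_cst[of 0] by (simp add: zero)
next
  case (mono m c)
  show ?case by (simp only: pvar_times_single subst_poly_single monom_val_step) (simp add: mult_ac)
qed (simp add: distrib_left subst_poly_add)

lemma subst_poly_pvar [simp]: "subst_poly \<phi> f (pvar x) = f x"
  using subst_poly_pvar_mult[of x 1] subst_poly_cst[of 1] by (simp add: one)

lemma subst_poly_cst_mult: "subst_poly \<phi> f (cst c * P) = \<phi> c * subst_poly \<phi> f P"
proof (induction P rule: poly_mapping_additive_induct)
  case null
  show ?case using subst_poly_cst[of 0] by (simp add: zero)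
next
  case (mono m a)
  show ?case by (simp add: cst_def mult_single subst_poly_single mult mult_ac)
qed (simp add: distrib_left subst_poly_add)

lemma rhom_subst_poly: "rhom (subst_poly \<phi> f)"
proof
  show "subst_poly \<phi> f 1 = 1" using subst_poly_cst[of 1] by (simp add: one)
  show "subst_poly \<phi> f (x * y) = subst_poly \<phi> f x * subst_poly \<phi> f y" for x y
    by (induction x rule: mpoly_induct)
      (simp_all add: subst_poly_add distrib_right subst_poly_pvar_mult mult.assoc subst_poly_cst_mult)
qed (rule subst_poly_add)

end

lemma subst_poly_cong:
  assumes "\<And>x. x \<in> pvars P \<Longrightarrow> f x = g x"
  shows "subst_poly \<phi> f P = subst_poly \<phi> g P"
proof -
  have "f x = g x" if "m \<in> Poly_Mapping.keys P" "x \<in> Poly_Mapping.keys m" for m x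
    using that by (intro assms) (auto simp: pvars_def)
  then show ?thesis
    unfolding subst_poly_def by (intro sum.cong refl arg_cong2[where f="(*)"] prod.cong) simp
qed

subsection \<open>Derivations\<close>

lemma derivation_extend:
  assumes "finite S" "Poly_Mapping.keys P \<subseteq> S"
  shows "derivation \<delta> P = (\<Sum>m\<in>S. \<Sum>x\<in>Poly_Mapping.keys m.
      Poly_Mapping.single (m - Poly_Mapping.single x 1)
        (of_nat (Poly_Mapping.lookup m x) * Poly_Mapping.lookup P m) * \<delta> x)"
  unfolding derivation_def using assms by (intro sum.mono_neutral_left) (auto simp: in_keys_iff)

lemma derivation_add: "derivation \<delta> (P + Q) = derivation \<delta> P + derivation \<delta> Q"
proof -
  let ?S = "Poly_Mapping.keys P \<union> Poly_Mapping.keys Q"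
  have "Poly_Mapping.keys (P + Q) \<subseteq> ?S" by (rule keys_add)
  then show ?thesis
    by (subst (1 2 3) derivation_extend[of ?S])
      (auto simp: lookup_add distrib_left distrib_right single_add sum.distrib)
qed

lemma derivation_0 [simp]: "derivation \<delta> 0 = 0"
  by (simp add: derivation_def)

lemma derivation_single:
  "derivation \<delta> (Poly_Mapping.single m c) = (\<Sum>x\<in>Poly_Mapping.keys m.
      Poly_Mapping.single (m - Poly_Mapping.single x 1) (of_nat (Poly_Mapping.lookup m x) * c) * \<delta> x)"
  by (simp add: derivation_def)

lemma derivation_pvar_mult: "derivation \<delta> (pvar x * P) = \<delta> x * P + pvar x * derivation \<delta> P"
proof (induction P rule: poly_mapping_additive_induct)
  case (mono m c)
  let ?m = "Poly_Mapping.single x 1 + m"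
  let ?S = "insert x (Poly_Mapping.keys m)"
  have *: "derivation \<delta> (Poly_Mapping.single k c) = (\<Sum>y\<in>?S.
      Poly_Mapping.single (k - Poly_Mapping.single y 1) (of_nat (Poly_Mapping.lookup k y) * c) * \<delta> y)"
    if "Poly_Mapping.keys k \<subseteq> ?S" for k
    unfolding derivation_single using that by (intro sum.mono_neutral_left) (auto simp: in_keys_iff)
  have "derivation \<delta> (pvar x * Poly_Mapping.single m c) = (\<Sum>y\<in>?S.
      Poly_Mapping.single (?m - Poly_Mapping.single y 1) (of_nat (Poly_Mapping.lookup ?m y) * c) * \<delta> y)"
    using keys_add[of "Poly_Mapping.single x (1::nat)" m]
    by (simp only: pvar_times_single, intro *) auto
  also have "\<dots> = (\<Sum>y\<in>?S. (if y = x then Poly_Mapping.single m c * \<delta> x else 0) + pvar x *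
      (Poly_Mapping.single (m - Poly_Mapping.single y 1) (of_nat (Poly_Mapping.lookup m y) * c) * \<delta> y))"
  proof (rule sum.cong[OF refl])
    fix y assume y: "y \<in> ?S"
    show "Poly_Mapping.single (?m - Poly_Mapping.single y 1) (of_nat (Poly_Mapping.lookup ?m y) * c) * \<delta> y =
      (if y = x then Poly_Mapping.single m c * \<delta> x else 0) + pvar x *
      (Poly_Mapping.single (m - Poly_Mapping.single y 1) (of_nat (Poly_Mapping.lookup m y) * c) * \<delta> y)"
    proof (cases "y \<in> Poly_Mapping.keys m")
      case True
      have e: "?m - Poly_Mapping.single y 1 = Poly_Mapping.single x 1 + (m - Poly_Mapping.single y 1)"
        using True by (intro poly_mapping_eqI) (auto simp: lookup_add lookup_minus lookup_single when_def in_keys_iff)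
      have e2: "Poly_Mapping.single x 1 + (m - Poly_Mapping.single x 1) = m" if "y = x"
        using exponent_split[of x m] True that by simp
      show ?thesis
        unfolding e mult.assoc[symmetric] pvar_times_single
        using e2 by (auto simp: lookup_add lookup_single when_def single_add algebra_simps)
    next
      case False
      with y have "y = x" "Poly_Mapping.lookup m x = 0" by (auto simp: in_keys_iff)
      then show ?thesis by (simp add: lookup_add)
    qed
  qed
  also have "\<dots> = \<delta> x * Poly_Mapping.single m c + pvar x * derivation \<delta> (Poly_Mapping.single m c)"
    by (subst *[of m]) (auto simp: sum.distrib sum_distrib_left mult.commute)
  finally show ?case .
qed (simp_all add: derivation_add algebra_simps)

lemma derivation_cst_mult: "derivation \<delta> (cst c * P) = cst c * derivation \<delta> P"
proof (induction P rule: poly_mapping_additive_induct)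
  case (mono m a)
  have "cst c * (Poly_Mapping.single k b * y) = Poly_Mapping.single k (c * b) * y" for k b and y :: "'a rpoly"
    by (simp add: cst_def mult_single flip: mult.assoc)
  then show ?case
    by (simp add: cst_def mult_single derivation_single sum_distrib_left) (simp add: mult_ac)
qed (simp_all add: derivation_add algebra_simps)

lemma derivation_cst [simp]: "derivation \<delta> (cst c) = 0"
  by (simp add: cst_def derivation_single)

lemma der_derivation: "der (\<lambda>x. x) (derivation \<delta>)"
proof
  show "derivation \<delta> (x * y) = derivation \<delta> x * y + x * derivation \<delta> y" for x y
    by (induction x rule: mpoly_induct)
      (simp_all add: derivation_add derivation_pvar_mult derivation_cst_mult mult.assoc distrib_left distrib_right add_ac)
qed (rule derivation_add)

lemmas derivation_mult = der.leibniz[OF der_derivation]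

lemma derivation_1 [simp]: "derivation \<delta> 1 = 0"
  using derivation_cst[of \<delta> 1] by simp

lemma derivation_of_nat [simp]: "derivation \<delta> (of_nat n) = 0"
  using derivation_cst[of \<delta> "of_nat n"] by simp

lemma derivation_unique:
  assumes "der (\<lambda>x. x) d" "\<And>c. d (cst c) = 0" "\<And>x. d (pvar x) = \<delta> x"
  shows "d P = derivation \<delta> P"
  by (rule der_ext[OF assms(1) der_derivation]) (simp_all add: assms derivation_pvar)

text \<open>Compatibility is demanded only at the variables that occur in \<open>P\<close>: for hook
  expressions the derivative of a variable is known to be correct only for the hooks actually
  present.\<close>

lemma subst_poly_derivation:
  assumes "rhom \<phi>" "der (\<lambda>x. x) d" "\<And>c. d (\<phi> c) = 0"
    and "\<And>x. x \<in> pvars P \<Longrightarrow> d (f x) = subst_poly \<phi> f (\<delta> x)"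
  shows "d (subst_poly \<phi> f P) = subst_poly \<phi> f (derivation \<delta> P)"
proof -
  interpret h: rhom "subst_poly \<phi> f" by (rule rhom_subst_poly) fact
  interpret d: der "\<lambda>x. x" d by fact
  interpret e: der "\<lambda>x. x" "derivation \<delta>" by (rule der_derivation)
  have mon: "Poly_Mapping.keys m \<subseteq> pvars P \<Longrightarrow>
    d (subst_poly \<phi> f (Poly_Mapping.single m c)) = subst_poly \<phi> f (derivation \<delta> (Poly_Mapping.single m c))" for m c
  proof (induction m rule: exponent_induct)
    case null
    show ?case using subst_poly_cst[OF assms(1), of f c] derivation_cst[of \<delta> c]
      by (simp add: assms(3) h.zero flip: cst_def)
  next
    case (step x m)
    from step.prems have "x \<in> pvars P" "Poly_Mapping.keys m \<subseteq> pvars P"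
      by (auto simp: in_keys_iff lookup_add)
    with step.IH assms(4)[of x] show ?case
      unfolding pvar_times_single[symmetric] h.mult derivation_pvar_mult h.add d.leibniz
        subst_poly_pvar[OF assms(1)] by simp
  qed
  show ?thesis
    by (induction P rule: poly_mapping_additive_induct)
      (use mon in \<open>auto simp: h.zero d.zero h.add d.add e.add pvars_def\<close>)
qed

section \<open>Coefficientwise maps on power series\<close>

definition fps_lift :: "('a \<Rightarrow> 'b) \<Rightarrow> 'a fps \<Rightarrow> 'b fps" where
  "fps_lift \<phi> f = Abs_fps (\<lambda>n. \<phi> (fps_nth f n))"

lemma fps_lift_nth [simp]: "fps_nth (fps_lift \<phi> f) n = \<phi> (fps_nth f n)"
  by (simp add: fps_lift_def)

lemma fps_lift_id [simp]: "fps_lift (\<lambda>x. x) = (\<lambda>x. x)"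
  by (simp add: fun_eq_iff fps_eq_iff)

lemma rhom_fps_lift:
  assumes "rhom \<phi>" shows "rhom (fps_lift \<phi>)"
proof -
  interpret rhom \<phi> by fact
  show ?thesis
    by unfold_locales (simp_all add: fps_eq_iff one add zero fps_mult_nth sum mult)
qed

lemma der_fps_lift:
  assumes "rhom \<phi>" "der \<phi> d" shows "der (fps_lift \<phi>) (fps_lift d)"
proof -
  interpret rhom \<phi> by fact
  interpret d: der \<phi> d by fact
  show ?thesis
    by unfold_locales (simp_all add: fps_eq_iff d.add d.sum fps_mult_nth d.leibniz sum.distrib)
qed

lemma der_fps_deriv: "der (\<lambda>x. x) (fps_deriv :: 'a::comm_ring_1 fps \<Rightarrow> _)"
  by unfold_locales (simp_all add: algebra_simps)

text \<open>Since \<open>g\<close> has no constant term, \<open>g ^ i\<close> starts at order i. A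
  coefficient of the composition is thus that of a finite sum, to which a derivation applies term by
  term.\<close>

lemma fps_compose_cst_nth:
  assumes "fps_nth g 0 = 0" "n \<le> N"
  shows "fps_nth (fps_compose (fps_cst a) g) n = fps_nth (\<Sum>i\<le>N. fps_const (cst (fps_nth a i)) * g ^ i) n"
proof -
  have "fps_nth (g ^ i) n = 0" if "n < i" for i
    using startsby_zero_power_prefix[OF assms(1)] that by blast
  then have "(\<Sum>i\<le>N. cst (fps_nth a i) * fps_nth (g ^ i) n) = (\<Sum>i\<le>n. cst (fps_nth a i) * fps_nth (g ^ i) n)"
    using assms(2) by (intro sum.mono_neutral_right) auto
  then show ?thesis
    by (simp add: fps_compose_nth fps_cst_def fps_sum_nth atMost_atLeast0)
qed

text \<open>The continuity assumption, a loss of at most one order, holds for maps acting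
  coefficientwise and for \<open>fps_deriv\<close> alike; it justifies the truncation at
  \<open>Suc n\<close>.\<close>

lemma der_fps_compose:
  fixes d :: "('m::comm_monoid_add \<Rightarrow>\<^sub>0 rat) fps \<Rightarrow> ('m \<Rightarrow>\<^sub>0 rat) fps"
  assumes d: "der (\<lambda>x. x) d" "\<And>c. d (fps_const (cst c)) = 0" and g: "fps_nth g 0 = 0"
    and cont: "\<And>N f. (\<And>n. n \<le> Suc N \<Longrightarrow> fps_nth f n = 0) \<Longrightarrow> fps_nth (d f) N = 0"
  shows "d (fps_compose (fps_cst a) g) = fps_compose (fps_cst (fps_deriv a)) g * d g"
proof (rule fps_ext)
  fix n
  interpret der "\<lambda>x. x" d by fact
  let ?P = "\<Sum>i\<le>Suc n. fps_const (cst (fps_nth a i)) * g ^ i"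
  let ?Q = "\<Sum>i\<le>n. fps_const (cst (fps_nth (fps_deriv a) i)) * g ^ i"
  have "fps_nth (d (fps_compose (fps_cst a) g - ?P)) n = 0"
    by (rule cont) (simp add: fps_compose_cst_nth[OF g])
  then have 1: "fps_nth (d (fps_compose (fps_cst a) g)) n = fps_nth (d ?P) n"
    by (simp add: diff)
  have "d ?P = (\<Sum>i\<le>Suc n. fps_const (cst (fps_nth a i)) * (of_nat i * g ^ (i - 1) * d g))"
    by (simp add: sum leibniz d(2) der_power[OF d(1)] del: sum.atMost_Suc)
  also have "\<dots> = (\<Sum>i\<le>n. fps_const (cst (fps_nth (fps_deriv a) i)) * g ^ i * d g)"
    by (subst sum.atMost_Suc_shift) (simp add: cst_mult cst_add fps_of_nat[symmetric] mult_ac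
        flip: fps_const_mult cst_of_nat of_nat_Suc)
  finally have "fps_nth (d (fps_compose (fps_cst a) g)) n = fps_nth (?Q * d g) n"
    by (simp add: 1 sum_distrib_right)
  also have "\<dots> = fps_nth (fps_compose (fps_cst (fps_deriv a)) g * d g) n"
    unfolding fps_mult_nth
    by (intro sum.cong refl arg_cong2[where f="(*)"] fps_compose_cst_nth[OF g, symmetric]) auto
  finally show "fps_nth (d (fps_compose (fps_cst a) g)) n =
    fps_nth (fps_compose (fps_cst (fps_deriv a)) g * d g) n" .
qed

text \<open>The derivative of ln(1 + X) is the geometric series in -X, and the truncated product
  telescopes to 1 - (-g)^(n+1).\<close>

lemma fps_compose_geometric:
  fixes g :: "('m::comm_monoid_add \<Rightarrow>\<^sub>0 rat) fps"
  assumes g: "fps_nth g 0 = 0"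
  shows "(1 + g) * fps_compose (fps_cst (fps_deriv (fps_ln 1))) g = 1"
proof (rule fps_ext)
  fix n
  have nth: "fps_nth (fps_deriv (fps_ln 1)) i = ((-1) ^ i :: rat)" for i
    by (simp add: fps_ln_def)
  have c: "cst ((-1) ^ i :: rat) = ((-1) ^ i :: 'm \<Rightarrow>\<^sub>0 rat)" for i
    using rhom.power[OF rhom_cst, of "-1::rat" i] by (simp add: cst_uminus)
  let ?Q = "\<Sum>i\<le>n. fps_const (cst (fps_nth (fps_deriv (fps_ln 1)) i)) * g ^ i"
  have Q: "?Q = (\<Sum>i\<le>n. (- g) ^ i)"
    by (intro sum.cong refl) (simp only: nth c, simp add: power_minus[of g] flip: fps_const_neg fps_const_power)
  have "fps_nth ((1 + g) * fps_compose (fps_cst (fps_deriv (fps_ln 1))) g) n = fps_nth ((1 + g) * ?Q) n"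
    unfolding fps_mult_nth
    by (intro sum.cong refl arg_cong2[where f="(*)"] fps_compose_cst_nth[OF g]) auto
  also have "(1 + g) * ?Q = 1 - (- g) ^ Suc n"
    unfolding Q using one_diff_power_eq[of "- g" "Suc n"]
    by (simp only: lessThan_Suc_atMost flip: diff_minus_eq_add)
  finally show "fps_nth ((1 + g) * fps_compose (fps_cst (fps_deriv (fps_ln 1))) g) n = fps_nth 1 n"
    using startsby_zero_power_prefix[of "- g" "Suc n"] g by simp
qed

lemma der_ln:
  assumes d: "der (\<lambda>x. x) d" "\<And>c. d (cst c) = 0" and g: "fps_nth f 0 = 1"
  shows "fps_lift d f = f * fps_lift d (fps_compose (fps_cst (fps_ln 1)) (f - 1))"
proof -
  interpret der "\<lambda>x. x" d by fact
  have D: "der (\<lambda>x. x) (fps_lift d)" using der_fps_lift[OF rhom_id d(1)] by simp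
  interpret D: der "\<lambda>x. x" "fps_lift d" by fact
  have one: "fps_lift d 1 = 0" using D.leibniz[of 1 1] by simp
  have "fps_lift d (fps_compose (fps_cst (fps_ln 1)) (f - 1)) =
    fps_compose (fps_cst (fps_deriv (fps_ln 1))) (f - 1) * fps_lift d (f - 1)"
    by (rule der_fps_compose[OF D]) (auto simp: fps_eq_iff d(2) zero g)
  then have "f * fps_lift d (fps_compose (fps_cst (fps_ln 1)) (f - 1)) =
    ((1 + (f - 1)) * fps_compose (fps_cst (fps_deriv (fps_ln 1))) (f - 1)) * fps_lift d f"
    by (simp add: D.diff one mult_ac)
  then show ?thesis using fps_compose_geometric[of "f - 1"] g by simp
qed

text \<open>If \<open>f * k = 0\<close>, the coefficients of \<open>k\<close> vanish one after the
  other. This is how tau is divided out of the equations below.\<close>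

lemma fps_cancel_const_1:
  fixes f :: "'a::comm_ring_1 fps"
  assumes "fps_nth f 0 = 1" "f * g = f * h" shows "g = h"
proof -
  have "f * k = 0 \<Longrightarrow> fps_nth k n = 0" for k n
  proof (induction n rule: less_induct)
    case (less n)
    then have "0 = fps_nth (f * k) n" by simp
    also have "\<dots> = (\<Sum>i=0..n. if i = 0 then fps_nth k n else 0)"
      unfolding fps_mult_nth by (intro sum.cong) (use less assms(1) in auto)
    finally show ?case by simp
  qed
  from this[of "g - h"] assms(2) show ?thesis by (simp add: fps_eq_iff right_diff_distrib)
qed

lemma h_poly_0: "h_poly p 0 = 1"
  by (simp add: h_poly_def fps_cst_def)

text \<open>Newton's identity: compare coefficients in E' = E \<xi>', where E is the exponential of
  \<xi>.\<close>

lemma h_poly_rec: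
  fixes p :: "nat \<Rightarrow> 'a rpoly"
  shows "of_nat n * h_poly p n = (\<Sum>i=1..n. p i * h_poly p (n - i))"
proof (cases n)
  case (Suc m)
  define \<xi> where "\<xi> = Abs_fps (\<lambda>i. if i = 0 then 0 else cst (1 / of_nat i) * p i)"
  define E where "E = fps_compose (fps_cst (fps_exp 1)) \<xi>"
  have "fps_deriv E = E * fps_deriv \<xi>"
    unfolding E_def by (subst der_fps_compose[OF der_fps_deriv]) (auto simp: \<xi>_def)
  moreover have "fps_nth (fps_deriv \<xi>) i = p (Suc i)" for i
  proof -
    have "of_nat (Suc i) * (cst (1 / of_nat (Suc i)) * p (Suc i)) = p (Suc i)"
      unfolding mult.assoc[symmetric] by (subst of_nat_mult_cst_inverse) simp_all
    then show ?thesis by (simp add: \<xi>_def)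
  qed
  ultimately have "fps_nth (fps_deriv E) m = (\<Sum>i=0..m. fps_nth E i * p (Suc (m - i)))"
    by (simp only: fps_mult_nth)
  also have "\<dots> = (\<Sum>i=0..m. p (Suc i) * fps_nth E (m - i))"
    by (subst sum.atLeastAtMost_rev) (simp add: mult.commute)
  also have "\<dots> = (\<Sum>i=1..n. p i * fps_nth E (n - i))"
    unfolding Suc One_nat_def sum.shift_bounds_cl_Suc_ivl by simp
  finally show ?thesis by (simp add: Suc E_def h_poly_def \<xi>_def)
qed simp

section \<open>Deleting an edge of a bipartite map\<close>

lemma orbit_enum:
  assumes "0 < r" "\<And>i. Suc i < r \<Longrightarrow> f (a i) = a (Suc i)" "f (a (r - 1)) = a 0"
  shows "orbit f (a 0) = a ` {..<r}"
proof -
  have it: "(f ^^ i) (a 0) = a i" if "i < r" for i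
    using that by (induction i) (simp_all add: assms(2))
  have "(f ^^ r) (a 0) = f ((f ^^ (r - 1)) (a 0))"
    using assms(1) by (cases r) simp_all
  also have "\<dots> = a 0" using it[of "r - 1"] assms(1,3) by simp
  finally have "orbit f (a 0) = {(f ^^ m) (a 0) |m. m < r}"
    by (rule orbit_altdef_bounded) fact
  also have "\<dots> = a ` {..<r}" using it by (auto simp: image_def) (metis)+
  finally show ?thesis .
qed

lemma orbit_cases:
  fixes x :: 'a
  assumes "permutation \<pi>"
  defines "m \<equiv> card (orbit \<pi> x)"
  shows "0 < m" "(\<pi> ^^ m) x = x" "inj_on (\<lambda>i. (\<pi> ^^ i) x) {..<m}"
    "orbit \<pi> x = (\<lambda>i. (\<pi> ^^ i) x) ` {..<m}"
proof -
  define l where "l = (LEAST l. 0 < l \<and> (\<pi> ^^ l) x = x)"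
  have ex: "\<exists>l. 0 < l \<and> (\<pi> ^^ l) x = x"
    using permutation_self[OF assms(1), of x] by metis
  have l: "0 < l" "(\<pi> ^^ l) x = x" using LeastI_ex[OF ex] by (auto simp: l_def)
  have "\<And>k. 0 < k \<Longrightarrow> k < l \<Longrightarrow> (\<pi> ^^ k) x \<noteq> x" using not_less_Least l_def by blast
  then have inj: "inj_on (\<lambda>i. (\<pi> ^^ i) x) {..<l}"
    using inj_on_funpow_least[OF l(2)] by (simp add: atLeast0LessThan)
  have orb: "orbit \<pi> x = (\<lambda>i. (\<pi> ^^ i) x) ` {..<l}"
    using orbit_altdef_bounded[OF l(2,1)] by auto
  have "m = l" unfolding m_def orb using card_image[OF inj] by simp
  then show "0 < m" "(\<pi> ^^ m) x = x" "inj_on (\<lambda>i. (\<pi> ^^ i) x) {..<m}"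
    "orbit \<pi> x = (\<lambda>i. (\<pi> ^^ i) x) ` {..<m}" using l inj orb by auto
qed

lemma orbit_eq_iff:
  assumes "permutation \<pi>" shows "orbit \<pi> x = orbit \<pi> y \<longleftrightarrow> y \<in> orbit \<pi> x"
  using assms by (metis cyclic_on_orbit' orbit_cyclic_eq3 permutation_self_in_orbit)

lemma orbit_sym: "permutation \<pi> \<Longrightarrow> y \<in> orbit \<pi> x \<longleftrightarrow> x \<in> orbit \<pi> y"
  by (metis orbit_eq_iff)

lemma orbit_disjoint:
  assumes "permutation \<pi>" "y \<notin> orbit \<pi> x" shows "orbit \<pi> x \<inter> orbit \<pi> y = {}"
  using assms by (metis disjoint_iff orbit_eq_iff)

lemma orbit_transpose_other:
  assumes "permutation \<pi>" "x \<notin> orbit \<pi> z" "y \<notin> orbit \<pi> z"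
  shows "orbit (transpose x y \<circ> \<pi>) z = orbit \<pi> z"
proof (rule orbit_cong[OF permutation_self_in_orbit[OF assms(1)]])
  fix s assume "s \<in> orbit \<pi> z"
  then have "\<pi> s \<in> orbit \<pi> z" by (rule orbit.step)
  then show "(transpose x y \<circ> \<pi>) s = \<pi> s" using assms by (auto simp: transpose_def)
qed

text \<open>The two cycles are run through in succession: the last element of the cycle of
  \<open>x\<close> is now sent to \<open>y\<close>, and the last element of the cycle of
  \<open>y\<close> back to \<open>x\<close>.\<close>

lemma orbit_transpose_join:
  assumes \<pi>: "permutation \<pi>" and y: "y \<notin> orbit \<pi> x"
  shows "orbit (transpose x y \<circ> \<pi>) x = orbit \<pi> x \<union> orbit \<pi> y"
proof -
  define m where "m = card (orbit \<pi> x)"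
  define l where "l = card (orbit \<pi> y)"
  note X = orbit_cases[OF \<pi>, of x, folded m_def] and Y = orbit_cases[OF \<pi>, of y, folded l_def]
  define a where "a i = (if i < m then (\<pi> ^^ i) x else (\<pi> ^^ (i - m)) y)" for i
  have x: "x \<notin> orbit \<pi> y" using y \<pi> orbit_eq_iff by metis
  have inX: "(\<pi> ^^ i) x \<in> orbit \<pi> x" for i by (simp add: funpow_in_orbit permutation_self_in_orbit \<pi>)
  have inY: "(\<pi> ^^ i) y \<in> orbit \<pi> y" for i by (simp add: funpow_in_orbit permutation_self_in_orbit \<pi>)
  have nx: "(\<pi> ^^ i) x \<noteq> x" if "0 < i" "i < m" for i using inj_onD[OF X(3), of i 0] that by auto
  have ny: "(\<pi> ^^ i) y \<noteq> y" if "0 < i" "i < l" for i using inj_onD[OF Y(3), of i 0] that by auto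
  have "orbit (transpose x y \<circ> \<pi>) (a 0) = a ` {..<m + l}"
  proof (rule orbit_enum)
    fix i assume i: "Suc i < m + l"
    consider "Suc i < m" | "Suc i = m" | "m \<le> i" by linarith
    then show "(transpose x y \<circ> \<pi>) (a i) = a (Suc i)"
    proof cases
      case 1
      then show ?thesis using nx[of "Suc i"] inX[of "Suc i"] y by (auto simp: a_def transpose_def)
    next
      case 2
      then show ?thesis using X(2) by (auto simp: a_def)
    next
      case 3
      then show ?thesis using i ny[of "Suc i - m"] inY[of "Suc i - m"] x
        by (auto simp: a_def transpose_def Suc_diff_le)
    qed
  next
    have "\<pi> ((\<pi> ^^ (l - 1)) y) = y" using Y(1,2) by (cases l) simp_all
    then show "(transpose x y \<circ> \<pi>) (a (m + l - 1)) = a 0" using X(1) Y(1) by (auto simp: a_def)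
  qed (use X in auto)
  moreover have "{..<m + l} = {..<m} \<union> (+) m ` {..<l}"
  proof (intro set_eqI iffI)
    show "i \<in> {..<m} \<union> (+) m ` {..<l}" if "i \<in> {..<m + l}" for i
      using that by (cases "i < m") (auto intro!: image_eqI[of _ _ "i - m"])
  qed auto
  then have "a ` {..<m + l} = a ` {..<m} \<union> a ` ((+) m ` {..<l})"
    by (simp only: image_Un)
  moreover have "a ` {..<m} = orbit \<pi> x" "a ` ((+) m ` {..<l}) = orbit \<pi> y"
    unfolding X(4) Y(4) image_image by (auto simp: a_def intro!: image_cong)
  ultimately show ?thesis using X(1) by (simp add: a_def)
qed

text \<open>The element before \<open>y\<close> now returns to \<open>x\<close>, and the last
  element of the cycle goes to \<open>y\<close>; so the positions below \<open>r\<close> and those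
  from \<open>r\<close> on become separate cycles.\<close>

lemma orbit_transpose_cut:
  assumes \<pi>: "permutation \<pi>" and r: "0 < r" "r < card (orbit \<pi> x)" and y: "y = (\<pi> ^^ r) x"
  shows "orbit (transpose x y \<circ> \<pi>) x = (\<lambda>i. (\<pi> ^^ i) x) ` {..<r}"
    and "orbit (transpose x y \<circ> \<pi>) y = (\<lambda>i. (\<pi> ^^ i) x) ` {r..<card (orbit \<pi> x)}"
proof -
  define m where "m = card (orbit \<pi> x)"
  note X = orbit_cases[OF \<pi>, of x, folded m_def]
  have rm: "r < m" using r by (simp add: m_def)
  have nx: "(\<pi> ^^ i) x \<noteq> x" if "0 < i" "i < m" for i using inj_onD[OF X(3), of i 0] that by auto
  have ny: "(\<pi> ^^ i) x \<noteq> y" if "i \<noteq> r" "i < m" for i using inj_onD[OF X(3), of i r] that y rm by auto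
  have "orbit (transpose x y \<circ> \<pi>) ((\<pi> ^^ 0) x) = (\<lambda>i. (\<pi> ^^ i) x) ` {..<r}"
  proof (rule orbit_enum[where a="\<lambda>i. (\<pi> ^^ i) x"])
    fix i assume "Suc i < r"
    then show "(transpose x y \<circ> \<pi>) ((\<pi> ^^ i) x) = (\<pi> ^^ Suc i) x"
      using nx[of "Suc i"] ny[of "Suc i"] rm by (auto simp: transpose_def)
  next
    have "\<pi> ((\<pi> ^^ (r - 1)) x) = y" using r y by (cases r) simp_all
    then show "(transpose x y \<circ> \<pi>) ((\<pi> ^^ (r - 1)) x) = (\<pi> ^^ 0) x" by simp
  qed (use r in auto)
  then show "orbit (transpose x y \<circ> \<pi>) x = (\<lambda>i. (\<pi> ^^ i) x) ` {..<r}" by simp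
  have "orbit (transpose x y \<circ> \<pi>) ((\<pi> ^^ (r + 0)) x) = (\<lambda>i. (\<pi> ^^ (r + i)) x) ` {..<m - r}"
  proof (rule orbit_enum[where a="\<lambda>i. (\<pi> ^^ (r + i)) x"])
    fix i assume "Suc i < m - r"
    then show "(transpose x y \<circ> \<pi>) ((\<pi> ^^ (r + i)) x) = (\<pi> ^^ (r + Suc i)) x"
      using nx[of "Suc (r + i)"] ny[of "Suc (r + i)"] rm by (auto simp: transpose_def)
  next
    have "\<pi> ((\<pi> ^^ (m - 1)) x) = x" using X(1,2) by (cases m) simp_all
    then show "(transpose x y \<circ> \<pi>) ((\<pi> ^^ (r + (m - r - 1))) x) = (\<pi> ^^ (r + 0)) x"
      using rm y by simp
  qed (use rm in auto)
  also have "\<dots> = (\<lambda>i. (\<pi> ^^ i) x) ` ((+) r ` {..<m - r})"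
    by (simp only: image_image)
  also have "(+) r ` {..<m - r} = {r..<m}"
    using rm image_add_atLeastLessThan[of r 0 "m - r"] by (simp add: atLeast0LessThan)
  finally show "orbit (transpose x y \<circ> \<pi>) y = (\<lambda>i. (\<pi> ^^ i) x) ` {r..<card (orbit \<pi> x)}"
    by (simp only: y m_def add_0_right)
qed

definition other_cycles :: "('a \<Rightarrow> 'a) \<Rightarrow> 'a set \<Rightarrow> 'a \<Rightarrow> 'a set set" where
  "other_cycles \<pi> S x = orbit \<pi> ` (S - orbit \<pi> x)"

lemma other_cycles_alt:
  assumes "permutation \<pi>" "x \<in> S"
  shows "other_cycles \<pi> S x = orbit \<pi> ` S - {orbit \<pi> x}"
  using assms orbit_eq_iff[OF assms(1)] by (auto simp: other_cycles_def)

lemma other_cycles_join: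
  assumes \<pi>: "permutation \<pi>" and a: "a \<notin> orbit \<pi> x"
  shows "orbit (transpose a x \<circ> \<pi>) x = orbit \<pi> a \<union> orbit \<pi> x"
    and "other_cycles (transpose a x \<circ> \<pi>) S x = other_cycles \<pi> S x - {orbit \<pi> a}"
proof -
  have x: "x \<notin> orbit \<pi> a" using a \<pi> orbit_eq_iff by metis
  show *: "orbit (transpose a x \<circ> \<pi>) x = orbit \<pi> a \<union> orbit \<pi> x"
    using orbit_transpose_join[OF \<pi> a] by (simp add: transpose_commute Un_commute)
  have "orbit (transpose a x \<circ> \<pi>) z = orbit \<pi> z" if "z \<notin> orbit \<pi> a" "z \<notin> orbit \<pi> x" for z
    using that orbit_sym[OF \<pi>] by (intro orbit_transpose_other[OF \<pi>]) auto
  then have "other_cycles (transpose a x \<circ> \<pi>) S x = orbit \<pi> ` (S - (orbit \<pi> a \<union> orbit \<pi> x))"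
    unfolding other_cycles_def * by (intro image_cong) auto
  moreover have "orbit \<pi> z = orbit \<pi> a \<longleftrightarrow> z \<in> orbit \<pi> a" for z
    using orbit_eq_iff[OF \<pi>, of a z] by metis
  then have "orbit \<pi> ` (S - (orbit \<pi> a \<union> orbit \<pi> x)) = orbit \<pi> ` (S - orbit \<pi> x) - {orbit \<pi> a}"
    by blast
  ultimately show "other_cycles (transpose a x \<circ> \<pi>) S x = other_cycles \<pi> S x - {orbit \<pi> a}"
    by (simp add: other_cycles_def)
qed

lemma other_cycles_cut:
  assumes \<pi>: "permutation \<pi>" and r: "0 < r" "r < card (orbit \<pi> x)" and a: "a = (\<pi> ^^ r) x"
    and S: "orbit \<pi> x \<subseteq> S"
  shows "card (orbit (transpose a x \<circ> \<pi>) x) = r"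
    and "other_cycles (transpose a x \<circ> \<pi>) S x = insert (orbit (transpose a x \<circ> \<pi>) a) (other_cycles \<pi> S x)"
    and "card (orbit (transpose a x \<circ> \<pi>) a) = card (orbit \<pi> x) - r"
    and "orbit (transpose a x \<circ> \<pi>) a \<notin> other_cycles \<pi> S x"
proof -
  let ?f = "transpose a x \<circ> \<pi>"
  let ?e = "\<lambda>i. (\<pi> ^^ i) x"
  note X = orbit_cases[OF \<pi>, of x]
  have f1: "orbit ?f x = ?e ` {..<r}" and f2: "orbit ?f a = ?e ` {r..<card (orbit \<pi> x)}"
    using orbit_transpose_cut[OF \<pi> r a] by (simp_all add: transpose_commute)
  show "card (orbit ?f x) = r" "card (orbit ?f a) = card (orbit \<pi> x) - r"
    unfolding f1 f2 using r by (simp_all add: card_image inj_on_subset[OF X(3)] subset_iff)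
  have fp: "permutation ?f" by (intro permutation_compose \<pi> permutation_swap_id)
  have un: "orbit \<pi> x = orbit ?f x \<union> orbit ?f a"
    unfolding f1 f2 image_Un[symmetric] using X(4) r(2) by (metis ivl_disj_un_one(2) less_imp_le)
  have oth: "orbit ?f z = orbit \<pi> z" if "z \<notin> orbit \<pi> x" for z
    using that orbit_eq_iff[OF \<pi>] a funpow_in_orbit[OF permutation_self_in_orbit[OF \<pi>, of x], of r]
    by (intro orbit_transpose_other[OF \<pi>]) metis+
  have dj: "orbit ?f x \<inter> orbit ?f a = {}"
    unfolding f1 f2 using inj_onD[OF X(3)] r(2) by fastforce
  have "S - orbit ?f x = (S - orbit \<pi> x) \<union> orbit ?f a" using un dj S by auto
  moreover have "orbit ?f ` orbit ?f a = {orbit ?f a}"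
    using orbit_eq_iff[OF fp] permutation_self_in_orbit[OF fp] by auto
  ultimately show "other_cycles ?f S x = insert (orbit ?f a) (other_cycles \<pi> S x)"
    using oth by (auto simp: other_cycles_def image_Un)
  show "orbit ?f a \<notin> other_cycles \<pi> S x"
  proof
    assume "orbit ?f a \<in> other_cycles \<pi> S x"
    then obtain z where "z \<notin> orbit \<pi> x" "orbit ?f a = orbit \<pi> z" by (auto simp: other_cycles_def)
    then show False using un permutation_self_in_orbit[OF \<pi>, of z] by blast
  qed
qed


lemma sum_over_orbits:
  fixes h :: "'a set \<Rightarrow> 'r::comm_semiring_1"
  assumes \<pi>: "\<pi> permutes S" and S: "finite S"
  shows "(\<Sum>x\<in>S. h (orbit \<pi> x)) = (\<Sum>C\<in>orbit \<pi> ` S. of_nat (card C) * h C)"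
proof -
  have p: "permutation \<pi>" using \<pi> S permutation_permutes by blast
  have "(\<Sum>x\<in>S. h (orbit \<pi> x)) = (\<Sum>C\<in>orbit \<pi> ` S. \<Sum>x\<in>{x\<in>S. orbit \<pi> x = C}. h (orbit \<pi> x))"
    by (rule sum.image_gen[OF S])
  also have "\<dots> = (\<Sum>C\<in>orbit \<pi> ` S. of_nat (card C) * h C)"
  proof (rule sum.cong[OF refl])
    fix C assume "C \<in> orbit \<pi> ` S"
    then obtain y where y: "y \<in> S" "C = orbit \<pi> y" by auto
    then have "{x\<in>S. orbit \<pi> x = C} = C"
      using orbit_eq_iff[OF p, of y] permutes_orbit_subset[OF \<pi> y(1)] by auto
    then have "(\<Sum>x\<in>{x\<in>S. orbit \<pi> x = C}. h (orbit \<pi> x)) = (\<Sum>x\<in>C. h C)"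
      by (intro sum.cong) auto
    then show "(\<Sum>x\<in>{x\<in>S. orbit \<pi> x = C}. h (orbit \<pi> x)) = of_nat (card C) * h C" by simp
  qed
  finally show ?thesis .
qed

section \<open>Weights of rooted permutations and the insertion of an edge\<close>

context
  fixes g :: "nat \<Rightarrow> 'r::comm_ring_1"
begin

definition cycle_weight :: "'a set set \<Rightarrow> 'r" where
  "cycle_weight Cs = (\<Prod>C\<in>Cs. g (card C))"

definition rooted_weight :: "nat \<Rightarrow> ('a \<Rightarrow> 'a) \<Rightarrow> 'a set \<Rightarrow> 'a \<Rightarrow> 'r" where
  "rooted_weight m \<pi> S x = (if card (orbit \<pi> x) = m then cycle_weight (other_cycles \<pi> S x) else 0)"

text \<open>The new element \<open>n\<close> is a fixed point of \<open>\<phi>\<close>. The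
  transposition of \<open>b\<close> and \<open>n\<close> puts it into the cycle of \<open>b\<close>;
  the one of \<open>a\<close> and \<open>n\<close> then joins the cycle of \<open>a\<close>, if this
  is another one, and otherwise cuts the cycle of \<open>n\<close>. The last claim is summed over
  \<open>a\<close> because the place of the cut runs once through all positions.\<close>

lemma rooted_weight_insert:
  fixes \<phi> :: "'a \<Rightarrow> 'a"
  assumes \<phi>: "\<phi> permutes N" and N: "finite N" and n: "n \<notin> N" and b: "b \<in> N"
  defines "S \<equiv> insert n N" and "Cs \<equiv> orbit \<phi> ` N" and "\<psi> \<equiv> transpose b n \<circ> \<phi>"
  shows "rooted_weight m \<phi> S n = (if m = 1 then cycle_weight Cs else 0)"
    and "rooted_weight m \<psi> S n = (if card (orbit \<phi> b) + 1 = m then cycle_weight (Cs - {orbit \<phi> b}) else 0)"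
    and "a \<in> N \<Longrightarrow> a \<notin> orbit \<phi> b \<Longrightarrow> rooted_weight m (transpose a n \<circ> \<psi>) S n =
      (if card (orbit \<phi> a) + card (orbit \<phi> b) + 1 = m then cycle_weight (Cs - {orbit \<phi> b} - {orbit \<phi> a}) else 0)"
    and "(\<Sum>a\<in>orbit \<phi> b. rooted_weight m (transpose a n \<circ> \<psi>) S n) =
      (if 1 \<le> m \<and> m \<le> card (orbit \<phi> b) then g (card (orbit \<phi> b) + 1 - m) * cycle_weight (Cs - {orbit \<phi> b}) else 0)"
proof -
  have p: "permutation \<phi>" using \<phi> N permutation_permutes by blast
  have "\<phi> n = n" using \<phi> n by (simp add: permutes_not_in)
  then have on: "orbit \<phi> n = {n}" by (simp add: orbit_eq_singleton_iff)
  have bn: "b \<notin> orbit \<phi> n" using on b n by auto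
  have Cs: "other_cycles \<phi> S n = Cs" using n by (auto simp: other_cycles_def on S_def Cs_def)
  show "rooted_weight m \<phi> S n = (if m = 1 then cycle_weight Cs else 0)"
    by (auto simp: rooted_weight_def on Cs)
  have sub: "orbit \<phi> x \<subseteq> N" if "x \<in> N" for x using permutes_orbit_subset[OF \<phi> that] .
  have fin: "finite (orbit \<phi> x)" for x using finite_orbit permutation_self_in_orbit[OF p] by metis
  have n_orb: "n \<notin> orbit \<phi> x" if "x \<in> N" for x using sub[OF that] n by auto
  have o\<psi>: "orbit \<psi> n = orbit \<phi> b \<union> {n}" and c\<psi>: "other_cycles \<psi> S n = Cs - {orbit \<phi> b}"
    using other_cycles_join[OF p bn] by (simp_all add: \<psi>_def on Cs)
  have p\<psi>: "permutation \<psi>" unfolding \<psi>_def by (intro permutation_compose p permutation_swap_id)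
  have card\<psi>: "card (orbit \<psi> n) = card (orbit \<phi> b) + 1" using n_orb[OF b] fin by (simp add: o\<psi>)
  show "rooted_weight m \<psi> S n = (if card (orbit \<phi> b) + 1 = m then cycle_weight (Cs - {orbit \<phi> b}) else 0)"
    by (simp add: rooted_weight_def card\<psi> c\<psi>)
  show "rooted_weight m (transpose a n \<circ> \<psi>) S n =
      (if card (orbit \<phi> a) + card (orbit \<phi> b) + 1 = m then cycle_weight (Cs - {orbit \<phi> b} - {orbit \<phi> a}) else 0)"
    if a: "a \<in> N" "a \<notin> orbit \<phi> b"
  proof -
    have "b \<notin> orbit \<phi> a" using a orbit_sym[OF p] by metis
    then have oa: "orbit \<psi> a = orbit \<phi> a"
      unfolding \<psi>_def using n_orb[OF a(1)] by (intro orbit_transpose_other[OF p])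
    have "a \<notin> orbit \<psi> n" using a n by (auto simp: o\<psi>)
    note J = other_cycles_join[OF p\<psi> this]
    have "card (orbit \<phi> a \<union> (orbit \<phi> b \<union> {n})) = card (orbit \<phi> a) + (card (orbit \<phi> b) + 1)"
      using orbit_disjoint[OF p a(2)] n_orb[OF a(1)] fin card\<psi> by (subst card_Un_disjoint) (auto simp: o\<psi>)
    then show ?thesis by (simp add: rooted_weight_def J oa o\<psi> c\<psi>)
  qed
  note X = orbit_cases[OF p\<psi>, of n, unfolded card\<psi>]
  let ?j = "card (orbit \<phi> b)"
  \<comment> \<open>The cycle of \<open>b\<close> occupies the positions 1 to \<open>?j\<close> of
    the cycle of \<open>\<psi>\<close> started at \<open>n\<close>. A cut at position r leaves
    \<open>n\<close> in a cycle of length r and splits off one of length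
    \<open>?j + 1 - r\<close>.\<close>
  have "orbit \<phi> b = orbit \<psi> n - {n}" using n_orb[OF b] by (auto simp: o\<psi>)
  also have "\<dots> = (\<lambda>i. (\<psi> ^^ i) n) ` ({..<?j + 1} - {0})"
    using inj_on_image_set_diff[OF X(3), of "{..<?j + 1}" "{0}"] by (simp add: X(4))
  also have "{..<?j + 1} - {0} = {1..?j}" by auto
  finally have ob: "orbit \<phi> b = (\<lambda>i. (\<psi> ^^ i) n) ` {1..?j}" .
  have inj: "inj_on (\<lambda>i. (\<psi> ^^ i) n) {1..?j}" by (rule inj_on_subset[OF X(3)]) auto
  have "(\<Sum>a\<in>orbit \<phi> b. rooted_weight m (transpose a n \<circ> \<psi>) S n) =
    (\<Sum>r\<in>{1..?j}. rooted_weight m (transpose ((\<psi> ^^ r) n) n \<circ> \<psi>) S n)"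
    by (subst ob, subst sum.reindex[OF inj]) simp
  also have "\<dots> = (\<Sum>r\<in>{1..?j}. if r = m then g (?j + 1 - m) * cycle_weight (Cs - {orbit \<phi> b}) else 0)"
  proof (rule sum.cong[OF refl])
    fix r assume r: "r \<in> {1..?j}"
    have "orbit \<psi> n \<subseteq> S" using sub[OF b] by (auto simp: o\<psi> S_def)
    note C = other_cycles_cut[OF p\<psi>, where r=r, OF _ _ refl this]
    have "finite (other_cycles \<psi> S n)" using N by (simp add: other_cycles_def S_def)
    show "rooted_weight m (transpose ((\<psi> ^^ r) n) n \<circ> \<psi>) S n =
      (if r = m then g (?j + 1 - m) * cycle_weight (Cs - {orbit \<phi> b}) else 0)"
    proof (cases "r = m")
      case True
      then show ?thesis
        using C r \<open>finite (other_cycles \<psi> S n)\<close> unfolding True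
        by (simp add: rooted_weight_def card\<psi> cycle_weight_def) (simp add: c\<psi>)
    qed (use C r in \<open>simp add: rooted_weight_def card\<psi>\<close>)
  qed
  also have "\<dots> = (if 1 \<le> m \<and> m \<le> ?j then g (?j + 1 - m) * cycle_weight (Cs - {orbit \<phi> b}) else 0)"
    by (simp add: sum.delta)
  finally show "(\<Sum>a\<in>orbit \<phi> b. rooted_weight m (transpose a n \<circ> \<psi>) S n) = \<dots>" .
qed

end

subsection \<open>Virasoro operators\<close>

text \<open>The map \<open>pv\<close> enumerates the variables playing the role of the \<open>p\<^sub>i\<close>; it is \<open>VarP\<close> or one of the two copies of
  it in the bilinear identity.\<close>

definition der_on :: "(nat \<Rightarrow> 'x) \<Rightarrow> (nat \<Rightarrow> 'x rpoly) \<Rightarrow> 'x rpoly \<Rightarrow> 'x rpoly" where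
  "der_on pv e = derivation (\<lambda>x. if x \<in> range pv then e (inv pv x) else 0)"

lemma der_der_on: "der (\<lambda>x. x) (der_on pv e)"
  by (simp add: der_on_def der_derivation)

lemma der_on_pvar: "inj pv \<Longrightarrow> der_on pv e (pvar (pv j)) = e j"
  by (simp add: der_on_def derivation_pvar)

lemma der_on_other: "x \<notin> range pv \<Longrightarrow> der_on pv e (pvar x) = 0"
  by (simp add: der_on_def derivation_pvar)

lemma der_on_cst [simp]: "der_on pv e (cst c) = 0"
  by (simp add: der_on_def)

lemma der_on_of_nat [simp]: "der_on pv e (of_nat c) = 0"
  by (simp add: der_on_def)

lemmas der_on_mult = der.leibniz[OF der_der_on]
lemmas der_on_add = additive_map.add[OF der.axioms(1)[OF der_der_on]]
lemmas der_on_sum = additive_map.sum[OF der.axioms(1)[OF der_der_on]]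
lemmas der_on_diff = additive_map.diff[OF der.axioms(1)[OF der_der_on]]

abbreviation pd :: "(nat \<Rightarrow> 'x) \<Rightarrow> nat \<Rightarrow> 'x rpoly \<Rightarrow> 'x rpoly" where
  "pd pv k \<equiv> der_on pv (\<lambda>j. if j = k then 1 else 0)"

definition pconst :: "(nat \<Rightarrow> 'x) \<Rightarrow> 'x rpoly \<Rightarrow> bool" where
  "pconst pv c \<longleftrightarrow> (\<forall>e. der_on pv e c = 0)"

lemma pconst_mult: "pconst pv c \<Longrightarrow> pconst pv d \<Longrightarrow> pconst pv (c * d)"
  by (simp add: pconst_def der_on_mult)

lemma pconst_add: "pconst pv c \<Longrightarrow> pconst pv d \<Longrightarrow> pconst pv (c + d)"
  by (simp add: pconst_def der_on_add)

lemma pconst_cst [simp]: "pconst pv (cst c)"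
  by (simp add: pconst_def)

lemma pconst_1 [simp]: "pconst pv 1"
  using pconst_cst[of pv 1] by simp

lemma pconst_of_nat [simp]: "pconst pv (of_nat n)"
  by (simp add: pconst_def)

lemma pconst_power: "pconst pv c \<Longrightarrow> pconst pv (c ^ n)"
  by (induction n) (simp_all add: pconst_mult)

lemma der_on_const_mult: "pconst pv c \<Longrightarrow> der_on pv e (c * f) = c * der_on pv e f"
  by (simp add: pconst_def der_on_mult)

definition virasoro :: "(nat \<Rightarrow> 'x) \<Rightarrow> 'x rpoly \<Rightarrow> 'x rpoly \<Rightarrow> nat \<Rightarrow> 'x rpoly \<Rightarrow> 'x rpoly" where
  "virasoro pv u v k f = der_on pv (\<lambda>j. if k < j then of_nat j * pvar (pv (j - k)) else 0) f
     + (u + v) * of_nat k * pd pv k f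
     + (\<Sum>i\<in>{1..<k}. of_nat (i * (k - i)) * pd pv i (pd pv (k - i) f))
     + (if k = 0 then u * v * f else 0)"

lemma virasoro_add: "virasoro pv u v k (f + g) = virasoro pv u v k f + virasoro pv u v k g"
  by (simp add: virasoro_def der_on_add distrib_left add_ac sum.distrib del: of_nat_mult)

lemma additive_virasoro: "additive_map (virasoro pv u v k)"
  by unfold_locales (rule virasoro_add)

lemma virasoro_const_mult: "pconst pv c \<Longrightarrow> virasoro pv u v k (c * f) = c * virasoro pv u v k f"
  by (simp add: virasoro_def der_on_const_mult distrib_left sum_distrib_left mult_ac)

text \<open>The summands list the ways in which a new element can lie in a root cycle of length k +
  1: it enters a longer cycle that is then cut, it enters a cycle of length k, it joins two cycles
  of total length k, or, for k = 0, it is a cycle by itself.\<close>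

lemma virasoro_cycle_weight:
  fixes pv :: "nat \<Rightarrow> 'x" and u v :: "'x rpoly"
  assumes pv: "inj pv" and Cs: "finite Cs" "\<And>C. C \<in> Cs \<Longrightarrow> 0 < card C"
  defines "w \<equiv> cycle_weight (\<lambda>i. pvar (pv i) :: 'x rpoly)"
  shows "virasoro pv u v k (w Cs) =
      (\<Sum>C\<in>Cs. if k < card C then of_nat (card C) * pvar (pv (card C - k)) * w (Cs - {C}) else 0)
    + (u + v) * (\<Sum>C\<in>Cs. if card C = k then of_nat (card C) * w (Cs - {C}) else 0)
    + (\<Sum>C\<in>Cs. \<Sum>B\<in>Cs - {C}. if card B + card C = k then of_nat (card C) * of_nat (card B) * w (Cs - {C} - {B}) else 0)
    + (if k = 0 then u * v * w Cs else 0)"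
proof -
  have d: "der_on pv e (w S) = (\<Sum>C\<in>S. e (card C) * w (S - {C}))" if "finite S" for e and S :: "'a set set"
    unfolding w_def cycle_weight_def by (simp add: der_prod[OF der_der_on that] der_on_pvar[OF pv])
  have pd: "pd pv i (w S) = (\<Sum>C\<in>S. if card C = i then w (S - {C}) else 0)" if "finite S" for i and S :: "'a set set"
    unfolding d[OF that] by (intro sum.cong) auto
  have 2: "pd pv i (pd pv j (w Cs)) = (\<Sum>C\<in>Cs. \<Sum>B\<in>Cs - {C}. if card C = j \<and> card B = i then w (Cs - {C} - {B}) else 0)" for i j
  proof -
    have "pd pv i (pd pv j (w Cs)) = (\<Sum>C\<in>Cs. pd pv i (if card C = j then w (Cs - {C}) else 0))"
      by (simp only: pd[OF Cs(1)] der_on_sum)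
    also have "\<dots> = (\<Sum>C\<in>Cs. if card C = j then (\<Sum>B\<in>Cs - {C}. if card B = i then w (Cs - {C} - {B}) else 0) else 0)"
      using Cs(1) by (intro sum.cong refl) (simp add: pd additive_map.zero[OF der.axioms(1)[OF der_der_on]])
    also have "\<dots> = (\<Sum>C\<in>Cs. \<Sum>B\<in>Cs - {C}. if card C = j \<and> card B = i then w (Cs - {C} - {B}) else 0)"
      by (intro sum.cong) auto
    finally show ?thesis .
  qed
  have "(\<Sum>i\<in>{1..<k}. of_nat (i * (k - i)) * pd pv i (pd pv (k - i) (w Cs))) =
     (\<Sum>C\<in>Cs. \<Sum>B\<in>Cs - {C}. \<Sum>i\<in>{1..<k}. if card C = k - i \<and> card B = i then of_nat (i * (k - i)) * w (Cs - {C} - {B}) else 0)"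
    unfolding 2 sum_distrib_left
    by (subst sum.swap, intro sum.cong refl, subst sum.swap, intro sum.cong) auto
  also have "\<dots> = (\<Sum>C\<in>Cs. \<Sum>B\<in>Cs - {C}. if card B + card C = k then of_nat (card C) * of_nat (card B) * w (Cs - {C} - {B}) else 0)"
  proof (intro sum.cong refl)
    fix C B assume C: "C \<in> Cs" and B: "B \<in> Cs - {C}"
    have "(\<Sum>i\<in>{1..<k}. if card C = k - i \<and> card B = i then of_nat (i * (k - i)) * w (Cs - {C} - {B}) else 0)
      = (\<Sum>i\<in>{1..<k}. if card B = i then (if card C = k - card B then of_nat (card C) * of_nat (card B) * w (Cs - {C} - {B}) else 0) else 0)"
      by (intro sum.cong) (auto simp: mult_ac)
    also have "\<dots> = (if card B \<in> {1..<k} then (if card C = k - card B then of_nat (card C) * of_nat (card B) * w (Cs - {C} - {B}) else 0) else 0)"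
      by (simp add: sum.delta')
    also have "\<dots> = (if card B + card C = k then of_nat (card C) * of_nat (card B) * w (Cs - {C} - {B}) else 0)"
      using Cs(2)[OF C] Cs(2)[of B] B by auto
    finally show "(\<Sum>i\<in>{1..<k}. if card C = k - i \<and> card B = i then of_nat (i * (k - i)) * w (Cs - {C} - {B}) else 0)
      = (if card B + card C = k then of_nat (card C) * of_nat (card B) * w (Cs - {C} - {B}) else 0)" .
  qed
  moreover have "der_on pv (\<lambda>j. if k < j then of_nat j * pvar (pv (j - k)) else 0) (w Cs) =
    (\<Sum>C\<in>Cs. if k < card C then of_nat (card C) * pvar (pv (card C - k)) * w (Cs - {C}) else 0)"
    unfolding d[OF Cs(1)] by (intro sum.cong) auto
  moreover have "(u + v) * of_nat k * pd pv k (w Cs) =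
    (u + v) * (\<Sum>C\<in>Cs. if card C = k then of_nat (card C) * w (Cs - {C}) else 0)"
    unfolding pd[OF Cs(1)] sum_distrib_left mult.assoc by (intro sum.cong) auto
  ultimately show ?thesis by (simp add: virasoro_def)
qed

text \<open>If \<open>a\<close> and \<open>b\<close> both equal \<open>n\<close>, the term with u v
  arises; if exactly one does, a term with u or v; if neither does, a cut or a join of two cycles.
  Sums over elements become sums over cycles weighted by their length.\<close>

lemma sum_rooted_weight_insert:
  fixes pv :: "nat \<Rightarrow> 'x" and u v :: "'x rpoly" and \<phi> :: "'a \<Rightarrow> 'a"
  assumes pv: "inj pv" and \<phi>: "\<phi> permutes N" and N: "finite N" and n: "n \<notin> N" and m: "1 \<le> m"
  defines "g \<equiv> (\<lambda>i. pvar (pv i) :: 'x rpoly)"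
  shows "(\<Sum>b\<in>insert n N. \<Sum>a\<in>insert n N. (if a = n then u else 1) * (if b = n then v else 1) *
      rooted_weight g m (transpose a n \<circ> transpose b n \<circ> \<phi>) (insert n N) n) =
    virasoro pv u v (m - 1) (cycle_weight g (orbit \<phi> ` N))"
proof -
  define Cs where "Cs = orbit \<phi> ` N"
  define w :: "'a set set \<Rightarrow> 'x rpoly" where "w = cycle_weight g"
  define S where "S = insert n N"
  note R = rooted_weight_insert[OF \<phi> N n, where g=g and m=m, folded S_def Cs_def w_def]
  have p: "permutation \<phi>" using \<phi> N permutation_permutes by blast
  have id: "transpose n n \<circ> f = f" for f :: "'a \<Rightarrow> 'a" by (simp add: fun_eq_iff)
  have cc: "transpose a n \<circ> transpose b n \<circ> \<phi> = transpose a n \<circ> (transpose b n \<circ> \<phi>)" for a b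
    by (simp add: comp_assoc)
  define X where "X = (\<Sum>b\<in>N. if card (orbit \<phi> b) + 1 = m then w (Cs - {orbit \<phi> b}) else 0)"
  have sub: "orbit \<phi> x \<subseteq> N" if "x \<in> N" for x using permutes_orbit_subset[OF \<phi> that] .
  have Cs: "finite Cs" "\<And>C. C \<in> Cs \<Longrightarrow> 0 < card C"
    using N sub by (auto simp: Cs_def card_gt_0_iff orbit_nonempty intro: finite_subset)
  have one: "(\<Sum>b\<in>N. rooted_weight g m (transpose b n \<circ> \<phi>) S n) = X"
    unfolding X_def by (intro sum.cong refl R(2))
  have two: "(\<Sum>a\<in>N. rooted_weight g m (transpose a n \<circ> (transpose b n \<circ> \<phi>)) S n) =
     (if 1 \<le> m \<and> m \<le> card (orbit \<phi> b) then g (card (orbit \<phi> b) + 1 - m) * w (Cs - {orbit \<phi> b}) else 0) +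
     (\<Sum>B\<in>Cs - {orbit \<phi> b}. if card B + card (orbit \<phi> b) = m - 1 then of_nat (card B) * w (Cs - {orbit \<phi> b} - {B}) else 0)"
    if b: "b \<in> N" for b
  proof -
    let ?h = "\<lambda>B. if B \<noteq> orbit \<phi> b \<and> card B + card (orbit \<phi> b) = m - 1 then w (Cs - {orbit \<phi> b} - {B}) else 0"
    have "(\<Sum>a\<in>N. rooted_weight g m (transpose a n \<circ> (transpose b n \<circ> \<phi>)) S n) =
      (\<Sum>a\<in>orbit \<phi> b. rooted_weight g m (transpose a n \<circ> (transpose b n \<circ> \<phi>)) S n) +
      (\<Sum>a\<in>N - orbit \<phi> b. rooted_weight g m (transpose a n \<circ> (transpose b n \<circ> \<phi>)) S n)"
      using sum.subset_diff[OF sub[OF b] N] by (simp add: add.commute)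
    also have "(\<Sum>a\<in>N - orbit \<phi> b. rooted_weight g m (transpose a n \<circ> (transpose b n \<circ> \<phi>)) S n) =
      (\<Sum>a\<in>N - orbit \<phi> b. ?h (orbit \<phi> a))"
      using orbit_eq_iff[OF p] orbit_sym[OF p, of _ b] m by (intro sum.cong refl) (auto simp: R(3)[OF b])
    also have "\<dots> = (\<Sum>a\<in>N. ?h (orbit \<phi> a))"
      using N orbit_eq_iff[OF p] orbit_sym[OF p, of _ b] by (intro sum.mono_neutral_left) auto
    also have "\<dots> = (\<Sum>B\<in>Cs. of_nat (card B) * ?h B)"
      unfolding Cs_def by (rule sum_over_orbits[OF \<phi> N])
    also have "\<dots> = (\<Sum>B\<in>Cs - {orbit \<phi> b}. if card B + card (orbit \<phi> b) = m - 1 then of_nat (card B) * w (Cs - {orbit \<phi> b} - {B}) else 0)"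
      using Cs(1) by (intro sum.mono_neutral_cong_right) auto
    finally show ?thesis unfolding R(4)[OF b] .
  qed
  have V: "virasoro pv u v (m - 1) (w Cs) =
      (\<Sum>C\<in>Cs. if m - 1 < card C then of_nat (card C) * g (card C - (m - 1)) * w (Cs - {C}) else 0)
    + (u + v) * (\<Sum>C\<in>Cs. if card C = m - 1 then of_nat (card C) * w (Cs - {C}) else 0)
    + (\<Sum>C\<in>Cs. \<Sum>B\<in>Cs - {C}. if card B + card C = m - 1 then of_nat (card C) * of_nat (card B) * w (Cs - {C} - {B}) else 0)
    + (if m - 1 = 0 then u * v * w Cs else 0)"
    unfolding w_def g_def by (rule virasoro_cycle_weight[OF pv Cs])
  have m1: "m - 1 = 0 \<longleftrightarrow> m = 1" using m by auto
  have split: "sum F S = F n + sum F N" for F :: "'a \<Rightarrow> 'x rpoly"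
    using N n by (simp add: S_def)
  have "(\<Sum>b\<in>S. \<Sum>a\<in>S. (if a = n then u else 1) * (if b = n then v else 1) *
      rooted_weight g m (transpose a n \<circ> transpose b n \<circ> \<phi>) S n) =
    u * v * rooted_weight g m \<phi> S n + u * (\<Sum>b\<in>N. rooted_weight g m (transpose b n \<circ> \<phi>) S n)
    + (v * (\<Sum>a\<in>N. rooted_weight g m (transpose a n \<circ> \<phi>) S n)
       + (\<Sum>b\<in>N. \<Sum>a\<in>N. rooted_weight g m (transpose a n \<circ> (transpose b n \<circ> \<phi>)) S n))"
    unfolding split sum.distrib cc id sum_distrib_left using n
    by (intro arg_cong2[where f="(+)"] sum.cong refl) (auto simp: mult_ac id)
  also have "\<dots> = (if m = 1 then u * v * w Cs else 0) + (u + v) * X +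
    (\<Sum>b\<in>N. (if 1 \<le> m \<and> m \<le> card (orbit \<phi> b) then g (card (orbit \<phi> b) + 1 - m) * w (Cs - {orbit \<phi> b}) else 0) +
     (\<Sum>B\<in>Cs - {orbit \<phi> b}. if card B + card (orbit \<phi> b) = m - 1 then of_nat (card B) * w (Cs - {orbit \<phi> b} - {B}) else 0))"
  \<comment> \<open>The facts \<open>R\<close> presuppose some \<open>b\<close> in \<open>N\<close>,
    so the empty map is treated by hand.\<close>
  proof (cases "N = {}")
    case True
    then have "\<phi> = id" using \<phi> by simp
    then have "orbit \<phi> n = {n}" by (simp add: orbit_eq_singleton_iff)
    then show ?thesis using True by (simp add: rooted_weight_def other_cycles_def S_def Cs_def X_def w_def)
  next
    case False
    then show ?thesis using R(1) by (auto simp: one two algebra_simps)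
  qed
  also have "X = (\<Sum>C\<in>Cs. of_nat (card C) * (if card C + 1 = m then w (Cs - {C}) else 0))"
    unfolding X_def Cs_def by (rule sum_over_orbits[OF \<phi> N])
  also have "\<dots> = (\<Sum>C\<in>Cs. if card C = m - 1 then of_nat (card C) * w (Cs - {C}) else 0)"
    using m by (intro sum.cong) auto
  also have "(\<Sum>b\<in>N. (if 1 \<le> m \<and> m \<le> card (orbit \<phi> b) then g (card (orbit \<phi> b) + 1 - m) * w (Cs - {orbit \<phi> b}) else 0) +
     (\<Sum>B\<in>Cs - {orbit \<phi> b}. if card B + card (orbit \<phi> b) = m - 1 then of_nat (card B) * w (Cs - {orbit \<phi> b} - {B}) else 0)) =
    (\<Sum>C\<in>Cs. of_nat (card C) * ((if 1 \<le> m \<and> m \<le> card C then g (card C + 1 - m) * w (Cs - {C}) else 0) +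
     (\<Sum>B\<in>Cs - {C}. if card B + card C = m - 1 then of_nat (card B) * w (Cs - {C} - {B}) else 0)))"
    unfolding Cs_def by (rule sum_over_orbits[OF \<phi> N])
  also have "\<dots> = (\<Sum>C\<in>Cs. if m - 1 < card C then of_nat (card C) * g (card C - (m - 1)) * w (Cs - {C}) else 0) +
    (\<Sum>C\<in>Cs. \<Sum>B\<in>Cs - {C}. if card B + card C = m - 1 then of_nat (card C) * of_nat (card B) * w (Cs - {C} - {B}) else 0)"
    unfolding distrib_left sum.distrib sum_distrib_left using m
    by (intro arg_cong2[where f="(+)"] sum.cong refl) auto
  finally show ?thesis
    unfolding S_def[symmetric] Cs_def[symmetric] w_def[symmetric] V m1 by (simp only: add_ac)
qed


subsection \<open>The generating series\<close>

abbreviation perms :: "nat \<Rightarrow> (nat \<Rightarrow> nat) set" where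
  "perms n \<equiv> {\<sigma>. \<sigma> permutes {1..n}}"

abbreviation ncyc :: "(nat \<Rightarrow> nat) \<Rightarrow> nat \<Rightarrow> nat" where
  "ncyc \<sigma> n \<equiv> card (perm_cycles \<sigma> n)"

lemma perm_permutation: "\<sigma> \<in> perms n \<Longrightarrow> permutation \<sigma>"
  using permutation_permutes by auto

text \<open>The new element either forms a cycle of its own, for \<open>a = Suc n\<close>, or is put
  into an existing cycle. This is the origin of the factors u and v in the edge insertion.\<close>

lemma ncyc_insert:
  assumes \<sigma>: "\<sigma> \<in> perms n" and a: "a \<in> {1..Suc n}"
  shows "ncyc (transpose a (Suc n) \<circ> \<sigma>) (Suc n) = ncyc \<sigma> n + (if a = Suc n then 1 else 0)"
proof -
  have p: "permutation \<sigma>" using \<sigma> by (rule perm_permutation)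
  have S: "{1..Suc n} = insert (Suc n) {1..n}" by auto
  have on: "orbit \<sigma> (Suc n) = {Suc n}"
    using \<sigma> by (auto simp: orbit_eq_singleton_iff intro!: permutes_not_in)
  have oc: "other_cycles \<sigma> {1..Suc n} (Suc n) = perm_cycles \<sigma> n"
    unfolding other_cycles_def on perm_cycles_def S by (intro arg_cong[where f="(`) (orbit \<sigma>)"]) auto
  have card: "ncyc f (Suc n) = Suc (card (other_cycles f {1..Suc n} (Suc n)))" if "permutation f" for f
  proof -
    have o: "other_cycles f {1..Suc n} (Suc n) = orbit f ` {1..Suc n} - {orbit f (Suc n)}"
      by (rule other_cycles_alt[OF that]) simp
    show ?thesis unfolding perm_cycles_def o by (rule card_Suc_Diff1[symmetric]) auto
  qed
  show ?thesis
  proof (cases "a = Suc n")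
    case True
    then have "transpose a (Suc n) \<circ> \<sigma> = \<sigma>" by (simp add: fun_eq_iff)
    then show ?thesis unfolding card[OF p] oc using True by (simp only: card[OF p] oc) simp
  next
    case False
    then have an: "a \<notin> orbit \<sigma> (Suc n)" "a \<in> {1..n}" using a on by auto
    have "ncyc (transpose a (Suc n) \<circ> \<sigma>) (Suc n) = Suc (card (perm_cycles \<sigma> n - {orbit \<sigma> a}))"
      using card[of "transpose a (Suc n) \<circ> \<sigma>"] other_cycles_join(2)[OF p an(1)] p
      by (simp add: oc[simplified] permutation_compose permutation_swap_id)
    also have "\<dots> = ncyc \<sigma> n"
      using an(2) by (intro card_Suc_Diff1) (auto simp: perm_cycles_def)
    finally show ?thesis using False by simp
  qed
qed

context
  fixes pv :: "nat \<Rightarrow> 'x" and u v :: "'x rpoly"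
  assumes pv: "inj pv" and u: "pconst pv u" and v: "pconst pv v"
begin

definition maps_sum :: "nat \<Rightarrow> 'x rpoly" where
  "maps_sum n = (\<Sum>\<sigma>\<in>perms n. \<Sum>\<rho>\<in>perms n. u ^ ncyc \<sigma> n * v ^ ncyc \<rho> n *
     cycle_weight (\<lambda>i. pvar (pv i)) (perm_cycles (\<sigma> \<circ> \<rho>) n))"

definition rooted_sum :: "nat \<Rightarrow> nat \<Rightarrow> nat \<Rightarrow> 'x rpoly" where
  "rooted_sum m n x = (\<Sum>\<sigma>\<in>perms n. \<Sum>\<rho>\<in>perms n. u ^ ncyc \<sigma> n * v ^ ncyc \<rho> n *
     rooted_weight (\<lambda>i. pvar (pv i)) m (\<sigma> \<circ> \<rho>) {1..n} x)"

text \<open>A permutation of n + 1 elements is in exactly one way the transposition of some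
  \<open>a\<close> and n + 1 after a permutation fixing n + 1; this is applied to both permutations
  of the map.\<close>

lemma rooted_sum_insert:
  assumes m: "1 \<le> m"
  shows "rooted_sum m (Suc n) (Suc n) = virasoro pv u v (m - 1) (maps_sum n)"
proof -
  let ?S = "{1..Suc n}" and ?N = "Suc n"
  let ?g = "\<lambda>i. pvar (pv i) :: 'x rpoly"
  have S: "?S = insert ?N {1..n}" by auto
  have sum_perms: "(\<Sum>\<sigma>\<in>perms ?N. f \<sigma>) = (\<Sum>a\<in>?S. \<Sum>\<sigma>\<in>perms n. f (transpose a ?N \<circ> \<sigma>))" for f :: "_ \<Rightarrow> 'x rpoly"
    unfolding S by (subst sum_over_permutations_insert) (auto simp: transpose_commute)
  let ?u = "\<lambda>a. if a = ?N then u else 1" and ?v = "\<lambda>b. if b = ?N then v else 1"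
  have "rooted_sum m ?N ?N = (\<Sum>a\<in>?S. \<Sum>\<sigma>\<in>perms n. \<Sum>b\<in>?S. \<Sum>\<rho>\<in>perms n.
      u ^ ncyc (transpose a ?N \<circ> \<sigma>) ?N * v ^ ncyc (transpose b ?N \<circ> \<rho>) ?N *
      rooted_weight ?g m ((transpose a ?N \<circ> \<sigma>) \<circ> (transpose b ?N \<circ> \<rho>)) ?S ?N)"
    unfolding rooted_sum_def sum_perms ..
  also have "\<dots> = (\<Sum>a\<in>?S. \<Sum>\<sigma>\<in>perms n. \<Sum>b\<in>?S. \<Sum>\<rho>\<in>perms n.
      u ^ ncyc \<sigma> n * v ^ ncyc \<rho> n * (?u a * ?v (\<sigma> b) *
      rooted_weight ?g m (transpose a ?N \<circ> transpose (\<sigma> b) ?N \<circ> (\<sigma> \<circ> \<rho>)) ?S ?N))"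
  proof (intro sum.cong refl)
    fix a b \<sigma> \<rho> assume a: "a \<in> ?S" and b: "b \<in> ?S" and \<sigma>: "\<sigma> \<in> perms n" and \<rho>: "\<rho> \<in> perms n"
    have bij: "bij \<sigma>" using \<sigma> permutes_bij by auto
    have \<sigma>N: "\<sigma> ?N = ?N" using \<sigma> by (auto intro: permutes_not_in)
    have eqN: "\<sigma> x = ?N \<longleftrightarrow> x = ?N" for x using \<sigma>N bij by (metis bij_def inj_eq)
    \<comment> \<open>Moving the second transposition to the left of \<open>\<sigma>\<close>
      replaces \<open>b\<close> by \<open>\<sigma> b\<close>. The sum over \<open>b\<close> is later
      reindexed by \<open>\<sigma>\<close>, which permutes \<open>?S\<close>.\<close>
    have "\<sigma> \<circ> transpose b ?N = transpose (\<sigma> b) ?N \<circ> \<sigma>"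
      using \<sigma>N eqN bij by (auto simp: fun_eq_iff transpose_def bij_def inj_eq)
    then have "(transpose a ?N \<circ> \<sigma>) \<circ> (transpose b ?N \<circ> \<rho>) = transpose a ?N \<circ> transpose (\<sigma> b) ?N \<circ> (\<sigma> \<circ> \<rho>)"
      by (metis comp_assoc)
    with eqN[of b] show "u ^ ncyc (transpose a ?N \<circ> \<sigma>) ?N * v ^ ncyc (transpose b ?N \<circ> \<rho>) ?N *
      rooted_weight ?g m ((transpose a ?N \<circ> \<sigma>) \<circ> (transpose b ?N \<circ> \<rho>)) ?S ?N =
      u ^ ncyc \<sigma> n * v ^ ncyc \<rho> n * (?u a * ?v (\<sigma> b) *
      rooted_weight ?g m (transpose a ?N \<circ> transpose (\<sigma> b) ?N \<circ> (\<sigma> \<circ> \<rho>)) ?S ?N)"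
      unfolding ncyc_insert[OF \<sigma> a] ncyc_insert[OF \<rho> b] by simp
  qed
  also have "\<dots> = (\<Sum>\<sigma>\<in>perms n. \<Sum>\<rho>\<in>perms n. u ^ ncyc \<sigma> n * v ^ ncyc \<rho> n *
      (\<Sum>b\<in>?S. \<Sum>a\<in>?S. ?u a * ?v (\<sigma> b) *
      rooted_weight ?g m (transpose a ?N \<circ> transpose (\<sigma> b) ?N \<circ> (\<sigma> \<circ> \<rho>)) ?S ?N))"
    unfolding sum_distrib_left
    by (subst sum.swap, intro sum.cong refl, subst sum.swap, subst (2) sum.swap, subst sum.swap, rule refl)
  also have "\<dots> = (\<Sum>\<sigma>\<in>perms n. \<Sum>\<rho>\<in>perms n. virasoro pv u v (m - 1) (u ^ ncyc \<sigma> n * v ^ ncyc \<rho> n *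
      cycle_weight ?g (perm_cycles (\<sigma> \<circ> \<rho>) n)))"
  proof (intro sum.cong refl)
    fix \<sigma> \<rho> assume \<sigma>: "\<sigma> \<in> perms n" and \<rho>: "\<rho> \<in> perms n"
    have "\<sigma> permutes ?S" using \<sigma> by (auto intro: permutes_subset)
    then have bij: "bij_betw \<sigma> ?S ?S" by (rule permutes_imp_bij)
    have \<phi>: "\<sigma> \<circ> \<rho> permutes {1..n}" using \<sigma> \<rho> by (auto intro: permutes_compose)
    have "(\<Sum>b\<in>?S. \<Sum>a\<in>?S. ?u a * ?v (\<sigma> b) *
        rooted_weight ?g m (transpose a ?N \<circ> transpose (\<sigma> b) ?N \<circ> (\<sigma> \<circ> \<rho>)) ?S ?N) =
      (\<Sum>b\<in>?S. \<Sum>a\<in>?S. ?u a * ?v b *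
        rooted_weight ?g m (transpose a ?N \<circ> transpose b ?N \<circ> (\<sigma> \<circ> \<rho>)) ?S ?N)"
      by (rule sum.reindex_bij_betw[OF bij])
    also have "\<dots> = virasoro pv u v (m - 1) (cycle_weight ?g (perm_cycles (\<sigma> \<circ> \<rho>) n))"
      unfolding S perm_cycles_def by (rule sum_rooted_weight_insert[OF pv \<phi> _ _ m]) auto
    finally show "u ^ ncyc \<sigma> n * v ^ ncyc \<rho> n *
      (\<Sum>b\<in>?S. \<Sum>a\<in>?S. ?u a * ?v (\<sigma> b) *
      rooted_weight ?g m (transpose a ?N \<circ> transpose (\<sigma> b) ?N \<circ> (\<sigma> \<circ> \<rho>)) ?S ?N) =
      virasoro pv u v (m - 1) (u ^ ncyc \<sigma> n * v ^ ncyc \<rho> n * cycle_weight ?g (perm_cycles (\<sigma> \<circ> \<rho>) n))"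
      by (simp only: virasoro_const_mult pconst_mult pconst_power u v)
  qed
  also have "\<dots> = virasoro pv u v (m - 1) (maps_sum n)"
    unfolding maps_sum_def additive_map.sum[OF additive_virasoro] ..
  finally show ?thesis .
qed

text \<open>Conjugating both permutations by the transposition of \<open>x\<close> and
  \<open>y\<close> preserves all numbers of cycles and cycle lengths, and moves the root from
  \<open>x\<close> to \<open>y\<close>.\<close>

lemma rooted_sum_root:
  assumes x: "x \<in> {1..n}" and y: "y \<in> {1..n}"
  shows "rooted_sum m n x = rooted_sum m n y"
proof -
  define \<theta> where "\<theta> = transpose x y"
  let ?c = "\<lambda>\<sigma>. \<theta> \<circ> \<sigma> \<circ> \<theta>"
  have \<theta>\<theta>: "\<theta> \<circ> \<theta> = id" "\<theta> (\<theta> z) = z" for z by (simp_all add: \<theta>_def fun_eq_iff)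
  have \<theta>p: "\<theta> permutes {1..n}" unfolding \<theta>_def using x y by (rule permutes_swap_id)
  have inv: "?c (?c \<sigma>) = \<sigma>" for \<sigma> using \<theta>\<theta> by (simp add: fun_eq_iff)
  have c: "?c \<sigma> \<in> perms n" if "\<sigma> \<in> perms n" for \<sigma>
    using that \<theta>p by (auto intro!: permutes_compose)
  have bij: "bij_betw ?c (perms n) (perms n)"
    by (rule bij_betw_byWitness[where f'="?c"]) (use inv c in \<open>auto simp: image_subset_iff\<close>)
  have orb: "orbit (?c \<sigma>) (\<theta> z) = \<theta> ` orbit \<sigma> z" if "\<sigma> \<in> perms n" for \<sigma> z
    using perm_permutation[OF that] \<theta>\<theta>
    by (intro orbit_inverse[symmetric] permutation_self_in_orbit) auto
  have inj: "inj \<theta>" using \<theta>p permutes_inj by blast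
  have im: "\<theta> ` {1..n} = {1..n}" using \<theta>p permutes_image by blast
  have injim: "inj_on ((`) \<theta>) Y" for Y using inj by (simp add: inj_on_def inj_image_eq_iff)
  have pc: "perm_cycles (?c \<sigma>) n = (`) \<theta> ` perm_cycles \<sigma> n" if "\<sigma> \<in> perms n" for \<sigma>
  proof -
    have "perm_cycles (?c \<sigma>) n = orbit (?c \<sigma>) ` (\<theta> ` {1..n})" by (simp only: im perm_cycles_def)
    also have "\<dots> = (`) \<theta> ` perm_cycles \<sigma> n" unfolding image_image perm_cycles_def
      by (intro image_cong refl orb that)
    finally show ?thesis .
  qed
  have nc: "ncyc (?c \<sigma>) n = ncyc \<sigma> n" if "\<sigma> \<in> perms n" for \<sigma>
    unfolding pc[OF that] by (rule card_image[OF injim])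
  have cc: "?c \<sigma> \<circ> ?c \<rho> = ?c (\<sigma> \<circ> \<rho>)" for \<sigma> \<rho> using \<theta>\<theta> by (simp add: fun_eq_iff)
  have rw: "rooted_weight g m (?c \<phi>) {1..n} y = rooted_weight g m \<phi> {1..n} x" if "\<phi> \<in> perms n" for \<phi> and g :: "nat \<Rightarrow> 'x rpoly"
  proof -
    have y: "y = \<theta> x" by (simp add: \<theta>_def)
    have "{1..n} - \<theta> ` orbit \<phi> x = \<theta> ` ({1..n} - orbit \<phi> x)"
      using image_set_diff[OF inj, of "{1..n}" "orbit \<phi> x"] im by simp
    then have oc: "other_cycles (?c \<phi>) {1..n} y = (`) \<theta> ` other_cycles \<phi> {1..n} x"
      unfolding other_cycles_def y orb[OF that]
      by (simp only: image_image) (intro image_cong refl orb that)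
    have card: "card (\<theta> ` C) = card C" for C by (rule card_image) (rule inj_on_subset[OF inj], simp)
    show ?thesis
      unfolding rooted_weight_def cycle_weight_def oc unfolding y orb[OF that] card
      by (simp add: prod.reindex[OF injim] card)
  qed
  have dbl: "(\<Sum>\<sigma>\<in>perms n. \<Sum>\<rho>\<in>perms n. F (?c \<sigma>) (?c \<rho>)) = (\<Sum>\<sigma>\<in>perms n. \<Sum>\<rho>\<in>perms n. F \<sigma> \<rho>)"
    for F :: "_ \<Rightarrow> _ \<Rightarrow> 'x rpoly"
    by (simp only: sum.reindex_bij_betw[OF bij, of "F x" for x]
        sum.reindex_bij_betw[OF bij, of "\<lambda>\<sigma>. \<Sum>\<rho>\<in>perms n. F \<sigma> \<rho>"])
  have "rooted_sum m n y = (\<Sum>\<sigma>\<in>perms n. \<Sum>\<rho>\<in>perms n. u ^ ncyc (?c \<sigma>) n * v ^ ncyc (?c \<rho>) n *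
     rooted_weight (\<lambda>i. pvar (pv i)) m (?c \<sigma> \<circ> ?c \<rho>) {1..n} y)"
    unfolding rooted_sum_def by (rule dbl[symmetric])
  also have "\<dots> = rooted_sum m n x"
    unfolding rooted_sum_def cc
  proof (intro sum.cong refl)
    fix \<sigma> \<rho> assume \<sigma>: "\<sigma> \<in> perms n" and \<rho>: "\<rho> \<in> perms n"
    then have "\<sigma> \<circ> \<rho> \<in> perms n" by (simp add: permutes_compose)
    then show "u ^ ncyc (?c \<sigma>) n * v ^ ncyc (?c \<rho>) n * rooted_weight (\<lambda>i. pvar (pv i)) m (?c (\<sigma> \<circ> \<rho>)) {1..n} y =
      u ^ ncyc \<sigma> n * v ^ ncyc \<rho> n * rooted_weight (\<lambda>i. pvar (pv i)) m (\<sigma> \<circ> \<rho>) {1..n} x"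
      by (simp only: nc[OF \<sigma>] nc[OF \<rho>] rw)
  qed
  finally show ?thesis ..
qed

lemma maps_sum_0: "maps_sum 0 = 1"
  by (simp add: maps_sum_def perm_cycles_def cycle_weight_def)

text \<open>Differentiating by p_m removes a cycle of length m from the weight; the factor m chooses
  a root on it.\<close>

lemma pd_maps_sum:
  "of_nat m * pd pv m (maps_sum n) = (\<Sum>x\<in>{1..n}. rooted_sum m n x)"
proof -
  let ?g = "\<lambda>i. pvar (pv i) :: 'x rpoly"
  have "of_nat m * pd pv m (cycle_weight ?g (perm_cycles \<phi> n)) = (\<Sum>x\<in>{1..n}. rooted_weight ?g m \<phi> {1..n} x)"
    if \<phi>: "\<phi> \<in> perms n" for \<phi>
  proof -
    let ?C = "perm_cycles \<phi> n"
    have fin: "finite ?C" by (simp add: perm_cycles_def)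
    have "of_nat m * pd pv m (cycle_weight ?g ?C) = (\<Sum>C\<in>?C. of_nat (card C) * (if card C = m then cycle_weight ?g (?C - {C}) else 0))"
      unfolding cycle_weight_def der_prod[OF der_der_on fin] der_on_pvar[OF pv] sum_distrib_left
      by (intro sum.cong) auto
    also have "\<dots> = (\<Sum>x\<in>{1..n}. if card (orbit \<phi> x) = m then cycle_weight ?g (?C - {orbit \<phi> x}) else 0)"
      unfolding perm_cycles_def using \<phi> by (intro sum_over_orbits[symmetric]) auto
    also have "\<dots> = (\<Sum>x\<in>{1..n}. rooted_weight ?g m \<phi> {1..n} x)"
      unfolding rooted_weight_def
      by (intro sum.cong refl if_cong) (simp add: other_cycles_alt[OF perm_permutation[OF \<phi>]] perm_cycles_def)
    finally show ?thesis .
  qed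
  then have 1: "of_nat m * pd pv m (cycle_weight ?g (perm_cycles (\<sigma> \<circ> \<rho>) n)) = (\<Sum>x\<in>{1..n}. rooted_weight ?g m (\<sigma> \<circ> \<rho>) {1..n} x)"
    if "\<sigma> \<in> perms n" "\<rho> \<in> perms n" for \<sigma> \<rho> using that by (auto simp: permutes_compose)
  have 2: "of_nat m * (c * d) = c * (of_nat m * d)" for c d :: "'x rpoly" by (simp add: mult_ac)
  have "of_nat m * pd pv m (maps_sum n) = (\<Sum>\<sigma>\<in>perms n. \<Sum>\<rho>\<in>perms n. u ^ ncyc \<sigma> n * v ^ ncyc \<rho> n *
     (\<Sum>x\<in>{1..n}. rooted_weight ?g m (\<sigma> \<circ> \<rho>) {1..n} x))"
    unfolding maps_sum_def der_on_sum sum_distrib_left[of "of_nat m"]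
    by (intro sum.cong refl) (simp only: der_on_const_mult pconst_mult pconst_power u v 1 2)
  also have "\<dots> = (\<Sum>x\<in>{1..n}. rooted_sum m n x)"
    unfolding rooted_sum_def sum_distrib_left
    by (subst (2) sum.swap, subst sum.swap, rule refl)
  finally show ?thesis .
qed

theorem maps_sum_rec:
  assumes "1 \<le> m"
  shows "of_nat m * pd pv m (maps_sum (Suc n)) = of_nat (Suc n) * virasoro pv u v (m - 1) (maps_sum n)"
proof -
  have "of_nat m * pd pv m (maps_sum (Suc n)) = (\<Sum>x\<in>{1..Suc n}. rooted_sum m (Suc n) (Suc n))"
    unfolding pd_maps_sum by (intro sum.cong rooted_sum_root) auto
  then show ?thesis by (simp add: rooted_sum_insert[OF assms])
qed

text \<open>For each of the n roots, multiplying by p_m for the length m of the root cycle restores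
  the full weight.\<close>

lemma euler_maps_sum:
  "(\<Sum>m\<in>{1..n}. of_nat m * pvar (pv m) * pd pv m (maps_sum n)) = of_nat n * maps_sum n"
proof -
  let ?g = "\<lambda>i. pvar (pv i) :: 'x rpoly"
  have key: "(\<Sum>m\<in>{1..n}. ?g m * rooted_weight ?g m \<phi> {1..n} x) = cycle_weight ?g (perm_cycles \<phi> n)"
    if \<phi>: "\<phi> \<in> perms n" and x: "x \<in> {1..n}" for \<phi> x
  proof -
    have "orbit \<phi> x \<subseteq> {1..n}" using \<phi> x permutes_orbit_subset[of \<phi> "{1..n}" x] by auto
    then have c: "card (orbit \<phi> x) \<in> {1..n}"
      using card_mono[of "{1..n}" "orbit \<phi> x"] by (auto simp: Suc_le_eq card_gt_0_iff orbit_nonempty intro: finite_subset)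
    have "(\<Sum>m\<in>{1..n}. ?g m * rooted_weight ?g m \<phi> {1..n} x) =
      (\<Sum>m\<in>{1..n}. if card (orbit \<phi> x) = m then ?g m * cycle_weight ?g (perm_cycles \<phi> n - {orbit \<phi> x}) else 0)"
      unfolding rooted_weight_def other_cycles_alt[OF perm_permutation[OF \<phi>] x] perm_cycles_def
      by (intro sum.cong) auto
    also have "\<dots> = ?g (card (orbit \<phi> x)) * cycle_weight ?g (perm_cycles \<phi> n - {orbit \<phi> x})"
      using c by (simp add: sum.delta')
    also have "\<dots> = cycle_weight ?g (perm_cycles \<phi> n)"
      unfolding cycle_weight_def using x by (intro prod.remove[symmetric]) (auto simp: perm_cycles_def)
    finally show ?thesis .
  qed
  have "(\<Sum>m\<in>{1..n}. of_nat m * pvar (pv m) * pd pv m (maps_sum n)) =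
    (\<Sum>m\<in>{1..n}. \<Sum>x\<in>{1..n}. ?g m * rooted_sum m n x)"
    by (simp only: mult.commute[of "of_nat _" "pvar _"] mult.assoc pd_maps_sum sum_distrib_left)
  also have "\<dots> = (\<Sum>x\<in>{1..n}. \<Sum>m\<in>{1..n}. ?g m * rooted_sum m n x)" by (rule sum.swap)
  also have "\<dots> = (\<Sum>x\<in>{1..n}. maps_sum n)"
  proof (rule sum.cong[OF refl])
    fix x assume x: "x \<in> {1..n}"
    have "(\<Sum>m\<in>{1..n}. ?g m * rooted_sum m n x) = (\<Sum>\<sigma>\<in>perms n. \<Sum>\<rho>\<in>perms n. \<Sum>m\<in>{1..n}.
      ?g m * (u ^ ncyc \<sigma> n * v ^ ncyc \<rho> n * rooted_weight ?g m (\<sigma> \<circ> \<rho>) {1..n} x))"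
      unfolding rooted_sum_def sum_distrib_left
      by (subst sum.swap, intro sum.cong refl, rule sum.swap)
    also have "\<dots> = maps_sum n"
      unfolding maps_sum_def
    proof (intro sum.cong refl)
      fix \<sigma> \<rho> assume "\<sigma> \<in> perms n" "\<rho> \<in> perms n"
      then have "\<sigma> \<circ> \<rho> \<in> perms n" by (auto simp: permutes_compose)
      from key[OF this x, symmetric] show "(\<Sum>m\<in>{1..n}. ?g m * (u ^ ncyc \<sigma> n * v ^ ncyc \<rho> n * rooted_weight ?g m (\<sigma> \<circ> \<rho>) {1..n} x))
        = u ^ ncyc \<sigma> n * v ^ ncyc \<rho> n * cycle_weight ?g (perm_cycles (\<sigma> \<circ> \<rho>) n)"
        by (simp add: sum_distrib_left mult_ac)
    qed
    finally show "(\<Sum>m\<in>{1..n}. ?g m * rooted_sum m n x) = maps_sum n" .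
  qed
  finally show ?thesis by simp
qed

end

section \<open>Vertex operators\<close>

subsection \<open>Complete homogeneous polynomials\<close>

definition hseries :: "(nat \<Rightarrow> 'a rpoly) \<Rightarrow> 'a rpoly fps" where
  "hseries q = Abs_fps (h_poly q)"

text \<open>The extension by 0 to negative indices makes these the coefficients of a Laurent series,
  so that shifts of the index need no side conditions.\<close>

definition hint :: "(nat \<Rightarrow> 'a rpoly) \<Rightarrow> int \<Rightarrow> 'a rpoly" where
  "hint q n = (if n < 0 then 0 else h_poly q (nat n))"

lemma hseries_hint: "fls_nth (fps_to_fls (hseries q)) n = hint q n"
  by (simp add: hseries_def hint_def)

text \<open>Newton's identity; the upper limit may be any \<open>k\<close> from n on, since further
  terms have negative index.\<close>

lemma hint_rec:
  assumes "n \<le> int k"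
  shows "of_int n * hint q n = (\<Sum>i=1..k. q i * hint q (n - int i))"
proof (cases "n < 0")
  case False
  then obtain m where m: "n = int m" by (metis nonneg_int_cases not_less)
  have "(\<Sum>i=1..k. q i * hint q (n - int i)) = (\<Sum>i=1..m. q i * hint q (n - int i))"
    using assms by (intro sum.mono_neutral_right) (auto simp: m hint_def)
  also have "\<dots> = (\<Sum>i=1..m. q i * h_poly q (m - i))"
    by (intro sum.cong) (auto simp: m hint_def nat_diff_distrib)
  finally show ?thesis using h_poly_rec[of m q] by (simp add: m hint_def)
qed (simp add: hint_def)

lemma fps_deriv_hseries: "fps_deriv (hseries q) = hseries q * Abs_fps (\<lambda>i. q (Suc i))"
proof (rule fps_ext)
  fix n
  have "fps_nth (fps_deriv (hseries q)) n = (\<Sum>i=1..Suc n. q i * h_poly q (Suc n - i))"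
    by (simp add: hseries_def h_poly_rec del: of_nat_Suc sum.cl_ivl_Suc)
  also have "\<dots> = (\<Sum>i=0..n. q (Suc i) * h_poly q (n - i))"
    unfolding One_nat_def sum.shift_bounds_cl_Suc_ivl by simp
  also have "\<dots> = fps_nth (hseries q * Abs_fps (\<lambda>i. q (Suc i))) n"
    by (subst mult.commute) (simp add: fps_mult_nth hseries_def)
  finally show "fps_nth (fps_deriv (hseries q)) n = fps_nth (hseries q * Abs_fps (\<lambda>i. q (Suc i))) n" .
qed

lemma fps_ode_unique:
  fixes f f' :: "'a rpoly fps"
  assumes "fps_deriv f = f * g" "fps_deriv f' = f' * g" "fps_nth f 0 = fps_nth f' 0"
  shows "f = f'"
proof (rule fps_ext)
  fix n show "fps_nth f n = fps_nth f' n"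
  proof (induction n rule: less_induct)
    case (less n)
    show ?case
    proof (cases n)
      case (Suc m)
      have "of_nat n * fps_nth f n = fps_nth (f * g) m" "of_nat n * fps_nth f' n = fps_nth (f' * g) m"
        using assms(1,2) Suc by (simp_all add: fps_eq_iff)
      moreover have "fps_nth (f * g) m = fps_nth (f' * g) m"
        unfolding fps_mult_nth using less Suc by (intro sum.cong) auto
      ultimately show ?thesis using of_nat_mult_cancel[of n "fps_nth f n" "fps_nth f' n"] Suc by simp
    qed (use assms(3) in simp)
  qed
qed

lemma hseries_0: "fps_nth (hseries q) 0 = 1"
  by (simp add: hseries_def h_poly_0)

text \<open>Both sides solve the same linear differential equation with constant term 1.\<close>

lemma hseries_add: "hseries (\<lambda>i. q i + r i) = hseries q * hseries r"
proof (rule fps_ode_unique[OF fps_deriv_hseries])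
  have "Abs_fps (\<lambda>i. q (Suc i) + r (Suc i)) = Abs_fps (\<lambda>i. q (Suc i)) + Abs_fps (\<lambda>i. r (Suc i))"
    by (simp add: fps_eq_iff)
  then show "fps_deriv (hseries q * hseries r) = hseries q * hseries r * Abs_fps (\<lambda>i. q (Suc i) + r (Suc i))"
    by (simp add: fps_deriv_hseries algebra_simps)
qed (simp add: hseries_0)

lemma der_hint:
  assumes d: "der (\<lambda>x. x) d" "\<And>c. d (cst c) = 0" and n: "n \<le> int k"
  shows "d (hint q n) = (\<Sum>i=1..k. cst (1 / of_nat i) * d (q i) * hint q (n - int i))"
proof -
  interpret der "\<lambda>x. x" d by fact
  show ?thesis
  proof (cases "n < 0")
    case False
    then obtain m where m: "n = int m" by (metis nonneg_int_cases not_less)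
    define \<xi> where "\<xi> = Abs_fps (\<lambda>i. if i = 0 then 0 else cst (1 / of_nat i) * q i)"
    have E: "hseries q = fps_compose (fps_cst (fps_exp 1)) \<xi>"
      by (rule fps_ext) (simp add: hseries_def h_poly_def \<xi>_def)
    have "der (\<lambda>x. x) (fps_lift d)" using der_fps_lift[OF rhom_id d(1)] by simp
    then have "fps_lift d (hseries q) = hseries q * fps_lift d \<xi>"
      unfolding E by (subst der_fps_compose) (auto simp: \<xi>_def zero fps_eq_iff d(2))
    then have "d (h_poly q m) = (\<Sum>i=0..m. fps_nth (fps_lift d \<xi>) i * h_poly q (m - i))"
      by (subst (asm) mult.commute) (simp add: fps_eq_iff fps_mult_nth hseries_def)
    also have "\<dots> = (\<Sum>i=1..m. cst (1 / of_nat i) * d (q i) * h_poly q (m - i))"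
      by (subst sum.atLeast_Suc_atMost) (auto simp: \<xi>_def zero leibniz d(2))
    also have "\<dots> = (\<Sum>i=1..m. cst (1 / of_nat i) * d (q i) * hint q (n - int i))"
      by (intro sum.cong) (auto simp: m hint_def nat_diff_distrib)
    also have "\<dots> = (\<Sum>i=1..k. cst (1 / of_nat i) * d (q i) * hint q (n - int i))"
      using n by (intro sum.mono_neutral_left) (auto simp: m hint_def)
    finally show ?thesis by (simp add: m hint_def)
  qed (simp add: hint_def zero)
qed

subsection \<open>The cut-and-join operator\<close>

lemma derivation_cong_vars:
  assumes "\<And>x. x \<in> pvars P \<Longrightarrow> \<delta> x = \<delta>' x"
  shows "derivation \<delta> P = derivation \<delta>' P"
proof -
  have "\<delta> x = \<delta>' x" if "m \<in> Poly_Mapping.keys P" "x \<in> Poly_Mapping.keys m" for m x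
    using that by (intro assms) (auto simp: pvars_def)
  then show ?thesis unfolding derivation_def by (intro sum.cong refl) simp
qed

lemma finite_pvars [simp]: "finite (pvars P)"
  by (simp add: pvars_def)

lemma pd_eq_0:
  assumes "inj pv" "pv j \<notin> pvars f" shows "pd pv j f = 0"
proof -
  have "pd pv j f = derivation (\<lambda>x. 0) f"
    unfolding der_on_def using assms by (intro derivation_cong_vars) (auto simp: image_iff)
  then show ?thesis by (simp add: derivation_def)
qed

text \<open>A derivation is determined by the finitely many variables that occur in
  \<open>f\<close>. That any larger index set is allowed lets several polynomials share one.\<close>

lemma der_on_expand:
  assumes pv: "inj pv" and J: "finite J" "\<And>j. j \<notin> J \<Longrightarrow> pd pv j f = 0"
  shows "der_on pv e f = (\<Sum>j\<in>J. e j * pd pv j f)"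
proof -
  define K where "K = J \<union> {j. pv j \<in> pvars f}"
  have "finite {j. pv j \<in> pvars f}" using finite_vimageI[OF finite_pvars pv] by (simp add: vimage_def)
  then have K: "finite K" using J by (simp add: K_def)
  have D: "der (\<lambda>x. x) (\<lambda>f. \<Sum>j\<in>K. e j * pd pv j f)"
    by unfold_locales (simp_all add: der_on_add der_on_mult distrib_left sum.distrib sum_distrib_left sum_distrib_right mult_ac)
  have pdv: "pd pv j (pvar x) = (if x = pv j then 1 else 0)" for j x
    using pv by (cases "x \<in> range pv") (auto simp: der_on_pvar der_on_other inj_eq)
  have "(\<Sum>j\<in>K. e j * pd pv j f) = derivation (\<lambda>x. \<Sum>j\<in>K. e j * pd pv j (pvar x)) f"
    by (rule derivation_unique[OF D]) simp_all
  also have "\<dots> = der_on pv e f"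
    unfolding der_on_def[of pv e]
  proof (rule derivation_cong_vars)
    fix x assume x: "x \<in> pvars f"
    show "(\<Sum>j\<in>K. e j * pd pv j (pvar x)) = (if x \<in> range pv then e (inv pv x) else 0)"
    proof (cases "x \<in> range pv")
      case True
      then obtain i where i: "x = pv i" by auto
      have "(\<Sum>j\<in>K. e j * pd pv j (pvar x)) = (\<Sum>j\<in>K. if j = i then e i else 0)"
        unfolding pdv i using pv by (intro sum.cong) (auto simp: inj_eq)
      also have "\<dots> = e i" using K x i by (simp add: K_def)
      finally show ?thesis using i pv by simp
    qed (auto simp: pdv intro!: sum.neutral)
  qed
  finally have "der_on pv e f = (\<Sum>j\<in>K. e j * pd pv j f)" ..
  also have "\<dots> = (\<Sum>j\<in>J. e j * pd pv j f)"
    using K J by (intro sum.mono_neutral_right) (auto simp: K_def)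
  finally show ?thesis .
qed

context
  fixes pv :: "nat \<Rightarrow> 'x"
begin

text \<open>The double sum over \<open>i, j\<close> of \<open>i j p\<^sub>i\<^sub>+\<^sub>j\<^sub>+\<^sub>1 \<partial>\<^sub>i \<partial>\<^sub>j\<close> is the sum over \<open>j\<close> of \<open>join_der j \<circ> pd j\<close>, which is finite on each
  polynomial.\<close>

definition join_der :: "nat \<Rightarrow> 'x rpoly \<Rightarrow> 'x rpoly" where
  "join_der j = der_on pv (\<lambda>i. of_nat (i * j) * pvar (pv (i + j + 1)))"

text \<open>The coefficient of the derivative by p_j in the sum over k of p_(k+1) times
  \<open>virasoro pv u v k\<close>.\<close>

definition cut_coeff :: "'x rpoly \<Rightarrow> 'x rpoly \<Rightarrow> nat \<Rightarrow> 'x rpoly" where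
  "cut_coeff u v j = of_nat j * (\<Sum>l=1..j. pvar (pv l) * pvar (pv (j + 1 - l))) + (u + v) * of_nat j * pvar (pv (j + 1))"

definition cut_join :: "'x rpoly \<Rightarrow> 'x rpoly \<Rightarrow> 'x rpoly \<Rightarrow> 'x rpoly" where
  "cut_join u v f = der_on pv (cut_coeff u v) f + u * v * pvar (pv 1) * f
     + (\<Sum>j\<in>{j. pv j \<in> pvars f}. join_der j (pd pv j f))"

end

lemma der_join_der: "der (\<lambda>x. x) (join_der pv j)"
  by (simp add: join_der_def der_der_on)

lemmas join_der_add = additive_map.add[OF der.axioms(1)[OF der_join_der]]
lemmas join_der_0 [simp] = additive_map.zero[OF der.axioms(1)[OF der_join_der]]

lemma der_on_0 [simp]: "der_on pv e 0 = 0"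
  by (simp add: der_on_def)

lemma der_on_1 [simp]: "der_on pv e 1 = 0"
  by (simp add: der_on_def)

context
  fixes pv :: "nat \<Rightarrow> 'x"
  assumes pv: "inj pv"
begin

lemma finite_indices: "finite {j. pv j \<in> pvars f}"
  using finite_vimageI[OF finite_pvars pv] by (simp add: vimage_def)

text \<open>The index set in \<open>cut_join\<close> depends on \<open>f\<close>; the freedom to
  enlarge it is what gives additivity.\<close>

lemma cut_join_extend:
  assumes J: "finite J" "\<And>j. j \<notin> J \<Longrightarrow> pd pv j f = 0"
  shows "cut_join pv u v f = der_on pv (cut_coeff pv u v) f + u * v * pvar (pv 1) * f
     + (\<Sum>j\<in>J. join_der pv j (pd pv j f))"
proof -
  let ?K = "{j. pv j \<in> pvars f}"
  have "(\<Sum>j\<in>J. join_der pv j (pd pv j f)) = (\<Sum>j\<in>J \<union> ?K. join_der pv j (pd pv j f))"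
    using J finite_indices by (intro sum.mono_neutral_left) auto
  also have "\<dots> = (\<Sum>j\<in>?K. join_der pv j (pd pv j f))"
    using J(1) finite_indices by (intro sum.mono_neutral_right) (auto simp: pd_eq_0[OF pv])
  finally show ?thesis by (simp add: cut_join_def)
qed

lemma obtain_index_bound:
  obtains J where "finite J" "\<And>j. j \<notin> J \<Longrightarrow> pd pv j f = 0" "\<And>j. j \<notin> J \<Longrightarrow> pd pv j g = 0" "i \<in> J"
  by (rule that[of "insert i ({j. pv j \<in> pvars f} \<union> {j. pv j \<in> pvars g})"])
    (auto simp: finite_indices pd_eq_0[OF pv])

lemma cut_join_add: "cut_join pv u v (f + g) = cut_join pv u v f + cut_join pv u v g"
proof -
  obtain J where J: "finite J" "\<And>j. j \<notin> J \<Longrightarrow> pd pv j f = 0" "\<And>j. j \<notin> J \<Longrightarrow> pd pv j g = 0"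
    using obtain_index_bound[of f g undefined] by metis
  show ?thesis
    by (subst (1 2 3) cut_join_extend[of J]) (simp_all add: J der_on_add join_der_add distrib_left sum.distrib)
qed

lemma additive_cut_join: "additive_map (cut_join pv u v)"
  by unfold_locales (rule cut_join_add)

lemma join_der_const_mult: "pconst pv c \<Longrightarrow> join_der pv j (c * f) = c * join_der pv j f"
  by (simp add: join_der_def der_on_const_mult)

lemma cut_join_const_mult:
  assumes c: "pconst pv c" shows "cut_join pv u v (c * f) = c * cut_join pv u v f"
proof -
  obtain J where J: "finite J" "\<And>j. j \<notin> J \<Longrightarrow> pd pv j f = 0"
    using obtain_index_bound[of f f undefined] by metis
  show ?thesis
    by (subst (1 2) cut_join_extend[of J])
      (simp_all add: J der_on_const_mult c join_der_const_mult distrib_left sum_distrib_left mult_ac)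
qed

text \<open>An operator of order two has a commutator of order one with p_j. The factor 2 reflects
  the symmetry of i j p_(i+j+1) in i and j.\<close>

lemma cut_join_pvar_mult:
  "cut_join pv u v (pvar (pv j) * f) =
     pvar (pv j) * cut_join pv u v f + cut_coeff pv u v j * f + 2 * join_der pv j f"
proof -
  obtain J where J: "finite J" "\<And>i. i \<notin> J \<Longrightarrow> pd pv i f = 0" "j \<in> J"
    using obtain_index_bound[of f f j] by metis
  have pdm: "pd pv i (pvar (pv j) * f) = (if i = j then f else 0) + pvar (pv j) * pd pv i f" for i
    by (simp add: der_on_mult der_on_pvar[OF pv])
  have jm: "join_der pv i ((if i = j then f else 0) + pvar (pv j) * pd pv i f) =
    (if i = j then join_der pv j f else 0) + of_nat (j * i) * pvar (pv (j + i + 1)) * pd pv i f + pvar (pv j) * join_der pv i (pd pv i f)" for i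
    by (simp add: join_der_def der_on_add der_on_mult der_on_pvar[OF pv] del: of_nat_mult)
  have "(\<Sum>i\<in>J. join_der pv i (pd pv i (pvar (pv j) * f))) =
    join_der pv j f + (\<Sum>i\<in>J. of_nat (j * i) * pvar (pv (j + i + 1)) * pd pv i f) + pvar (pv j) * (\<Sum>i\<in>J. join_der pv i (pd pv i f))"
    unfolding pdm jm sum.distrib sum_distrib_left using J by simp
  also have "(\<Sum>i\<in>J. of_nat (j * i) * pvar (pv (j + i + 1)) * pd pv i f) = join_der pv j f"
    unfolding join_der_def by (subst der_on_expand[OF pv J(1,2)]) (simp_all add: mult.commute[of j] add_ac)
  finally have "cut_join pv u v (pvar (pv j) * f) =
    der_on pv (cut_coeff pv u v) (pvar (pv j) * f) + u * v * pvar (pv 1) * (pvar (pv j) * f) +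
    (join_der pv j f + join_der pv j f + pvar (pv j) * (\<Sum>i\<in>J. join_der pv i (pd pv i f)))"
    by (subst cut_join_extend[of J]) (use J in \<open>auto simp: pdm\<close>)
  moreover have "cut_join pv u v f = der_on pv (cut_coeff pv u v) f + u * v * pvar (pv 1) * f
     + (\<Sum>i\<in>J. join_der pv i (pd pv i f))"
    by (rule cut_join_extend) (use J in auto)
  ultimately show ?thesis
    by (simp add: der_on_mult der_on_pvar[OF pv] algebra_simps)
qed

text \<open>The value k is attained by k - 1 pairs of positive integers.\<close>

lemma double_sum_diag:
  fixes F :: "nat \<Rightarrow> 'r::comm_ring_1"
  shows "(\<Sum>j=1..n. \<Sum>i=1..n - j. F (i + j)) = (\<Sum>k=1..n. of_nat (k - 1) * F k)"
proof (induction n)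
  case (Suc n)
  have "(\<Sum>j=1..Suc n. \<Sum>i=1..Suc n - j. F (i + j)) = (\<Sum>j=1..n. \<Sum>i=1..Suc (n - j). F (i + j))"
    by (simp add: Suc_diff_le)
  also have "\<dots> = (\<Sum>j=1..n. (\<Sum>i=1..n - j. F (i + j)) + F (Suc n))"
    by (intro sum.cong) auto
  finally show ?case using Suc.IH by (simp add: sum.distrib)
qed simp

context
  fixes \<epsilon> :: rat
  assumes \<epsilon>: "\<epsilon> * \<epsilon> = 1"
begin

private abbreviation (input) "P j \<equiv> pvar (pv j) :: 'x rpoly"
private abbreviation (input) "e \<equiv> cst \<epsilon> :: 'x rpoly"
private abbreviation (input) "h \<equiv> hint (\<lambda>i. e * P i)"

lemma e_e: "e * e = 1" "e * (e * x) = x"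
  using \<epsilon> by (simp_all flip: cst_mult mult.assoc)

lemma der_on_hint:
  assumes "n \<le> int k"
  shows "der_on pv a (h n) = e * (\<Sum>i=1..k. cst (1 / of_nat i) * a i * h (n - int i))"
  by (subst der_hint[OF der_der_on der_on_cst assms])
    (simp add: der_on_mult der_on_pvar[OF pv] sum_distrib_left mult_ac)

lemma pd_hint:
  assumes "j \<noteq> 0"
  shows "pd pv j (h n) = cst (1 / of_nat j) * e * h (n - int j)"
proof -
  define k where "k = max j (nat n)"
  have "pd pv j (h n) = e * (\<Sum>i=1..k. cst (1 / of_nat i) * (if i = j then 1 else 0) * h (n - int i))"
    by (rule der_on_hint) (auto simp: k_def)
  also have "(\<Sum>i=1..k. cst (1 / of_nat i) * (if i = j then 1 else 0) * h (n - int i)) =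
    (\<Sum>i=1..k. if i = j then cst (1 / of_nat j) * h (n - int j) else 0)"
    by (intro sum.cong) auto
  also have "\<dots> = cst (1 / of_nat j) * h (n - int j)" using assms by (simp add: k_def)
  finally show ?thesis by (simp add: mult_ac)
qed

lemma cst_inverse_cancel: "j \<noteq> 0 \<Longrightarrow> cst (1 / of_nat j) * (of_nat j * x) = (x :: 'x rpoly)"
  using of_nat_mult_cst_inverse[of j] by (metis mult.assoc mult.commute mult_1_left)

lemma join_der_hint:
  assumes "n \<le> int k"
  shows "join_der pv j (h n) = e * of_nat j * (\<Sum>i=1..k. P (i + j + 1) * h (n - int i))"
proof -
  have "cst (1 / of_nat i) * (of_nat (i * j) * P (i + j + 1)) * h (n - int i) =
    of_nat j * (P (i + j + 1) * h (n - int i))" if "i \<in> {1..k}" for i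
    using cst_inverse_cancel[of i "of_nat j * (P (i + j + 1) * h (n - int i))"] that by (simp add: mult_ac)
  then show ?thesis
    unfolding join_der_def der_on_hint[OF assms] by (simp add: sum_distrib_left mult_ac)
qed

text \<open>This is the vertex operator applied to 1. With theta = z d/dz and P = sum p_i z^i, the
  series Q of the h_n satisfies theta Q = e P Q and theta^2 Q = e (theta P) Q + P^2 Q. The cut terms
  produce P^2 and the join terms theta P, so that together they give the square of n + 1.\<close>

lemma cut_join_hint:
  "cut_join pv (u + e) (v + e) (h n) = u * v * (P 1 * h n)
     + (e * of_int ((n + 1) * (n + 1)) + (u + v) * of_int (n + 1)) * h (n + 1)"
proof (cases "n < 0")
  case True
  \<comment> \<open>At n = -1 the value of h at n + 1 = 0 is 1, but its coefficient vanishes with n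
    + 1.\<close>
  then show ?thesis
    using additive_map.zero[OF additive_cut_join] by (cases "n = -1") (simp_all add: hint_def)
next
  case False
  then obtain m where m: "n = int m" by (metis nonneg_int_cases not_less)
  define H where "H i = h_poly (\<lambda>i. e * P i) i" for i
  have hH: "h (int i) = H i" for i by (simp add: hint_def H_def)
  have hHd: "h (int m - int i) = H (m - i)" if "i \<le> m" for i
    using that by (simp add: hint_def H_def nat_diff_distrib)
  define PP where "PP i = (\<Sum>l=1..i. P l * P (i + 1 - l))" for i
  define S1 where "S1 = (\<Sum>i=0..m. P (i + 1) * H (m - i))"
  define S2 where "S2 = (\<Sum>i=0..m. of_nat (i + 1) * (P (i + 1) * H (m - i)))"
  define S3 where "S3 = (\<Sum>i=1..m. PP i * H (m - i))"
  define Pz where "Pz = Abs_fps (\<lambda>i. if i = 0 then 0 else P i)"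
  define Q where "Q = hseries (\<lambda>i. e * P i)"
  define \<theta> where "\<theta> f = fps_X * fps_deriv f" for f :: "'x rpoly fps"
  have \<theta>n: "fps_nth (\<theta> f) i = of_nat i * fps_nth f i" for f i by (cases i) (simp_all add: \<theta>_def)
  have \<theta>m: "\<theta> (f * g) = \<theta> f * g + f * \<theta> g" for f g by (simp add: \<theta>_def algebra_simps)
  have "fps_X * Abs_fps (\<lambda>i. e * P (Suc i)) = fps_const e * Pz"
    by (rule fps_ext) (auto simp: Pz_def fps_X_mult_nth)
  moreover have "\<theta> Q = Q * (fps_X * Abs_fps (\<lambda>i. e * P (Suc i)))"
    by (simp only: \<theta>_def Q_def fps_deriv_hseries mult.left_commute)
  ultimately have 1: "\<theta> Q = fps_const e * Pz * Q" by (simp only: mult.commute)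
  have \<theta>c: "\<theta> (fps_const e * f) = fps_const e * \<theta> f" for f by (simp add: \<theta>_def mult_ac)
  have 2: "\<theta> (\<theta> Q) = fps_const e * \<theta> Pz * Q + Pz * Pz * Q"
  proof -
    have "fps_const e * (fps_const e * f) = f" for f :: "'x rpoly fps"
      using \<epsilon> by (simp add: e_e flip: mult.assoc)
    moreover have "\<theta> (\<theta> Q) = fps_const e * (\<theta> Pz * Q + Pz * (fps_const e * Pz * Q))"
      by (subst 1) (simp only: mult.assoc \<theta>c, simp only: \<theta>m, simp only: 1 mult.assoc)
    moreover have "Pz * (fps_const e * Pz * Q) = fps_const e * (Pz * Pz * Q)"
      by (simp only: mult_ac)
    ultimately show ?thesis by (simp only: distrib_left mult.assoc)
  qed
  have Qn: "fps_nth Q i = H i" for i by (simp add: Q_def hseries_def H_def)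
  have conv: "fps_nth (f * Q) (m + 1) = fps_nth f 0 * H (m + 1) + (\<Sum>i=0..m. fps_nth f (i + 1) * H (m - i))" for f
    by (simp add: fps_mult_nth Qn sum.atLeast0_atMost_Suc_shift del: sum.atMost_Suc sum.cl_ivl_Suc)
  have PPn: "fps_nth (Pz * Pz) (i + 1) = PP i" for i
    by (simp add: fps_mult_nth Pz_def PP_def sum.atLeast_Suc_atMost[of 0] sum.cl_ivl_Suc Suc_diff_le cong: sum.cong_simp)
  have N1: "of_nat (m + 1) * H (m + 1) = e * S1"
  proof -
    have "of_nat (m + 1) * H (m + 1) = fps_nth (\<theta> Q) (m + 1)" by (simp only: \<theta>n Qn)
    then show ?thesis unfolding 1 conv by (simp add: Pz_def S1_def sum_distrib_left mult_ac)
  qed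
  have N2: "of_nat (m + 1) * (of_nat (m + 1) * H (m + 1)) = e * S2 + S3"
  proof -
    have "of_nat (m + 1) * (of_nat (m + 1) * H (m + 1)) = fps_nth (\<theta> (\<theta> Q)) (m + 1)" by (simp only: \<theta>n Qn)
    also have "\<dots> = e * S2 + (\<Sum>i=0..m. PP i * H (m - i))"
      unfolding 2 fps_add_nth conv PPn
      by (simp add: \<theta>n Pz_def S2_def sum_distrib_left mult_ac)
    also have "(\<Sum>i=0..m. PP i * H (m - i)) = S3"
      unfolding S3_def by (subst sum.atLeast_Suc_atMost) (simp_all add: PP_def)
    finally show ?thesis .
  qed
  have T1: "(\<Sum>i=1..m. P (i + 1) * H (m - i)) = S1 - P 1 * H m"
    unfolding S1_def by (subst (2) sum.atLeast_Suc_atMost) simp_all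
  have T2: "(\<Sum>k=1..m. of_nat (k - 1) * (P (k + 1) * H (m - k))) = S2 - 2 * S1 + P 1 * H m"
  proof -
    have "S2 - 2 * S1 = (\<Sum>i=0..m. (of_nat (i + 1) - 2) * (P (i + 1) * H (m - i)))"
      by (simp only: S1_def S2_def sum_distrib_left sum_subtractf left_diff_distrib)
    also have "\<dots> = - (P 1 * H m) + (\<Sum>i=1..m. (of_nat (i + 1) - 2) * (P (i + 1) * H (m - i)))"
      by (subst sum.atLeast_Suc_atMost) simp_all
    also have "(\<Sum>i=1..m. (of_nat (i + 1) - 2) * (P (i + 1) * H (m - i))) =
      (\<Sum>k=1..m. of_nat (k - 1) * (P (k + 1) * H (m - k)))"
      by (intro sum.cong refl arg_cong2[where f="(*)"]) (auto simp: of_nat_diff)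
    finally show ?thesis by simp
  qed
  have "der_on pv (cut_coeff pv (u + e) (v + e)) (h n) =
      e * (\<Sum>i=1..m. PP i * H (m - i) + (u + v + 2 * e) * (P (i + 1) * H (m - i)))"
  proof -
    have "cst (1 / of_nat i) * cut_coeff pv (u + e) (v + e) i * h (n - int i) =
       PP i * H (m - i) + (u + v + 2 * e) * (P (i + 1) * H (m - i))" if i: "i \<in> {1..m}" for i
    proof -
      have "cut_coeff pv (u + e) (v + e) i = of_nat i * (PP i + (u + v + 2 * e) * P (i + 1))"
        by (simp add: cut_coeff_def PP_def algebra_simps)
      then show ?thesis using cst_inverse_cancel[of i "PP i + (u + v + 2 * e) * P (i + 1)"] i hHd[of i]
        by (simp add: m algebra_simps)
    qed
    then show ?thesis using der_on_hint[of n m "cut_coeff pv (u + e) (v + e)"] by (simp add: m)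
  qed
  also have "\<dots> = e * S3 + (e * (u + v) + 2) * (S1 - P 1 * H m)"
  proof -
    have "e * (x + (w + 2 * e) * y) = e * x + (e * w + 2) * y" for w x y
      by (simp add: algebra_simps e_e)
    then show ?thesis unfolding sum.distrib S3_def T1[symmetric] sum_distrib_left[symmetric] .
  qed
  finally have D: "der_on pv (cut_coeff pv (u + e) (v + e)) (h n) = e * S3 + (e * (u + v) + 2) * (S1 - P 1 * H m)" .
  \<comment> \<open>The two factors e cancel, as do j and 1/j; each k = i + j then occurs k - 1
    times, as computed in \<open>T2\<close>.\<close>
  have J: "(\<Sum>j\<in>{1..m}. join_der pv j (pd pv j (h n))) = S2 - 2 * S1 + P 1 * H m"
  proof -
    have "join_der pv j (pd pv j (h n)) = (\<Sum>i=1..m - j. P (i + j + 1) * H (m - (i + j)))" if j: "j \<in> {1..m}" for j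
    proof -
      have jc: "join_der pv j (cst c * f) = cst c * join_der pv j f" for c f
        by (simp add: join_der_const_mult)
      have "join_der pv j (pd pv j (h n)) = cst (1 / of_nat j) * (e * (e * of_nat j * (\<Sum>i=1..m - j. P (i + j + 1) * h (n - int j - int i))))"
        using j join_der_hint[of "n - int j" "m - j" j] by (simp add: pd_hint mult.assoc jc m)
      also have "\<dots> = (\<Sum>i=1..m - j. P (i + j + 1) * h (n - int j - int i))"
        using j cst_inverse_cancel[of j] by (simp add: mult.assoc e_e)
      also have "\<dots> = (\<Sum>i=1..m - j. P (i + j + 1) * H (m - (i + j)))"
        using hHd[of "i + j" for i] j by (intro sum.cong refl arg_cong2[where f="(*)"]) (auto simp: m diff_diff_eq add.commute)
      finally show ?thesis .
    qed
    then have "(\<Sum>j\<in>{1..m}. join_der pv j (pd pv j (h n))) = (\<Sum>j=1..m. \<Sum>i=1..m - j. P (i + j + 1) * H (m - (i + j)))"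
      by (intro sum.cong) auto
    then show ?thesis using double_sum_diag[of "\<lambda>k. P (k + 1) * H (m - k)" m] T2 by simp
  qed
  have "pd pv j (h n) = 0" if "j \<notin> {1..m}" for j
  proof (cases "j = 0")
    case True
    have "pd pv 0 (h n) = e * (\<Sum>i=1..m. cst (1 / of_nat i) * (if i = 0 then 1 else 0) * h (n - int i))"
      by (rule der_on_hint) (simp add: m)
    also have "\<dots> = 0" by (simp add: sum.neutral)
    finally show ?thesis using True by simp
  next
    case False
    then show ?thesis using that by (simp add: pd_hint) (simp add: hint_def m)
  qed
  then have C: "cut_join pv (u + e) (v + e) (h n) = der_on pv (cut_coeff pv (u + e) (v + e)) (h n) +
     (u + e) * (v + e) * P 1 * h n + (\<Sum>j\<in>{1..m}. join_der pv j (pd pv j (h n)))"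
    by (intro cut_join_extend) auto
  have hn: "h n = H m" "h (n + 1) = H (m + 1)" using hH[of m] hH[of "m + 1"] by (simp_all add: m add.commute)
  have "cut_join pv (u + e) (v + e) (h n) = e * S3 + (e * (u + v) + 2) * (S1 - P 1 * H m) +
     (u + e) * (v + e) * P 1 * H m + (S2 - 2 * S1 + P 1 * H m)"
    unfolding C D J unfolding hn ..
  \<comment> \<open>The coefficients of P 1 * H m add up to -(e (u + v) + 2) + (u + e)(v + e) + 1 =
    u v. This balance requires the shift of u and v by e.\<close>
  also have "\<dots> = u * v * (P 1 * H m) + (e * (e * S2 + S3) + (u + v) * (e * S1))"
    by (simp add: algebra_simps e_e)
  also have "\<dots> = u * v * (P 1 * H m) + (e * of_nat ((m + 1) * (m + 1)) + (u + v) * of_nat (m + 1)) * H (m + 1)"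
    unfolding N1[symmetric] N2[symmetric] of_nat_mult by (simp only: distrib_right mult.assoc)
  also have "of_nat ((m + 1) * (m + 1)) = (of_int ((n + 1) * (n + 1)) :: 'x rpoly)" by (simp add: m algebra_simps)
  also have "of_nat (m + 1) = (of_int (n + 1) :: 'x rpoly)" by (simp add: m)
  finally show ?thesis unfolding hn .
qed

end

end

subsection \<open>Intertwining with the cut-and-join operator\<close>

lemma rhom_fls_const: "rhom (\<lambda>c. fls_const (cst c :: 'a rpoly))"
  by unfold_locales (simp_all add: cst_add cst_mult fls_plus_const)

lemma fls_const_mult_nth: "fls_nth (fls_const c * f) n = c * fls_nth f n" for c :: "'a::comm_ring_1"
  by simp

lemma pconst_pvar: "x \<notin> range pv \<Longrightarrow> pconst pv (pvar x)"
  by (simp add: pconst_def der_on_other)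

definition vertex_subst :: "(nat \<Rightarrow> 'x) \<Rightarrow> rat \<Rightarrow> 'x rpoly \<Rightarrow> 'x rpoly fls" where
  "vertex_subst pv \<epsilon> = subst_poly (\<lambda>c. fls_const (cst c)) (\<lambda>x. fls_const (pvar x) -
     (if x \<in> pv ` {1..} then fls_const (cst \<epsilon>) * fls_X_intpow (- int (inv pv x)) else 0))"

text \<open>The vertex operator \<open>f(p) \<mapsto> exp (\<epsilon> \<Sum>i p\<^sub>i z\<^sup>i / i) f(p - \<epsilon> [1/z])\<close>, \<open>\<epsilon> = 1, -1\<close>, where
  \<open>p - \<epsilon> [1/z]\<close> has the entries \<open>p\<^sub>i - \<epsilon> z\<^sup>-\<^sup>i\<close>.\<close>

definition vertex :: "(nat \<Rightarrow> 'x) \<Rightarrow> rat \<Rightarrow> 'x rpoly \<Rightarrow> 'x rpoly fls" where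
  "vertex pv \<epsilon> f = fps_to_fls (hseries (\<lambda>i. cst \<epsilon> * pvar (pv i))) * vertex_subst pv \<epsilon> f"

lemma rhom_vertex_subst: "rhom (vertex_subst pv \<epsilon>)"
  unfolding vertex_subst_def by (rule rhom_subst_poly[OF rhom_fls_const])

lemma vertex_subst_cst: "vertex_subst pv \<epsilon> (cst c) = fls_const (cst c)"
  unfolding vertex_subst_def by (rule subst_poly_cst[OF rhom_fls_const])

lemma vertex_subst_other: "x \<notin> range pv \<Longrightarrow> vertex_subst pv \<epsilon> (pvar x) = fls_const (pvar x)"
  unfolding vertex_subst_def by (subst subst_poly_pvar[OF rhom_fls_const]) auto

lemma vertex_subst_pvar:
  assumes "inj pv"
  shows "vertex_subst pv \<epsilon> (pvar (pv j)) = fls_const (pvar (pv j)) -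
     (if j = 0 then 0 else fls_const (cst \<epsilon>) * fls_X_intpow (- int j))"
  unfolding vertex_subst_def
  by (subst subst_poly_pvar[OF rhom_fls_const]) (use assms in \<open>auto simp: inj_image_mem_iff\<close>)

lemma additive_vertex: "additive_map (\<lambda>f. fls_nth (vertex pv \<epsilon> f) n)"
  by unfold_locales (simp add: vertex_def rhom.add[OF rhom_vertex_subst] distrib_left)

lemmas vertex_add = additive_map.add[OF additive_vertex]
lemmas vertex_sum = additive_map.sum[OF additive_vertex]
lemmas vertex_of_nat_mult = additive_map.of_nat_mult[OF additive_vertex]

text \<open>The elements over which the vertex operator is linear, such as u, v and the variables of
  the other copy.\<close>

definition vertex_scalar :: "(nat \<Rightarrow> 'x) \<Rightarrow> rat \<Rightarrow> 'x rpoly \<Rightarrow> bool" where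
  "vertex_scalar pv \<epsilon> c \<longleftrightarrow> vertex_subst pv \<epsilon> c = fls_const c"

lemma vertex_scalar_mult: "vertex_scalar pv \<epsilon> c \<Longrightarrow> fls_nth (vertex pv \<epsilon> (c * f)) n = c * fls_nth (vertex pv \<epsilon> f) n"
  unfolding vertex_def vertex_scalar_def rhom.mult[OF rhom_vertex_subst]
  by (simp only: mult.left_commute[of "fps_to_fls _"]) simp

lemma vertex_scalar_intros:
  "vertex_scalar pv \<epsilon> (cst c)" "x \<notin> range pv \<Longrightarrow> vertex_scalar pv \<epsilon> (pvar x)"
  "vertex_scalar pv \<epsilon> c' \<Longrightarrow> vertex_scalar pv \<epsilon> c'' \<Longrightarrow> vertex_scalar pv \<epsilon> (c' + c'')"
  "vertex_scalar pv \<epsilon> c' \<Longrightarrow> vertex_scalar pv \<epsilon> c'' \<Longrightarrow> vertex_scalar pv \<epsilon> (c' * c'')"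
  by (simp_all add: vertex_scalar_def vertex_subst_cst vertex_subst_other rhom.add[OF rhom_vertex_subst]
      rhom.mult[OF rhom_vertex_subst] fls_plus_const)

context
  fixes pv :: "nat \<Rightarrow> 'x" and \<epsilon> :: rat
  assumes pv: "inj pv" and \<epsilon>: "\<epsilon> * \<epsilon> = 1"
begin

private abbreviation (input) "Pv j \<equiv> pvar (pv j) :: 'x rpoly"
private abbreviation (input) "ev \<equiv> cst \<epsilon> :: 'x rpoly"
private abbreviation (input) "hv \<equiv> hint (\<lambda>i. ev * Pv i)"
private abbreviation (input) "V f n \<equiv> fls_nth (vertex pv \<epsilon> f) n"

lemma vertex_1: "V 1 n = hv n"
  by (simp only: vertex_def rhom.one[OF rhom_vertex_subst] mult_1_right hseries_hint)

text \<open>Inside the vertex operator p_j becomes p_j - eps z^(-j), and z^(-j) moves the index of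
  the coefficient up by j. The index 0 is not among the p_i and is not shifted.\<close>

lemma vertex_pvar_mult:
  "V (Pv j * f) n = Pv j * V f n - (if j = 0 then 0 else ev * V f (n + int j))"
proof -
  let ?E = "fps_to_fls (hseries (\<lambda>i. ev * Pv i))"
  have "vertex pv \<epsilon> (Pv j * f) = fls_const (Pv j) * vertex pv \<epsilon> f -
      (if j = 0 then 0 else fls_const ev * (fls_X_intpow (- int j) * vertex pv \<epsilon> f))"
    unfolding vertex_def rhom.mult[OF rhom_vertex_subst] vertex_subst_pvar[OF pv]
    by (simp only: left_diff_distrib right_diff_distrib mult.left_commute[of ?E] mult.assoc if_distrib[of "\<lambda>x. x * _"]
        if_distrib[of "\<lambda>x. ?E * x"] mult_zero_left mult_zero_right cong: if_cong)
  moreover have "fls_X_intpow (- int j) * f = fls_shift (int j) f" for f :: "'x rpoly fls"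
    using fls_X_intpow_times_conv_shift(1)[of "- int j" f] by simp
  ultimately show ?thesis by (simp only: if_distrib[of "\<lambda>f. fls_nth f _"] cong: if_cong) simp
qed

lemma vertex_induct [case_names one scalar plus var]:
  assumes one: "Q (1 :: 'x rpoly)"
    and scalar: "\<And>f c. Q f \<Longrightarrow> vertex_scalar pv \<epsilon> c \<Longrightarrow> pconst pv c \<Longrightarrow> Q (c * f)"
    and plus: "\<And>f g. Q f \<Longrightarrow> Q g \<Longrightarrow> Q (f + g)" and var: "\<And>j f. Q f \<Longrightarrow> Q (Pv j * f)"
  shows "Q f"
proof (induction f rule: mpoly_induct)
  case (const c)
  show ?case using scalar[OF one, of "cst c"] by (simp add: vertex_scalar_intros)
next
  case (var x f)
  then show ?case
    using assms(4)[of f] scalar[of f "pvar x"] vertex_scalar_intros(2)[of x pv \<epsilon>] pconst_pvar[of x pv]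
    by (cases "x \<in> range pv") auto
qed (rule plus)

text \<open>The same commutation rule for the commutator of \<open>cut_join\<close> with p_j. With
  K(n) = eps (n + 1 + eps u)(n + 1 + eps v), the factor in \<open>vertex_cut_join\<close>, the
  factor on the right is eps (K(n + j) - K(n)).\<close>

lemma vertex_join_der:
  assumes u: "vertex_scalar pv \<epsilon> u" and v: "vertex_scalar pv \<epsilon> v"
  shows "cut_coeff pv (u + ev) (v + ev) j * V f n + 2 * join_der pv j (V f n)
     - V (cut_coeff pv u v j * f) n - 2 * V (join_der pv j f) n =
     of_nat j * (of_int (2 * (n + 1) + int j) + ev * (u + v)) * V f (n + 1 + int j)"
proof (induction f arbitrary: n rule: vertex_induct)
  case one
  define N where "N = n + 1 + int j"
  define k where "k = j + nat N"
  have cc: "cut_coeff pv (u + ev) (v + ev) j = cut_coeff pv u v j + 2 * ev * of_nat j * Pv (j + 1)"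
    by (simp add: cut_coeff_def algebra_simps)
  have "V (cut_coeff pv u v j) n = of_nat j * (\<Sum>l=1..j. V (Pv l * Pv (j + 1 - l)) n) + (u + v) * of_nat j * V (Pv (j + 1)) n"
    by (simp add: cut_coeff_def vertex_add vertex_sum vertex_of_nat_mult mult.assoc vertex_scalar_mult
        vertex_scalar_intros u v distrib_right)
  also have "(\<Sum>l=1..j. V (Pv l * Pv (j + 1 - l)) n) =
     (\<Sum>l=1..j. Pv l * Pv (j + 1 - l) * hv n - ev * (Pv l * hv (N - int l)) - ev * (Pv (j + 1 - l) * hv (N - int (j + 1 - l))) + hv N)"
  proof (rule sum.cong[OF refl])
    fix l assume l: "l \<in> {1..j}"
    have V1: "V (Pv i) m = Pv i * hv m - (if i = 0 then 0 else ev * hv (m + int i))" for i m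
      using vertex_pvar_mult[of i 1 m] by (simp add: vertex_1)
    have i: "n + int (j + 1 - l) = N - int l" "n + int l = N - int (j + 1 - l)" "n + int l + int (j + 1 - l) = N"
      using l by (auto simp: N_def)
    have "V (Pv l * Pv (j + 1 - l)) n = Pv l * (Pv (j + 1 - l) * hv n - ev * hv (n + int (j + 1 - l)))
       - ev * (Pv (j + 1 - l) * hv (n + int l) - ev * hv (n + int l + int (j + 1 - l)))"
      using l by (simp add: vertex_pvar_mult[of l] V1 del: of_nat_diff)
    also have "\<dots> = Pv l * Pv (j + 1 - l) * hv n - ev * (Pv l * hv (N - int l)) - ev * (Pv (j + 1 - l) * hv (N - int (j + 1 - l))) + hv N"
      unfolding i by (simp add: algebra_simps e_e[OF pv \<epsilon>] del: of_nat_diff)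
    finally show "V (Pv l * Pv (j + 1 - l)) n = \<dots>" .
  qed
  also have "\<dots> = (\<Sum>l=1..j. Pv l * Pv (j + 1 - l)) * hv n - 2 * ev * (\<Sum>l=1..j. Pv l * hv (N - int l)) + of_nat j * hv N"
  proof -
    have "(\<Sum>l=1..j. Pv (j + 1 - l) * hv (N - int (j + 1 - l))) = (\<Sum>l=1..j. Pv l * hv (N - int l))"
      by (rule sum.reindex_bij_witness[of _ "\<lambda>l. j + 1 - l" "\<lambda>l. j + 1 - l"]) auto
    then show ?thesis
      by (simp add: sum.distrib sum_subtractf flip: sum_distrib_left sum_distrib_right)
  qed
  also have "V (Pv (j + 1)) n = Pv (j + 1) * hv n - ev * hv N"
    using vertex_pvar_mult[of "j + 1" 1 n] by (simp add: vertex_1 N_def add_ac)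
  finally have V: "V (cut_coeff pv u v j) n = cut_coeff pv u v j * hv n - 2 * ev * of_nat j * (\<Sum>l=1..j. Pv l * hv (N - int l))
     + of_nat j * of_nat j * hv N - ev * (u + v) * of_nat j * hv N"
    by (simp add: cut_coeff_def algebra_simps)
  \<comment> \<open>Newton's identity for h_N is split at l = j + 1: larger l come from
    \<open>join_der\<close>, l = j + 1 from the shift of u and v, and smaller l from the products in
    \<open>cut_coeff\<close>.\<close>
  have J: "join_der pv j (hv n) + ev * of_nat j * Pv (j + 1) * hv n + ev * of_nat j * (\<Sum>l=1..j. Pv l * hv (N - int l)) =
     of_nat j * (of_int N * hv N)"
  proof (cases "j = 0")
    case True
    then show ?thesis by (simp add: join_der_def der_on_def derivation_def)
  next
    case False
    have nk: "n \<le> int (nat N)" by (auto simp: N_def)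
    have "join_der pv j (hv n) = ev * of_nat j * (\<Sum>i=1..nat N. Pv (i + j + 1) * hv (n - int i))"
      by (rule join_der_hint[OF pv \<epsilon> nk])
    also have "(\<Sum>i=1..nat N. Pv (i + j + 1) * hv (n - int i)) = (\<Sum>l=j + 2..nat N + j + 1. Pv l * hv (N - int l))"
      by (rule sum.reindex_bij_witness[of _ "\<lambda>l. l - (j + 1)" "\<lambda>i. i + j + 1"]) (auto simp: N_def algebra_simps of_nat_diff)
    finally have 1: "join_der pv j (hv n) = ev * of_nat j * (\<Sum>l=j + 2..nat N + j + 1. Pv l * hv (N - int l))" .
    have "of_int N * hv N = (\<Sum>l=1..nat N + j + 1. ev * Pv l * hv (N - int l))"
      by (rule hint_rec) auto
    also have "\<dots> = ev * (\<Sum>l=1..nat N + j + 1. Pv l * hv (N - int l))"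
      by (simp only: sum_distrib_left mult.assoc)
    also have "{1..nat N + j + 1} = {1..j} \<union> {j + 1} \<union> {j + 2..nat N + j + 1}" by auto
    also have "(\<Sum>l\<in>{1..j} \<union> {j + 1} \<union> {j + 2..nat N + j + 1}. Pv l * hv (N - int l)) =
       (\<Sum>l=1..j. Pv l * hv (N - int l)) + Pv (j + 1) * hv n + (\<Sum>l=j + 2..nat N + j + 1. Pv l * hv (N - int l))"
      by (subst sum.union_disjoint; (subst sum.union_disjoint)?) (auto simp: N_def)
    finally show ?thesis by (simp add: 1 algebra_simps)
  qed
  have "cut_coeff pv (u + ev) (v + ev) j * hv n + 2 * join_der pv j (hv n) - V (cut_coeff pv u v j) n =
    2 * (join_der pv j (hv n) + ev * of_nat j * Pv (j + 1) * hv n + ev * of_nat j * (\<Sum>l=1..j. Pv l * hv (N - int l)))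
    - of_nat j * of_nat j * hv N + ev * (u + v) * of_nat j * hv N"
    unfolding V cc by (simp add: algebra_simps)
  also have "\<dots> = of_nat j * (of_int (2 * (n + 1) + int j) + ev * (u + v)) * hv N"
    unfolding J by (simp add: N_def algebra_simps)
  finally show ?case
    by (simp add: vertex_1 N_def join_der_def additive_map.zero[OF additive_vertex])
next
  case (scalar f c)
  then show ?case using scalar.IH[of n]
    by (simp add: vertex_scalar_mult join_der_const_mult[OF pv] mult.left_commute[of _ c] flip: right_diff_distrib distrib_left)
next
  case (plus f g)
  then show ?case
    by (simp add: vertex_add join_der_add distrib_left distrib_right algebra_simps)
next
  case (var i f)
  define s where "s = (if i = 0 then 0 else ev)"
  have vm: "V (Pv i * g) m = Pv i * V g m - s * V g (m + int i)" for g m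
    by (simp add: vertex_pvar_mult s_def)
  have ps: "pconst pv s" by (simp add: s_def flip: cst_0)
  have jd: "join_der pv j (Pv i * g) = of_nat (i * j) * (Pv (i + j + 1) * g) + Pv i * join_der pv j g" for g
    by (simp add: join_der_def der_on_mult der_on_pvar[OF pv] mult.assoc)
  let ?N = "n + 1 + int j"
  have V: "V (join_der pv j (Pv i * f)) n = of_nat (i * j) * (Pv (i + j + 1) * V f n - ev * V f (?N + int i))
      + (Pv i * V (join_der pv j f) n - s * V (join_der pv j f) (n + int i))"
    unfolding jd vertex_add vertex_of_nat_mult vm[symmetric] by (simp add: vertex_pvar_mult add_ac)
  have J: "join_der pv j (V (Pv i * f) n) = of_nat (i * j) * (Pv (i + j + 1) * V f n) + Pv i * join_der pv j (V f n)
      - s * join_der pv j (V f (n + int i))"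
    unfolding vm join_der_def der_on_diff der_on_const_mult[OF ps]
    by (simp add: der_on_mult der_on_pvar[OF pv] mult.assoc)
  have C: "V (cut_coeff pv u v j * (Pv i * f)) n = Pv i * V (cut_coeff pv u v j * f) n - s * V (cut_coeff pv u v j * f) (n + int i)"
    unfolding vm[symmetric] by (simp only: mult_ac)
  have I1: "Pv i * (cut_coeff pv (u + ev) (v + ev) j * V f n + 2 * join_der pv j (V f n)
     - V (cut_coeff pv u v j * f) n - 2 * V (join_der pv j f) n) =
     Pv i * (of_nat j * (of_int (2 * (n + 1) + int j) + ev * (u + v)) * V f ?N)"
    by (simp only: var.IH)
  have I2: "s * (cut_coeff pv (u + ev) (v + ev) j * V f (n + int i) + 2 * join_der pv j (V f (n + int i))
     - V (cut_coeff pv u v j * f) (n + int i) - 2 * V (join_der pv j f) (n + int i)) =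
     s * (of_nat j * (of_int (2 * (n + int i + 1) + int j) + ev * (u + v)) * V f (?N + int i))"
    using var.IH[of "n + int i"] by (simp add: add_ac)
  have "cut_coeff pv (u + ev) (v + ev) j * V (Pv i * f) n + 2 * join_der pv j (V (Pv i * f) n)
     - V (cut_coeff pv u v j * (Pv i * f)) n - 2 * V (join_der pv j (Pv i * f)) n =
    Pv i * (of_nat j * (of_int (2 * (n + 1) + int j) + ev * (u + v)) * V f ?N)
    - s * (of_nat j * (of_int (2 * (n + int i + 1) + int j) + ev * (u + v)) * V f (?N + int i))
    + 2 * of_nat (i * j) * (ev * V f (?N + int i))"
    unfolding I1[symmetric] I2[symmetric] V J C unfolding vm by (simp add: algebra_simps)
  also have "\<dots> = of_nat j * (of_int (2 * (n + 1) + int j) + ev * (u + v)) * (Pv i * V f ?N - s * V f (?N + int i))"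
    by (cases "i = 0") (simp_all add: s_def algebra_simps)
  finally show ?case unfolding vm .
qed

text \<open>The constant 1 is covered by \<open>cut_join_hint\<close>. Multiplication by p_j
  commutes with both operators up to the first-order terms compared in
  \<open>vertex_join_der\<close>, so the rule extends to all polynomials.\<close>

theorem vertex_cut_join:
  assumes u: "vertex_scalar pv \<epsilon> u" and v: "vertex_scalar pv \<epsilon> v"
  shows "cut_join pv (u + ev) (v + ev) (V f n) = V (cut_join pv u v f) n +
     ev * (of_int (n + 1) + ev * u) * (of_int (n + 1) + ev * v) * V f (n + 1)"
proof (induction f arbitrary: n rule: vertex_induct)
  case one
  have c1: "cut_join pv u v 1 = u * (v * (Pv 1 * 1))"
    using cut_join_extend[OF pv, of "{}" 1 u v] by (simp add: mult.assoc)
  have "V (cut_join pv u v 1) n = u * (v * (Pv 1 * hv n - ev * hv (n + 1)))"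
    unfolding c1 vertex_scalar_mult[OF u] vertex_scalar_mult[OF v] vertex_pvar_mult by (simp add: vertex_1)
  moreover have "ev * (of_int (n + 1) + ev * u) * (of_int (n + 1) + ev * v) * hv (n + 1) =
    (ev * of_int ((n + 1) * (n + 1)) + (u + v) * of_int (n + 1)) * hv (n + 1) + u * (v * (ev * hv (n + 1)))"
    by (simp add: algebra_simps e_e[OF pv \<epsilon>])
  ultimately show ?case unfolding vertex_1 cut_join_hint[OF pv \<epsilon>] by (simp add: algebra_simps)
next
  case (scalar f c)
  then show ?case using scalar.IH[of n]
    by (simp add: vertex_scalar_mult cut_join_const_mult[OF pv] distrib_left mult.left_commute[of _ c])
next
  case (plus f g)
  then show ?case by (simp add: vertex_add cut_join_add[OF pv] distrib_left add_ac)
next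
  case (var j f)
  define s where "s = (if j = 0 then 0 else ev)"
  have vm: "V (Pv j * g) m = Pv j * V g m - s * V g (m + int j)" for g m
    by (simp add: vertex_pvar_mult s_def)
  have ps: "pconst pv s" by (simp add: s_def flip: cst_0)
  let ?A = "cut_join pv (u + ev) (v + ev)" and ?K = "\<lambda>n. ev * (of_int (n + 1) + ev * u) * (of_int (n + 1) + ev * v)"
  have L: "?A (V (Pv j * f) n) = Pv j * ?A (V f n) + cut_coeff pv (u + ev) (v + ev) j * V f n + 2 * join_der pv j (V f n)
     - s * ?A (V f (n + int j))"
    unfolding vm additive_map.diff[OF additive_cut_join[OF pv]] cut_join_const_mult[OF pv ps] cut_join_pvar_mult[OF pv] ..
  have R: "V (cut_join pv u v (Pv j * f)) n = Pv j * V (cut_join pv u v f) n - s * V (cut_join pv u v f) (n + int j)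
     + V (cut_coeff pv u v j * f) n + 2 * V (join_der pv j f) n"
    unfolding cut_join_pvar_mult[OF pv] vertex_add vm using vertex_of_nat_mult[of pv \<epsilon> 2 "join_der pv j f" n] by simp
  have "?A (V (Pv j * f) n) - V (cut_join pv u v (Pv j * f)) n =
    Pv j * (?K n * V f (n + 1)) - s * (?K (n + int j) * V f (n + int j + 1)) +
    (cut_coeff pv (u + ev) (v + ev) j * V f n + 2 * join_der pv j (V f n)
     - V (cut_coeff pv u v j * f) n - 2 * V (join_der pv j f) n)"
    unfolding L R var.IH by (simp only: algebra_simps)
  also have "\<dots> = Pv j * (?K n * V f (n + 1)) - s * (?K (n + int j) * V f (n + int j + 1)) +
    of_nat j * (of_int (2 * (n + 1) + int j) + ev * (u + v)) * V f (n + int j + 1)"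
    unfolding vertex_join_der[OF u v] by (simp add: add_ac)
  \<comment> \<open>The first-order contribution is s (K(n + j) - K(n)), written without K; it turns
    the factor K(n + j) of the shifted term into K(n).\<close>
  also have "\<dots> = ?K n * (Pv j * V f (n + 1) - s * V f (n + int j + 1))"
    by (cases "j = 0") (simp_all add: s_def algebra_simps e_e[OF pv \<epsilon>])
  finally show ?case unfolding vm by (simp add: algebra_simps)
qed

end

subsection \<open>The evolution equation\<close>

lemma virasoro_cst: "virasoro pv u v k (cst c) = (if k = 0 then u * v * cst c else 0)"
  by (simp add: virasoro_def)

text \<open>The factor 2 arises because either of the two derivatives in the quadratic part can hit
  p_j.\<close>

lemma virasoro_pvar_mult:
  assumes pv: "inj pv"
  shows "virasoro pv u v k (pvar (pv j) * f) = pvar (pv j) * virasoro pv u v k f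
     + (if k < j then of_nat j * pvar (pv (j - k)) * f else 0)
     + (if k = j then (u + v) * of_nat j * f else 0)
     + (if j < k then 2 * of_nat (j * (k - j)) * pd pv (k - j) f else 0)"
proof -
  let ?p = "pvar (pv j)"
  have pdp: "pd pv i (?p * g) = (if i = j then g else 0) + ?p * pd pv i g" for i g
    by (simp add: der_on_mult der_on_pvar[OF pv])
  have "(\<Sum>i\<in>{1..<k}. of_nat (i * (k - i)) * pd pv i (pd pv (k - i) (?p * f))) =
     (\<Sum>i\<in>{1..<k}. if i = k - j \<and> 1 \<le> j then of_nat (j * (k - j)) * pd pv (k - j) f else 0)
     + (\<Sum>i\<in>{1..<k}. if i = j then of_nat (j * (k - j)) * pd pv (k - j) f else 0)
     + ?p * (\<Sum>i\<in>{1..<k}. of_nat (i * (k - i)) * pd pv i (pd pv (k - i) f))"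
    unfolding sum_distrib_left sum.distrib[symmetric]
  proof (intro sum.cong refl)
    fix i assume i: "i \<in> {1..<k}"
    have "pd pv i (pd pv (k - i) (?p * f)) = (if k - i = j then pd pv i f else 0) +
      ((if i = j then pd pv (k - i) f else 0) + ?p * pd pv i (pd pv (k - i) f))"
      unfolding pdp der_on_add by (simp add: der_on_def)
    then show "of_nat (i * (k - i)) * pd pv i (pd pv (k - i) (?p * f)) =
      (if i = k - j \<and> 1 \<le> j then of_nat (j * (k - j)) * pd pv (k - j) f else 0) +
      (if i = j then of_nat (j * (k - j)) * pd pv (k - j) f else 0) +
      ?p * (of_nat (i * (k - i)) * pd pv i (pd pv (k - i) f))"
      using i by (auto simp: distrib_left mult_ac simp del: of_nat_mult of_nat_diff)
  qed
  also have "(\<Sum>i\<in>{1..<k}. if i = k - j \<and> 1 \<le> j then of_nat (j * (k - j)) * pd pv (k - j) f else 0) =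
    (if j < k then of_nat (j * (k - j)) * pd pv (k - j) f else 0)"
    by (cases "j = 0") (auto simp: sum.delta)
  also have "(\<Sum>i\<in>{1..<k}. if i = j then of_nat (j * (k - j)) * pd pv (k - j) f else 0) =
    (if j < k then of_nat (j * (k - j)) * pd pv (k - j) f else 0)"
    by (cases "j = 0") (auto simp: sum.delta)
  finally have s: "(\<Sum>i\<in>{1..<k}. of_nat (i * (k - i)) * pd pv i (pd pv (k - i) (?p * f))) =
    (if j < k then 2 * of_nat (j * (k - j)) * pd pv (k - j) f else 0)
    + ?p * (\<Sum>i\<in>{1..<k}. of_nat (i * (k - i)) * pd pv i (pd pv (k - i) f))"
    by (simp add: algebra_simps)
  show ?thesis
    unfolding virasoro_def s pdp[of k f]
    by (simp add: der_on_mult der_on_pvar[OF pv] distrib_left distrib_right mult_ac add_ac del: of_nat_mult One_nat_def)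
qed

text \<open>As an operator the sum over k is infinite, but only finitely many terms are nonzero on a
  given polynomial. Validity for all large \<open>L\<close> lets the bounds for two summands be
  combined.\<close>

lemma cut_join_virasoro:
  assumes pv: "inj pv"
  shows "\<exists>L0. \<forall>L\<ge>L0. cut_join pv u v f = (\<Sum>k<L. pvar (pv (k + 1)) * virasoro pv u v k f)"
proof (induction f rule: mpoly_induct)
  case (const c)
  have "cut_join pv u v (cst c) = (\<Sum>k<L. pvar (pv (k + 1)) * virasoro pv u v k (cst c))" if "1 \<le> L" for L
  proof -
    have "(\<Sum>k<L. pvar (pv (k + 1)) * virasoro pv u v k (cst c)) = (\<Sum>k<L. if k = 0 then u * v * pvar (pv 1) * cst c else 0)"
      by (intro sum.cong) (auto simp: virasoro_cst)
    then show ?thesis using that cut_join_extend[OF pv, of "{}" "cst c" u v] by simp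
  qed
  then show ?case by blast
next
  case (plus f g)
  then obtain L1 L2 where "\<forall>L\<ge>L1. cut_join pv u v f = (\<Sum>k<L. pvar (pv (k + 1)) * virasoro pv u v k f)"
    "\<forall>L\<ge>L2. cut_join pv u v g = (\<Sum>k<L. pvar (pv (k + 1)) * virasoro pv u v k g)" by blast
  then show ?case
    unfolding cut_join_add[OF pv] virasoro_add distrib_left sum.distrib
    by (metis (no_types, lifting) linorder_linear order_trans)
next
  case (var x f)
  then obtain L0 where L0: "\<And>L. L \<ge> L0 \<Longrightarrow> cut_join pv u v f = (\<Sum>k<L. pvar (pv (k + 1)) * virasoro pv u v k f)" by blast
  show ?case
  proof (cases "x \<in> range pv")
    case False
    then have "pconst pv (pvar x)" by (rule pconst_pvar)
    then show ?thesis using L0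
      by (intro exI[of _ L0]) (simp add: cut_join_const_mult[OF pv] virasoro_const_mult sum_distrib_left mult.left_commute)
  next
    case True
    then obtain j where x: "x = pv j" by auto
    obtain b where b: "\<And>i. b < i \<Longrightarrow> pd pv i f = 0"
    proof -
      obtain b where "\<forall>i\<in>{j. pv j \<in> pvars f}. i \<le> b"
        using finite_indices[OF pv, of f] finite_nat_set_iff_bounded_le by metis
      then show thesis by (intro that[of b] pd_eq_0[OF pv]) (metis mem_Collect_eq not_less)
    qed
    have "cut_join pv u v (pvar x * f) = (\<Sum>k<L. pvar (pv (k + 1)) * virasoro pv u v k (pvar x * f))"
      if L: "L \<ge> max L0 (j + b + 2)" for L
    proof -
      have "(\<Sum>k<L. pvar (pv (k + 1)) * virasoro pv u v k (pvar x * f)) =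
        pvar x * (\<Sum>k<L. pvar (pv (k + 1)) * virasoro pv u v k f)
        + (\<Sum>k<L. if k < j then of_nat j * (pvar (pv (k + 1)) * pvar (pv (j - k))) * f else 0)
        + (\<Sum>k<L. if k = j then (u + v) * of_nat j * pvar (pv (j + 1)) * f else 0)
        + 2 * (\<Sum>k<L. if j < k then of_nat (j * (k - j)) * pvar (pv (k + 1)) * pd pv (k - j) f else 0)"
        unfolding x virasoro_pvar_mult[OF pv] sum_distrib_left sum.distrib[symmetric]
        by (intro sum.cong refl) (auto simp: algebra_simps)
      also have "(\<Sum>k<L. if k < j then of_nat j * (pvar (pv (k + 1)) * pvar (pv (j - k))) * f else 0) =
        (\<Sum>k<j. of_nat j * (pvar (pv (k + 1)) * pvar (pv (j - k))) * f)"
        using L by (intro sum.mono_neutral_cong_right) auto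
      also have "\<dots> = of_nat j * (\<Sum>l=1..j. pvar (pv l) * pvar (pv (j + 1 - l))) * f"
        unfolding sum_distrib_left sum_distrib_right
        by (rule sum.reindex_bij_witness[of _ "\<lambda>l. l - 1" "\<lambda>k. k + 1"]) auto
      also have "(\<Sum>k<L. if k = j then (u + v) * of_nat j * pvar (pv (j + 1)) * f else 0) =
        (u + v) * of_nat j * pvar (pv (j + 1)) * f" using L by simp
      also have "(\<Sum>k<L. if j < k then of_nat (j * (k - j)) * pvar (pv (k + 1)) * pd pv (k - j) f else 0) =
        (\<Sum>i<L - j. of_nat (i * j) * pvar (pv (i + j + 1)) * pd pv i f)"
      proof -
        have "(\<Sum>k<L. if j < k then of_nat (j * (k - j)) * pvar (pv (k + 1)) * pd pv (k - j) f else 0) =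
          (\<Sum>k\<in>{j..<L}. of_nat (j * (k - j)) * pvar (pv (k + 1)) * pd pv (k - j) f)"
          by (intro sum.mono_neutral_cong_right) auto
        also have "\<dots> = (\<Sum>i<L - j. of_nat (i * j) * pvar (pv (i + j + 1)) * pd pv i f)"
          by (rule sum.reindex_bij_witness[of _ "\<lambda>i. i + j" "\<lambda>k. k - j"]) (auto simp: mult_ac)
        finally show ?thesis .
      qed
      also have "\<dots> = join_der pv j f"
        unfolding join_der_def using L b by (intro der_on_expand[OF pv, symmetric]) auto
      finally show ?thesis
        unfolding x cut_join_pvar_mult[OF pv] using L L0[of L]
        by (simp add: cut_coeff_def distrib_left distrib_right mult_ac add_ac)
    qed
    then show ?thesis by blast
  qed
qed

section \<open>Recurrences for the coefficients of the generating series\<close>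

definition maps_coeff :: "(nat \<Rightarrow> 'x) \<Rightarrow> 'x rpoly \<Rightarrow> 'x rpoly \<Rightarrow> nat \<Rightarrow> 'x rpoly" where
  "maps_coeff pv u v n = cst (1 / fact n) * maps_sum pv u v n"

lemma of_nat_Suc_fact: "of_nat (Suc n) * (cst (1 / fact (Suc n)) * f) = (cst (1 / fact n) * f :: 'x rpoly)"
proof -
  have "of_nat (Suc n) * cst (1 / fact (Suc n)) = (cst (of_nat (Suc n) * (1 / fact (Suc n))) :: 'x rpoly)"
    by (simp only: cst_mult cst_of_nat)
  also have "of_nat (Suc n) * (1 / fact (Suc n)) = (1 / fact n :: rat)"
    unfolding fact_Suc of_nat_mult by (simp del: of_nat_Suc)
  finally show ?thesis by (simp only: mult.assoc[symmetric])
qed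

context
  fixes pv :: "nat \<Rightarrow> 'x" and u v :: "'x rpoly"
  assumes pv: "inj pv" and u: "pconst pv u" and v: "pconst pv v"
begin

lemma maps_coeff_0: "maps_coeff pv u v 0 = 1"
  by (simp add: maps_coeff_def maps_sum_0[OF pv u v])

lemma maps_coeff_rec:
  assumes "1 \<le> m"
  shows "of_nat m * pd pv m (maps_coeff pv u v (Suc n)) = virasoro pv u v (m - 1) (maps_coeff pv u v n)"
proof -
  have "of_nat m * pd pv m (maps_coeff pv u v (Suc n)) =
    cst (1 / fact (Suc n)) * (of_nat m * pd pv m (maps_sum pv u v (Suc n)))"
    by (simp add: maps_coeff_def der_on_const_mult mult_ac del: fact_Suc)
  also have "\<dots> = of_nat (Suc n) * (cst (1 / fact (Suc n)) * virasoro pv u v (m - 1) (maps_sum pv u v n))"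
    unfolding maps_sum_rec[OF pv u v assms] by (simp only: mult_ac)
  also have "\<dots> = virasoro pv u v (m - 1) (maps_coeff pv u v n)"
    unfolding of_nat_Suc_fact maps_coeff_def by (rule virasoro_const_mult[symmetric]) simp
  finally show ?thesis .
qed

lemma euler_maps_coeff:
  "(\<Sum>m\<in>{1..n}. of_nat m * pvar (pv m) * pd pv m (maps_coeff pv u v n)) = of_nat n * maps_coeff pv u v n"
proof -
  have "(\<Sum>m\<in>{1..n}. of_nat m * pvar (pv m) * pd pv m (maps_coeff pv u v n)) =
    cst (1 / fact n) * (\<Sum>m\<in>{1..n}. of_nat m * pvar (pv m) * pd pv m (maps_sum pv u v n))"
    unfolding maps_coeff_def sum_distrib_left by (intro sum.cong refl) (simp add: der_on_const_mult mult_ac)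
  then show ?thesis unfolding euler_maps_sum[OF pv u v] by (simp add: maps_coeff_def mult_ac)
qed

text \<open>A permutation of n elements has no cycle longer than n.\<close>

lemma pd_maps_coeff_eq_0:
  assumes "n < m" shows "pd pv m (maps_coeff pv u v n) = 0"
proof -
  have "rooted_sum pv u v m n x = 0" if x: "x \<in> {1..n}" for x
  proof -
    have "card (orbit (\<sigma> \<circ> \<rho>) x) \<noteq> m" if "\<sigma> \<in> perms n" "\<rho> \<in> perms n" for \<sigma> \<rho>
    proof -
      have "\<sigma> \<circ> \<rho> permutes {1..n}" using that by (auto intro: permutes_compose)
      from card_mono[OF _ permutes_orbit_subset[OF this x]] show ?thesis using assms by simp
    qed
    then show ?thesis unfolding rooted_sum_def[OF pv u v] rooted_weight_def by (intro sum.neutral ballI) simp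
  qed
  then have "of_nat m * pd pv m (maps_sum pv u v n) = of_nat m * 0"
    unfolding pd_maps_sum[OF pv u v] by simp
  then have "pd pv m (maps_sum pv u v n) = 0"
    using of_nat_mult_cancel[of m "pd pv m (maps_sum pv u v n)" 0] assms by simp
  then show ?thesis by (simp add: maps_coeff_def der_on_const_mult)
qed

text \<open>By the Virasoro recursion p_(k+1) L_k becomes p_m m d/dp_m one order higher, m = k + 1,
  and Euler's relation sums these terms.\<close>

theorem maps_coeff_evolution:
  "of_nat (Suc n) * maps_coeff pv u v (Suc n) = cut_join pv u v (maps_coeff pv u v n)"
proof -
  let ?f = "maps_coeff pv u v n"
  obtain L0 where L0: "\<And>L. L \<ge> L0 \<Longrightarrow> cut_join pv u v ?f = (\<Sum>k<L. pvar (pv (k + 1)) * virasoro pv u v k ?f)"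
    using cut_join_virasoro[OF pv] by blast
  define L where "L = max L0 (Suc n)"
  have "cut_join pv u v ?f = (\<Sum>k<L. pvar (pv (k + 1)) * virasoro pv u v k ?f)"
    by (rule L0) (simp add: L_def)
  also have "\<dots> = (\<Sum>k<L. pvar (pv (k + 1)) * (of_nat (k + 1) * pd pv (k + 1) (maps_coeff pv u v (Suc n))))"
    using maps_coeff_rec[of "k + 1" n for k] by (intro sum.cong) auto
  also have "\<dots> = (\<Sum>k<Suc n. pvar (pv (k + 1)) * (of_nat (k + 1) * pd pv (k + 1) (maps_coeff pv u v (Suc n))))"
    by (intro sum.mono_neutral_right) (auto simp: L_def pd_maps_coeff_eq_0)
  also have "\<dots> = (\<Sum>m\<in>{1..Suc n}. of_nat m * pvar (pv m) * pd pv m (maps_coeff pv u v (Suc n)))"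
    by (rule sum.reindex_bij_witness[of _ "\<lambda>m. m - 1" "\<lambda>k. k + 1"]) auto
  finally show ?thesis by (simp only: euler_maps_coeff)
qed

lemma rhom_maps_coeff:
  assumes \<phi>: "rhom \<phi>"
  shows "\<phi> (maps_coeff pv u v n) = \<phi> (cst (1 / fact n)) * (\<Sum>\<sigma>\<in>perms n. \<Sum>\<rho>\<in>perms n. \<phi> u ^ ncyc \<sigma> n * \<phi> v ^ ncyc \<rho> n *
     (\<Prod>C\<in>perm_cycles (\<sigma> \<circ> \<rho>) n. \<phi> (pvar (pv (card C)))))"
proof -
  interpret rhom \<phi> by fact
  show ?thesis unfolding maps_coeff_def maps_sum_def[OF pv u v] cycle_weight_def by (simp only: mult sum power prod)
qed

end


subsection \<open>The bilinear identity\<close>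

datatype bivar = BU | BV | BP bool nat

abbreviation "bi1 \<equiv> BP True"
abbreviation "bi2 \<equiv> BP False"
abbreviation "bu \<equiv> pvar BU :: bivar rpoly"
abbreviation "bv \<equiv> pvar BV :: bivar rpoly"

lemma inj_BP: "inj (BP s)"
  by (simp add: inj_def)

lemma bivar_const: "pconst (BP s) bu" "pconst (BP s) bv" "s \<noteq> r \<Longrightarrow> pconst (BP s) (pvar (BP r j))"
  by (auto intro!: pconst_pvar)

lemma bivar_scalar: "vertex_scalar (BP s) \<epsilon> bu" "vertex_scalar (BP s) \<epsilon> bv"
  by (auto intro!: vertex_scalar_intros)

abbreviation "bmaps s \<equiv> maps_coeff (BP s) bu bv"

text \<open>An induction that stays within the polynomials in u, v and one copy of the p_i;
  induction over the whole ring would bring in the variables of the other copy.\<close>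

lemma maps_coeff_closed:
  fixes pv :: "nat \<Rightarrow> 'x"
  assumes pv: "inj pv" "pconst pv u" "pconst pv v"
    and Q1: "Q 1" and Q_add: "\<And>f g. Q f \<Longrightarrow> Q g \<Longrightarrow> Q (f + g)"
    and Q_u: "\<And>f. Q f \<Longrightarrow> Q (u * f)" and Q_v: "\<And>f. Q f \<Longrightarrow> Q (v * f)"
    and Q_c: "\<And>f c. Q f \<Longrightarrow> Q (cst c * f)" and Q_p: "\<And>f j. Q f \<Longrightarrow> Q (pvar (pv j) * f)"
  shows "Q (maps_coeff pv u v n)"
proof -
  have Q0: "Q 0" using Q_c[OF Q1, of 0] by simp
  have Q_sum: "Q (sum f S)" if "\<And>x. x \<in> S \<Longrightarrow> Q (f x)" for f :: "(nat \<Rightarrow> nat) \<Rightarrow> 'x rpoly" and S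
    using that by (induction S rule: infinite_finite_induct) (auto simp: Q0 Q_add)
  have Q_prod: "Q (\<Prod>C\<in>S. pvar (pv (card C)))" for S :: "nat set set"
    by (induction S rule: infinite_finite_induct) (auto simp: Q1 Q_p)
  have Q_pow: "Q f \<Longrightarrow> Q (u ^ a * f)" "Q f \<Longrightarrow> Q (v ^ a * f)" for f a
    by (induction a) (simp_all add: Q_u Q_v mult.assoc)
  show ?thesis
    unfolding maps_coeff_def maps_sum_def[OF pv] cycle_weight_def
    by (intro Q_c Q_sum) (simp only: mult.assoc Q_pow Q_prod)
qed

lemma pconst_hint:
  assumes "\<And>i. pconst pv (q i)" shows "pconst pv (hint q n)"
  unfolding pconst_def
proof
  fix a
  have "n \<le> int (nat n)" by simp
  from der_hint[OF der_der_on der_on_cst this, of pv a q] show "der_on pv a (hint q n) = 0"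
    using assms by (simp add: pconst_def)
qed

text \<open>This allows the cut-and-join operator in one copy to pass the vertex operator acting on
  the other.\<close>

lemma pconst_vertex_bmaps:
  assumes "s \<noteq> r" and \<epsilon>: "\<epsilon> * \<epsilon> = 1"
  shows "pconst (BP r) (fls_nth (vertex (BP s) \<epsilon> (bmaps s n)) m)"
proof -
  have "\<forall>m. pconst (BP r) (fls_nth (vertex (BP s) \<epsilon> (bmaps s n)) m)"
  proof (rule maps_coeff_closed[OF inj_BP bivar_const(1,2)], goal_cases)
    case 1
    then show ?case using assms bivar_const(3)[of r s]
      by (auto simp: vertex_1[OF inj_BP \<epsilon>] intro!: pconst_hint pconst_mult)
  next
    case (6 f j)
    have d: "pconst (BP r) (x - y)" if "pconst (BP r) x" "pconst (BP r) y" for x y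
      using that by (simp add: pconst_def der_on_diff)
    show ?case using 6 assms bivar_const(3)[of r s]
      by (auto simp: vertex_pvar_mult[OF inj_BP \<epsilon>] intro!: d pconst_mult simp flip: cst_0)
  qed (auto simp: vertex_add pconst_add pconst_mult bivar_const vertex_scalar_mult bivar_scalar vertex_scalar_intros)
  then show ?thesis by blast
qed

lemma fls_mult_nth_bounds:
  fixes f g :: "'a::comm_ring_1 fls"
  assumes "\<And>i. i < a \<Longrightarrow> fls_nth f i = 0" "\<And>i. n - b > i \<Longrightarrow> fls_nth g i = 0"
  shows "fls_nth (f * g) n = (\<Sum>i=a..b. fls_nth f i * fls_nth g (n - i))"
proof -
  let ?S = "{fls_subdegree f..n - fls_subdegree g}"
  have "fls_nth (f * g) n = (\<Sum>i\<in>?S. fls_nth f i * fls_nth g (n - i))" by (rule fls_times_nth(2))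
  also have "\<dots> = (\<Sum>i\<in>?S \<union> {a..b}. fls_nth f i * fls_nth g (n - i))"
    by (intro sum.mono_neutral_left) auto
  also have "\<dots> = (\<Sum>i=a..b. fls_nth f i * fls_nth g (n - i))"
    using assms by (intro sum.mono_neutral_right) force+
  finally show ?thesis .
qed

lemma sum_telescope_int:
  fixes F :: "int \<Rightarrow> 'a::ab_group_add"
  shows "(\<Sum>i\<in>{a..<a + int n}. F (i + 1) - F i) = F (a + int n) - F a"
proof (induction n)
  case (Suc n)
  have "{a..<a + int (Suc n)} = insert (a + int n) {a..<a + int n}" by auto
  then show ?case using Suc by (simp add: add_ac)
qed simp

text \<open>The coefficient of 1/z is the residue in the spectral parameter z.\<close>

definition bilinear :: "bivar rpoly \<Rightarrow> bivar rpoly \<Rightarrow> bivar rpoly" where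
  "bilinear f g = fls_nth (vertex bi1 1 f * vertex bi2 (-1) g) (-1)"

lemma vertex_of_nat_mult_fls: "vertex pv \<epsilon> (of_nat n * f) = of_nat n * vertex pv \<epsilon> f"
  by (intro fls_eqI) (simp add: vertex_of_nat_mult fls_of_nat)

lemma bilinear_of_nat: "bilinear (of_nat n * f) g = of_nat n * bilinear f g" "bilinear f (of_nat n * g) = of_nat n * bilinear f g"
  unfolding bilinear_def vertex_of_nat_mult_fls fls_of_nat
  by (simp_all only: mult.assoc mult.left_commute[of _ "fls_const _"] fls_const_mult_nth)

lemma bilinear_0 [simp]: "bilinear 0 g = 0" "bilinear f 0 = 0"
  using bilinear_of_nat(1)[of 0 0 g] bilinear_of_nat(2)[of f 0 0] by simp_all

abbreviation "bi_cut_join f \<equiv> cut_join bi1 (bu + 1) (bv + 1) f + cut_join bi2 (bu - 1) (bv - 1) f"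

text \<open>The extra terms of \<open>vertex_cut_join\<close> in the two copies are values of one
  function at neighbouring indices, with opposite signs, so their sum over all indices
  telescopes.\<close>

lemma bilinear_cut_join:
  defines "f n \<equiv> bmaps True n" and "g n \<equiv> bmaps False n"
  shows "bi_cut_join (bilinear (f a) (g b)) = bilinear (cut_join bi1 bu bv (f a)) (g b) + bilinear (f a) (cut_join bi2 bu bv (g b))"
proof -
  define F where "F = vertex bi1 1 (f a)"
  define F' where "F' = vertex bi1 1 (cut_join bi1 bu bv (f a))"
  define K where "K = vertex bi2 (-1) (g b)"
  define K' where "K' = vertex bi2 (-1) (cut_join bi2 bu bv (g b))"
  obtain M :: nat where M: "\<And>i. i < - int M \<Longrightarrow> fls_nth F i = 0 \<and> fls_nth F' i = 0 \<and> fls_nth K i = 0 \<and> fls_nth K' i = 0"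
  proof -
    define d where "d = - Min {fls_subdegree F, fls_subdegree F', fls_subdegree K, fls_subdegree K'}"
    show thesis
      by (rule that[of "nat d"]) (auto simp: d_def min_def intro!: fls_eq0_below_subdegree split: if_splits)
  qed
  have ex: "fls_nth (x * y) (-1) = (\<Sum>i\<in>{- int M - 1..<- int M - 1 + int (2 * M + 2)}. fls_nth x i * fls_nth y (-1 - i))"
    if "\<And>i. i < - int M \<Longrightarrow> fls_nth x i = 0" "\<And>i. i < - int M \<Longrightarrow> fls_nth y i = 0" for x y :: "bivar rpoly fls"
  proof -
    have "fls_nth (x * y) (-1) = (\<Sum>i\<in>{- int M - 1..int M}. fls_nth x i * fls_nth y (-1 - i))"
      by (rule fls_mult_nth_bounds) (use that in auto)
    also have "{- int M - 1..int M} = {- int M - 1..<- int M - 1 + int (2 * M + 2)}" by auto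
    finally show ?thesis .
  qed
  let ?S = "{- int M - 1..<- int M - 1 + int (2 * M + 2)}"
  let ?A = "cut_join bi1 (bu + 1) (bv + 1)" and ?B = "cut_join bi2 (bu - 1) (bv - 1)"
  interpret A: additive_map ?A by (rule additive_cut_join[OF inj_BP])
  interpret B: additive_map ?B by (rule additive_cut_join[OF inj_BP])
  have cF: "pconst bi2 (fls_nth F i)" and cK: "pconst bi1 (fls_nth K i)" for i
    unfolding F_def K_def f_def g_def by (auto intro!: pconst_vertex_bmaps)
  \<comment> \<open>For the second copy n = -1 - i and eps = -1, so that the factor becomes -(-i -
    u)(-i - v) = -(i + u)(i + v); for the first copy it is the same product at i + 1 with positive
    sign.\<close>
  define W where "W i = (of_int i + bu) * (of_int i + bv) * (fls_nth F i * fls_nth K (- i))" for i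
  have AF: "?A (fls_nth F i * fls_nth K (-1 - i)) = fls_nth F' i * fls_nth K (-1 - i) + W (i + 1)" for i
  proof -
    have "?A (fls_nth F i) = fls_nth F' i + (of_int (i + 1) + bu) * (of_int (i + 1) + bv) * fls_nth F (i + 1)"
      using vertex_cut_join[where pv=bi1 and \<epsilon>=1 and u=bu and v=bv and f="f a" and n=i, OF inj_BP]
      by (simp add: bivar_scalar F_def F'_def)
    then have "?A (fls_nth K (-1 - i) * fls_nth F i) =
      fls_nth K (-1 - i) * (fls_nth F' i + (of_int (i + 1) + bu) * (of_int (i + 1) + bv) * fls_nth F (i + 1))"
      by (simp only: cut_join_const_mult[OF inj_BP cK])
    moreover have "- (i + 1) = -1 - i" by simp
    ultimately show ?thesis by (simp only: W_def distrib_left mult_ac)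
  qed
  have BK: "?B (fls_nth F i * fls_nth K (-1 - i)) = fls_nth F i * fls_nth K' (-1 - i) - W i" for i
  proof -
    have "?B (fls_nth K (-1 - i)) = fls_nth K' (-1 - i) - (of_int i + bu) * (of_int i + bv) * fls_nth K (- i)"
      using vertex_cut_join[where pv=bi2 and \<epsilon>="-1" and u=bu and v=bv and f="g b" and n="-1 - i", OF inj_BP]
      by (simp add: bivar_scalar K_def K'_def cst_uminus algebra_simps)
    then show ?thesis
      by (simp only: cut_join_const_mult[OF inj_BP cF] W_def right_diff_distrib mult_ac)
  qed
  \<comment> \<open>The boundary values are \<open>W (M + 1)\<close> and \<open>W (- M - 1)\<close>;
    a factor \<open>K\<close> vanishes in the one and a factor \<open>F\<close> in the other. The
    range of summation was widened for this.\<close>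
  have tele: "(\<Sum>i\<in>?S. W (i + 1) - W i) = 0"
    unfolding sum_telescope_int using M by (simp add: W_def)
  have "bi_cut_join (bilinear (f a) (g b)) =
    (\<Sum>i\<in>?S. fls_nth F' i * fls_nth K (-1 - i)) + (\<Sum>i\<in>?S. fls_nth F i * fls_nth K' (-1 - i)) + (\<Sum>i\<in>?S. W (i + 1) - W i)"
    unfolding bilinear_def F_def[symmetric] K_def[symmetric]
    by (subst (1 2) ex) (simp_all add: M A.sum B.sum AF BK sum.distrib sum_subtractf)
  also have "\<dots> = bilinear (cut_join bi1 bu bv (f a)) (g b) + bilinear (f a) (cut_join bi2 bu bv (g b))"
    unfolding tele bilinear_def F_def[symmetric] K_def[symmetric] F'_def[symmetric] K'_def[symmetric]
    by (subst (1 2) ex) (simp_all add: M)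
  finally show ?thesis .
qed

text \<open>At order 0 both vertex operators give power series in z, which have no residue. For the
  step, n + 1 is split as a + (n + 1 - a) and the evolution equation is applied in each
  copy.\<close>

theorem bilinear_identity: "(\<Sum>a\<le>n. bilinear (bmaps True a) (bmaps False (n - a))) = 0"
proof (induction n)
  case 0
  have "bilinear 1 1 = 0"
    by (simp add: bilinear_def vertex_def rhom.one[OF rhom_vertex_subst] flip: fls_times_fps_to_fls)
  then show ?case by (simp add: maps_coeff_0[OF inj_BP bivar_const(1,2)])
next
  case (Suc n)
  let ?f = "bmaps True" and ?g = "bmaps False"
  let ?Z = "\<Sum>a\<le>n. bilinear (?f a) (?g (n - a))"
  interpret A: additive_map "\<lambda>f. bi_cut_join f"
    by unfold_locales (simp add: cut_join_add[OF inj_BP])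
  have ev: "of_nat (Suc m) * bmaps s (Suc m) = cut_join (BP s) bu bv (bmaps s m)" for s m
    by (rule maps_coeff_evolution[OF inj_BP bivar_const(1,2)])
  have "of_nat (Suc n) * (\<Sum>a\<le>Suc n. bilinear (?f a) (?g (Suc n - a))) =
    (\<Sum>a\<le>Suc n. bilinear (of_nat a * ?f a) (?g (Suc n - a))) + (\<Sum>a\<le>Suc n. bilinear (?f a) (of_nat (Suc n - a) * ?g (Suc n - a)))"
    unfolding sum_distrib_left sum.distrib[symmetric] bilinear_of_nat distrib_right[symmetric] of_nat_add[symmetric]
    by (intro sum.cong refl) simp
  also have "(\<Sum>a\<le>Suc n. bilinear (of_nat a * ?f a) (?g (Suc n - a))) = (\<Sum>a\<le>n. bilinear (cut_join bi1 bu bv (?f a)) (?g (n - a)))"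
    by (subst sum.atMost_Suc_shift) (simp add: ev[symmetric] del: of_nat_Suc)
  also have "(\<Sum>a\<le>Suc n. bilinear (?f a) (of_nat (Suc n - a) * ?g (Suc n - a))) = (\<Sum>a\<le>n. bilinear (?f a) (cut_join bi2 bu bv (?g (n - a))))"
    by (simp add: ev[symmetric] Suc_diff_le del: of_nat_Suc of_nat_diff cong: sum.cong_simp)
  also have "(\<Sum>a\<le>n. bilinear (cut_join bi1 bu bv (?f a)) (?g (n - a))) + (\<Sum>a\<le>n. bilinear (?f a) (cut_join bi2 bu bv (?g (n - a)))) =
    (\<Sum>a\<le>n. bi_cut_join (bilinear (?f a) (?g (n - a))))"
    unfolding sum.distrib[symmetric] bilinear_cut_join ..
  also have "\<dots> = bi_cut_join ?Z" by (rule A.sum[symmetric])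
  also have "\<dots> = of_nat (Suc n) * 0" unfolding Suc.IH A.zero by simp
  finally show ?case by (rule of_nat_mult_cancel[rotated]) simp
qed

subsection \<open>Hirota derivatives\<close>

text \<open>\<open>p\<close> and \<open>p'\<close> denote the two copies \<open>BP True\<close>, \<open>BP False\<close>; \<open>bi_der i\<close> is
  \<open>\<partial>/\<partial>p'\<^sub>i - \<partial>/\<partial>p\<^sub>i\<close>, and \<open>bi_shift\<close> substitutes \<open>p - [1/z]\<close>, \<open>p' + [1/z]\<close>.\<close>

definition bi_der :: "nat \<Rightarrow> bivar rpoly \<Rightarrow> bivar rpoly" where
  "bi_der i = derivation (\<lambda>x. case x of BP s j \<Rightarrow> if j = i then (if s then -1 else 1) else 0 | _ \<Rightarrow> 0)"

definition bi_shift :: "bivar rpoly \<Rightarrow> bivar rpoly fls" where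
  "bi_shift = subst_poly (\<lambda>c. fls_const (cst c)) (\<lambda>x. fls_const (pvar x) -
     (case x of BP s j \<Rightarrow> if j = 0 then 0 else fls_const (if s then 1 else -1) * fls_X_intpow (- int j) | _ \<Rightarrow> 0))"

definition bi_series :: "nat \<Rightarrow> bivar rpoly" where
  "bi_series i = pvar (bi1 i) - pvar (bi2 i)"

text \<open>Both vertex operators at once, applied to a polynomial in both copies; on the products
  forming \<open>bi_maps\<close>, the index -1 gives \<open>bilinear\<close>.\<close>

definition bi_vertex :: "bivar rpoly \<Rightarrow> int \<Rightarrow> bivar rpoly" where
  "bi_vertex Y n = fls_nth (fps_to_fls (hseries bi_series) * bi_shift Y) n"

definition bi_maps :: "nat \<Rightarrow> bivar rpoly" where
  "bi_maps n = (\<Sum>a\<le>n. bmaps True a * bmaps False (n - a))"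

lemma rhom_bi_shift: "rhom bi_shift"
  unfolding bi_shift_def by (rule rhom_subst_poly[OF rhom_fls_const])

lemma bi_shift_cst: "bi_shift (cst c) = fls_const (cst c)"
  unfolding bi_shift_def by (rule subst_poly_cst[OF rhom_fls_const])

lemma bi_shift_pvar: "bi_shift (pvar x) = fls_const (pvar x) -
     (case x of BP s j \<Rightarrow> if j = 0 then 0 else fls_const (if s then 1 else -1) * fls_X_intpow (- int j) | _ \<Rightarrow> 0)"
  unfolding bi_shift_def by (rule subst_poly_pvar[OF rhom_fls_const])

text \<open>A polynomial in one copy does not see the shift of the other copy.\<close>

lemma vertex_subst_bmaps:
  "vertex_subst (BP s) (if s then 1 else -1) (bmaps s n) = bi_shift (bmaps s n)"
proof -
  have p: "vertex_subst (BP s) (if s then 1 else -1) (pvar (BP s j)) = bi_shift (pvar (BP s j))" for j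
    unfolding vertex_subst_pvar[OF inj_BP] bi_shift_pvar by (simp add: cst_uminus)
  have c: "vertex_subst (BP s) (if s then 1 else -1) bu = bi_shift bu" "vertex_subst (BP s) (if s then 1 else -1) bv = bi_shift bv"
    by (auto simp: bi_shift_pvar intro!: vertex_subst_other)
  show ?thesis
    unfolding rhom_maps_coeff[OF inj_BP bivar_const(1,2) rhom_vertex_subst]
      rhom_maps_coeff[OF inj_BP bivar_const(1,2) rhom_bi_shift] p c vertex_subst_cst bi_shift_cst ..
qed

lemma additive_bi_vertex: "additive_map (\<lambda>Y. bi_vertex Y n)"
  by unfold_locales (simp add: bi_vertex_def rhom.add[OF rhom_bi_shift] distrib_left)

lemma bilinear_bi_vertex:
  "bilinear (bmaps True a) (bmaps False b) = bi_vertex (bmaps True a * bmaps False b) (-1)"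
proof -
  have "hseries bi_series = hseries (\<lambda>i. cst 1 * pvar (bi1 i) + cst (-1) * pvar (bi2 i))"
    by (intro arg_cong[where f=hseries]) (simp add: bi_series_def fun_eq_iff cst_uminus)
  then have h: "hseries bi_series = hseries (\<lambda>i. cst 1 * pvar (bi1 i)) * hseries (\<lambda>i. cst (-1) * pvar (bi2 i))"
    by (simp only: hseries_add)
  have "vertex_subst bi1 1 (bmaps True a) = bi_shift (bmaps True a)"
    "vertex_subst bi2 (-1) (bmaps False b) = bi_shift (bmaps False b)"
    using vertex_subst_bmaps[of True a] vertex_subst_bmaps[of False b] by simp_all
  then show ?thesis
    unfolding bilinear_def bi_vertex_def vertex_def h rhom.mult[OF rhom_bi_shift] fls_times_fps_to_fls
    by (simp only: mult_ac)
qed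

lemma bi_vertex_bi_maps: "bi_vertex (bi_maps n) (-1) = 0"
  unfolding bi_maps_def additive_map.sum[OF additive_bi_vertex] bilinear_bi_vertex[symmetric]
  by (rule bilinear_identity)

lemma fls_shift_term:
  "fls_nth ((fls_const p - (if j = 0 then 0 else fls_const e * fls_X_intpow (- int j))) * f) n =
   p * fls_nth f n - (if j = 0 then 0 else e * fls_nth f (n + int j))" for f :: "'a::comm_ring_1 fls"
proof -
  have "fls_X_intpow (- int j) * f = fls_shift (int j) f"
    using fls_X_intpow_times_conv_shift(1)[of "- int j" f] by simp
  then show ?thesis
    by (cases "j = 0") (simp_all only: left_diff_distrib mult.assoc if_True if_False fls_minus_nth fls_const_mult_nth
      fls_shift_nth mult_zero_left fls_zero_nth simp_thms)
qed

definition bi_sgn :: "bool \<Rightarrow> nat \<Rightarrow> bivar rpoly" where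
  "bi_sgn s j = (if j = 0 then 0 else if s then 1 else -1)"

lemma bi_shift_BP_mult:
  "fls_nth (bi_shift (pvar (BP s j) * Y)) n = pvar (BP s j) * fls_nth (bi_shift Y) n - bi_sgn s j * fls_nth (bi_shift Y) (n + int j)"
  unfolding rhom.mult[OF rhom_bi_shift] bi_shift_pvar bivar.case fls_shift_term by (simp add: bi_sgn_def)

lemma bi_vertex_BP_mult:
  "bi_vertex (pvar (BP s j) * Y) n = pvar (BP s j) * bi_vertex Y n - bi_sgn s j * bi_vertex Y (n + int j)"
  unfolding bi_vertex_def rhom.mult[OF rhom_bi_shift] bi_shift_pvar bivar.case
    mult.left_commute[of "fps_to_fls _" "fls_const _ - _"] fls_shift_term by (simp add: bi_sgn_def)

lemma bi_const_mult:
  assumes "bi_shift c = fls_const c"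
  shows "bi_vertex (c * Y) n = c * bi_vertex Y n" "fls_nth (bi_shift (c * Y)) n = c * fls_nth (bi_shift Y) n"
  unfolding bi_vertex_def rhom.mult[OF rhom_bi_shift] assms mult.left_commute[of "fps_to_fls _" "fls_const _"]
  by (rule fls_const_mult_nth)+

lemma bi_induct [case_names one scalar plus var]:
  assumes one: "Q 1"
    and scalar: "\<And>c Y. Q Y \<Longrightarrow> bi_shift c = fls_const c \<Longrightarrow> (\<And>i. bi_der i c = 0) \<Longrightarrow> Q (c * Y)"
    and plus: "\<And>X Y. Q X \<Longrightarrow> Q Y \<Longrightarrow> Q (X + Y)"
    and var: "\<And>s j Y. Q Y \<Longrightarrow> Q (pvar (BP s j) * Y)"
  shows "Q Y"
proof (induction Y rule: mpoly_induct)
  case (const c)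
  show ?case using scalar[OF one, of "cst c"] by (simp add: bi_shift_cst bi_der_def)
next
  case (var x Y)
  then show ?case using assms(4)[of Y] scalar[of Y "pvar x"]
    by (cases x) (auto simp: bi_shift_pvar bi_der_def derivation_pvar)
qed (rule plus)

lemma der_bi_der: "der (\<lambda>x. x) (bi_der i)"
  by (simp add: bi_der_def der_derivation)

lemmas bi_der_mult = der.leibniz[OF der_bi_der]
lemmas bi_der_add = additive_map.add[OF der.axioms(1)[OF der_bi_der]]
lemmas bi_der_diff = additive_map.diff[OF der.axioms(1)[OF der_bi_der]]
lemmas bi_der_0 = additive_map.zero[OF der.axioms(1)[OF der_bi_der]]
lemmas bi_der_of_nat_mult = additive_map.of_nat_mult[OF der.axioms(1)[OF der_bi_der]]

lemma bi_der_cst [simp]: "bi_der i (cst c) = 0"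
  by (simp add: bi_der_def)

lemma bi_der_BP: "bi_der i (pvar (BP s j)) = (if j = i then (if s then -1 else 1) else 0)"
  by (simp add: bi_der_def derivation_pvar)

lemma bi_der_sgn [simp]: "bi_der i (bi_sgn s j) = 0"
  using bi_der_cst[of i 1] bi_der_cst[of i "-1"] by (simp add: bi_sgn_def cst_uminus bi_der_0)

text \<open>The derivation commutes with the shift and multiplies the exponential of sum (p_i -
  p'_i) z^i / i by -2 z^a / a, one half from each copy.\<close>

lemma bi_der_vertex:
  assumes a: "a \<noteq> 0"
  shows "of_nat a * bi_der a (bi_vertex Y n) = of_nat a * bi_vertex (bi_der a Y) n - 2 * bi_vertex Y (n - int a)"
proof (induction Y arbitrary: n rule: bi_induct)
  case one
  have v1: "bi_vertex 1 m = hint bi_series m" for m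
    by (simp only: bi_vertex_def rhom.one[OF rhom_bi_shift] mult_1_right hseries_hint)
  define k where "k = max a (nat n)"
  have "bi_der a (hint bi_series n) = (\<Sum>i=1..k. cst (1 / of_nat i) * bi_der a (bi_series i) * hint bi_series (n - int i))"
    by (rule der_hint[OF der_bi_der]) (auto simp: k_def)
  also have "\<dots> = (\<Sum>i=1..k. if i = a then - 2 * (cst (1 / of_nat a) * hint bi_series (n - int a)) else 0)"
    by (intro sum.cong) (auto simp: bi_series_def bi_der_diff bi_der_BP)
  also have "\<dots> = - 2 * (cst (1 / of_nat a) * hint bi_series (n - int a))" using a by (simp add: k_def)
  finally have "of_nat a * bi_der a (hint bi_series n) = - 2 * ((of_nat a * cst (1 / of_nat a)) * hint bi_series (n - int a))"
    by (simp add: mult_ac)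
  moreover have "bi_der a 1 = 0" using bi_der_cst[of a 1] by simp
  ultimately show ?case unfolding v1 of_nat_mult_cst_inverse[OF a]
    using additive_map.zero[OF additive_bi_vertex] by simp
next
  case (scalar c Y)
  then show ?case
    using arg_cong[OF scalar(1)[of n], of "\<lambda>x. c * x"] by (simp add: bi_const_mult bi_der_mult right_diff_distrib mult.left_commute[of _ c])
next
  case (plus X Y)
  then show ?case by (simp add: bi_der_add additive_map.add[OF additive_bi_vertex] distrib_left)
next
  case (var s j Y)
  let ?p = "pvar (BP s j) :: bivar rpoly" and ?b = "of_nat a :: bivar rpoly"
  let ?d = "bi_der a ?p"
  have i: "n + int j - int a = n - int a + int j" by simp
  have d: "bi_vertex (?d * Y) n = ?d * bi_vertex Y n"
    using additive_map.uminus[OF additive_bi_vertex, where x=Y] additive_map.zero[OF additive_bi_vertex]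
    by (auto simp: bi_der_BP)
  have "?b * bi_der a (bi_vertex (?p * Y) n) = ?b * (?d * bi_vertex Y n)
     + ?p * (?b * bi_der a (bi_vertex Y n)) - bi_sgn s j * (?b * bi_der a (bi_vertex Y (n + int j)))"
    unfolding bi_vertex_BP_mult by (simp add: bi_der_diff bi_der_mult algebra_simps)
  also have "\<dots> = ?b * bi_vertex (bi_der a (?p * Y)) n - 2 * bi_vertex (?p * Y) (n - int a)"
    unfolding var.IH bi_der_mult additive_map.add[OF additive_bi_vertex] bi_vertex_BP_mult d i
    by (simp only: algebra_simps)
  finally show ?case .
qed

lemma bi_shift_positive: "0 < n \<Longrightarrow> fls_nth (bi_shift Y) n = 0"
  by (induction Y arbitrary: n rule: bi_induct)
    (simp_all add: rhom.one[OF rhom_bi_shift] bi_const_mult rhom.add[OF rhom_bi_shift] bi_shift_BP_mult)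

lemma bi_shift_0: "fls_nth (bi_shift Y) 0 = Y"
  by (induction Y rule: bi_induct)
    (simp_all add: rhom.one[OF rhom_bi_shift] bi_const_mult rhom.add[OF rhom_bi_shift] bi_shift_BP_mult
      bi_shift_positive bi_sgn_def)

text \<open>The shift is the exponential of sum z^(-i) \<open>bi_der i\<close>; this is Newton's
  identity for its coefficients.\<close>

lemma bi_shift_rec:
  "of_nat m * fls_nth (bi_shift Y) (- int m) =
   (\<Sum>i=1..m. of_nat i * fls_nth (bi_shift (bi_der i Y)) (- int (m - i)))"
proof (induction Y arbitrary: m rule: bi_induct)
  case one
  have "bi_der i 1 = 0" for i using bi_der_cst[of i 1] by simp
  then show ?case using additive_map.zero[OF rhom_additive[OF rhom_bi_shift]] by (cases m) (simp_all add: rhom.one[OF rhom_bi_shift])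
next
  case (scalar c Y)
  then show ?case
    using arg_cong[OF scalar(1)[of m], of "\<lambda>x. c * x"] by (simp add: bi_const_mult bi_der_mult sum_distrib_left mult.left_commute[of _ c])
next
  case (plus X Y)
  then show ?case by (simp add: bi_der_add rhom.add[OF rhom_bi_shift] distrib_left sum.distrib)
next
  case (var s j Y)
  let ?p = "pvar (BP s j) :: bivar rpoly" and ?N = "\<lambda>Y n. fls_nth (bi_shift Y) n"
  have d: "?N (bi_der i ?p * Y) n = (if i = j then - (if s then 1 else -1) * ?N Y n else 0)" for i n
    using additive_map.uminus[OF rhom_additive[OF rhom_bi_shift], of Y] additive_map.zero[OF rhom_additive[OF rhom_bi_shift]] by (auto simp: bi_der_BP)
  have "(\<Sum>i=1..m. of_nat i * ?N (bi_der i (?p * Y)) (- int (m - i))) =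
    (\<Sum>i=1..m. of_nat i * (if i = j then - (if s then 1 else -1) * ?N Y (- int (m - i)) else 0))
    + ?p * (\<Sum>i=1..m. of_nat i * ?N (bi_der i Y) (- int (m - i)))
    - bi_sgn s j * (\<Sum>i=1..m. of_nat i * ?N (bi_der i Y) (- int (m - i) + int j))"
    unfolding bi_der_mult rhom.add[OF rhom_bi_shift] fls_plus_nth d bi_shift_BP_mult sum_distrib_left
      sum.distrib[symmetric] sum_subtractf[symmetric]
    by (intro sum.cong refl) (simp add: algebra_simps del: of_nat_diff)
  also have "(\<Sum>i=1..m. of_nat i * (if i = j then - (if s then 1 else -1) * ?N Y (- int (m - i)) else 0)) =
    - (bi_sgn s j * (of_nat j * ?N Y (- int m + int j)))"
  proof (cases "j \<in> {1..m}")
    case True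
    have "(\<Sum>i=1..m. of_nat i * (if i = j then - (if s then 1 else -1) * ?N Y (- int (m - i)) else 0)) =
      (\<Sum>i=1..m. if i = j then of_nat j * (- (if s then 1 else -1) * ?N Y (- int (m - j))) else 0)"
      by (intro sum.cong) auto
    also have "\<dots> = of_nat j * (- (if s then 1 else -1) * ?N Y (- int (m - j)))"
      using True by simp
    also have "- int (m - j) = - int m + int j" using True by (simp add: of_nat_diff)
    finally show ?thesis using True by (auto simp: bi_sgn_def)
  next
    case False
    then have "(\<Sum>i=1..m. of_nat i * (if i = j then - (if s then 1 else -1) * ?N Y (- int (m - i)) else 0)) = 0"
      by (intro sum.neutral) auto
    moreover have "bi_sgn s j * (of_nat j * ?N Y (- int m + int j)) = 0"
      using False bi_shift_positive[of "- int m + int j" Y] by (cases "j = 0") (auto simp: bi_sgn_def)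
    ultimately show ?thesis by simp
  qed
  also have "bi_sgn s j * (\<Sum>i=1..m. of_nat i * ?N (bi_der i Y) (- int (m - i) + int j)) =
    bi_sgn s j * ((of_nat m - of_nat j) * ?N Y (- int m + int j))"
  proof (cases "j \<le> m")
    case True
    have "(\<Sum>i=1..m. of_nat i * ?N (bi_der i Y) (- int (m - i) + int j)) =
      (\<Sum>i=1..m - j. of_nat i * ?N (bi_der i Y) (- int (m - j - i)))"
      using True by (intro sum.mono_neutral_cong_right) (auto simp: of_nat_diff bi_shift_positive algebra_simps)
    also have "\<dots> = of_nat (m - j) * ?N Y (- int (m - j))" by (rule var.IH[symmetric])
    finally have e: "(\<Sum>i=1..m. of_nat i * ?N (bi_der i Y) (- int (m - i) + int j)) =
      of_nat (m - j) * ?N Y (- int (m - j))" .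
    have "- int (m - j) = - int m + int j" "of_nat (m - j) = (of_nat m - of_nat j :: bivar rpoly)"
      using True by (simp_all add: of_nat_diff)
    then show ?thesis unfolding e by (simp only:)
  next
    case False
    then have "(\<Sum>i=1..m. of_nat i * ?N (bi_der i Y) (- int (m - i) + int j)) = 0"
      by (intro sum.neutral) (auto simp: bi_shift_positive)
    then show ?thesis using False bi_shift_positive[of "- int m + int j" Y] by simp
  qed
  finally show ?case
    unfolding var.IH[symmetric] bi_shift_BP_mult by (simp add: algebra_simps)
qed

lemma bi_der_commute: "bi_der i (bi_der j Y) = bi_der j (bi_der i Y)"
proof -
  have D: "der (\<lambda>x. x) (\<lambda>Y. bi_der i (bi_der j Y) - bi_der j (bi_der i Y))"
    by unfold_locales (simp_all add: bi_der_add bi_der_mult algebra_simps)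
  have c: "bi_der a (bi_der b (pvar x)) = 0" for a b x
    by (cases x) (use bi_der_cst[of a 1] bi_der_cst[of a "-1"] in
      \<open>auto simp: bi_der_def[of b] derivation_pvar cst_uminus bi_der_0\<close>)
  have "bi_der i (bi_der j Y) - bi_der j (bi_der i Y) = derivation (\<lambda>x. 0) Y"
    by (rule derivation_unique[OF D]) (simp_all add: c bi_der_0)
  also have "\<dots> = 0" by (simp add: derivation_def)
  finally show ?thesis by simp
qed

definition hirota_op :: "nat rpoly \<Rightarrow> bivar rpoly \<Rightarrow> bivar rpoly" where
  "hirota_op A Y = (\<Sum>m\<in>Poly_Mapping.keys A. cst (Poly_Mapping.lookup A m) * foldr bi_der (indices m) Y)"

lemma foldr_bi_der_cong:
  assumes "mset xs = mset ys" shows "foldr bi_der xs Y = foldr bi_der ys Y"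
proof -
  have "fold bi_der (rev xs) = fold bi_der (rev ys)"
    using assms by (intro fold_multiset_equiv) (auto simp: fun_eq_iff bi_der_commute)
  then show ?thesis by (simp add: foldr_conv_fold)
qed

lemma count_indices: "count (mset (indices m)) i = Poly_Mapping.lookup m i"
proof -
  have "count (mset (concat (map (\<lambda>i. replicate (Poly_Mapping.lookup m i) i) xs))) i =
    (if i \<in> set xs then Poly_Mapping.lookup m i else 0)" if "distinct xs" for xs
    using that by (induction xs) auto
  then show ?thesis by (auto simp: indices_def in_keys_iff)
qed

lemma mset_indices_add: "mset (indices (a + b)) = mset (indices a) + mset (indices b)"
  by (rule multiset_eqI) (simp add: count_indices lookup_add)

lemma mset_indices_single: "mset (indices (Poly_Mapping.single i 1)) = {#i#}"
  by (rule multiset_eqI) (simp add: count_indices lookup_single when_def)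

lemma hirota_op_single: "hirota_op (Poly_Mapping.single m c) Y = cst c * foldr bi_der (indices m) Y"
  by (simp add: hirota_op_def)

lemma hirota_op_add: "hirota_op (A + B) Y = hirota_op A Y + hirota_op B Y"
  unfolding hirota_op_def by (rule setsum_keys_plus_distrib) (simp_all add: cst_add distrib_right)

lemma additive_hirota_op: "additive_map (\<lambda>A. hirota_op A Y)"
  by unfold_locales (rule hirota_op_add)

lemma hirota_op_1: "hirota_op 1 Y = Y"
proof -
  have "mset (indices 0) = mset []" by (rule multiset_eqI) (simp add: count_indices)
  then have "indices 0 = []" by simp
  then show ?thesis using hirota_op_single[of 0 1 Y] by simp
qed

lemma hirota_op_D_mult: "hirota_op (D i * A) Y = hirota_op A (bi_der i Y)"
proof (induction A rule: poly_mapping_additive_induct)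
  case null
  show ?case using additive_map.zero[OF additive_hirota_op] by simp
next
  case (mono m c)
  have "foldr bi_der (indices (Poly_Mapping.single i 1 + m)) Y = foldr bi_der (indices m @ [i]) Y"
    by (rule foldr_bi_der_cong) (simp add: mset_indices_add mset_indices_single[simplified])
  then show ?case unfolding D_def pvar_times_single hirota_op_single by simp
next
  case (plus A B)
  then show ?case by (simp add: distrib_left hirota_op_add)
qed

lemma hirota_op_of_nat_mult: "hirota_op (of_nat n * A) Y = of_nat n * hirota_op A Y"
  by (rule additive_map.of_nat_mult[OF additive_hirota_op])

text \<open>Both sides satisfy Newton's identity with the same initial value, which brings the h_m
  of (star) out of the shift by [1/z].\<close>

lemma hirota_op_h: "hirota_op (h_poly D_check m) Y = fls_nth (bi_shift Y) (- int m)"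
proof (induction m arbitrary: Y rule: less_induct)
  case (less m)
  show ?case
  proof (cases "m = 0")
    case True
    then show ?thesis by (simp add: h_poly_0 hirota_op_1 bi_shift_0)
  next
    case False
    have "of_nat m * hirota_op (h_poly D_check m) Y = hirota_op (\<Sum>i=1..m. D_check i * h_poly D_check (m - i)) Y"
      unfolding hirota_op_of_nat_mult[symmetric] h_poly_rec ..
    also have "\<dots> = (\<Sum>i=1..m. of_nat i * hirota_op (h_poly D_check (m - i)) (bi_der i Y))"
      unfolding additive_map.sum[OF additive_hirota_op] D_check_def mult.assoc hirota_op_of_nat_mult hirota_op_D_mult ..
    also have "\<dots> = (\<Sum>i=1..m. of_nat i * fls_nth (bi_shift (bi_der i Y)) (- int (m - i)))"
      using less by (intro sum.cong refl arg_cong2[where f="(*)"]) auto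
    also have "\<dots> = of_nat m * fls_nth (bi_shift Y) (- int m)" by (rule bi_shift_rec[symmetric])
    finally show ?thesis by (rule of_nat_mult_cancel[OF False])
  qed
qed

definition bi_diag :: "bivar rpoly \<Rightarrow> var rpoly" where
  "bi_diag = subst_poly cst (\<lambda>x. case x of BU \<Rightarrow> pvar VarU | BV \<Rightarrow> pvar VarV | BP s j \<Rightarrow> pvar (VarP j))"

lemma rhom_bi_diag: "rhom bi_diag"
  unfolding bi_diag_def by (rule rhom_subst_poly[OF rhom_cst])

lemma bi_diag_pvar: "bi_diag (pvar x) = (case x of BU \<Rightarrow> pvar VarU | BV \<Rightarrow> pvar VarV | BP s j \<Rightarrow> pvar (VarP j))"
  unfolding bi_diag_def by (rule subst_poly_pvar[OF rhom_cst])

lemma bi_diag_cst: "bi_diag (cst c) = cst c"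
  unfolding bi_diag_def by (rule subst_poly_cst[OF rhom_cst])

text \<open>On the diagonal the exponent sum (p_i - p'_i) z^i / i vanishes, and only the shift
  remains.\<close>

lemma bi_diag_vertex: "bi_diag (bi_vertex Y n) = bi_diag (fls_nth (bi_shift Y) n)"
proof -
  interpret rhom bi_diag by (rule rhom_bi_diag)
  have h: "bi_diag (hint bi_series i) = (if i = 0 then 1 else 0)" if "0 \<le> i" for i
  proof -
    obtain m where m: "i = int m" using \<open>0 \<le> i\<close> by (metis nonneg_int_cases)
    have "of_nat m * bi_diag (h_poly bi_series m) = bi_diag (\<Sum>i=1..m. bi_series i * h_poly bi_series (m - i))"
      unfolding h_poly_rec[symmetric] by (simp add: mult of_nat)
    also have "\<dots> = of_nat m * 0" by (simp add: sum mult bi_series_def diff bi_diag_pvar)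
    finally show ?thesis using of_nat_mult_cancel[of m "bi_diag (h_poly bi_series m)" 0]
      by (cases "m = 0") (auto simp: m hint_def h_poly_0 one)
  qed
  define b where "b = max 0 (n - fls_subdegree (bi_shift Y))"
  have "bi_vertex Y n = (\<Sum>i=0..b. hint bi_series i * fls_nth (bi_shift Y) (n - i))"
    unfolding bi_vertex_def hseries_hint[symmetric]
    by (rule fls_mult_nth_bounds) (auto simp: b_def intro!: fls_eq0_below_subdegree)
  then have "bi_diag (bi_vertex Y n) = (\<Sum>i=0..b. (if i = 0 then 1 else 0) * bi_diag (fls_nth (bi_shift Y) (n - i)))"
    unfolding sum mult by (auto simp: sum mult h intro!: sum.cong)
  also have "\<dots> = (\<Sum>i=0..b. if i = 0 then bi_diag (fls_nth (bi_shift Y) n) else 0)"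
    by (intro sum.cong) auto
  also have "\<dots> = bi_diag (fls_nth (bi_shift Y) n)" by (simp add: b_def)
  finally show ?thesis .
qed

text \<open>The right-hand side vanishes, being an odd derivative on the diagonal of a polynomial symmetric in \<open>p\<close>
  and \<open>p'\<close>.\<close>

theorem kp_star_bi_maps:
  assumes l: "2 \<le> l" and k: "1 \<le> k"
  shows "2 * bi_diag (hirota_op (kp_star k l) (bi_maps n)) =
    of_nat (k * (l - 1)) * bi_diag (bi_der 1 (bi_der k (bi_der (l - 1) (bi_maps n))))"
proof -
  interpret rhom bi_diag by (rule rhom_bi_diag)
  define b where "b = l - 1"
  define Y where "Y = bi_maps n"
  have b: "1 \<le> b" "l = b + 1" using l by (auto simp: b_def)
  let ?h = "\<lambda>m X. bi_diag (hirota_op (h_poly D_check m) X)"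
  have hv: "bi_diag (bi_vertex X (-1 - int m)) = ?h (m + 1) X" for m X
    unfolding bi_diag_vertex hirota_op_h by (simp add: algebra_simps)
  have hv0: "bi_diag (bi_vertex X (-1)) = bi_diag (bi_der 1 X)" for X
  proof -
    have "h_poly D_check 1 = D 1"
      using h_poly_rec[of 1 D_check] by (simp add: h_poly_0 D_check_def)
    then have "hirota_op (h_poly D_check 1) X = bi_der 1 X"
      using hirota_op_D_mult[of 1 1 X] by (simp add: hirota_op_1)
    then show ?thesis using hv[of X 0] by simp
  qed
  \<comment> \<open>One derivative of the identity: \<open>bi_der_vertex\<close> at index -1, where
    the residue of \<open>Y\<close> itself vanishes.\<close>
  have first: "of_nat a * bi_diag (bi_der 1 (bi_der a Y)) = 2 * ?h (a + 1) Y" if "1 \<le> a" for a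
  proof -
    have "of_nat a * bi_vertex (bi_der a Y) (-1) = 2 * bi_vertex Y (-1 - int a)"
      using bi_der_vertex[of a Y "-1"] that by (simp add: Y_def bi_vertex_bi_maps bi_der_0)
    then have "bi_diag (of_nat a * bi_vertex (bi_der a Y) (-1)) = bi_diag (of_nat 2 * bi_vertex Y (-1 - int a))" by simp
    then show ?thesis unfolding of_nat_mult hv hv0 by simp
  qed
  \<comment> \<open>Two derivatives of the identity, by b and then by k. The left-hand side is of
    third order and will vanish for reasons of parity.\<close>
  have second: "of_nat (k * b) * bi_diag (bi_der 1 (bi_der k (bi_der b Y))) =
     2 * (of_nat k * ?h (b + 1) (bi_der k Y)) + 2 * (of_nat b * ?h (k + 1) (bi_der b Y)) - 4 * ?h (k + b + 1) Y"
  proof -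
    have e1: "of_nat b * bi_vertex (bi_der b Y) (-1) = 2 * bi_vertex Y (-1 - int b)"
      using bi_der_vertex[of b Y "-1"] b by (simp add: Y_def bi_vertex_bi_maps bi_der_0)
    have "of_nat b * (of_nat k * bi_der k (bi_vertex (bi_der b Y) (-1))) = of_nat k * bi_der k (of_nat b * bi_vertex (bi_der b Y) (-1))"
      by (simp only: bi_der_of_nat_mult mult.left_commute)
    also have "\<dots> = 2 * (of_nat k * bi_der k (bi_vertex Y (-1 - int b)))"
      unfolding e1 using bi_der_of_nat_mult[of k 2] by (simp add: mult.left_commute)
    finally have "of_nat b * (of_nat k * bi_vertex (bi_der k (bi_der b Y)) (-1) - 2 * bi_vertex (bi_der b Y) (-1 - int k)) =
      2 * (of_nat k * bi_vertex (bi_der k Y) (-1 - int b) - 2 * bi_vertex Y (-1 - int (k + b)))"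
      using bi_der_vertex[of k "bi_der b Y" "-1"] bi_der_vertex[of k Y "-1 - int b"] k
      by (simp add: algebra_simps)
    then have "bi_diag (of_nat b * (of_nat k * bi_vertex (bi_der k (bi_der b Y)) (-1) - of_nat 2 * bi_vertex (bi_der b Y) (-1 - int k))) =
      bi_diag (of_nat 2 * (of_nat k * bi_vertex (bi_der k Y) (-1 - int b) - of_nat 2 * bi_vertex Y (-1 - int (k + b))))" by simp
    then show ?thesis unfolding of_nat_mult diff hv hv0 by (simp add: algebra_simps)
  qed
  have "hirota_op (kp_star k l) Y = of_nat k * hirota_op (h_poly D_check (b + 1)) (bi_der k Y)
     + of_nat b * hirota_op (h_poly D_check (k + 1)) (bi_der b Y) - of_nat (k + b) * bi_der 1 (bi_der (k + b) Y)"
  proof -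
    have "kp_star k l = of_nat k * (D k * h_poly D_check (b + 1)) + of_nat b * (D b * h_poly D_check (k + 1))
      - of_nat (k + b) * (D (k + b) * (D 1 * 1))"
      unfolding kp_star_def b(2) by (simp add: mult_ac del: of_nat_add)
    then show ?thesis
      by (simp only: hirota_op_add hirota_op_of_nat_mult hirota_op_D_mult hirota_op_1
          additive_map.diff[OF additive_hirota_op])
  qed
  then have "2 * bi_diag (hirota_op (kp_star k l) Y) = 2 * (of_nat k * ?h (b + 1) (bi_der k Y))
     + 2 * (of_nat b * ?h (k + 1) (bi_der b Y)) - 2 * (of_nat (k + b) * bi_diag (bi_der 1 (bi_der (k + b) Y)))"
    by (simp only: add diff of_nat_mult distrib_left right_diff_distrib)
  \<comment> \<open>The instance a = k + b of \<open>first\<close> trades h_(k+b+1) for D_1 D_(k+b),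
    the last summand of (star).\<close>
  also have "\<dots> = of_nat (k * b) * bi_diag (bi_der 1 (bi_der k (bi_der b Y)))"
    unfolding second using first[of "k + b"] k by simp
  finally show ?thesis by (simp only: Y_def b_def)
qed

section \<open>The generating series of bipartite maps\<close>

lemma finite_partitions_of: "finite (partitions_of n)"
proof -
  have "partitions_of n \<subseteq> mset ` {xs. set xs \<subseteq> {1..n} \<and> length xs \<le> n}"
  proof
    fix \<mu> assume "\<mu> \<in> partitions_of n"
    then have \<mu>: "0 \<notin># \<mu>" "sum_mset \<mu> = n" by (auto simp: partitions_of_def)
    obtain xs where xs: "\<mu> = mset xs" using ex_mset by metis
    have "length ys \<le> sum_list ys \<and> set ys \<subseteq> {1..sum_list ys}" if "0 \<notin> set ys" for ys :: "nat list"
      using that by (induction ys) (force simp: Suc_le_eq)+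
    from this[of xs] \<mu> have "set xs \<subseteq> {1..n}" "length xs \<le> n" by (auto simp: xs sum_mset_sum_list)
    then show "\<mu> \<in> mset ` {xs. set xs \<subseteq> {1..n} \<and> length xs \<le> n}" using xs by auto
  qed
  then show ?thesis using finite_lists_length_le[of "{1..n}" n] by (auto intro: finite_subset)
qed

lemma cycle_type_partition:
  assumes \<pi>: "\<pi> \<in> perms n"
  shows "image_mset card (mset_set (perm_cycles \<pi> n)) \<in> partitions_of n"
proof -
  have fin: "finite (perm_cycles \<pi> n)" by (simp add: perm_cycles_def)
  have "sum card (perm_cycles \<pi> n) = n"
    using sum_over_orbits[of \<pi> "{1..n}" "\<lambda>_. 1 :: nat"] \<pi> by (simp add: perm_cycles_def)
  moreover have "0 \<notin> card ` perm_cycles \<pi> n"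
  proof
    assume "0 \<in> card ` perm_cycles \<pi> n"
    then obtain x where "card (orbit \<pi> x) = 0" by (auto simp: perm_cycles_def)
    then show False using orbit_cases(1)[OF perm_permutation[OF \<pi>], of x] by simp
  qed
  ultimately show ?thesis using fin by (simp add: partitions_of_def sum_unfold_sum_mset)
qed

lemma inj_VarP: "inj VarP"
  by (simp add: inj_def)

lemma pconst_VarUV: "pconst VarP (pvar VarU)" "pconst VarP (pvar VarV)"
  by (auto intro!: pconst_pvar)

text \<open>The pairs of permutations are grouped by their numbers of cycles and the cycle type of
  the product, which turns the counting definition into a sum over pairs.\<close>

lemma map_tau_nth: "fps_nth map_tau n = maps_coeff VarP (pvar VarU) (pvar VarV) n"
proof -
  define ty where "ty \<phi> = image_mset card (mset_set (perm_cycles \<phi> n))" for \<phi>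
  let ?S = "perms n \<times> perms n"
  let ?w = "\<lambda>Vb Vw \<mu>. pvar VarU ^ Vb * pvar VarV ^ Vw * prod_mset (image_mset (\<lambda>i. pvar (VarP i)) \<mu>) :: var rpoly"
  let ?g = "\<lambda>(\<sigma>, \<rho>). (ncyc \<sigma> n, ncyc \<rho> n, ty (\<sigma> \<circ> \<rho>))"
  let ?h = "\<lambda>(\<sigma>, \<rho>). ?w (ncyc \<sigma> n) (ncyc \<rho> n) (ty (\<sigma> \<circ> \<rho>))"
  let ?T = "{..n} \<times> {..n} \<times> partitions_of n"
  have fin: "finite ?S" by (simp add: finite_permutations)
  have nc: "ncyc \<sigma> n \<le> n" for \<sigma>
    using card_image_le[of "{1..n}" "orbit \<sigma>"] by (simp add: perm_cycles_def)
  have key: "of_nat (num_maps Vb Vw \<mu> n) * ?w Vb Vw \<mu> = sum ?h {x \<in> ?S. ?g x = (Vb, Vw, \<mu>)}" for Vb Vw \<mu>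
  proof -
    have "num_maps Vb Vw \<mu> n = card {x \<in> ?S. ?g x = (Vb, Vw, \<mu>)}"
      unfolding num_maps_def by (rule arg_cong[where f=card]) (auto simp: ty_def)
    moreover have "sum ?h {x \<in> ?S. ?g x = (Vb, Vw, \<mu>)} = (\<Sum>x\<in>{x \<in> ?S. ?g x = (Vb, Vw, \<mu>)}. ?w Vb Vw \<mu>)"
      by (intro sum.cong) auto
    ultimately show ?thesis by simp
  qed
  have "(\<Sum>Vb\<le>n. \<Sum>Vw\<le>n. \<Sum>\<mu>\<in>partitions_of n. of_nat (num_maps Vb Vw \<mu> n) * ?w Vb Vw \<mu>) =
    (\<Sum>(Vb, Vw, \<mu>)\<in>?T. of_nat (num_maps Vb Vw \<mu> n) * ?w Vb Vw \<mu>)"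
    by (simp only: sum.cartesian_product)
  also have "\<dots> = (\<Sum>y\<in>?T. sum ?h {x \<in> ?S. ?g x = y})"
  proof (rule sum.cong[OF refl])
    fix y
    show "(case y of (Vb, Vw, \<mu>) \<Rightarrow> of_nat (num_maps Vb Vw \<mu> n) * ?w Vb Vw \<mu>) = sum ?h {x \<in> ?S. ?g x = y}"
      by (cases y) (simp only: prod.case key)
  qed
  also have "\<dots> = sum ?h ?S"
    using fin finite_partitions_of nc
    by (intro sum.group) (auto simp: ty_def intro!: cycle_type_partition permutes_compose)
  also have "\<dots> = maps_sum VarP (pvar VarU) (pvar VarV) n"
    unfolding maps_sum_def[OF inj_VarP pconst_VarUV] sum.cartesian_product[symmetric]
    by (simp add: cycle_weight_def ty_def image_mset.compositionality comp_def prod_unfold_prod_mset)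
  finally show ?thesis by (simp add: map_tau_def maps_coeff_def mult.assoc)
qed

lemma map_tau_0: "fps_nth map_tau 0 = 1"
  by (simp add: map_tau_nth maps_coeff_0[OF inj_VarP pconst_VarUV])

lemma partial_p_pd: "partial_p k = pd VarP k"
proof -
  have "(\<lambda>x. if x = VarP k then 1 else 0) = (\<lambda>x. if x \<in> range VarP then (if inv VarP x = k then 1 else 0) else (0 :: var rpoly))"
    by (rule ext) (auto simp: inv_f_f[OF inj_VarP])
  then show ?thesis by (simp add: partial_p_def der_on_def)
qed

lemma der_map_tau:
  assumes "der (\<lambda>x. x) d" "\<And>c. d (cst c) = 0"
  shows "fps_lift d map_tau = map_tau * fps_lift d map_F"
  unfolding map_F_def by (rule der_ln[OF assms map_tau_0])

subsection \<open>Hirota derivatives and logarithmic derivatives\<close>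

lemma partition_on_insert_block:
  assumes P: "partition_on {..<n} P" and B: "B \<in> insert {} P"
  shows "partition_on {..<Suc n} (insert (insert n B) (P - {B}))"
proof (rule partition_onI)
  have U: "\<Union>P = {..<n}" using partition_onD1[OF P] by simp
  have "\<Union>(P - {B}) \<union> B = \<Union>P" using B by auto
  then show "\<Union>(insert (insert n B) (P - {B})) = {..<Suc n}" using U by (auto simp: lessThan_Suc)
  have dj: "disjoint P" by (rule partition_onD2[OF P])
  have n: "n \<notin> C" if "C \<in> P" for C using that U by blast
  have dj: "disjnt C C'" if "C \<in> P" "C' \<in> P" "C \<noteq> C'" for C C'
    using dj that by (simp add: disjoint_def disjnt_def)
  have BP: "disjnt (insert n B) C" if "C \<in> P - {B}" for C
  proof (cases "B = {}")
    case True
    then show ?thesis using n[of C] that by (simp add: disjnt_def)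
  next
    case False
    then show ?thesis using n[of C] that B dj[of B C] by (auto simp: disjnt_def)
  qed
  show "disjnt p q" if pq: "p \<in> insert (insert n B) (P - {B})" "q \<in> insert (insert n B) (P - {B})" "p \<noteq> q" for p q
  proof (cases "p = insert n B")
    case True
    then show ?thesis using pq BP[of q] by simp
  next
    case False
    then show ?thesis
      using pq BP[of p] dj[of p q] by (cases "q = insert n B") (simp_all add: disjnt_sym)
  qed
  show "{} \<notin> insert (insert n B) (P - {B})" using partition_onD3[OF P] by auto
qed

text \<open>A set partition of n + 1 points arises in exactly one way from one of n points, by
  adding the last point to a block or as a block of its own.\<close>

lemma sum_partition_on_Suc:
  fixes f :: "nat set set \<Rightarrow> 'r::comm_monoid_add"
  shows "(\<Sum>Q | partition_on {..<Suc n} Q. f Q) =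
    (\<Sum>P | partition_on {..<n} P. f (insert {n} P) + (\<Sum>B\<in>P. f (insert (insert n B) (P - {B}))))"
proof -
  \<comment> \<open>The choice \<open>B = {}\<close> encodes a new block; the empty set is not
    itself a block, so the encoding is unambiguous.\<close>
  let ?I = "SIGMA P : {P. partition_on {..<n} P}. insert {} P"
  let ?g = "\<lambda>(P, B). insert (insert n B) (P - {B})"
  define blk where "blk Q = (THE C. C \<in> Q \<and> n \<in> C)" for Q
  have fin: "finite {P. partition_on {..<n} P}" by (rule finitely_many_partition_on) simp
  have finP: "finite P" if "partition_on {..<n} P" for P using finite_elements[OF _ that] by simp
  have blk: "blk Q \<in> Q" "n \<in> blk Q" "\<And>C. C \<in> Q \<Longrightarrow> n \<in> C \<Longrightarrow> C = blk Q" if Q: "partition_on {..<Suc n} Q" for Q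
  proof -
    have "n \<in> \<Union>Q" using partition_onD1[OF Q] by blast
    then have "\<exists>!C. C \<in> Q \<and> n \<in> C"
      using partition_onD2[OF Q] unfolding disjoint_def by blast
    then show "blk Q \<in> Q" "n \<in> blk Q" "\<And>C. C \<in> Q \<Longrightarrow> n \<in> C \<Longrightarrow> C = blk Q"
      unfolding blk_def using theI'[of "\<lambda>C. C \<in> Q \<and> n \<in> C"] by (auto intro: the1_equality[symmetric])
  qed
  have nP: "n \<notin> C" if "partition_on {..<n} P" "C \<in> P" for P C
    using that partition_onD1[of "{..<n}" P] by auto
  have "(\<Sum>Q | partition_on {..<Suc n} Q. f Q) = (\<Sum>x\<in>?I. f (?g x))"
  proof (rule sum.reindex_bij_witness[of _ ?g "\<lambda>Q. (insert (blk Q - {n}) (Q - {blk Q}) - {{}}, blk Q - {n})"], goal_cases)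
    case (1 Q)
    then have Q: "partition_on {..<Suc n} Q" by simp
    have "insert n (blk Q - {n}) = blk Q" using blk(2)[OF Q] by auto
    moreover have "blk Q - {n} \<notin> Q - {blk Q}"
    proof
      assume a: "blk Q - {n} \<in> Q - {blk Q}"
      then have "disjnt (blk Q - {n}) (blk Q)" using partition_onD2[OF Q] blk(1)[OF Q] by (auto simp: disjoint_def disjnt_def)
      then have "blk Q - {n} = {}" by (auto simp: disjnt_def)
      then show False using a partition_onD3[OF Q] by (metis DiffD1)
    qed
    ultimately show ?case using blk(1)[OF Q] partition_onD3[OF Q] by auto
  next
    case (2 Q)
    then have Q: "partition_on {..<Suc n} Q" by simp
    have dj: "disjoint Q" by (rule partition_onD2[OF Q])
    have U: "\<Union>Q = {..<Suc n}" using partition_onD1[OF Q] by simp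
    have nn: "n \<notin> C" if "C \<in> Q - {blk Q}" for C using that blk(3)[OF Q] by auto
    have "partition_on {..<n} (insert (blk Q - {n}) (Q - {blk Q}) - {{}})"
    proof (rule partition_onI)
      have "\<Union>(insert (blk Q - {n}) (Q - {blk Q}) - {{}}) = (blk Q - {n}) \<union> \<Union>(Q - {blk Q})" by auto
      also have "\<dots> = (blk Q \<union> \<Union>(Q - {blk Q})) - {n}" using nn by blast
      also have "blk Q \<union> \<Union>(Q - {blk Q}) = \<Union>Q" using blk(1)[OF Q] by blast
      also have "\<Union>Q - {n} = {..<n}" unfolding U by auto
      finally show "\<Union>(insert (blk Q - {n}) (Q - {blk Q}) - {{}}) = {..<n}" .
      show "disjnt p q" if "p \<in> insert (blk Q - {n}) (Q - {blk Q}) - {{}}" "q \<in> insert (blk Q - {n}) (Q - {blk Q}) - {{}}" "p \<noteq> q" for p q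
      proof -
        have "disjnt (blk Q - {n}) C" "disjnt C (blk Q - {n})" if "C \<in> Q - {blk Q}" for C
          using dj blk(1)[OF Q] that by (auto simp: disjnt_def disjoint_def)
        moreover have "disjnt p q" if "p \<in> Q" "q \<in> Q" "p \<noteq> q"
          using dj that by (simp add: disjnt_def disjoint_def)
        ultimately show ?thesis using that by (metis DiffD1 insertE)
      qed
    qed auto
    then show ?case by auto
  next
    case (3 x)
    then obtain P B where x: "x = (P, B)" and P: "partition_on {..<n} P" and B: "B \<in> insert {} P" by auto
    let ?Q = "insert (insert n B) (P - {B})"
    have Q: "partition_on {..<Suc n} ?Q" by (rule partition_on_insert_block[OF P B])
    have "blk ?Q = insert n B" using blk(3)[OF Q, of "insert n B"] by simp
    moreover have nB: "n \<notin> B" using B nP[OF P] by auto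
    moreover have "insert n B \<notin> P - {B}" using nP[OF P] by blast
    ultimately have "insert (blk ?Q - {n}) (?Q - {blk ?Q}) - {{}} = P"
      using B partition_onD3[OF P] by auto
    then show ?case using \<open>blk ?Q = insert n B\<close> nB x by auto
  next
    case (4 x)
    then show ?case using partition_on_insert_block by auto
  next
    case (5 Q)
    then have Q: "partition_on {..<Suc n} Q" by simp
    have "insert n (blk Q - {n}) = blk Q" using blk(2)[OF Q] by auto
    moreover have "blk Q - {n} \<notin> Q - {blk Q}"
    proof
      assume a: "blk Q - {n} \<in> Q - {blk Q}"
      then have "disjnt (blk Q - {n}) (blk Q)" using partition_onD2[OF Q] blk(1)[OF Q] by (auto simp: disjoint_def disjnt_def)
      then have "blk Q - {n} = {}" by (auto simp: disjnt_def)
      then show False using a partition_onD3[OF Q] by (metis DiffD1)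
    qed
    ultimately have "?g (insert (blk Q - {n}) (Q - {blk Q}) - {{}}, blk Q - {n}) = Q"
      using blk(1)[OF Q] partition_onD3[OF Q] by auto
    then show ?case by simp
  qed
  also have "\<dots> = (\<Sum>P | partition_on {..<n} P. \<Sum>B\<in>insert {} P. f (insert (insert n B) (P - {B})))"
    using sum.Sigma[of "{P. partition_on {..<n} P}" "\<lambda>P. insert {} P" "\<lambda>P B. f (insert (insert n B) (P - {B}))"] fin finP
    by (simp add: case_prod_unfold)
  also have "\<dots> = (\<Sum>P | partition_on {..<n} P. f (insert {n} P) + (\<Sum>B\<in>P. f (insert (insert n B) (P - {B}))))"
    using finP partition_onD3 by (intro sum.cong refl, subst sum.insert) (auto simp: Diff_triv)
  finally show ?thesis .
qed

text \<open>Here \<open>Y\<close> behaves as the exponential of \<open>\<Phi>\<close>. A further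
  derivative either falls on \<open>Y\<close>, which opens a new block, or on one of the factors,
  which enlarges a block.\<close>

lemma log_derivatives:
  fixes d :: "nat \<Rightarrow> 'r::comm_ring_1 \<Rightarrow> 'r"
  assumes d: "\<And>i. der (\<lambda>x. x) (d i)" and Y: "\<And>i. d i Y = Y * d i \<Phi>"
  shows "foldl (\<lambda>f i. d i f) Y xs = Y * (\<Sum>P | partition_on {..<length xs} P. \<Prod>B\<in>P. foldl (\<lambda>f i. d i f) \<Phi> (nths xs B))"
proof (induction xs rule: rev_induct)
  case Nil
  have "{P. partition_on {..<0::nat} P} = {{}}" by (auto simp: partition_on_empty)
  then show ?case by simp
next
  case (snoc x xs)
  interpret der "\<lambda>x. x" "d x" by (rule d)
  let ?n = "length xs"
  let ?\<Phi> = "\<lambda>ys. foldl (\<lambda>f i. d i f) \<Phi> ys"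
  have nP: "?n \<notin> C" if "partition_on {..<?n} P" "C \<in> P" for P C
    using that partition_onD1[of "{..<?n}" P] by auto
  have old: "nths (xs @ [x]) B = nths xs B" if "?n \<notin> B" for B
    using that by (simp add: nths_append)
  have new: "?\<Phi> (nths (xs @ [x]) (insert ?n B)) = d x (?\<Phi> (nths xs B))" for B
  proof -
    have "nths xs (insert ?n B) = nths xs B"
      unfolding nths_def by (intro arg_cong[where f="map fst"] filter_cong) (auto simp: set_zip)
    then show ?thesis by (simp add: nths_append)
  qed
  have "(\<Sum>Q | partition_on {..<Suc ?n} Q. \<Prod>B\<in>Q. ?\<Phi> (nths (xs @ [x]) B)) =
    (\<Sum>P | partition_on {..<?n} P. d x \<Phi> * (\<Prod>B\<in>P. ?\<Phi> (nths xs B)) + d x (\<Prod>B\<in>P. ?\<Phi> (nths xs B)))"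
    unfolding sum_partition_on_Suc
  proof (intro sum.cong refl arg_cong2[where f="(+)"])
    fix P assume "P \<in> {P. partition_on {..<?n} P}"
    then have P: "partition_on {..<?n} P" by simp
    have fin: "finite P" using finite_elements[OF _ P] by simp
    have eq: "(\<Prod>B\<in>R. ?\<Phi> (nths (xs @ [x]) B)) = (\<Prod>B\<in>R. ?\<Phi> (nths xs B))" if "R \<subseteq> P" for R
      using that nP[OF P] old by (intro prod.cong refl) auto
    have "{?n} \<notin> P" using nP[OF P, of "{?n}"] by auto
    then show "(\<Prod>B\<in>insert {?n} P. ?\<Phi> (nths (xs @ [x]) B)) = d x \<Phi> * (\<Prod>B\<in>P. ?\<Phi> (nths xs B))"
      using fin new[of "{}"] by (simp add: eq)
    have "(\<Prod>C\<in>insert (insert ?n B) (P - {B}). ?\<Phi> (nths (xs @ [x]) C)) =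
      d x (?\<Phi> (nths xs B)) * (\<Prod>C\<in>P - {B}. ?\<Phi> (nths xs C))" if "B \<in> P" for B
    proof -
      have "insert ?n B \<notin> P" using nP[OF P, of "insert ?n B"] by auto
      then show ?thesis using fin by (simp add: new eq del: foldl_append)
    qed
    then show "(\<Sum>B\<in>P. \<Prod>C\<in>insert (insert ?n B) (P - {B}). ?\<Phi> (nths (xs @ [x]) C)) =
      d x (\<Prod>B\<in>P. ?\<Phi> (nths xs B))"
      unfolding der_prod[OF d fin] by (intro sum.cong) auto
  qed
  then have s: "(\<Sum>Q | partition_on {..<length (xs @ [x])} Q. \<Prod>B\<in>Q. ?\<Phi> (nths (xs @ [x]) B)) =
    d x \<Phi> * (\<Sum>P | partition_on {..<?n} P. \<Prod>B\<in>P. ?\<Phi> (nths xs B))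
    + d x (\<Sum>P | partition_on {..<?n} P. \<Prod>B\<in>P. ?\<Phi> (nths xs B))"
    by (simp add: sum.distrib sum_distrib_left sum)
  have "foldl (\<lambda>f i. d i f) Y (xs @ [x]) = d x (Y * (\<Sum>P | partition_on {..<?n} P. \<Prod>B\<in>P. ?\<Phi> (nths xs B)))"
    by (simp add: snoc.IH)
  then show ?case unfolding s by (simp only: leibniz Y) (simp only: distrib_left mult_ac)
qed

section \<open>The logarithm of tau and the product of its two copies\<close>

definition F_der :: "nat list \<Rightarrow> var rpoly fps" where
  "F_der xs = foldl (\<lambda>f i. fps_lift (partial_p i) f) map_F xs"

definition F_hirota :: "nat list \<Rightarrow> var rpoly fps" where
  "F_hirota xs = (\<Sum>P\<in>{P. partition_on {..<length xs} P \<and> (\<forall>B\<in>P. even (card B))}. \<Prod>B\<in>P. 2 * F_der (nths xs B))"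

definition bi_copy :: "bool \<Rightarrow> var rpoly \<Rightarrow> bivar rpoly" where
  "bi_copy s = subst_poly cst (\<lambda>x. case x of VarU \<Rightarrow> bu | VarV \<Rightarrow> bv | VarP j \<Rightarrow> pvar (BP s j))"

lemma rhom_bi_copy: "rhom (bi_copy s)"
  unfolding bi_copy_def by (rule rhom_subst_poly[OF rhom_cst])

lemma bi_copy_pvar: "bi_copy s (pvar x) = (case x of VarU \<Rightarrow> bu | VarV \<Rightarrow> bv | VarP j \<Rightarrow> pvar (BP s j))"
  unfolding bi_copy_def by (rule subst_poly_pvar[OF rhom_cst])

lemma bi_copy_cst: "bi_copy s (cst c) = cst c"
  unfolding bi_copy_def by (rule subst_poly_cst[OF rhom_cst])

lemma bi_diag_copy: "bi_diag (bi_copy s f) = f"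
proof -
  have "(\<lambda>f. bi_diag (bi_copy s f)) f = (\<lambda>f. f) f"
    by (rule rhom_ext[OF rhom_comp[OF rhom_bi_copy rhom_bi_diag] rhom_id])
      (auto simp: bi_copy_cst bi_diag_cst bi_copy_pvar bi_diag_pvar split: var.split)
  then show ?thesis by simp
qed

lemma bi_copy_maps: "bi_copy s (maps_coeff VarP (pvar VarU) (pvar VarV) n) = bmaps s n"
  unfolding rhom_maps_coeff[OF inj_VarP pconst_VarUV rhom_bi_copy] rhom_maps_coeff[OF inj_BP bivar_const(1,2) rhom_id]
  by (simp add: bi_copy_cst bi_copy_pvar)

lemma bi_der_copy: "bi_der i (bi_copy s f) = (if s then - bi_copy s (partial_p i f) else bi_copy s (partial_p i f))"
proof -
  interpret c: rhom "bi_copy s" by (rule rhom_bi_copy)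
  define e where "e = (if s then - 1 else 1 :: bivar rpoly)"
  have p: "der (\<lambda>x. x) (partial_p i)" by (simp add: partial_p_def der_derivation)
  have "(\<lambda>f. bi_der i (bi_copy s f)) f = (\<lambda>f. e * bi_copy s (partial_p i f)) f"
  proof (rule der_ext[where \<phi>="bi_copy s" and d="\<lambda>f. bi_der i (bi_copy s f)" and e="\<lambda>f. e * bi_copy s (partial_p i f)"])
    show "der (\<lambda>x. bi_copy s x) (\<lambda>x. bi_der i (bi_copy s x))"
      using der_comp_right[OF der_bi_der rhom_bi_copy] .
    show "der (\<lambda>x. bi_copy s x) (\<lambda>f. e * bi_copy s (partial_p i f))"
      by unfold_locales (simp_all add: partial_p_def derivation_add derivation_mult c.add c.mult algebra_simps)
    show "bi_der i (bi_copy s (cst c)) = e * bi_copy s (partial_p i (cst c))" for c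
      by (simp add: bi_copy_cst partial_p_def c.zero)
    show "bi_der i (bi_copy s (pvar x)) = e * bi_copy s (partial_p i (pvar x))" for x
      by (cases x) (auto simp: bi_copy_pvar bi_der_def derivation_pvar partial_p_def e_def c.one c.zero)
  qed
  then show ?thesis by (simp add: e_def)
qed

text \<open>The logarithm of tau(p) tau(p') is F(p) + F(p'), so the expansion over set partitions
  applies to the product.\<close>

theorem hirota_F:
  "bi_diag (foldr bi_der xs (bi_maps n)) = fps_nth (map_tau * map_tau * F_hirota xs) n"
proof -
  define Y where "Y = fps_lift (bi_copy True) map_tau * fps_lift (bi_copy False) map_tau"
  define \<Phi> where "\<Phi> = fps_lift (bi_copy True) map_F + fps_lift (bi_copy False) map_F"
  let ?d = "\<lambda>i. fps_lift (bi_der i)"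
  interpret g: rhom "fps_lift bi_diag" by (rule rhom_fps_lift[OF rhom_bi_diag])
  have d: "der (\<lambda>x. x) (?d i)" for i using der_fps_lift[OF rhom_id der_bi_der] by simp
  interpret d: der "\<lambda>x. x" "?d i" for i by (rule d)
  interpret c: rhom "fps_lift (bi_copy s)" for s by (rule rhom_fps_lift[OF rhom_bi_copy])
  define e where "e s = (if s then - 1 else 1 :: bivar rpoly fps)" for s
  have dc: "?d i (fps_lift (bi_copy s) f) = e s * fps_lift (bi_copy s) (fps_lift (partial_p i) f)" for i s f
    by (simp add: fps_eq_iff bi_der_copy e_def)
  have p: "der (\<lambda>x. x) (partial_p i)" "\<And>c. partial_p i (cst c) = 0" for i
    by (simp_all add: partial_p_def der_derivation)
  have dt: "fps_lift (partial_p i) map_tau = map_tau * fps_lift (partial_p i) map_F" for i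
    by (rule der_map_tau[OF p])
  have Y: "?d i Y = Y * ?d i \<Phi>" for i
    unfolding Y_def \<Phi>_def d.leibniz d.add dc dt c.mult by (simp add: algebra_simps)
  have Yn: "fps_nth Y n = bi_maps n" for n
    by (simp add: Y_def fps_mult_nth bi_maps_def map_tau_nth bi_copy_maps atLeast0AtMost)
  have fl: "fps_nth (foldl (\<lambda>f i. ?d i f) Z ys) n = foldl (\<lambda>f i. bi_der i f) (fps_nth Z n) ys" for Z ys
    by (induction ys rule: rev_induct) simp_all
  have "foldl (\<lambda>f i. bi_der i f) (bi_maps n) xs = foldr bi_der (rev xs) (bi_maps n)"
    by (simp add: foldr_conv_foldl)
  also have "\<dots> = foldr bi_der xs (bi_maps n)" by (rule foldr_bi_der_cong) simp
  finally have "bi_diag (foldr bi_der xs (bi_maps n)) = fps_nth (fps_lift bi_diag (foldl (\<lambda>f i. ?d i f) Y xs)) n"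
    by (simp add: fl Yn)
  also have "fps_lift bi_diag (foldl (\<lambda>f i. ?d i f) Y xs) = fps_lift bi_diag Y *
    (\<Sum>P | partition_on {..<length xs} P. \<Prod>B\<in>P. fps_lift bi_diag (foldl (\<lambda>f i. ?d i f) \<Phi> (nths xs B)))"
    unfolding log_derivatives[OF d Y] g.mult g.sum g.prod ..
  also have "fps_lift bi_diag Y = map_tau * map_tau"
    unfolding Y_def g.mult by (simp add: fps_eq_iff bi_diag_copy fps_mult_nth)
  also have "(\<Sum>P | partition_on {..<length xs} P. \<Prod>B\<in>P. fps_lift bi_diag (foldl (\<lambda>f i. ?d i f) \<Phi> (nths xs B))) = F_hirota xs"
  proof -
    \<comment> \<open>Each \<open>bi_der\<close> brings a sign on the first copy. On the diagonal,
      derivatives of even order are therefore doubled and those of odd order cancel, which leaves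
      the partitions into even blocks.\<close>
    have lin: "foldl (\<lambda>f i. ?d i f) \<Phi> ys = (-1) ^ length ys * fps_lift (bi_copy True) (F_der ys) + fps_lift (bi_copy False) (F_der ys)" for ys
    proof (induction ys rule: rev_induct)
      case (snoc y ys)
      have e1: "?d y ((-1) ^ k * f) = (-1) ^ k * ?d y f" for k f
        by (induction k) (simp_all add: d.uminus)
      show ?case by (simp add: snoc.IH d.add e1 dc e_def F_der_def)
    qed (simp add: F_der_def \<Phi>_def)
    have diag: "fps_lift bi_diag (foldl (\<lambda>f i. ?d i f) \<Phi> ys) = (if even (length ys) then 2 * F_der ys else 0)" for ys
    proof -
      have "fps_lift bi_diag (fps_lift (bi_copy s) f) = f" for s f by (simp add: fps_eq_iff bi_diag_copy)
      moreover have "fps_lift bi_diag ((-1) ^ k) = (-1) ^ k" for k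
        using g.power[of "-1" k] g.uminus[of 1] by (simp add: g.one)
      ultimately show ?thesis by (simp add: lin g.add g.mult)
    qed
    have len: "length (nths xs B) = card B" if "partition_on {..<length xs} P" "B \<in> P" for P B
    proof -
      have "B \<subseteq> {..<length xs}" using that partition_onD1 by blast
      then show ?thesis unfolding length_nths by (intro arg_cong[where f=card]) auto
    qed
    have "(\<Sum>P | partition_on {..<length xs} P. \<Prod>B\<in>P. fps_lift bi_diag (foldl (\<lambda>f i. ?d i f) \<Phi> (nths xs B))) =
      (\<Sum>P | partition_on {..<length xs} P. \<Prod>B\<in>P. if even (card B) then 2 * F_der (nths xs B) else 0)"
      using len by (intro sum.cong prod.cong refl) (simp add: diag)
    also have "\<dots> = F_hirota xs"
      unfolding F_hirota_def
    proof (rule sum.mono_neutral_cong_right)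
      show "finite {P. partition_on {..<length xs} P}" by (rule finitely_many_partition_on) simp
      show "\<forall>P\<in>{P. partition_on {..<length xs} P} - {P. partition_on {..<length xs} P \<and> (\<forall>B\<in>P. even (card B))}.
        (\<Prod>B\<in>P. if even (card B) then 2 * F_der (nths xs B) else 0) = 0"
      proof
        fix P assume "P \<in> {P. partition_on {..<length xs} P} - {P. partition_on {..<length xs} P \<and> (\<forall>B\<in>P. even (card B))}"
        then obtain B where "B \<in> P" "odd (card B)" "finite P" using finite_elements[of "{..<length xs}" P] by auto
        then show "(\<Prod>B\<in>P. if even (card B) then 2 * F_der (nths xs B) else 0) = 0" by (intro prod_zero) auto
      qed
    qed (auto intro!: prod.cong)
    finally show ?thesis .
  qed
  finally show ?thesis .
qed

lemma F_hirota_odd: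
  assumes "odd (length xs)" shows "F_hirota xs = 0"
proof -
  have "\<not> (partition_on {..<length xs} P \<and> (\<forall>B\<in>P. even (card B)))" for P
  proof
    assume a: "partition_on {..<length xs} P \<and> (\<forall>B\<in>P. even (card B))"
    then have P: "partition_on {..<length xs} P" by simp
    have U: "\<Union>P = {..<length xs}" using partition_onD1[OF P] by (rule sym)
    have "finite B" if "B \<in> P" for B
      using that U by (intro finite_subset[of B "{..<length xs}"]) blast+
    then have "card (\<Union>P) = sum card P"
      using partition_onD2[OF P] by (intro card_Union_disjoint) (auto simp: disjoint_def pairwise_def disjnt_def)
    moreover have "even (sum card P)" using a by (intro dvd_sum) auto
    moreover note U
    ultimately show False using assms by simp
  qed
  then have "{P. partition_on {..<length xs} P \<and> (\<forall>B\<in>P. even (card B))} = {}" by blast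
  then show ?thesis by (simp only: F_hirota_def sum.empty)
qed

lemma F_hirota_pair: "F_hirota [a, b] = 2 * F_der [a, b]"
proof -
  have "{P. partition_on {..<2::nat} P \<and> (\<forall>B\<in>P. even (card B))} = {{{..<2}}}"
  proof (intro equalityI subsetI)
    fix P :: "nat set set" assume "P \<in> {P. partition_on {..<2} P \<and> (\<forall>B\<in>P. even (card B))}"
    then have P: "partition_on {..<2} P" and e: "\<And>B. B \<in> P \<Longrightarrow> even (card B)" by auto
    have "B = {..<2}" if B: "B \<in> P" for B
    proof (rule card_subset_eq)
      show s: "B \<subseteq> {..<2}" using B partition_onD1[OF P] by auto
      have "B \<noteq> {}" "finite B" using B partition_onD3[OF P] s finite_subset by auto
      then have "0 < card B" by (simp add: card_gt_0_iff)
      moreover have "card B \<le> 2" using card_mono[OF _ s] by simp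
      ultimately show "card B = card {..<2::nat}" using e[OF B] by (cases "card B = 1") auto
    qed simp
    moreover have "0 \<in> \<Union>P" unfolding partition_onD1[OF P, symmetric] by simp
    then have "P \<noteq> {}" by auto
    ultimately show "P \<in> {{{..<2}}}" by blast
  qed (auto intro!: partition_onI dest: arg_cong[where f=card])
  moreover have "nths [a, b] {..<2} = [a, b]" by (simp add: nths_upt_eq_take[of "[a, b]" 2, simplified])
  ultimately show ?thesis by (simp add: F_hirota_def numeral_2_eq_2)
qed

text \<open>The remainder in \<open>kp_star_bi_maps\<close> has three derivatives, and three points
  have no partition into blocks of even size.\<close>

theorem kp_star_F:
  assumes "2 \<le> l" "1 \<le> k"
  shows "bi_diag (hirota_op (kp_star k l) (bi_maps n)) = 0"
proof -
  have "bi_der 1 (bi_der k (bi_der (l - 1) (bi_maps n))) = foldr bi_der [1, k, l - 1] (bi_maps n)" by simp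
  then have "2 * bi_diag (hirota_op (kp_star k l) (bi_maps n)) = 0"
    unfolding kp_star_bi_maps[OF assms] by (simp only: hirota_F F_hirota_odd) (simp add: F_hirota_odd)
  then show ?thesis using of_nat_mult_cancel[of 2 "bi_diag (hirota_op (kp_star k l) (bi_maps n))" 0] by simp
qed

section \<open>Evaluation of the KP polynomials\<close>

lemma pvars_0 [simp]: "pvars 0 = {}"
  by (simp add: pvars_def)

lemma pvars_add: "pvars (f + g) \<subseteq> pvars f \<union> pvars g"
  unfolding pvars_def using keys_add[of f g] by blast

lemma pvars_uminus [simp]: "pvars (- f) = pvars f" for f :: "('a \<Rightarrow>\<^sub>0 nat) \<Rightarrow>\<^sub>0 'c::ab_group_add"
  by (simp add: pvars_def Poly_Mapping.keys.rep_eq uminus_poly_mapping.rep_eq)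

lemma keys_add_exponent: "Poly_Mapping.keys (a + b) = Poly_Mapping.keys a \<union> Poly_Mapping.keys b" for a b :: "'a \<Rightarrow>\<^sub>0 nat"
  by (auto simp: in_keys_iff lookup_add)

lemma pvars_mult: "pvars (f * g) \<subseteq> pvars f \<union> pvars g" for f g :: "('a \<Rightarrow>\<^sub>0 nat) \<Rightarrow>\<^sub>0 'c::comm_ring_1"
proof
  fix x assume "x \<in> pvars (f * g)"
  then obtain m where m: "m \<in> Poly_Mapping.keys (f * g)" "x \<in> Poly_Mapping.keys m" by (auto simp: pvars_def)
  then obtain a b where "m = a + b" "a \<in> Poly_Mapping.keys f" "b \<in> Poly_Mapping.keys g"
    using keys_mult[of f g] by blast
  then show "x \<in> pvars f \<union> pvars g" using m(2) by (auto simp: pvars_def keys_add_exponent)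
qed

lemma pvars_cst [simp]: "pvars (cst c) = {}"
  by (simp add: pvars_def cst_def)

lemma pvars_pvar [simp]: "pvars (pvar x :: ('a \<Rightarrow>\<^sub>0 nat) \<Rightarrow>\<^sub>0 'c::comm_ring_1) = {x}"
  by (simp add: pvars_def pvar_def)

definition pvars_in :: "'a set \<Rightarrow> (('a \<Rightarrow>\<^sub>0 nat) \<Rightarrow>\<^sub>0 'c::comm_ring_1) \<Rightarrow> bool" where
  "pvars_in S f \<longleftrightarrow> pvars f \<subseteq> S"

lemma pvars_in_add: "pvars_in S f \<Longrightarrow> pvars_in S g \<Longrightarrow> pvars_in S (f + g)"
  using pvars_add[of f g] unfolding pvars_in_def by blast

lemma pvars_in_uminus: "pvars_in S f \<Longrightarrow> pvars_in S (- f)"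
  by (simp add: pvars_in_def)

lemma pvars_in_mult: "pvars_in S f \<Longrightarrow> pvars_in S g \<Longrightarrow> pvars_in S (f * g)"
  using pvars_mult[of f g] unfolding pvars_in_def by blast

lemma pvars_in_cst [simp]: "pvars_in S (cst c)"
  by (simp add: pvars_in_def)

lemma pvars_in_of_nat [simp]: "pvars_in S (of_nat n :: ('a \<Rightarrow>\<^sub>0 nat) \<Rightarrow>\<^sub>0 'c::comm_ring_1)"
  unfolding cst_of_nat[symmetric] by (rule pvars_in_cst)

lemma pvars_in_1 [simp]: "pvars_in S (1 :: ('a \<Rightarrow>\<^sub>0 nat) \<Rightarrow>\<^sub>0 'c::comm_ring_1)"
  using pvars_in_of_nat[of S 1] by simp

lemma pvars_in_0 [simp]: "pvars_in S 0"
  by (simp add: pvars_in_def)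

lemma pvars_in_sum: "(\<And>x. x \<in> A \<Longrightarrow> pvars_in S (f x)) \<Longrightarrow> pvars_in S (sum f A)"
  by (induction A rule: infinite_finite_induct) (simp_all add: pvars_in_add)

lemma pvars_in_prod: "(\<And>x. x \<in> A \<Longrightarrow> pvars_in S (f x)) \<Longrightarrow> pvars_in S (prod f A)"
  by (induction A rule: infinite_finite_induct) (simp_all add: pvars_in_mult)

lemma pvars_in_mono: "pvars_in S f \<Longrightarrow> S \<subseteq> S' \<Longrightarrow> pvars_in S' f"
  by (auto simp: pvars_in_def)

lemma pvars_in_derivation:
  assumes f: "pvars_in S f" and \<delta>: "\<And>x. x \<in> pvars f \<Longrightarrow> pvars_in S (\<delta> x)"
  shows "pvars_in S (derivation \<delta> f)"
  unfolding derivation_def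
proof (intro pvars_in_sum pvars_in_mult)
  fix m x assume m: "m \<in> Poly_Mapping.keys f" and x: "x \<in> Poly_Mapping.keys m"
  have "Poly_Mapping.keys (m - Poly_Mapping.single x 1) \<subseteq> Poly_Mapping.keys m"
    by (auto simp: in_keys_iff lookup_minus)
  then show "pvars_in S (Poly_Mapping.single (m - Poly_Mapping.single x 1) (of_nat (Poly_Mapping.lookup m x) * Poly_Mapping.lookup f m))"
    using f m by (auto simp: pvars_in_def pvars_def split: if_splits)
  show "pvars_in S (\<delta> x)" using m x by (intro \<delta>) (auto simp: pvars_def)
qed

subsection \<open>Hook expressions\<close>

abbreviation "Fdp i \<equiv> fps_lift (partial_p i)"

lemma der_Fdp: "der (\<lambda>x. x) (Fdp i)"
  using der_fps_lift[OF rhom_id, of "partial_p i"] by (simp add: partial_p_def der_derivation)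

lemma partial_p_commute: "partial_p i (partial_p j f) = partial_p j (partial_p i f)"
proof -
  have D: "der (\<lambda>x. x) (\<lambda>f. partial_p i (partial_p j f) - partial_p j (partial_p i f))"
    by unfold_locales (simp_all add: partial_p_def derivation_add derivation_mult algebra_simps)
  have "partial_p i (partial_p j f) - partial_p j (partial_p i f) = derivation (\<lambda>x. 0) f"
    by (rule derivation_unique[OF D]) (auto simp: partial_p_def derivation_pvar)
  also have "\<dots> = 0" by (simp add: derivation_def)
  finally show ?thesis by simp
qed

lemma Fdp_commute: "Fdp i (Fdp j f) = Fdp j (Fdp i f)"
  by (simp add: fps_eq_iff partial_p_commute)

lemma Fdp_funpow_commute: "Fdp i ((Fdp j ^^ a) f) = (Fdp j ^^ a) (Fdp i f)"
  by (induction a) (simp_all add: Fdp_commute[of i j])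

lemma F_der_cong: "mset xs = mset ys \<Longrightarrow> F_der xs = F_der ys"
  unfolding F_der_def foldl_conv_fold
  by (rule fun_cong[OF fold_multiset_equiv]) (auto simp: fun_eq_iff Fdp_commute)

lemma F_der_append: "F_der (xs @ [c]) = Fdp c (F_der xs)"
  by (simp add: F_der_def)

definition F_hook :: "nat \<Rightarrow> nat \<Rightarrow> var rpoly fps" where
  "F_hook i a = (Fdp 1 ^^ a) (Fdp i map_F)"

definition hook_eval :: "hook_poly \<Rightarrow> var rpoly fps" where
  "hook_eval = subst_poly (\<lambda>c. fps_const (cst c)) (\<lambda>(i, a). F_hook i a)"

lemma rhom_fps_const: "rhom (\<lambda>c. fps_const (cst c :: 'a rpoly))"
  by unfold_locales (simp_all add: cst_add cst_mult)

lemma rhom_hook_eval: "rhom hook_eval"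
  unfolding hook_eval_def by (rule rhom_subst_poly[OF rhom_fps_const])

lemma hook_eval_cst: "hook_eval (cst c) = fps_const (cst c)"
  unfolding hook_eval_def by (rule subst_poly_cst[OF rhom_fps_const])

lemma hook_eval_H: "hook_eval (H i a) = F_hook i a"
  unfolding hook_eval_def H_def by (subst subst_poly_pvar[OF rhom_fps_const]) simp

lemma hook_eval_derivation:
  assumes "\<And>i a. (i, a) \<in> pvars f \<Longrightarrow> Fdp c (F_hook i a) = hook_eval (\<delta> (i, a))"
  shows "hook_eval (derivation \<delta> f) = Fdp c (hook_eval f)"
  unfolding hook_eval_def
  by (rule subst_poly_derivation[OF rhom_fps_const der_Fdp, symmetric])
    (use assms in \<open>auto simp: hook_eval_def fps_eq_iff partial_p_def\<close>)

lemma hook_eval_hook_d1: "hook_eval ((hook_d1 ^^ a) f) = (Fdp 1 ^^ a) (hook_eval f)"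
proof (induction a)
  case (Suc a)
  have "hook_eval (hook_d1 g) = Fdp 1 (hook_eval g)" for g
    unfolding hook_d1_def by (rule hook_eval_derivation) (simp add: hook_eval_H, simp add: F_hook_def)
  then show ?case using Suc by simp
qed simp

definition hooks_upto :: "nat \<Rightarrow> (nat \<times> nat) set" where
  "hooks_upto M = {1..M} \<times> UNIV"

lemma hooks_upto_mono: "M \<le> M' \<Longrightarrow> hooks_upto M \<subseteq> hooks_upto M'"
  by (auto simp: hooks_upto_def)

lemma pvars_hook_d1: "pvars_in (hooks_upto M) f \<Longrightarrow> pvars_in (hooks_upto M) ((hook_d1 ^^ a) f)"
proof (induction a)
  case (Suc a)
  then have "pvars_in (hooks_upto M) ((hook_d1 ^^ a) f)" by simp
  then have "pvars_in (hooks_upto M) (derivation (\<lambda>(i, a). H i (Suc a)) ((hook_d1 ^^ a) f))"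
    by (rule pvars_in_derivation)
      (use \<open>pvars_in (hooks_upto M) ((hook_d1 ^^ a) f)\<close> in \<open>auto simp: pvars_in_def H_def hooks_upto_def\<close>)
  then show ?case by (simp flip: hook_d1_def)
qed simp

text \<open>For the partition (i, j) the bound on hooks reads i + j - 1. It accompanies the value
  because it decides which pairs are looked up in the next differentiation.\<close>

definition good_pair :: "(nat \<Rightarrow> nat \<Rightarrow> hook_poly) \<Rightarrow> nat \<Rightarrow> nat \<Rightarrow> bool" where
  "good_pair K i j \<longleftrightarrow> hook_eval (K i j) = F_der [i, j] \<and> pvars_in (hooks_upto (i + j - 1)) (K i j)"

text \<open>The bound grows by c - 1: a new part c raises the size of the partition by c and its
  length by 1.\<close>

lemma hook_d_eval:
  assumes f: "pvars_in (hooks_upto M) f" and c: "1 \<le> c"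
    and good: "\<And>i a. (i, a) \<in> pvars f \<Longrightarrow> good_pair K i c"
  shows "hook_eval (hook_d K c f) = Fdp c (hook_eval f)"
    and "pvars_in (hooks_upto (M + c - 1)) (hook_d K c f)"
proof -
  show "hook_eval (hook_d K c f) = Fdp c (hook_eval f)"
    unfolding hook_d_def
  proof (rule hook_eval_derivation)
    fix i a assume "(i, a) \<in> pvars f"
    then have "hook_eval (K i c) = F_der [i, c]" using good by (simp add: good_pair_def)
    then show "Fdp c (F_hook i a) = hook_eval (case (i, a) of (i, a) \<Rightarrow> (hook_d1 ^^ a) (K i c))"
      by (simp add: hook_eval_hook_d1 F_hook_def F_der_def Fdp_funpow_commute)
  qed
  show "pvars_in (hooks_upto (M + c - 1)) (hook_d K c f)"
    unfolding hook_d_def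
  proof (rule pvars_in_derivation)
    show "pvars_in (hooks_upto (M + c - 1)) f"
      using c by (intro pvars_in_mono[OF f] hooks_upto_mono) simp
    fix x assume x: "x \<in> pvars f"
    obtain i a where ia: "x = (i, a)" by (cases x)
    have "i \<le> M" using f x ia by (auto simp: pvars_in_def hooks_upto_def)
    then have "hooks_upto (i + c - 1) \<subseteq> hooks_upto (M + c - 1)" by (intro hooks_upto_mono) simp
    then have "pvars_in (hooks_upto (M + c - 1)) (K i c)"
      using good[of i a] x ia pvars_in_mono[of "hooks_upto (i + c - 1)" "K i c"] by (simp add: good_pair_def)
    then show "pvars_in (hooks_upto (M + c - 1)) (case x of (i, a) \<Rightarrow> (hook_d1 ^^ a) (K i c))"
      unfolding ia by (simp add: pvars_hook_d1)
  qed
qed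

text \<open>Only the first two parts can form a pair of total size s. In each later step the hooks
  (i, 1^a) are smaller than the size reached so far, so that i + c < s.\<close>

lemma hook_expr_eval:
  assumes k: "1 \<le> k" and cs: "0 \<notin> set cs" and s: "k + sum_list cs \<le> s"
    and good: "\<And>i j. 1 \<le> i \<Longrightarrow> 1 \<le> j \<Longrightarrow> i + j < s \<Longrightarrow> good_pair K i j"
    and first: "cs \<noteq> [] \<Longrightarrow> good_pair K k (hd cs)"
  shows "hook_eval (hook_expr K (k # cs)) = F_der (k # cs) \<and>
    pvars_in (hooks_upto (k + sum_list cs - length cs)) (hook_expr K (k # cs))"
  using cs s first
proof (induction cs rule: rev_induct)
  case Nil
  have "F_der [k] = F_hook k 0" by (simp add: F_der_def F_hook_def)
  then show ?case using k by (simp add: hook_eval_H) (simp add: H_def pvars_in_def hooks_upto_def)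
next
  case (snoc c cs)
  let ?f = "hook_expr K (k # cs)" and ?M = "k + sum_list cs - length cs"
  have c: "1 \<le> c" using snoc.prems by auto
  have len: "length cs \<le> sum_list cs" if "0 \<notin> set cs" for cs :: "nat list"
    using that by (induction cs) (auto simp: Suc_le_eq)
  have IH: "hook_eval ?f = F_der (k # cs)" "pvars_in (hooks_upto ?M) ?f"
    using snoc.IH snoc.prems by (auto simp: hd_append split: if_splits)
  have gd: "good_pair K i c" if "(i, a) \<in> pvars ?f" for i a
  proof (cases "cs = []")
    case True
    then show ?thesis using that snoc.prems by (simp add: H_def)
  next
    case False
    have "1 \<le> i" "i \<le> ?M" using that IH(2) by (auto simp: pvars_in_def hooks_upto_def)
    moreover have "1 \<le> length cs" using False by (cases cs) auto
    moreover have "k + sum_list cs + c \<le> s" using snoc.prems by simp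
    ultimately have "i + c < s" using len[of cs] snoc.prems(1) by simp
    then show ?thesis using good \<open>1 \<le> i\<close> c by blast
  qed
  have e: "hook_expr K (k # cs @ [c]) = hook_d K c ?f" by simp
  have M: "?M + c - 1 = k + sum_list (cs @ [c]) - length (cs @ [c])"
    using len[of cs] snoc.prems(1) c by simp
  show ?case
    using hook_d_eval[OF IH(2) c gd] IH(1) F_der_append[of "k # cs" c] unfolding e M by simp
qed

lemma mset_nths_subseteq: "mset (nths xs A) \<subseteq># mset xs"
  by (induction xs arbitrary: A) (auto simp: nths_Cons subseteq_mset_def le_SucI)

lemma length_nths_subset: "B \<subseteq> {..<length xs} \<Longrightarrow> length (nths xs B) = card B"
  unfolding length_nths by (intro arg_cong[where f=card]) auto

lemma hirota_monom_eval:
  assumes "\<And>B. B \<subseteq> {..<length xs} \<Longrightarrow> B \<noteq> {} \<Longrightarrow> even (card B) \<Longrightarrow>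
      hook_eval (hook_expr K (rev (sort (nths xs B)))) = F_der (nths xs B) \<and>
      pvars_in S (hook_expr K (rev (sort (nths xs B))))"
  shows "hook_eval (hirota_monom K xs) = F_hirota xs" "pvars_in S (hirota_monom K xs)"
proof -
  interpret rhom hook_eval by (rule rhom_hook_eval)
  have B: "B \<subseteq> {..<length xs} \<and> B \<noteq> {} \<and> even (card B)"
    if "P \<in> {P. partition_on {..<length xs} P \<and> (\<forall>B\<in>P. even (card B))}" "B \<in> P" for P B
  proof -
    have P: "partition_on {..<length xs} P" using that(1) by simp
    have "\<Union>P = {..<length xs}" using partition_onD1[OF P] by (rule sym)
    then show ?thesis using that partition_onD3[OF P] by blast
  qed
  show "hook_eval (hirota_monom K xs) = F_hirota xs"
    unfolding hirota_monom_def F_hirota_def sum prod mult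
  proof (intro sum.cong prod.cong refl arg_cong2[where f="(*)"])
    show "hook_eval 2 = 2" using of_nat[of 2] by simp
    show "hook_eval (hook_expr K (rev (sort (nths xs B)))) = F_der (nths xs B)"
      if "P \<in> {P. partition_on {..<length xs} P \<and> (\<forall>B\<in>P. even (card B))}" "B \<in> P" for P B
      using B[OF that] assms[of B] by blast
  qed
  have "pvars_in S (2 :: hook_poly)" using pvars_in_of_nat[of S 2] by simp
  then show "pvars_in S (hirota_monom K xs)"
    unfolding hirota_monom_def
  proof (intro pvars_in_sum pvars_in_prod pvars_in_mult)
    show "pvars_in S (hook_expr K (rev (sort (nths xs B))))"
      if "P \<in> {P. partition_on {..<length xs} P \<and> (\<forall>B\<in>P. even (card B))}" "B \<in> P" for P B
      using B[OF that] assms[of B] by blast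
  qed
qed

subsection \<open>Monomials of the KP equations\<close>

text \<open>The criterion by which the monomials of (star) other than D_l D_k meet the descent
  condition of \<open>KP_two\<close>.\<close>

definition low :: "nat \<Rightarrow> (nat \<Rightarrow>\<^sub>0 nat) \<Rightarrow> bool" where
  "low l m \<longleftrightarrow> (\<exists>i\<in>Poly_Mapping.keys m. i < l)"

definition homog :: "nat \<Rightarrow> nat rpoly \<Rightarrow> bool" where
  "homog s A \<longleftrightarrow> (\<forall>m\<in>Poly_Mapping.keys A. sum_list (indices m) = s \<and> 0 \<notin> Poly_Mapping.keys m)"

definition all_low :: "nat \<Rightarrow> nat rpoly \<Rightarrow> bool" where
  "all_low l A \<longleftrightarrow> (\<forall>m\<in>Poly_Mapping.keys A. low l m)"

lemma sum_list_indices_add: "sum_list (indices (a + b)) = sum_list (indices a) + sum_list (indices b)"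
  unfolding sum_mset_sum_list[symmetric] mset_indices_add by simp

lemma set_indices: "set (indices m) = Poly_Mapping.keys m"
  by (auto simp: indices_def in_keys_iff)

lemma homog_mult: "homog s A \<Longrightarrow> homog r B \<Longrightarrow> homog (s + r) (A * B)"
  unfolding homog_def using keys_mult[of A B]
  by (force simp: sum_list_indices_add keys_add_exponent)

lemma homog_add: "homog s A \<Longrightarrow> homog s B \<Longrightarrow> homog s (A + B)"
  unfolding homog_def using keys_add[of A B] by blast

lemma homog_diff: "homog s A \<Longrightarrow> homog s B \<Longrightarrow> homog s (A - B)"
  unfolding homog_def using keys_diff[of A B] by blast

lemma homog_sum: "(\<And>x. x \<in> S \<Longrightarrow> homog s (f x)) \<Longrightarrow> homog s (sum f S)"
proof (induction S rule: infinite_finite_induct)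
  case (insert x S)
  then show ?case by (simp add: homog_add)
qed (simp_all add: homog_def)

lemma homog_cst: "homog 0 (cst c)"
proof -
  have "mset (indices 0) = mset []" by (rule multiset_eqI) (simp add: count_indices)
  then show ?thesis by (simp add: homog_def cst_def)
qed

lemma homog_cst_mult: "homog s A \<Longrightarrow> homog s (cst c * A)"
  using homog_mult[OF homog_cst] by fastforce

lemma homog_of_nat_mult: "homog s A \<Longrightarrow> homog s (of_nat c * A)"
  unfolding cst_of_nat[symmetric] by (rule homog_cst_mult)

lemma homog_D: "1 \<le> i \<Longrightarrow> homog i (D i)"
proof -
  assume "1 \<le> i"
  moreover have "sum_list (indices (Poly_Mapping.single i 1)) = i"
    unfolding sum_mset_sum_list[symmetric] mset_indices_single by simp
  ultimately show ?thesis by (simp add: homog_def D_def pvar_def)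
qed

lemma all_low_mult: "all_low l A \<Longrightarrow> all_low l (A * B)" "all_low l A \<Longrightarrow> all_low l (B * A)"
proof -
  have "all_low l A \<Longrightarrow> all_low l (A * B)" for A B
    unfolding all_low_def low_def using keys_mult[of A B] by (fastforce simp: keys_add_exponent)
  then show "all_low l A \<Longrightarrow> all_low l (A * B)" "all_low l A \<Longrightarrow> all_low l (B * A)"
    by (auto simp: mult.commute[of B])
qed

lemma all_low_add: "all_low l A \<Longrightarrow> all_low l B \<Longrightarrow> all_low l (A + B)"
  unfolding all_low_def using keys_add[of A B] by blast

lemma all_low_diff: "all_low l A \<Longrightarrow> all_low l B \<Longrightarrow> all_low l (A - B)"
  unfolding all_low_def using keys_diff[of A B] by blast

lemma all_low_sum: "(\<And>x. x \<in> S \<Longrightarrow> all_low l (f x)) \<Longrightarrow> all_low l (sum f S)"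
proof (induction S rule: infinite_finite_induct)
  case (insert x S)
  then show ?case by (simp add: all_low_add)
qed (simp_all add: all_low_def)

lemma all_low_D: "i < l \<Longrightarrow> all_low l (D i)"
  by (simp add: all_low_def low_def D_def pvar_def)

lemma h_poly_D_check:
  assumes "n \<noteq> 0"
  shows "h_poly D_check n = cst (1 / of_nat n) * (\<Sum>i=1..n. of_nat i * (D i * h_poly D_check (n - i)))"
proof (rule of_nat_mult_cancel[OF assms])
  show "of_nat n * h_poly D_check n = of_nat n * (cst (1 / of_nat n) * (\<Sum>i=1..n. of_nat i * (D i * h_poly D_check (n - i))))"
    unfolding mult.assoc[of "of_nat n", symmetric] of_nat_mult_cst_inverse[OF assms] h_poly_rec
    by (simp add: D_check_def mult.assoc)
qed

lemma homog_h_poly: "homog n (h_poly D_check n)"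
proof (induction n rule: less_induct)
  case (less n)
  show ?case
  proof (cases "n = 0")
    case True
    then show ?thesis using homog_cst[of 1] by (simp add: h_poly_0)
  next
    case False
    show ?thesis
      unfolding h_poly_D_check[OF False]
    proof (intro homog_cst_mult homog_sum homog_of_nat_mult)
      fix i assume i: "i \<in> {1..n}"
      then have "homog (i + (n - i)) (D i * h_poly D_check (n - i))"
        by (intro homog_mult homog_D less) auto
      then show "homog n (D i * h_poly D_check (n - i))" using i by simp
    qed
  qed
qed

text \<open>Beyond the removed summand, h_l contributes an index below l, and the two other terms
  contain D_(l-1) and D_1. A pair of total size k + l can therefore only have a smaller entry below
  l, as the lookup in \<open>KP_two\<close> demands.\<close>

lemma kp_star_monomials:
  assumes l: "2 \<le> l" "l \<le> k" and m: "m \<in> Poly_Mapping.keys (kp_star k l - of_nat k * D l * D k)"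
  shows "sum_list (indices m) = k + l" "0 \<notin> set (indices m)" "\<exists>i\<in>set (indices m). i < l"
proof -
  let ?A = "kp_star k l - of_nat k * D l * D k"
  have "homog (k + l) ?A"
  proof -
    have 1: "homog (k + l) (h_poly D_check l * D k)" "homog (k + l) (D l * D k)"
      using homog_mult[OF homog_h_poly[of l] homog_D[of k]] homog_mult[OF homog_D[of l] homog_D[of k]] l by (simp_all add: add.commute)
    have 2: "homog (k + l) (h_poly D_check (k + 1) * D (l - 1))" "homog (k + l) (D (k + l - 1) * D 1)"
      using homog_mult[OF homog_h_poly[of "k + 1"] homog_D[of "l - 1"]] homog_mult[OF homog_D[of "k + l - 1"] homog_D[of 1]] l by simp_all
    show ?thesis unfolding kp_star_def mult.assoc by (intro homog_diff homog_add homog_of_nat_mult 1 2)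
  qed
  then show "sum_list (indices m) = k + l" "0 \<notin> set (indices m)" using m by (auto simp: homog_def set_indices)
  \<comment> \<open>The part of h_l without smaller indices is (1/l) l D_l = D_l, with coefficient
    1.\<close>
  have hl: "h_poly D_check l = D l + cst (1 / of_nat l) * (\<Sum>i=1..l - 1. of_nat i * (D i * h_poly D_check (l - i)))"
  proof -
    have "{1..l} = insert l {1..l - 1}" using l by auto
    then have "(\<Sum>i=1..l. of_nat i * (D i * h_poly D_check (l - i))) =
      of_nat l * D l + (\<Sum>i=1..l - 1. of_nat i * (D i * h_poly D_check (l - i)))"
      using l by (simp add: h_poly_0)
    moreover have "cst (1 / of_nat l) * (of_nat l * D l) = D l"
      using of_nat_mult_cst_inverse[of l] l by (metis mult.assoc mult.commute mult_1_left not_numeral_le_zero)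
    ultimately show ?thesis using h_poly_D_check[of l] l by (simp add: distrib_left)
  qed
  have "?A = of_nat k * (cst (1 / of_nat l) * (\<Sum>i=1..l - 1. of_nat i * (D i * h_poly D_check (l - i)))) * D k
      + of_nat (l - 1) * h_poly D_check (k + 1) * D (l - 1) - of_nat (k + l - 1) * D (k + l - 1) * D 1"
    unfolding kp_star_def by (subst hl) (simp add: algebra_simps del: of_nat_diff)
  moreover have "all_low l \<dots>"
    using l by (intro all_low_add all_low_diff all_low_mult(1)[OF all_low_mult(2)[OF all_low_mult(2)[OF all_low_sum]]]
        all_low_mult(2)[OF all_low_D] all_low_mult(2)[OF all_low_mult(1)[OF all_low_D]]) auto
  ultimately have "all_low l ?A" by simp
  then show "\<exists>i\<in>set (indices m). i < l" using m by (auto simp: all_low_def low_def set_indices)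
qed

lemma hook_eval_hirota:
  assumes "\<And>m. m \<in> Poly_Mapping.keys A \<Longrightarrow> hook_eval (hirota_monom K (indices m)) = F_hirota (indices m)"
  shows "map_tau * map_tau * hook_eval (hirota K A) = Abs_fps (\<lambda>n. bi_diag (hirota_op A (bi_maps n)))"
proof (rule fps_ext)
  fix n
  interpret e: rhom hook_eval by (rule rhom_hook_eval)
  interpret g: rhom bi_diag by (rule rhom_bi_diag)
  have "map_tau * map_tau * hook_eval (hirota K A) =
    (\<Sum>m\<in>Poly_Mapping.keys A. fps_const (cst (Poly_Mapping.lookup A m)) * (map_tau * map_tau * F_hirota (indices m)))"
    unfolding hirota_def e.sum e.mult hook_eval_cst sum_distrib_left
    using assms by (intro sum.cong) (auto simp: mult_ac)
  then have "fps_nth (map_tau * map_tau * hook_eval (hirota K A)) n =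
    (\<Sum>m\<in>Poly_Mapping.keys A. cst (Poly_Mapping.lookup A m) * bi_diag (foldr bi_der (indices m) (bi_maps n)))"
    by (simp only: fps_sum_nth fps_mult_left_const_nth hirota_F)
  also have "\<dots> = bi_diag (hirota_op A (bi_maps n))"
    unfolding hirota_op_def g.sum g.mult bi_diag_cst ..
  finally show "fps_nth (map_tau * map_tau * hook_eval (hirota K A)) n =
    fps_nth (Abs_fps (\<lambda>n. bi_diag (hirota_op A (bi_maps n)))) n" by simp
qed

text \<open>The induction follows the recursion of \<open>KP_two\<close>. Value and hook bound have
  to be proved together, since the bound guarantees that the cut-off lookup \<open>K\<close> is
  consulted only where it is correct.\<close>

theorem KP_two_eval:
  "1 \<le> l \<Longrightarrow> l \<le> k \<Longrightarrow> hook_eval (KP_two k l) = F_der [k, l] \<and> pvars_in (hooks_upto (k + l - 1)) (KP_two k l)"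
proof (induction k l rule: KP_two.induct)
  case (1 k l)
  show ?case
  proof (cases "l \<le> 1")
    case True
    then have "l = 1" using 1 by simp
    then show ?thesis using 1
      by (subst (1 2) KP_two.simps) (simp add: hook_eval_H, simp add: F_hook_def F_der_def H_def pvars_in_def hooks_upto_def)
  next
    case False
    then have l: "2 \<le> l" by simp
    define C where "C = (\<lambda>i j. max i j + min i j < k + l \<or> (max i j + min i j = k + l \<and> min i j < l))"
    have mm: "max i j + min i j = i + j" for i j :: nat by simp
    define K where "K = (\<lambda>i j. if C i j then KP_two (max i j) (min i j) else 0)"
    let ?A = "kp_star k l - of_nat k * D l * D k"
    have KP: "KP_two k l = - cst (1 / of_nat (2 * k)) * hirota K ?A"
      unfolding KP_two.simps[of k l] K_def C_def using False by simp
    have good: "good_pair K i j" if "1 \<le> i" "1 \<le> j" "C i j" for i j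
    proof -
      have "hook_eval (KP_two (max i j) (min i j)) = F_der [max i j, min i j] \<and>
        pvars_in (hooks_upto (max i j + min i j - 1)) (KP_two (max i j) (min i j))"
        using that False by (intro 1(1)) (auto simp: C_def)
      moreover have "F_der [max i j, min i j] = F_der [i, j]"
        by (rule F_der_cong) (auto simp: max_def min_def)
      moreover have "max i j + min i j = i + j" by simp
      ultimately show ?thesis using that by (simp add: good_pair_def K_def)
    qed
    have mon: "hook_eval (hirota_monom K (indices m)) = F_hirota (indices m)"
      "pvars_in (hooks_upto (k + l - 1)) (hirota_monom K (indices m))"
      if m: "m \<in> Poly_Mapping.keys ?A" for m
    proof -
      define xs where "xs = indices m"
      note X = kp_star_monomials[OF l 1(3) m, folded xs_def]
      have B: "hook_eval (hook_expr K (rev (sort (nths xs B)))) = F_der (nths xs B) \<and>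
        pvars_in (hooks_upto (k + l - 1)) (hook_expr K (rev (sort (nths xs B))))"
        if B: "B \<subseteq> {..<length xs}" "B \<noteq> {}" "even (card B)" for B
      proof -
        define ys where "ys = rev (sort (nths xs B))"
        have ms: "mset ys = mset (nths xs B)" by (simp add: ys_def)
        have sub: "mset ys \<subseteq># mset xs" unfolding ms by (rule mset_nths_subseteq)
        have "finite B" using B(1) finite_subset by blast
        then have "card B \<noteq> 0" using B(2) by simp
        then have "2 \<le> card B" using B(3) by (cases "card B = 1") auto
        moreover have "length ys = card B" using length_nths_subset[OF B(1)] by (simp add: ys_def)
        ultimately have "2 \<le> length ys" by simp
        then obtain y1 y2 zs where ys: "ys = y1 # y2 # zs"
          by (metis One_nat_def Suc_1 Suc_le_length_iff)
        have set: "set ys \<subseteq> set xs" using set_mset_mono[OF sub] by simp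
        then have pos: "0 \<notin> set ys" using X(2) by auto
        obtain M where M: "mset xs = mset ys + M" using sub by (metis subset_mset.add_diff_inverse)
        have sxs: "sum_list xs = sum_list ys + sum_mset M" using arg_cong[OF M, of sum_mset] by (simp add: sum_mset_sum_list)
        \<comment> \<open>If the two largest indices of the block already add up to k + l, they make
          up the whole monomial, and one of them is below l.\<close>
        have "C y1 y2"
        proof (cases "y1 + y2 < k + l")
          case True
          then show ?thesis unfolding C_def mm by simp
        next
          case False
          then have eq: "y1 + y2 = k + l" "sum_list zs = 0" "sum_mset M = 0" using sxs X(1) ys by auto
          have "zs = []" using eq(2) pos ys by (cases zs) auto
          moreover have "M = {#}"
          proof (rule ccontr)
            assume "M \<noteq> {#}"
            then obtain x where x: "x \<in># M" by blast
            then have "x = 0" using eq(3) by (simp add: sum_mset_0_iff)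
            moreover have "x \<in> set xs" using x M by (metis UnCI set_mset_mset set_mset_union)
            ultimately show False using X(2) by simp
          qed
          ultimately have "mset xs = {#y1, y2#}" using M ys by simp
          then have "set xs = {y1, y2}" by (metis set_mset_mset set_mset_add_mset_insert set_mset_empty insert_commute)
          then have "min y1 y2 < l" using X(3) by auto
          then show ?thesis using eq(1) unfolding C_def mm by simp
        qed
        then have first: "good_pair K y1 y2" using pos ys by (intro good) auto
        have "hook_eval (hook_expr K (y1 # y2 # zs)) = F_der (y1 # y2 # zs) \<and>
          pvars_in (hooks_upto (y1 + sum_list (y2 # zs) - length (y2 # zs))) (hook_expr K (y1 # y2 # zs))"
        proof (rule hook_expr_eval[where s="k + l"])
          show "good_pair K i j" if "1 \<le> i" "1 \<le> j" "i + j < k + l" for i j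
            using that by (intro good) (unfold C_def mm, simp_all)
        qed (use pos ys sxs X(1) first in auto)
        moreover have "F_der ys = F_der (nths xs B)" by (rule F_der_cong[OF ms])
        moreover have "y1 + sum_list (y2 # zs) - length (y2 # zs) \<le> k + l - 1" using sxs X(1) ys by simp
        ultimately show ?thesis
          unfolding ys_def[symmetric] ys using pvars_in_mono[OF _ hooks_upto_mono] by metis
      qed
      show "hook_eval (hirota_monom K (indices m)) = F_hirota (indices m)"
        "pvars_in (hooks_upto (k + l - 1)) (hirota_monom K (indices m))"
        unfolding xs_def[symmetric] by (rule hirota_monom_eval[OF B], assumption+)+
    qed
    have "pvars_in (hooks_upto (k + l - 1)) (KP_two k l)"
      unfolding KP hirota_def using mon(2)
      by (intro pvars_in_mult pvars_in_sum pvars_in_uminus) auto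
    moreover have "hook_eval (KP_two k l) = F_der [k, l]"
    proof -
      interpret e: rhom hook_eval by (rule rhom_hook_eval)
      interpret g: rhom bi_diag by (rule rhom_bi_diag)
      \<comment> \<open>The full operator (star) gives 0, so what is left after the removal of k D_l
        D_k is minus the value of this summand.\<close>
      have "bi_diag (hirota_op ?A (bi_maps n)) = - (of_nat k * fps_nth (map_tau * map_tau * (2 * F_der [k, l])) n)" for n
      proof -
        have "hirota_op (of_nat k * D l * D k) (bi_maps n) = of_nat k * foldr bi_der [k, l] (bi_maps n)"
          using hirota_op_D_mult[of k 1] by (simp add: mult.assoc hirota_op_of_nat_mult hirota_op_D_mult hirota_op_1)
        then have "bi_diag (hirota_op ?A (bi_maps n)) = - (of_nat k * bi_diag (foldr bi_der [k, l] (bi_maps n)))"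
          unfolding additive_map.diff[OF additive_hirota_op] g.diff
          using kp_star_F[of l k n] l 1 by (simp add: g.mult g.of_nat)
        then show ?thesis unfolding hirota_F F_hirota_pair .
      qed
      then have "map_tau * map_tau * hook_eval (hirota K ?A) = - (of_nat k * (map_tau * map_tau * (2 * F_der [k, l])))"
        by (subst hook_eval_hirota[OF mon(1)]) (simp_all add: fps_eq_iff fps_mult_of_nat_nth)
      moreover have "map_tau * map_tau * (- x * f) = - (x * (map_tau * map_tau * f))" for x f
        by (simp add: mult_ac)
      ultimately have "map_tau * map_tau * hook_eval (KP_two k l) =
        fps_const (cst (1 / of_nat (2 * k))) * (of_nat k * (map_tau * map_tau * (2 * F_der [k, l])))"
        unfolding KP e.mult e.uminus hook_eval_cst by (simp only: mult_minus_right minus_minus)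
      also have "\<dots> = (fps_const (cst (1 / of_nat (2 * k))) * of_nat (2 * k)) * (map_tau * map_tau * F_der [k, l])"
        by (simp add: mult_ac)
      also have "fps_const (cst (1 / of_nat (2 * k))) * of_nat (2 * k) = (1 :: var rpoly fps)"
      proof -
        have "of_nat (2 * k) * cst (1 / of_nat (2 * k)) = (1 :: var rpoly)"
          by (rule of_nat_mult_cst_inverse) (use l 1 in simp)
        then show ?thesis
          by (simp only: fps_of_nat[symmetric] fps_const_mult mult.commute[of "cst _"] fps_const_1_eq_1)
      qed
      finally have "map_tau * (map_tau * hook_eval (KP_two k l)) = map_tau * (map_tau * F_der [k, l])"
        by (simp only: mult.assoc mult_1_left)
      from fps_cancel_const_1[OF map_tau_0 fps_cancel_const_1[OF map_tau_0 this]] show ?thesis .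
    qed
    ultimately show ?thesis by simp
  qed
qed

theorem KP_eval:
  assumes "xs \<noteq> []" "0 \<notin> set xs"
  shows "hook_eval (KP xs) = F_der xs" "pvars_in (hooks_upto (sum_list xs + 1 - length xs)) (KP xs)"
proof -
  define K where "K = (\<lambda>i j. KP_two (max i j) (min i j))"
  have good: "good_pair K i j" if "1 \<le> i" "1 \<le> j" for i j
  proof -
    have "F_der [max i j, min i j] = F_der [i, j]" by (rule F_der_cong) (auto simp: max_def min_def)
    moreover have "max i j + min i j = i + j" by simp
    ultimately show ?thesis using KP_two_eval[of "min i j" "max i j"] that by (simp add: good_pair_def K_def)
  qed
  have "sort xs \<noteq> []" using assms(1) by (metis length_0_conv length_sort)
  then obtain k cs where kcs: "rev (sort xs) = k # cs" by (cases "rev (sort xs)") auto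
  have ms: "mset (k # cs) = mset xs" unfolding kcs[symmetric] by simp
  have st: "set (k # cs) = set xs" by (rule mset_eq_setD[OF ms])
  have pos: "1 \<le> x" if "x \<in> set (k # cs)" for x
    using that st assms(2) by (metis less_one not_less)
  have "hook_eval (hook_expr K (k # cs)) = F_der (k # cs) \<and>
    pvars_in (hooks_upto (k + sum_list cs - length cs)) (hook_expr K (k # cs))"
  proof (rule hook_expr_eval[where s="k + sum_list cs"])
    show "1 \<le> k" by (rule pos) simp
    show "0 \<notin> set cs" using pos[of 0] by auto
    show "good_pair K k (hd cs)" if "cs \<noteq> []"
      using that by (intro good pos) simp_all
  qed (simp_all add: good)
  moreover have "KP xs = hook_expr K (k # cs)" unfolding KP_def K_def kcs ..
  moreover have "F_der (k # cs) = F_der xs" by (rule F_der_cong[OF ms])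
  moreover have "k + sum_list cs = sum_list xs" "Suc (length cs) = length xs"
    using arg_cong[OF ms, of sum_mset] arg_cong[OF ms, of size] by (simp_all add: sum_mset_sum_list)
  then have "k + sum_list cs - length cs = sum_list xs + 1 - length xs" by simp
  ultimately show "hook_eval (KP xs) = F_der xs" "pvars_in (hooks_upto (sum_list xs + 1 - length xs)) (KP xs)"
    by simp_all
qed

section \<open>Equations for the logarithm\<close>

lemma fps_deriv_map_tau: "fps_deriv map_tau = map_tau * fps_deriv map_F"
proof -
  have "fps_deriv map_F = fps_compose (fps_cst (fps_deriv (fps_ln 1))) (map_tau - 1) * fps_deriv (map_tau - 1)"
    unfolding map_F_def by (rule der_fps_compose[OF der_fps_deriv]) (simp_all add: map_tau_0)
  then have "map_tau * fps_deriv map_F =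
    ((1 + (map_tau - 1)) * fps_compose (fps_cst (fps_deriv (fps_ln 1))) (map_tau - 1)) * fps_deriv map_tau"
    by (simp add: mult_ac)
  then show ?thesis using fps_compose_geometric[of "map_tau - 1"] by (simp add: map_tau_0)
qed

definition vir_der :: "nat \<Rightarrow> var rpoly \<Rightarrow> var rpoly" where
  "vir_der k = der_on VarP (\<lambda>j. if k < j then of_nat j * pvar (VarP (j - k)) else 0)"

abbreviation "uv_sum \<equiv> fps_const (pvar VarU + pvar VarV) :: var rpoly fps"
abbreviation "uv_prod \<equiv> fps_const (pvar VarU * pvar VarV) :: var rpoly fps"

lemma map_tau_virasoro:
  "of_nat (k + 1) * Fdp (k + 1) map_tau = fps_X * fps_lift (virasoro VarP (pvar VarU) (pvar VarV) k) map_tau"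
proof (rule fps_ext)
  fix n
  show "fps_nth (of_nat (k + 1) * Fdp (k + 1) map_tau) n =
    fps_nth (fps_X * fps_lift (virasoro VarP (pvar VarU) (pvar VarV) k) map_tau) n"
  proof (cases n)
    case 0
    then show ?thesis by (simp add: map_tau_0 partial_p_pd)
  next
    case (Suc m)
    have "fps_nth (of_nat (k + 1) * Fdp (k + 1) map_tau) n = of_nat (k + 1) * pd VarP (k + 1) (fps_nth map_tau n)"
      by (simp only: fps_of_nat[symmetric] fps_mult_left_const_nth fps_lift_nth partial_p_pd)
    then show ?thesis
      using maps_coeff_rec[OF inj_VarP pconst_VarUV, of "k + 1" m] Suc by (simp add: map_tau_nth)
  qed
qed

text \<open>The constraint on tau divided by tau; the second derivatives turn into F_i F_j +
  F_(i,j).\<close>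

lemma map_F_virasoro:
  "of_nat (k + 1) * Fdp (k + 1) map_F = fps_X *
     (fps_lift (vir_der k) map_F + uv_sum * of_nat k * Fdp k map_F
      + (\<Sum>i\<in>{1..<k}. of_nat (i * (k - i)) * (Fdp i map_F * Fdp (k - i) map_F + Fdp i (Fdp (k - i) map_F)))
      + (if k = 0 then uv_prod else 0))"
    (is "_ = fps_X * ?V")
proof -
  have p: "der (\<lambda>x. x) (partial_p i)" "\<And>c. partial_p i (cst c) = 0" for i
    by (simp_all add: partial_p_def der_derivation)
  have dt: "Fdp i map_tau = map_tau * Fdp i map_F" for i by (rule der_map_tau[OF p])
  have dv: "fps_lift (vir_der k) map_tau = map_tau * fps_lift (vir_der k) map_F"
    unfolding vir_der_def by (rule der_map_tau[OF der_der_on]) simp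
  have d2: "Fdp i (Fdp j map_tau) = map_tau * (Fdp i map_F * Fdp j map_F + Fdp i (Fdp j map_F))" for i j
  proof -
    interpret der "\<lambda>x. x" "Fdp i" by (rule der_Fdp)
    show ?thesis unfolding dt[of j] leibniz dt[of i] by (simp add: algebra_simps)
  qed
  have "fps_lift (virasoro VarP (pvar VarU) (pvar VarV) k) map_tau =
    fps_lift (vir_der k) map_tau + uv_sum * of_nat k * Fdp k map_tau
      + (\<Sum>i\<in>{1..<k}. of_nat (i * (k - i)) * Fdp i (Fdp (k - i) map_tau))
      + (if k = 0 then uv_prod * map_tau else 0)"
    by (rule fps_ext) (auto simp: virasoro_def vir_der_def partial_p_pd fps_sum_nth mult.assoc
      fps_mult_of_nat_nth simp del: of_nat_mult of_nat_diff simp flip: fps_of_nat)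
  also have "\<dots> = map_tau * ?V"
    unfolding d2 unfolding dt dv by (simp add: distrib_left sum_distrib_left mult_ac del: of_nat_mult of_nat_diff)
  finally have "of_nat (k + 1) * (map_tau * Fdp (k + 1) map_F) = fps_X * (map_tau * ?V)"
    using map_tau_virasoro[of k] unfolding dt by simp
  then have "map_tau * (of_nat (k + 1) * Fdp (k + 1) map_F) = map_tau * (fps_X * ?V)"
    by (simp only: mult.left_commute)
  then show ?thesis by (rule fps_cancel_const_1[OF map_tau_0])
qed

text \<open>At order t^n the face degrees add up to n, so the degree in the p_i, with p_i of weight
  i, agrees with the degree in t.\<close>

lemma map_F_euler: "fps_lift (vir_der 0) map_F = fps_X * fps_deriv map_F"
proof -
  have "fps_lift (vir_der 0) map_tau = fps_X * fps_deriv map_tau"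
  proof (rule fps_ext)
    fix n
    have "vir_der 0 (fps_nth map_tau n) =
      (\<Sum>j\<in>{0..n}. (if 0 < j then of_nat j * pvar (VarP (j - 0)) else 0) * pd VarP j (fps_nth map_tau n))"
      unfolding vir_der_def
      by (rule der_on_expand[OF inj_VarP]) (auto simp: map_tau_nth pd_maps_coeff_eq_0[OF inj_VarP pconst_VarUV])
    also have "\<dots> = (\<Sum>j\<in>{1..n}. of_nat j * pvar (VarP j) * pd VarP j (fps_nth map_tau n))"
      by (intro sum.mono_neutral_cong_right) auto
    also have "\<dots> = of_nat n * fps_nth map_tau n"
      unfolding map_tau_nth by (rule euler_maps_coeff[OF inj_VarP pconst_VarUV])
    finally show "fps_nth (fps_lift (vir_der 0) map_tau) n = fps_nth (fps_X * fps_deriv map_tau) n"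
      by (cases n) simp_all
  qed
  moreover have "fps_lift (vir_der 0) map_tau = map_tau * fps_lift (vir_der 0) map_F"
    unfolding vir_der_def by (rule der_map_tau[OF der_der_on]) simp
  ultimately have "map_tau * fps_lift (vir_der 0) map_F = map_tau * (fps_X * fps_deriv map_F)"
    by (simp only: fps_deriv_map_tau mult.left_commute)
  then show ?thesis by (rule fps_cancel_const_1[OF map_tau_0])
qed

text \<open>The commutator comes from the coefficient p_i of the derivative by p_(k+i), present for
  i at least 1.\<close>

lemma partial_p_vir_der:
  assumes "1 \<le> i"
  shows "partial_p i (vir_der k f) = vir_der k (partial_p i f) + of_nat (k + i) * partial_p (k + i) f"
proof -
  have D: "der (\<lambda>x. x) (\<lambda>f. partial_p i (vir_der k f) - vir_der k (partial_p i f))"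
    by unfold_locales
      (simp_all add: partial_p_pd vir_der_def der_on_add der_on_mult algebra_simps)
  have E: "der (\<lambda>x. x) (\<lambda>f. of_nat (k + i) * partial_p (k + i) f)"
    by unfold_locales (simp_all add: partial_p_pd der_on_add der_on_mult algebra_simps)
  have "partial_p i (vir_der k f) - vir_der k (partial_p i f) = of_nat (k + i) * partial_p (k + i) f"
  proof (rule der_ext[OF D E])
    fix x
    show "partial_p i (vir_der k (pvar x)) - vir_der k (partial_p i (pvar x)) = of_nat (k + i) * partial_p (k + i) (pvar x)"
    proof (cases "x \<in> range VarP")
      case True
      then obtain j where x: "x = VarP j" by auto
      show ?thesis
        using assms by (auto simp: x partial_p_pd vir_der_def der_on_pvar[OF inj_VarP] der_on_mult)
    qed (auto simp: partial_p_pd vir_der_def der_on_other)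
  qed (simp add: partial_p_pd vir_der_def)
  then show ?thesis by (simp add: algebra_simps)
qed

lemma Fdp_vir_der:
  "1 \<le> i \<Longrightarrow> Fdp i (fps_lift (vir_der k) f) = fps_lift (vir_der k) (Fdp i f) + of_nat (k + i) * Fdp (k + i) f"
  by (simp only: fps_eq_iff fps_lift_nth partial_p_vir_der fps_add_nth fps_of_nat[symmetric] fps_mult_left_const_nth) simp

lemma Fdp_const: "pconst VarP c \<Longrightarrow> Fdp i (fps_const c * f) = fps_const c * Fdp i f"
  by (simp add: fps_eq_iff partial_p_pd der_on_const_mult)

lemma Fdp_X: "Fdp i (fps_X * f) = fps_X * Fdp i f"
  by (rule fps_ext) (simp add: fps_X_mult_nth partial_p_pd)

lemma Fdp_deriv: "Fdp i (fps_deriv f) = fps_deriv (Fdp i f)"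
  by (rule fps_ext) (simp add: partial_p_pd der_on_const_mult del: of_nat_Suc)

text \<open>Constraint 0 and Euler's relation give F_1 = t^2 dF/dt + t u v. The last term disappears
  under the derivative by p_m, and t^2 d/dt commutes with the derivative by p_1, so the relation can
  be iterated.\<close>

lemma F_hook_deriv: "F_hook m l = ((\<lambda>g. fps_X ^ 2 * fps_deriv g) ^^ l) (Fdp m map_F)"
proof -
  interpret der "\<lambda>x. x" "Fdp i" for i by (rule der_Fdp)
  let ?D = "\<lambda>g. fps_X ^ 2 * fps_deriv g :: var rpoly fps"
  have comm: "Fdp i (?D g) = ?D (Fdp i g)" for i g
    by (simp add: power2_eq_square mult.assoc Fdp_X Fdp_deriv)
  have c: "Fdp m uv_prod = 0" for m
    by (rule fps_ext) (use pconst_VarUV in \<open>auto simp: partial_p_pd der_on_mult pconst_def\<close>)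
  have "Fdp 1 map_F = fps_X * (fps_X * fps_deriv map_F + uv_prod)"
    using map_F_virasoro[of 0] by (simp add: map_F_euler)
  then have "Fdp 1 map_F = ?D map_F + fps_X * uv_prod"
    by (simp add: power2_eq_square algebra_simps)
  then have 1: "Fdp 1 (Fdp m map_F) = ?D (Fdp m map_F)"
    unfolding Fdp_commute[of 1 m] by (simp add: add comm Fdp_X c)
  show ?thesis
    unfolding F_hook_def
  proof (induction l)
    case (Suc l)
    have "(Fdp 1 ^^ Suc l) (Fdp m map_F) = (Fdp 1 ^^ l) (?D (Fdp m map_F))"
      unfolding funpow_Suc_right comp_def 1 ..
    also have "\<dots> = ?D ((Fdp 1 ^^ l) (Fdp m map_F))"
      by (induction l) (simp_all add: comm)
    finally have "(Fdp 1 ^^ Suc l) (Fdp m map_F) = ?D ((?D ^^ l) (Fdp m map_F))" unfolding Suc.IH .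
    then show ?case by (simp only: funpow.simps comp_def)
  qed simp
qed

lemma der_funpow_mult:
  fixes d :: "'a::comm_ring_1 \<Rightarrow> 'a"
  assumes "der (\<lambda>x. x) d"
  shows "(d ^^ l) (f * g) = (\<Sum>r\<le>l. of_nat (l choose r) * (d ^^ r) f * (d ^^ (l - r)) g)"
proof (induction l)
  case (Suc l)
  interpret der "\<lambda>x. x" d by fact
  let ?f = "\<lambda>r. (d ^^ r) f" and ?g = "\<lambda>r. (d ^^ r) g"
  have "(d ^^ Suc l) (f * g) = (\<Sum>r\<le>l. of_nat (l choose r) * (?f (Suc r) * ?g (l - r) + ?f r * ?g (Suc l - r)))"
    unfolding funpow.simps comp_def Suc.IH sum mult.assoc of_nat_mult
    by (intro sum.cong refl) (simp add: leibniz Suc_diff_le add.commute)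
  also have "\<dots> = (\<Sum>r\<le>l. of_nat (l choose r) * ?f (Suc r) * ?g (l - r)) +
    (\<Sum>r\<le>l. of_nat (l choose r) * ?f r * ?g (Suc l - r))"
    by (simp only: distrib_left sum.distrib mult.assoc)
  also have "(\<Sum>r\<le>l. of_nat (l choose r) * ?f r * ?g (Suc l - r)) =
    f * ?g (Suc l) + (\<Sum>r\<le>l. of_nat (l choose Suc r) * ?f (Suc r) * ?g (l - r))"
  proof -
    have "(\<Sum>r\<le>l. of_nat (l choose r) * ?f r * ?g (Suc l - r)) = (\<Sum>r\<le>Suc l. of_nat (l choose r) * ?f r * ?g (Suc l - r))"
      by (simp add: binomial_eq_0)
    then show ?thesis by (simp only: sum.atMost_Suc_shift) simp
  qed
  also have "(\<Sum>r\<le>l. of_nat (l choose r) * ?f (Suc r) * ?g (l - r)) +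
      (f * ?g (Suc l) + (\<Sum>r\<le>l. of_nat (l choose Suc r) * ?f (Suc r) * ?g (l - r))) =
    (\<Sum>r\<le>Suc l. of_nat (Suc l choose r) * ?f r * ?g (Suc l - r))"
    by (simp only: sum.atMost_Suc_shift) (simp add: distrib_right sum.distrib algebra_simps)
  finally show ?case .
qed simp

lemma F_der_replicate: "F_der (xs @ replicate l 1) = (Fdp 1 ^^ l) (F_der xs)"
proof (induction l)
  case (Suc l)
  have "F_der (xs @ replicate (Suc l) 1) = F_der ((xs @ replicate l 1) @ [1])"
    by (rule F_der_cong) simp
  then show ?case by (simp only: F_der_append Suc) simp
qed simp

lemma F_hook_virasoro:
  "of_nat (k + 1) * F_hook (k + 1) l = fps_X *
     (fps_lift (vir_der k) ((Fdp 1 ^^ l) map_F) + of_nat (l * (k + 1)) * F_hook (k + 1) (l - 1)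
      + uv_sum * of_nat k * F_hook k l
      + (\<Sum>i\<in>{1..<k}. of_nat (i * (k - i)) *
          ((\<Sum>r\<le>l. of_nat (l choose r) * F_hook i r * F_hook (k - i) (l - r)) + F_der (i # (k - i) # replicate l 1)))
      + (if k = 0 \<and> l = 0 then uv_prod else 0))"
proof -
  interpret d: der "\<lambda>x. x" "Fdp i" for i by (rule der_Fdp)
  interpret p: additive_map "\<lambda>f. (Fdp 1 ^^ l) f"
    by unfold_locales (induction l, simp_all add: d.add)
  have X: "(Fdp 1 ^^ l) (fps_X * f) = fps_X * (Fdp 1 ^^ l) f" for f
    by (induction l) (simp_all add: Fdp_X)
  have n: "(Fdp 1 ^^ l) (of_nat a * f) = of_nat a * (Fdp 1 ^^ l) f" for a f
    by (rule p.of_nat_mult)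
  have c: "(Fdp 1 ^^ l) (uv_sum * f) = uv_sum * (Fdp 1 ^^ l) f" for f
    by (induction l) (simp_all add: Fdp_const pconst_add pconst_VarUV)
  have F: "(Fdp 1 ^^ l) (Fdp m map_F) = F_hook m l" for m l by (simp add: F_hook_def)
  \<comment> \<open>Each of the l derivatives by p_1 contributes one commutator (k + 1) F_(k+1) with
    \<open>vir_der k\<close>. For l = 0 the truncated index l - 1 is harmless, its coefficient being
    0.\<close>
  have v: "(Fdp 1 ^^ l) (fps_lift (vir_der k) map_F) =
    fps_lift (vir_der k) ((Fdp 1 ^^ l) map_F) + of_nat (l * (k + 1)) * F_hook (k + 1) (l - 1)"
  proof (induction l)
    case (Suc l)
    have s: "of_nat (l * (k + 1)) * Fdp 1 (F_hook (k + 1) (l - 1)) = of_nat (l * (k + 1)) * F_hook (k + 1) l"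
      by (cases l) (simp_all add: F_hook_def)
    have "(Fdp 1 ^^ Suc l) (fps_lift (vir_der k) map_F) =
      fps_lift (vir_der k) ((Fdp 1 ^^ Suc l) map_F) + of_nat (k + 1) * Fdp (k + 1) ((Fdp 1 ^^ l) map_F)
      + of_nat (l * (k + 1)) * F_hook (k + 1) l"
      by (simp only: funpow.simps comp_def Suc.IH d.add Fdp_vir_der[OF order_refl] d.of_nat_mult s)
    also have "Fdp (k + 1) ((Fdp 1 ^^ l) map_F) = F_hook (k + 1) l"
      by (simp only: Fdp_funpow_commute F_hook_def)
    finally show ?case by (simp add: algebra_simps)
  qed simp
  have q: "(Fdp 1 ^^ l) (Fdp i (Fdp j map_F)) = F_der (i # j # replicate l 1)" for i j
    using F_der_replicate[of "[i, j]" l] by (simp add: F_der_def Fdp_commute[of i j])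
  have z: "(Fdp 1 ^^ l) (if k = 0 then uv_prod else 0) = (if k = 0 \<and> l = 0 then uv_prod else 0)"
  proof -
    have "Fdp 1 uv_prod = 0"
      by (rule fps_ext) (use pconst_VarUV in \<open>auto simp: partial_p_pd der_on_mult pconst_def\<close>)
    moreover have "(Fdp 1 ^^ j) 0 = 0" for j
      by (induction j) (simp_all add: d.zero)
    ultimately have "l \<noteq> 0 \<Longrightarrow> (Fdp 1 ^^ l) uv_prod = 0"
      by (cases l) (simp_all only: funpow_Suc_right comp_def simp_thms)
    then show ?thesis using p.zero by auto
  qed
  have "of_nat (k + 1) * F_hook (k + 1) l = (Fdp 1 ^^ l) (of_nat (k + 1) * Fdp (k + 1) map_F)"
    by (simp only: n F)
  also have "\<dots> = fps_X *
     (fps_lift (vir_der k) ((Fdp 1 ^^ l) map_F) + of_nat (l * (k + 1)) * F_hook (k + 1) (l - 1)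
      + uv_sum * of_nat k * F_hook k l
      + (\<Sum>i\<in>{1..<k}. of_nat (i * (k - i)) *
          ((\<Sum>r\<le>l. of_nat (l choose r) * F_hook i r * F_hook (k - i) (l - r)) + F_der (i # (k - i) # replicate l 1)))
      + (if k = 0 \<and> l = 0 then uv_prod else 0))"
    unfolding map_F_virasoro X p.add v mult.assoc c n F p.sum
    unfolding der_funpow_mult[OF der_Fdp] q F z mult.assoc ..
  finally show ?thesis .
qed

section \<open>Projection\<close>

definition proj_series :: "nat \<Rightarrow> var rpoly fps \<Rightarrow> tseries" where
  "proj_series d f = fps_to_fls (fps_lift (proj d) f)"

lemma rhom_proj: "rhom (proj d)"
  unfolding proj_def by (rule rhom_subst_poly[OF rhom_cst])

lemma proj_pvar: "proj d (pvar x) = (case x of VarP i \<Rightarrow> if i \<le> d then pvar (VarP i) else 0 | _ \<Rightarrow> pvar x)"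
  unfolding proj_def by (rule subst_poly_pvar[OF rhom_cst])

lemma proj_cst: "proj d (cst c) = cst c"
  unfolding proj_def by (rule subst_poly_cst[OF rhom_cst])

lemma rhom_proj_series: "rhom (proj_series d)"
proof -
  interpret rhom "fps_lift (proj d)" by (rule rhom_fps_lift[OF rhom_proj])
  show ?thesis
    by unfold_locales (simp_all add: proj_series_def one add mult fls_times_fps_to_fls)
qed

lemma proj_series_const: "proj_series d (fps_const c) = fls_const (proj d c)"
proof -
  interpret rhom "proj d" by (rule rhom_proj)
  have "fps_lift (proj d) (fps_const c) = fps_const (proj d c)" by (rule fps_ext) (simp add: zero)
  then show ?thesis by (simp add: proj_series_def)
qed

lemma proj_series_X: "proj_series d fps_X = fls_X"
proof -
  interpret rhom "proj d" by (rule rhom_proj)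
  have "fps_lift (proj d) fps_X = fps_X" by (rule fps_ext) (simp add: zero one)
  then show ?thesis by (simp add: proj_series_def)
qed

lemma proj_series_deriv: "proj_series d (fps_deriv f) = fls_deriv (proj_series d f)"
proof -
  interpret rhom "proj d" by (rule rhom_proj)
  have "fps_lift (proj d) (fps_deriv f) = fps_deriv (fps_lift (proj d) f)"
    by (rule fps_ext) (simp add: mult of_nat del: of_nat_Suc)
  then show ?thesis by (simp add: proj_series_def fls_deriv_fps_to_fls)
qed

text \<open>Only the coefficients p_i with i > d vanish. The derivatives are taken before the
  projection and reach up to index d + k, which is why \<open>G\<close> has to express F_m also for
  m from d on.\<close>

lemma proj_vir_der:
  "proj d (vir_der k f) = (\<Sum>i=1..d. of_nat (i + k) * pvar (VarP i) * proj d (partial_p (i + k) f))"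
proof -
  interpret rhom "proj d" by (rule rhom_proj)
  obtain b where b: "\<And>j. b < j \<Longrightarrow> pd VarP j f = 0"
  proof -
    obtain b where "\<forall>i\<in>{j. VarP j \<in> pvars f}. i \<le> b"
      using finite_indices[OF inj_VarP, of f] finite_nat_set_iff_bounded_le by metis
    then show thesis by (intro that[of b] pd_eq_0[OF inj_VarP]) (metis mem_Collect_eq not_less)
  qed
  let ?e = "\<lambda>j. if k < j then of_nat j * pvar (VarP (j - k)) else 0"
  have "vir_der k f = (\<Sum>j\<in>{0..b + d + k}. ?e j * pd VarP j f)"
    unfolding vir_der_def using b by (intro der_on_expand[OF inj_VarP]) auto
  then have "proj d (vir_der k f) = (\<Sum>j\<in>{0..b + d + k}. proj d (?e j) * proj d (pd VarP j f))"
    by (simp only: sum mult)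
  also have "\<dots> = (\<Sum>j\<in>{1 + k..d + k}. of_nat j * pvar (VarP (j - k)) * proj d (pd VarP j f))"
    by (intro sum.mono_neutral_cong_right) (auto simp: mult of_nat proj_pvar zero)
  also have "\<dots> = (\<Sum>i=1..d. of_nat (i + k) * pvar (VarP i) * proj d (partial_p (i + k) f))"
    by (rule sum.reindex_bij_witness[of _ "\<lambda>i. i + k" "\<lambda>j. j - k"]) (auto simp: partial_p_pd)
  finally show ?thesis .
qed

lemma proj_series_vir_der:
  "proj_series d (fps_lift (vir_der k) f) = (\<Sum>i=1..d. of_nat (i + k) * tp i * proj_series d (Fdp (i + k) f))"
proof (rule fls_eqI)
  fix n
  have "fls_nth (of_nat a * tp i * g) n = of_nat a * pvar (VarP i) * fls_nth g n" for a i and g :: tseries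
    by (simp only: fls_of_nat tp_def fls_const_mult_const fls_const_mult_nth)
  then show "fls_nth (proj_series d (fps_lift (vir_der k) f)) n =
    fls_nth (\<Sum>i=1..d. of_nat (i + k) * tp i * proj_series d (Fdp (i + k) f)) n"
    by (simp add: proj_series_def proj_vir_der fls_nth_sum del: of_nat_add)
qed

definition Fh :: "nat \<Rightarrow> nat \<Rightarrow> nat \<Rightarrow> tseries" where
  "Fh d m l = proj_series d (F_hook m l)"

lemma F_proj_Fh: "F_proj d m = Fh d m 0"
  by (simp add: F_proj_def Fh_def F_hook_def proj_series_def fps_lift_def)

lemma Fh_deriv: "Fh d m l = ((\<lambda>g. fls_X ^ 2 * fls_deriv g) ^^ l) (F_proj d m)"
proof -
  interpret rhom "proj_series d" by (rule rhom_proj_series)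
  show ?thesis
    unfolding F_proj_Fh unfolding Fh_def F_hook_deriv
    by (induction l) (simp_all add: mult power proj_series_X proj_series_deriv)
qed

lemma Fh_virasoro:
  "of_nat (k + 1) * Fh d (k + 1) l = fls_X *
     ((\<Sum>i=1..d. of_nat (i + k) * tp i * Fh d (i + k) l) + of_nat (l * (k + 1)) * Fh d (k + 1) (l - 1)
      + (tu + tv) * of_nat k * Fh d k l
      + (\<Sum>i\<in>{1..<k}. of_nat (i * (k - i)) *
          ((\<Sum>r\<le>l. of_nat (l choose r) * Fh d i r * Fh d (k - i) (l - r)) + proj_series d (F_der (i # (k - i) # replicate l 1))))
      + (if k = 0 \<and> l = 0 then tu * tv else 0))"
proof -
  interpret rhom "proj_series d" by (rule rhom_proj_series)
  interpret p: rhom "proj d" by (rule rhom_proj)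
  have v: "proj_series d (fps_lift (vir_der k) ((Fdp 1 ^^ l) map_F)) = (\<Sum>i=1..d. of_nat (i + k) * tp i * Fh d (i + k) l)"
    unfolding proj_series_vir_der Fh_def F_hook_def Fdp_funpow_commute ..
  have uv: "proj_series d uv_sum = tu + tv" "proj_series d uv_prod = tu * tv"
    by (simp_all add: proj_series_const p.add p.mult proj_pvar tu_def tv_def fls_plus_const)
  have z: "proj_series d (if k = 0 \<and> l = 0 then uv_prod else 0) = (if k = 0 \<and> l = 0 then tu * tv else 0)"
    by (simp add: uv zero)
  have "proj_series d (of_nat (k + 1) * F_hook (k + 1) l) = of_nat (k + 1) * Fh d (k + 1) l"
    by (simp only: mult of_nat Fh_def)
  then show ?thesis
    unfolding F_hook_virasoro mult add sum of_nat v z uv proj_series_X by (simp only: Fh_def)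
qed

text \<open>Differentiating by p_k also hits the explicit p_k, which gives k F_k. The projection
  comes after the differentiation.\<close>

lemma Fh_euler:
  assumes "1 \<le> k"
  shows "(\<Sum>i=1..d. of_nat i * tp i * proj_series d (F_der [i, k])) + of_nat k * F_proj d k = fls_X * fls_deriv (F_proj d k)"
proof -
  interpret rhom "proj_series d" by (rule rhom_proj_series)
  have "Fdp k (fps_lift (vir_der 0) map_F) = fps_X * fps_deriv (Fdp k map_F)"
    by (simp only: map_F_euler Fdp_X Fdp_deriv)
  then have "proj_series d (fps_lift (vir_der 0) (Fdp k map_F) + of_nat k * Fdp k map_F) = proj_series d (fps_X * fps_deriv (Fdp k map_F))"
    using Fdp_vir_der[OF assms, of 0 map_F] by simp
  moreover have "F_der [i, k] = Fdp i (Fdp k map_F)" for i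
    by (simp add: F_der_def Fdp_commute[of k i])
  moreover have "proj_series d (Fdp k map_F) = F_proj d k"
    by (simp add: F_proj_Fh Fh_def F_hook_def)
  ultimately show ?thesis
    by (simp add: add mult of_nat proj_series_vir_der proj_series_X proj_series_deriv)
qed

lemma rhom_trat: "rhom trat"
  by unfold_locales (simp_all add: trat_def cst_add cst_mult fls_plus_const)

lemma subst_trat_Fh: "subst_poly trat (\<lambda>(m, l). Fh d m l) A = proj_series d (hook_eval A)"
proof (rule rhom_ext[OF rhom_subst_poly[OF rhom_trat] rhom_comp[OF rhom_hook_eval rhom_proj_series]])
  show "subst_poly trat (\<lambda>(m, l). Fh d m l) (cst c) = proj_series d (hook_eval (cst c))" for c
    by (simp add: subst_poly_cst[OF rhom_trat] hook_eval_cst proj_series_const proj_cst trat_def)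
  show "subst_poly trat (\<lambda>(m, l). Fh d m l) (pvar x) = proj_series d (hook_eval (pvar x))" for x
    using hook_eval_H[of "fst x" "snd x"] by (simp add: subst_poly_pvar[OF rhom_trat] Fh_def H_def split_def)
qed

lemma rhom_T: "rhom (T f)"
  unfolding T_def by (rule rhom_subst_poly[OF rhom_id])

lemma T_cst: "T f (cst c) = c"
  unfolding T_def by (rule subst_poly_cst[OF rhom_id])

lemma T_Fsym: "T f (Fsym k l) = ((\<lambda>g. fls_X ^ 2 * fls_deriv g) ^^ l) (f k)"
  unfolding T_def Fsym_def by (subst subst_poly_pvar[OF rhom_id]) simp

lemma rhom_cst_trat: "rhom (\<lambda>c. cst (trat c) :: expr)"
  by (rule rhom_comp[OF rhom_trat rhom_cst])

lemma T_hook_subst: "T f (hook_subst g A) = subst_poly trat (\<lambda>(m, l). T f (g m l)) A"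
proof -
  have "(\<lambda>A. T f (hook_subst g A)) A = subst_poly trat (\<lambda>(m, l). T f (g m l)) A"
  proof (rule rhom_ext[OF rhom_comp[OF _ rhom_T] rhom_subst_poly[OF rhom_trat]])
    show "rhom (hook_subst g)" unfolding hook_subst_def by (rule rhom_subst_poly[OF rhom_cst_trat])
    show "T f (hook_subst g (cst c)) = subst_poly trat (\<lambda>(m, l). T f (g m l)) (cst c)" for c
      by (simp add: hook_subst_def subst_poly_cst[OF rhom_cst_trat] subst_poly_cst[OF rhom_trat] T_cst)
    show "T f (hook_subst g (pvar x)) = subst_poly trat (\<lambda>(m, l). T f (g m l)) (pvar x)" for x
      by (simp add: hook_subst_def subst_poly_pvar[OF rhom_cst_trat] subst_poly_pvar[OF rhom_trat] split_def)
  qed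
  then show ?thesis .
qed

text \<open>By the bound on hooks, the substitution \<open>g\<close> has to be correct only up to
  index \<open>M\<close>.\<close>

lemma T_hook_subst_KP:
  assumes "xs \<noteq> []" "0 \<notin> set xs" "sum_list xs + 1 - length xs \<le> M"
    and g: "\<And>m l. 1 \<le> m \<Longrightarrow> m \<le> M \<Longrightarrow> T (F_proj d) (g m l) = Fh d m l"
  shows "T (F_proj d) (hook_subst g (KP xs)) = proj_series d (F_der xs)"
proof -
  have "pvars (KP xs) \<subseteq> hooks_upto M"
    using KP_eval(2)[OF assms(1,2)] hooks_upto_mono[OF assms(3)] by (auto simp: pvars_in_def)
  then have "T (F_proj d) (hook_subst g (KP xs)) = subst_poly trat (\<lambda>(m, l). Fh d m l) (KP xs)"
    unfolding T_hook_subst by (intro subst_poly_cong) (auto simp: hooks_upto_def g)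
  then show ?thesis by (simp add: subst_trat_Fh KP_eval(1)[OF assms(1,2)])
qed

lemma tp_tp_inv: "tp_inv d * (tp d * f) = f"
proof -
  have "Poly_Mapping.single (VarP d) (- 1) + Poly_Mapping.single (VarP d) 1 = (0 :: var \<Rightarrow>\<^sub>0 int)"
    by (simp flip: single_add)
  then have "tp_inv d * tp d = 1"
    by (simp add: tp_inv_def tp_def pvar_def mult_single)
  then show ?thesis by (simp flip: mult.assoc)
qed

lemma trat_inverse_mult: "m \<noteq> 0 \<Longrightarrow> trat (1 / of_nat m) * (of_nat m * f) = f"
proof -
  assume "m \<noteq> 0"
  then have "trat (1 / of_nat m) * of_nat m = 1"
    using of_nat_mult_cst_inverse[of m] by (simp add: trat_def fls_of_nat mult.commute)
  then show ?thesis by (simp flip: mult.assoc)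
qed

text \<open>In constraint k = m - d the unknown F_(m,1^l) appears with the coefficient m p_d, and
  p_d is invertible; solving for it is the recursion of \<open>G\<close>.\<close>

theorem T_G:
  assumes d: "2 \<le> d"
  shows "1 \<le> m \<Longrightarrow> m \<le> 2 * d - 1 \<Longrightarrow> T (F_proj d) (G d m l) = Fh d m l"
proof (induction m arbitrary: l rule: less_induct)
  case (less m)
  interpret T: rhom "T (F_proj d)" by (rule rhom_T)
  have Fs: "T (F_proj d) (Fsym i r) = Fh d i r" for i r by (simp add: T_Fsym Fh_deriv)
  show ?case
  proof (cases "m < d")
    case True
    then show ?thesis by (subst G.simps) (simp add: Fs)
  next
    case False
    define k where "k = m - d"
    have m: "m = d + k" "k < d" using False less.prems d by (auto simp: k_def)
    let ?Q = "\<Sum>i\<in>{1..<k}. of_nat (i * (k - i)) *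
          ((\<Sum>r\<le>l. of_nat (l choose r) * Fh d i r * Fh d (k - i) (l - r)) + proj_series d (F_der (i # (k - i) # replicate l 1)))"
    have Q: "T (F_proj d) (hook_subst Fsym (KP (i # (k - i) # replicate l 1))) = proj_series d (F_der (i # (k - i) # replicate l 1))"
      if "i \<in> {1..<k}" for i
      using that m by (intro T_hook_subst_KP[where M="2 * d"]) (auto simp: Fs sum_list_replicate)
    have "T (F_proj d) (\<Sum>i\<in>{1..<k}. of_nat (i * (k - i)) *
             ((\<Sum>r\<le>l. of_nat (l choose r) * Fsym i r * Fsym (k - i) (l - r)) +
              hook_subst Fsym (KP (i # (k - i) # replicate l 1)))) = ?Q"
      unfolding T.sum by (intro sum.cong refl) (simp only: T.mult T.of_nat T.add T.sum Fs Q)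
    note TQ = this
    \<comment> \<open>The induction applies because d is at least 2: k + 1 < k + d = m.\<close>
    have G1: "T (F_proj d) (G d (k + 1) r) = Fh d (k + 1) r" for r
      using m d by (intro less.IH) auto
    have G2: "T (F_proj d) (G d (d + j) l) = Fh d (d + j) l" if "j \<in> {..<k}" for j
      using m that d by (intro less.IH) auto
    have nd: "m - d = k" by (simp add: m)
    have G: "G d m l = cst (trat (1 / of_nat m) * tp_inv d) *
       (- (\<Sum>i\<in>{1..<k}. of_nat (i * (k - i)) *
             ((\<Sum>r\<le>l. of_nat (l choose r) * Fsym i r * Fsym (k - i) (l - r)) +
              hook_subst Fsym (KP (i # (k - i) # replicate l 1))))
        + of_nat (k + 1) * cst fls_X_inv * G d (k + 1) l
        - cst (tu + tv) * of_nat k * Fsym k l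
        - (if l = 0 then 0 else of_nat (l * (k + 1)) * G d (k + 1) (l - 1))
        - (if k = 0 \<and> l = 0 then cst (tu * tv) else 0)
        - (\<Sum>i\<in>{1..<d - k}. of_nat (i + k) * cst (tp i) * Fsym (i + k) l)
        - (\<Sum>j\<in>{..<k}. of_nat (d + j) * cst (tp (d + j - k)) * G d (d + j) l))"
    proof -
      have "m = d \<longleftrightarrow> k = 0" using m by auto
      then show ?thesis using False d less.prems by (subst G.simps) (simp only: nd if_False if_True simp_thms)
    qed
    have S1: "T (F_proj d) (\<Sum>i\<in>{1..<d - k}. of_nat (i + k) * cst (tp i) * Fsym (i + k) l) =
      (\<Sum>i\<in>{1..<d - k}. of_nat (i + k) * tp i * Fh d (i + k) l)"
      by (simp only: T.sum T.mult T.of_nat T_cst Fs)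
    have S2: "T (F_proj d) (\<Sum>j\<in>{..<k}. of_nat (d + j) * cst (tp (d + j - k)) * G d (d + j) l) =
      (\<Sum>j\<in>{..<k}. of_nat (d + j) * tp (d + j - k) * Fh d (d + j) l)"
      unfolding T.sum by (intro sum.cong refl) (simp only: T.mult T.of_nat T_cst G2)
    have I1: "T (F_proj d) (if l = 0 then 0 else of_nat (l * (k + 1)) * G d (k + 1) (l - 1)) =
      of_nat (l * (k + 1)) * Fh d (k + 1) (l - 1)"
      by (cases "l = 0") (simp_all only: T.zero T.mult T.of_nat G1 if_True if_False mult_0 of_nat_0 mult_zero_left simp_thms)
    have I2: "T (F_proj d) (if k = 0 \<and> l = 0 then cst (tu * tv) else 0) = (if k = 0 \<and> l = 0 then tu * tv else 0)"
      by (simp add: T_cst T.zero)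
    \<comment> \<open>Indices i + k below d belong to unknowns, those from d to m - 1 to earlier
      values of \<open>G\<close>, and i = d gives the term for which the constraint is
      solved.\<close>
    have split: "(\<Sum>i=1..d. of_nat (i + k) * tp i * Fh d (i + k) l) =
      (\<Sum>i\<in>{1..<d - k}. of_nat (i + k) * tp i * Fh d (i + k) l)
      + (\<Sum>j\<in>{..<k}. of_nat (d + j) * tp (d + j - k) * Fh d (d + j) l) + of_nat m * tp d * Fh d m l"
    proof -
      have "{1..d} = ({1..<d - k} \<union> {d - k..<d}) \<union> {d}" using m d by auto
      then have "(\<Sum>i=1..d. of_nat (i + k) * tp i * Fh d (i + k) l) =
        (\<Sum>i\<in>{1..<d - k}. of_nat (i + k) * tp i * Fh d (i + k) l)
        + (\<Sum>i\<in>{d - k..<d}. of_nat (i + k) * tp i * Fh d (i + k) l) + of_nat (d + k) * tp d * Fh d (d + k) l"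
        by (simp only:) (subst sum.union_disjoint; (subst sum.union_disjoint)?; auto)
      also have "(\<Sum>i\<in>{d - k..<d}. of_nat (i + k) * tp i * Fh d (i + k) l) =
        (\<Sum>j\<in>{..<k}. of_nat (d + j) * tp (d + j - k) * Fh d (d + j) l)"
        using m by (intro sum.reindex_bij_witness[of _ "\<lambda>j. d + j - k" "\<lambda>i. i + k - d"]) auto
      finally show ?thesis by (simp only: m)
    qed
    have X: "fls_X_inv * (fls_X * f) = (f :: tseries)" for f
      by (simp add: fls_X_inv_times_conv_shift fls_X_times_conv_shift)
    have "of_nat (k + 1) * fls_X_inv * Fh d (k + 1) l = fls_X_inv * (of_nat (k + 1) * Fh d (k + 1) l)"
      by (simp only: mult_ac)
    also have "\<dots> = (\<Sum>i=1..d. of_nat (i + k) * tp i * Fh d (i + k) l) + of_nat (l * (k + 1)) * Fh d (k + 1) (l - 1)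
      + (tu + tv) * of_nat k * Fh d k l + ?Q + (if k = 0 \<and> l = 0 then tu * tv else 0)"
      unfolding Fh_virasoro X ..
    finally have V: "- ?Q + of_nat (k + 1) * fls_X_inv * Fh d (k + 1) l - (tu + tv) * of_nat k * Fh d k l
      - of_nat (l * (k + 1)) * Fh d (k + 1) (l - 1) - (if k = 0 \<and> l = 0 then tu * tv else 0)
      - (\<Sum>i\<in>{1..<d - k}. of_nat (i + k) * tp i * Fh d (i + k) l)
      - (\<Sum>j\<in>{..<k}. of_nat (d + j) * tp (d + j - k) * Fh d (d + j) l) = of_nat m * tp d * Fh d m l"
      unfolding split by (simp del: of_nat_mult of_nat_add)
    have "T (F_proj d) (G d m l) = trat (1 / of_nat m) * tp_inv d * (of_nat m * tp d * Fh d m l)"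
      unfolding G T.mult T.diff T.add T.uminus TQ S1 S2 I1 I2 T_cst T.of_nat G1 Fs V ..
    also have "\<dots> = trat (1 / of_nat m) * (of_nat m * (tp_inv d * (tp d * Fh d m l)))"
      by (simp only: mult_ac)
    also have "\<dots> = Fh d m l"
      using less.prems trat_inverse_mult[of m] by (simp add: tp_tp_inv)
    finally show ?thesis .
  qed
qed

text \<open>The hooks that occur have first part at most i + k - 1, hence at most 2 d - 1, the range
  of \<open>T_G\<close>.\<close>

lemma T_G_KP:
  assumes d: "2 \<le> d" and i: "1 \<le> i" "i \<le> d" and k: "1 \<le> k" "k \<le> d"
  shows "T (F_proj d) (hook_subst (G d) (KP [i, k])) = proj_series d (F_der [i, k])"
  by (rule T_hook_subst_KP[where M="2 * d - 1"]) (use assms T_G[OF d] in auto)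

theorem E_eq_F_proj:
  assumes d: "2 \<le> d" and k: "k \<in> {1..d - 1}"
  shows "E_eq d k (F_proj d) = 0"
proof -
  let ?F = "F_proj d"
  have sum: "(\<Sum>i=1..d. of_nat i * tp i * T ?F (hook_subst (G d) (KP [i, j]))) = fls_X * fls_deriv (?F j) - of_nat j * ?F j"
    if "1 \<le> j" "j \<le> d" for j
  proof -
    have "(\<Sum>i=1..d. of_nat i * tp i * T ?F (hook_subst (G d) (KP [i, j]))) = (\<Sum>i=1..d. of_nat i * tp i * proj_series d (F_der [i, j]))"
      using that by (intro sum.cong refl) (simp add: T_G_KP[OF d])
    then show ?thesis using Fh_euler[OF that(1), of d] by (simp add: eq_diff_eq)
  qed
  show ?thesis
  proof (cases "k = 1")
    case False
    have "1 \<le> k" "k \<le> d" using k by auto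
    then show ?thesis using False sum[of k] by (simp add: E_eq_def)
  next
    case True
    define S where "S = (\<Sum>i=1..d - 1. of_nat i * tp i * ?F i)"
    define S' where "S' = (\<Sum>i=1..d - 1. of_nat i * tp i * fls_deriv (?F i))"
    \<comment> \<open>F_d is not among the unknowns. The factor d p_d in E_1 makes it enter only
      through this product, which constraint 0 determines.\<close>
    define A where "A = of_nat d * tp d * ?F d"
    have Xi: "fls_X_inv * (fls_X * f) = f" "fls_X * (fls_X_inv * f) = f" for f :: tseries
      by (simp_all add: fls_X_inv_times_conv_shift fls_X_times_conv_shift)
    have "?F 1 = fls_X * ((\<Sum>i=1..d. of_nat i * tp i * ?F i) + tu * tv)"
      using Fh_virasoro[of 0 d 0] by (simp add: F_proj_Fh)
    also have "{1..d} = insert d {1..d - 1}" using d by auto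
    finally have "fls_X_inv * ?F 1 = A + S + tu * tv" using d by (simp add: Xi A_def S_def)
    then have A: "A = fls_X_inv * ?F 1 - S - tu * tv" by (simp add: algebra_simps)
    have dc: "fls_deriv (of_nat i * tp i * f) = of_nat i * tp i * fls_deriv f" for i f
      unfolding tp_def fls_of_nat by simp
    have "fls_deriv S = S'" unfolding S_def S'_def fls_deriv_sum dc ..
    moreover have "fls_deriv (tu * tv) = 0" by (simp add: tu_def tv_def)
    \<comment> \<open>Differentiating t^(-1) gives one more -t^(-1) F_1 after multiplication by t;
      together with -d A this accounts for the coefficient d + 1 in E_1.\<close>
    ultimately have dA: "fls_deriv A = fls_X_inv * fls_deriv (?F 1) - fls_X_inv * (fls_X_inv * ?F 1) - S'"
      unfolding A by (simp add: power2_eq_square algebra_simps)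
    have "of_nat d * tp d * (fls_X * fls_deriv (?F d) - of_nat d * ?F d) = fls_X * fls_deriv A - of_nat d * A"
      unfolding A_def dc by (simp add: algebra_simps)
    also have "\<dots> = fls_deriv (?F 1) - fls_X_inv * ?F 1 - fls_X * S' - of_nat d * (fls_X_inv * ?F 1 - S - tu * tv)"
      unfolding dA unfolding A by (simp add: right_diff_distrib Xi)
    finally have D: "of_nat d * tp d * (fls_X * fls_deriv (?F d) - of_nat d * ?F d) =
      fls_deriv (?F 1) - fls_X_inv * ?F 1 - fls_X * S' - of_nat d * (fls_X_inv * ?F 1 - S - tu * tv)" .
    have E: "(\<Sum>i=1..d - 1. of_nat i * tp i * (of_nat d * ?F i - fls_X * fls_deriv (?F i))) = of_nat d * S - fls_X * S'"
      unfolding S_def S'_def sum_distrib_left sum_subtractf[symmetric]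
      by (intro sum.cong refl) (simp only: right_diff_distrib mult_ac)
    have "E_eq d 1 ?F = - (of_nat d * tp d * (fls_X * fls_deriv (?F d) - of_nat d * ?F d)) + fls_deriv (?F 1)
      - of_nat (d + 1) * fls_X_inv * ?F 1 + (of_nat d * S - fls_X * S') + of_nat d * tu * tv"
      unfolding E_eq_def E sum[OF order_trans[OF one_le_numeral d] order_refl] by simp
    also have "\<dots> = 0" unfolding D by (simp add: algebra_simps)
    finally show ?thesis using True by simp
  qed
qed

section \<open>Differential polynomials\<close>

text \<open>The coefficients of single powers of t in \<open>coeff_ring\<close>, separated from the
  condition of finite support in t.\<close>

definition laurent_ring :: "nat \<Rightarrow> laurent set" where
  "laurent_ring d = {c. \<forall>m\<in>Poly_Mapping.keys c. Poly_Mapping.keys m \<subseteq> {VarU, VarV} \<union> VarP ` {1..d} \<and>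
        (\<forall>x. x \<noteq> VarP d \<longrightarrow> 0 \<le> Poly_Mapping.lookup m x)}"

lemma coeff_ring_alt: "coeff_ring d = {c. finite {n. fls_nth c n \<noteq> 0} \<and> (\<forall>n. fls_nth c n \<in> laurent_ring d)}"
  by (auto simp: coeff_ring_def laurent_ring_def)

lemma laurent_ring_add: "a \<in> laurent_ring d \<Longrightarrow> b \<in> laurent_ring d \<Longrightarrow> a + b \<in> laurent_ring d"
  using keys_add[of a b] unfolding laurent_ring_def by blast

lemma laurent_ring_mult: "a \<in> laurent_ring d \<Longrightarrow> b \<in> laurent_ring d \<Longrightarrow> a * b \<in> laurent_ring d"
proof -
  assume a: "a \<in> laurent_ring d" and b: "b \<in> laurent_ring d"
  show ?thesis
    unfolding laurent_ring_def
  proof (clarify, intro conjI allI impI)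
    fix m assume "m \<in> Poly_Mapping.keys (a * b)"
    then obtain x y where m: "m = x + y" "x \<in> Poly_Mapping.keys a" "y \<in> Poly_Mapping.keys b"
      using keys_mult[of a b] by blast
    then show "Poly_Mapping.keys m \<subseteq> {VarU, VarV} \<union> VarP ` {1..d}"
      using a b keys_add[of x y] unfolding laurent_ring_def by blast
    fix z assume "z \<noteq> VarP d"
    then show "0 \<le> Poly_Mapping.lookup m z"
      using a b m by (auto simp: laurent_ring_def lookup_add)
  qed
qed

lemma laurent_ring_0: "0 \<in> laurent_ring d"
  by (simp add: laurent_ring_def)

lemma laurent_ring_sum: "(\<And>x. x \<in> S \<Longrightarrow> f x \<in> laurent_ring d) \<Longrightarrow> sum f S \<in> laurent_ring d"
  by (induction S rule: infinite_finite_induct) (auto simp: laurent_ring_0 laurent_ring_add)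

lemma coeff_ring_add: "a \<in> coeff_ring d \<Longrightarrow> b \<in> coeff_ring d \<Longrightarrow> a + b \<in> coeff_ring d"
proof -
  assume a: "a \<in> coeff_ring d" and b: "b \<in> coeff_ring d"
  have "finite {n. fls_nth (a + b) n \<noteq> 0}"
    by (rule finite_subset[of _ "{n. fls_nth a n \<noteq> 0} \<union> {n. fls_nth b n \<noteq> 0}"]) (use a b in \<open>auto simp: coeff_ring_alt\<close>)
  then show ?thesis using a b by (auto simp: coeff_ring_alt laurent_ring_add)
qed

lemma coeff_ring_mult: "a \<in> coeff_ring d \<Longrightarrow> b \<in> coeff_ring d \<Longrightarrow> a * b \<in> coeff_ring d"
proof -
  assume a: "a \<in> coeff_ring d" and b: "b \<in> coeff_ring d"
  let ?s = "\<lambda>c. {n. fls_nth c n \<noteq> 0}"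
  have "?s (a * b) \<subseteq> (\<lambda>(i, j). i + j) ` (?s a \<times> ?s b)"
  proof
    fix n assume "n \<in> ?s (a * b)"
    then have "(\<Sum>i=fls_subdegree a..n - fls_subdegree b. fls_nth a i * fls_nth b (n - i)) \<noteq> 0"
      unfolding mem_Collect_eq fls_times_nth(2) .
    then obtain i where "fls_nth a i * fls_nth b (n - i) \<noteq> 0" by (rule sum.not_neutral_contains_not_neutral)
    then have "fls_nth a i \<noteq> 0" "fls_nth b (n - i) \<noteq> 0" by auto
    then show "n \<in> (\<lambda>(i, j). i + j) ` (?s a \<times> ?s b)" by (intro image_eqI[of _ _ "(i, n - i)"]) auto
  qed
  moreover have "finite ((\<lambda>(i, j). i + j) ` (?s a \<times> ?s b))" using a b by (auto simp: coeff_ring_alt)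
  ultimately have "finite (?s (a * b))" by (rule finite_subset)
  moreover have "fls_nth (a * b) n \<in> laurent_ring d" for n
    unfolding fls_times_nth(2) using a b by (intro laurent_ring_sum laurent_ring_mult) (auto simp: coeff_ring_alt)
  ultimately show ?thesis by (simp add: coeff_ring_alt)
qed

lemma coeff_ring_const: "c \<in> laurent_ring d \<Longrightarrow> fls_const c \<in> coeff_ring d"
proof -
  assume c: "c \<in> laurent_ring d"
  have "finite {n. fls_nth (fls_const c) n \<noteq> 0}" by (rule finite_subset[of _ "{0}"]) auto
  then show ?thesis using c by (auto simp: coeff_ring_alt laurent_ring_0)
qed

lemma laurent_ring_cst: "cst c \<in> laurent_ring d"
  by (auto simp: laurent_ring_def cst_def)

lemma coeff_ring_0: "0 \<in> coeff_ring d"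
  using coeff_ring_const[OF laurent_ring_0] by simp

lemma coeff_ring_trat: "trat c \<in> coeff_ring d"
  unfolding trat_def by (intro coeff_ring_const laurent_ring_cst)

lemma coeff_ring_of_nat: "of_nat n \<in> coeff_ring d"
  using coeff_ring_const[OF laurent_ring_cst[of "of_nat n"]] by (simp add: fls_of_nat)

lemma coeff_ring_1: "1 \<in> coeff_ring d"
  using coeff_ring_of_nat[of 1] by simp

lemma coeff_ring_minus_1: "-1 \<in> coeff_ring d"
  using coeff_ring_const[OF laurent_ring_cst[of "-1"]] by (simp add: cst_uminus)

lemma coeff_ring_tu: "tu \<in> coeff_ring d" and coeff_ring_tv: "tv \<in> coeff_ring d"
  unfolding tu_def tv_def by (auto intro!: coeff_ring_const simp: laurent_ring_def pvar_def lookup_single when_def)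

lemma coeff_ring_tp: "1 \<le> i \<Longrightarrow> i \<le> d \<Longrightarrow> tp i \<in> coeff_ring d"
  unfolding tp_def by (auto intro!: coeff_ring_const simp: laurent_ring_def pvar_def lookup_single when_def)

lemma coeff_ring_tp_inv: "1 \<le> d \<Longrightarrow> tp_inv d \<in> coeff_ring d"
  unfolding tp_inv_def by (auto intro!: coeff_ring_const simp: laurent_ring_def lookup_single when_def)

lemma coeff_ring_X: "fls_X \<in> coeff_ring d" and coeff_ring_X_inv: "fls_X_inv \<in> coeff_ring d"
proof -
  have 1: "1 \<in> laurent_ring d" using laurent_ring_cst[of 1 d] by simp
  have "finite {n. fls_nth (fls_X :: tseries) n \<noteq> 0}" by (rule finite_subset[of _ "{1}"]) auto
  then show "fls_X \<in> coeff_ring d" using 1 by (auto simp: coeff_ring_alt laurent_ring_0)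
  have "finite {n. fls_nth (fls_X_inv :: tseries) n \<noteq> 0}" by (rule finite_subset[of _ "{-1}"]) auto
  then show "fls_X_inv \<in> coeff_ring d" using 1 by (auto simp: coeff_ring_alt laurent_ring_0)
qed

lemma coeff_ring_power: "a \<in> coeff_ring d \<Longrightarrow> a ^ n \<in> coeff_ring d"
  by (induction n) (auto simp: coeff_ring_1 coeff_ring_mult)

lemma admissible_add: "A \<in> admissible d \<Longrightarrow> B \<in> admissible d \<Longrightarrow> A + B \<in> admissible d"
  using keys_add[of A B] unfolding admissible_def mem_Collect_eq lookup_add by (blast intro: coeff_ring_add)

lemma admissible_single:
  "c \<in> coeff_ring d \<Longrightarrow> Poly_Mapping.keys m \<subseteq> {1..d - 1} \<times> UNIV \<Longrightarrow> Poly_Mapping.single m c \<in> admissible d"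
  by (auto simp: admissible_def lookup_single when_def coeff_ring_0)

lemma admissible_sum: "(\<And>x. x \<in> S \<Longrightarrow> f x \<in> admissible d) \<Longrightarrow> sum f S \<in> admissible d"
proof (induction S rule: infinite_finite_induct)
  case (insert x S)
  then show ?case by (simp add: admissible_add)
qed (auto simp: admissible_def coeff_ring_0)

lemma admissible_mult:
  assumes A: "A \<in> admissible d" and B: "B \<in> admissible d" shows "A * B \<in> admissible d"
proof -
  have "A * B = (\<Sum>m\<in>Poly_Mapping.keys A. Poly_Mapping.single m (Poly_Mapping.lookup A m)) *
    (\<Sum>n\<in>Poly_Mapping.keys B. Poly_Mapping.single n (Poly_Mapping.lookup B n))"
    by (simp only: poly_mapping_sum_single[symmetric])
  also have "\<dots> = (\<Sum>m\<in>Poly_Mapping.keys A. \<Sum>n\<in>Poly_Mapping.keys B.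
    Poly_Mapping.single (m + n) (Poly_Mapping.lookup A m * Poly_Mapping.lookup B n))"
    by (simp only: sum_product mult_single)
  also have "\<dots> \<in> admissible d"
    using A B by (intro admissible_sum admissible_single coeff_ring_mult)
      (auto simp: admissible_def keys_add_exponent)
  finally show ?thesis .
qed

section \<open>Closure properties of differential polynomials\<close>

definition ode_eval :: "expr \<Rightarrow> (nat \<Rightarrow> tseries) \<Rightarrow> tseries" where
  "ode_eval A f = subst_poly (\<lambda>c. c) (\<lambda>(k, j). (fls_deriv ^^ j) (f k)) A"

lemma is_ode_alt: "is_ode d \<Phi> \<longleftrightarrow> (\<exists>A\<in>admissible d. \<forall>f. \<Phi> f = ode_eval A f)"
  by (simp add: is_ode_def ode_eval_def)

lemma rhom_ode_eval: "rhom (\<lambda>A. ode_eval A f)"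
  unfolding ode_eval_def by (rule rhom_subst_poly[OF rhom_id])

lemma is_ode_add: "is_ode d \<Phi> \<Longrightarrow> is_ode d \<Psi> \<Longrightarrow> is_ode d (\<lambda>f. \<Phi> f + \<Psi> f)"
  unfolding is_ode_alt using admissible_add rhom.add[OF rhom_ode_eval] by metis

lemma is_ode_mult: "is_ode d \<Phi> \<Longrightarrow> is_ode d \<Psi> \<Longrightarrow> is_ode d (\<lambda>f. \<Phi> f * \<Psi> f)"
  unfolding is_ode_alt using admissible_mult rhom.mult[OF rhom_ode_eval] by metis

lemma is_ode_const: "c \<in> coeff_ring d \<Longrightarrow> is_ode d (\<lambda>f. c)"
  unfolding is_ode_alt
  by (rule bexI[of _ "cst c"]) (auto simp: ode_eval_def subst_poly_cst[OF rhom_id] cst_def intro!: admissible_single,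
      simp add: subst_poly_cst[OF rhom_id, unfolded cst_def])

lemma is_ode_deriv: "1 \<le> k \<Longrightarrow> k \<le> d - 1 \<Longrightarrow> is_ode d (\<lambda>f. (fls_deriv ^^ j) (f k))"
  unfolding is_ode_alt
  by (rule bexI[of _ "pvar (k, j)"])
    (simp add: ode_eval_def subst_poly_pvar[OF rhom_id], simp add: pvar_def admissible_single coeff_ring_1)

lemma is_ode_uminus: "is_ode d \<Phi> \<Longrightarrow> is_ode d (\<lambda>f. - \<Phi> f)"
  using is_ode_mult[OF is_ode_const[OF coeff_ring_minus_1]] by fastforce

lemma is_ode_diff: "is_ode d \<Phi> \<Longrightarrow> is_ode d \<Psi> \<Longrightarrow> is_ode d (\<lambda>f. \<Phi> f - \<Psi> f)"
  using is_ode_add[OF _ is_ode_uminus] by fastforce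

lemma is_ode_0: "is_ode d (\<lambda>f. 0)"
  by (rule is_ode_const[OF coeff_ring_0])

lemma is_ode_sum: "(\<And>x. x \<in> S \<Longrightarrow> is_ode d (\<Phi> x)) \<Longrightarrow> is_ode d (\<lambda>f. \<Sum>x\<in>S. \<Phi> x f)"
proof (induction S rule: infinite_finite_induct)
  case (insert x S)
  then show ?case by (simp add: is_ode_add)
qed (simp_all add: is_ode_0)

lemma is_ode_prod: "(\<And>x. x \<in> S \<Longrightarrow> is_ode d (\<Phi> x)) \<Longrightarrow> is_ode d (\<lambda>f. \<Prod>x\<in>S. \<Phi> x f)"
proof (induction S rule: infinite_finite_induct)
  case (insert x S)
  then show ?case by (simp add: is_ode_mult)
qed (simp_all add: is_ode_const coeff_ring_1)

lemma is_ode_power: "is_ode d \<Phi> \<Longrightarrow> is_ode d (\<lambda>f. \<Phi> f ^ n)"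
  by (induction n) (simp_all add: is_ode_const coeff_ring_1 is_ode_mult)

lemma is_ode_subst_trat:
  assumes "\<And>x. x \<in> pvars A \<Longrightarrow> is_ode d (\<lambda>f. g f x)"
  shows "is_ode d (\<lambda>f. subst_poly trat (g f) A)"
  unfolding subst_poly_def
  by (intro is_ode_sum is_ode_mult is_ode_prod is_ode_power is_ode_const coeff_ring_trat assms)
    (auto simp: pvars_def)

text \<open>This links the two readings of the symbols: powers of t^2 d/dt in \<open>T\<close>,
  ordinary derivatives in \<open>is_ode\<close>. The coefficients are natural numbers times powers
  of t and so lie in \<open>coeff_ring\<close>.\<close>

lemma euler_power_expansion:
  "\<exists>a :: nat \<Rightarrow> nat. \<forall>g :: tseries. ((\<lambda>g. fls_X ^ 2 * fls_deriv g) ^^ l) g =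
    (\<Sum>j\<le>l. of_nat (a j) * fls_X ^ (l + j) * (fls_deriv ^^ j) g)"
proof (induction l)
  case 0
  show ?case by (rule exI[of _ "\<lambda>_. 1"]) simp
next
  case (Suc l)
  then obtain a :: "nat \<Rightarrow> nat" where a: "\<And>g :: tseries. ((\<lambda>g. fls_X ^ 2 * fls_deriv g) ^^ l) g =
    (\<Sum>j\<le>l. of_nat (a j) * fls_X ^ (l + j) * (fls_deriv ^^ j) g)" by blast
  \<comment> \<open>Applying t^2 d/dt to t^(l+j) g^(j) gives (l + j) t^(l+j+1) g^(j) + t^(l+j+2)
    g^(j+1). With this recurrence the coefficients for j up to l are the unsigned Lah
    numbers.\<close>
  define b where "b j = (if j \<le> l then a j * (l + j) else 0) + (if j = 0 then 0 else a (j - 1))" for j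
  have dX: "fls_X ^ 2 * fls_deriv (of_nat c * fls_X ^ n * h) = of_nat (c * n) * fls_X ^ (n + 1) * h + of_nat c * fls_X ^ (n + 2) * fls_deriv h"
    for c n and h :: tseries
  proof -
    have d: "der (\<lambda>x. x) (fls_deriv :: tseries \<Rightarrow> tseries)" by unfold_locales (simp_all add: algebra_simps)
    have "fls_deriv (of_nat c * fls_X ^ n * h) = of_nat c * (of_nat n * fls_X ^ (n - 1) * h + fls_X ^ n * fls_deriv h)"
      using der_power[OF d, of fls_X n] by (simp add: algebra_simps)
    then show ?thesis
      by (cases n) (simp_all add: algebra_simps power2_eq_square)
  qed
  have "((\<lambda>g. fls_X ^ 2 * fls_deriv g) ^^ Suc l) g = (\<Sum>j\<le>Suc l. of_nat (b j) * fls_X ^ (Suc l + j) * (fls_deriv ^^ j) g)" for g :: tseries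
  proof -
    have "((\<lambda>g. fls_X ^ 2 * fls_deriv g) ^^ Suc l) g =
      (\<Sum>j\<le>l. of_nat (a j * (l + j)) * fls_X ^ (Suc l + j) * (fls_deriv ^^ j) g)
      + (\<Sum>j\<le>l. of_nat (a j) * fls_X ^ (Suc l + Suc j) * (fls_deriv ^^ Suc j) g)"
      by (simp only: funpow.simps comp_def a fls_deriv_sum sum_distrib_left dX sum.distrib) simp
    also have "(\<Sum>j\<le>l. of_nat (a j * (l + j)) * fls_X ^ (Suc l + j) * (fls_deriv ^^ j) g) =
      (\<Sum>j\<le>Suc l. of_nat (if j \<le> l then a j * (l + j) else 0) * fls_X ^ (Suc l + j) * (fls_deriv ^^ j) g)"
      by (intro sum.mono_neutral_cong_left) auto
    also have "(\<Sum>j\<le>l. of_nat (a j) * fls_X ^ (Suc l + Suc j) * (fls_deriv ^^ Suc j) g) =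
      (\<Sum>j\<le>Suc l. of_nat (if j = 0 then 0 else a (j - 1)) * fls_X ^ (Suc l + j) * (fls_deriv ^^ j) g)"
      by (subst sum.atMost_Suc_shift) simp
    finally show ?thesis by (simp only: b_def of_nat_add distrib_right sum.distrib)
  qed
  then show ?case by blast
qed

lemma is_ode_Fsym: "1 \<le> k \<Longrightarrow> k \<le> d - 1 \<Longrightarrow> is_ode d (\<lambda>f. T f (Fsym k l))"
proof -
  assume k: "1 \<le> k" "k \<le> d - 1"
  obtain a :: "nat \<Rightarrow> nat" where a: "\<And>g :: tseries. ((\<lambda>g. fls_X ^ 2 * fls_deriv g) ^^ l) g =
    (\<Sum>j\<le>l. of_nat (a j) * fls_X ^ (l + j) * (fls_deriv ^^ j) g)" using euler_power_expansion by blast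
  show ?thesis
    unfolding T_Fsym a using k
    by (intro is_ode_sum is_ode_mult is_ode_const is_ode_deriv coeff_ring_of_nat coeff_ring_power coeff_ring_X)
qed

lemma is_ode_hook_subst:
  assumes "\<And>m l. (m, l) \<in> pvars A \<Longrightarrow> is_ode d (\<lambda>f. T f (g m l))"
  shows "is_ode d (\<lambda>f. T f (hook_subst g A))"
  unfolding T_hook_subst using assms by (intro is_ode_subst_trat) auto

text \<open>The unknowns \<open>f\<close> are arbitrary, so the defining recursion is followed
  instead of the Virasoro constraints. The default 0 beyond 2 d - 1 is a differential polynomial
  too, which spares an upper bound on m.\<close>

lemma is_ode_G:
  assumes d: "2 \<le> d" shows "1 \<le> m \<Longrightarrow> is_ode d (\<lambda>f. T f (G d m l))"
proof (induction m arbitrary: l rule: less_induct)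
  case (less m)
  have hom: "T f (A + B) = T f A + T f B" "T f (A - B) = T f A - T f B" "T f (A * B) = T f A * T f B"
    "T f (- A) = - T f A" "T f (of_nat n) = of_nat n" "T f (sum g S) = (\<Sum>x\<in>S. T f (g x))" "T f 0 = 0"
    for f A B n and g :: "nat \<Rightarrow> expr" and S
  proof -
    interpret rhom "T f" by (rule rhom_T)
    show "T f (A + B) = T f A + T f B" "T f (A - B) = T f A - T f B" "T f (A * B) = T f A * T f B"
      "T f (- A) = - T f A" "T f (of_nat n) = of_nat n" "T f (sum g S) = (\<Sum>x\<in>S. T f (g x))" "T f 0 = 0"
      by (rule add diff mult uminus of_nat sum zero)+
  qed
  consider "m < d" | "d \<le> m" "m \<le> 2 * d - 1" | "2 * d - 1 < m" by linarith
  then show ?case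
  proof cases
    case 1
    then show ?thesis using less.prems by (subst G.simps) (simp add: is_ode_Fsym)
  next
    case 3
    then have "G d m l = 0" using d by (subst G.simps) simp
    then show ?thesis by (simp add: hom is_ode_0)
  next
    case 2
    define k where "k = m - d"
    have k: "k < d" "m = d + k" using 2 d by (auto simp: k_def)
    have G1: "is_ode d (\<lambda>f. T f (G d (k + 1) r))" for r using k d by (intro less.IH) auto
    have G2: "is_ode d (\<lambda>f. T f (G d (d + j) l))" if "j \<in> {..<k}" for j using k d that by (intro less.IH) auto
    \<comment> \<open>The factor k stays attached, since for k = 0 the symbol
      \<open>Fsym 0 l\<close> is not admissible and only its coefficient 0 removes it.\<close>
    have F1: "is_ode d (\<lambda>f. of_nat k * T f (Fsym k l))"
      using k by (cases "k = 0") (auto intro!: is_ode_0 is_ode_mult is_ode_const coeff_ring_of_nat is_ode_Fsym)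
    have KPi: "is_ode d (\<lambda>f. T f (hook_subst Fsym (KP (i # (k - i) # replicate l 1))))" if "i \<in> {1..<k}" for i
    proof (rule is_ode_hook_subst)
      fix a b assume "(a, b) \<in> pvars (KP (i # (k - i) # replicate l 1))"
      moreover have "pvars_in (hooks_upto (k - 1)) (KP (i # (k - i) # replicate l 1))"
        using KP_eval(2)[of "i # (k - i) # replicate l 1"] that by (simp add: sum_list_replicate)
      ultimately have "1 \<le> a" "a \<le> k - 1"
        by (auto simp: pvars_in_def hooks_upto_def)
      then show "is_ode d (\<lambda>f. T f (Fsym a b))"
        using k by (intro is_ode_Fsym) simp_all
    qed
    have md: "m - d = k" "m = d \<longleftrightarrow> k = 0" using k by auto
    have t1: "is_ode d (\<lambda>f. \<Sum>i\<in>{1..<k}. of_nat (i * (k - i)) *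
             ((\<Sum>r\<le>l. of_nat (l choose r) * T f (Fsym i r) * T f (Fsym (k - i) (l - r))) +
              T f (hook_subst Fsym (KP (i # (k - i) # replicate l 1)))))"
      by (intro is_ode_sum is_ode_mult is_ode_add is_ode_const coeff_ring_of_nat KPi is_ode_Fsym) (use k in auto)
    have t2: "is_ode d (\<lambda>f. T f (if l = 0 then 0 else of_nat (l * (k + 1)) * G d (k + 1) (l - 1)))"
      by (cases "l = 0") (simp_all only: hom if_True if_False is_ode_0 is_ode_mult is_ode_const coeff_ring_of_nat G1 simp_thms)
    have t3: "is_ode d (\<lambda>f. T f (if k = 0 \<and> l = 0 then cst (tu * tv) else 0))"
      by (cases "k = 0 \<and> l = 0")
        (simp_all only: hom T_cst if_True if_False is_ode_0 is_ode_const coeff_ring_mult coeff_ring_tu coeff_ring_tv simp_thms)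
    have t4: "is_ode d (\<lambda>f. \<Sum>i\<in>{1..<d - k}. of_nat (i + k) * tp i * T f (Fsym (i + k) l))"
      by (intro is_ode_sum is_ode_mult is_ode_const coeff_ring_of_nat coeff_ring_tp is_ode_Fsym) (use k in auto)
    have t5: "is_ode d (\<lambda>f. \<Sum>j\<in>{..<k}. of_nat (d + j) * tp (d + j - k) * T f (G d (d + j) l))"
      by (intro is_ode_sum is_ode_mult is_ode_const coeff_ring_of_nat coeff_ring_tp G2) (use k in auto)
    have md: "m - d = k" "m = d \<longleftrightarrow> k = 0" using k by auto
    have "G d m l = cst (trat (1 / of_nat m) * tp_inv d) *
       (- (\<Sum>i\<in>{1..<k}. of_nat (i * (k - i)) *
             ((\<Sum>r\<le>l. of_nat (l choose r) * Fsym i r * Fsym (k - i) (l - r)) +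
              hook_subst Fsym (KP (i # (k - i) # replicate l 1))))
        + of_nat (k + 1) * cst fls_X_inv * G d (k + 1) l
        - cst (tu + tv) * (of_nat k * Fsym k l)
        - (if l = 0 then 0 else of_nat (l * (k + 1)) * G d (k + 1) (l - 1))
        - (if k = 0 \<and> l = 0 then cst (tu * tv) else 0)
        - (\<Sum>i\<in>{1..<d - k}. of_nat (i + k) * cst (tp i) * Fsym (i + k) l)
        - (\<Sum>j\<in>{..<k}. of_nat (d + j) * cst (tp (d + j - k)) * G d (d + j) l))"
      \<comment> \<open>The recursion is rebracketed so that k and \<open>Fsym k l\<close> form the
        single factor treated in \<open>F1\<close>.\<close>
      unfolding mult.assoc[of "cst (tu + tv)", symmetric]
      using 2 d by (subst G.simps) (simp only: md not_less[symmetric] if_False if_True simp_thms)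
    then have "T f (G d m l) = trat (1 / of_nat m) * tp_inv d *
       (- (\<Sum>i\<in>{1..<k}. of_nat (i * (k - i)) *
             ((\<Sum>r\<le>l. of_nat (l choose r) * T f (Fsym i r) * T f (Fsym (k - i) (l - r))) +
              T f (hook_subst Fsym (KP (i # (k - i) # replicate l 1)))))
        + of_nat (k + 1) * fls_X_inv * T f (G d (k + 1) l)
        - (tu + tv) * (of_nat k * T f (Fsym k l))
        - T f (if l = 0 then 0 else of_nat (l * (k + 1)) * G d (k + 1) (l - 1))
        - T f (if k = 0 \<and> l = 0 then cst (tu * tv) else 0)
        - (\<Sum>i\<in>{1..<d - k}. of_nat (i + k) * tp i * T f (Fsym (i + k) l))
        - (\<Sum>j\<in>{..<k}. of_nat (d + j) * tp (d + j - k) * T f (G d (d + j) l)))" for f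
      by (simp only: hom T_cst)
    moreover have "is_ode d (\<lambda>f. trat (1 / of_nat m) * tp_inv d *
       (- (\<Sum>i\<in>{1..<k}. of_nat (i * (k - i)) *
             ((\<Sum>r\<le>l. of_nat (l choose r) * T f (Fsym i r) * T f (Fsym (k - i) (l - r))) +
              T f (hook_subst Fsym (KP (i # (k - i) # replicate l 1)))))
        + of_nat (k + 1) * fls_X_inv * T f (G d (k + 1) l)
        - (tu + tv) * (of_nat k * T f (Fsym k l))
        - T f (if l = 0 then 0 else of_nat (l * (k + 1)) * G d (k + 1) (l - 1))
        - T f (if k = 0 \<and> l = 0 then cst (tu * tv) else 0)
        - (\<Sum>i\<in>{1..<d - k}. of_nat (i + k) * tp i * T f (Fsym (i + k) l))
        - (\<Sum>j\<in>{..<k}. of_nat (d + j) * tp (d + j - k) * T f (G d (d + j) l))))"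
      using d by (intro is_ode_mult[OF is_ode_const] is_ode_diff is_ode_add is_ode_uminus t1 t2 t3 t4 t5 F1 G1
          coeff_ring_mult coeff_ring_add coeff_ring_trat coeff_ring_tp_inv coeff_ring_of_nat coeff_ring_X_inv
          coeff_ring_tu coeff_ring_tv) simp_all
    ultimately show ?thesis by (simp only:)
  qed
qed

theorem is_ode_E_eq:
  assumes d: "2 \<le> d" and k: "k \<in> {1..d - 1}"
  shows "is_ode d (E_eq d k)"
proof -
  have KPi: "is_ode d (\<lambda>f. T f (hook_subst (G d) (KP [i, j])))" if "1 \<le> i" "1 \<le> j" for i j
  proof (rule is_ode_hook_subst)
    fix a b assume "(a, b) \<in> pvars (KP [i, j])"
    then show "is_ode d (\<lambda>f. T f (G d a b))"
      using KP_eval(2)[of "[i, j]"] that by (intro is_ode_G[OF d]) (auto simp: pvars_in_def hooks_upto_def)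
  qed
  have F: "is_ode d (\<lambda>f. f i)" "is_ode d (\<lambda>f. fls_deriv (f i))" if "1 \<le> i" "i \<le> d - 1" for i
    using is_ode_deriv[OF that, of 0] is_ode_deriv[OF that, of 1] by simp_all
  note cl = is_ode_mult is_ode_add is_ode_diff is_ode_uminus is_ode_sum is_ode_const
    coeff_ring_of_nat coeff_ring_tp coeff_ring_X coeff_ring_X_inv coeff_ring_tu coeff_ring_tv KPi F
  show ?thesis
  proof (cases "k = 1")
    case True
    have "is_ode d (\<lambda>f. - (of_nat d * tp d * (\<Sum>i=1..d. of_nat i * tp i * T f (hook_subst (G d) (KP [i, d]))))
        + fls_deriv (f 1) - of_nat (d + 1) * fls_X_inv * f 1
        + (\<Sum>i=1..d - 1. of_nat i * tp i * (of_nat d * f i - fls_X * fls_deriv (f i)))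
        + of_nat d * tu * tv)"
      by (intro cl) (use d in auto)
    then show ?thesis by (simp add: E_eq_def[abs_def] True)
  next
    case False
    have "is_ode d (\<lambda>f. - (\<Sum>i=1..d. of_nat i * tp i * T f (hook_subst (G d) (KP [i, k])))
        + fls_X * fls_deriv (f k) - of_nat k * f k)"
      by (intro cl) (use d k in auto)
    then show ?thesis using False by (simp add: E_eq_def[abs_def])
  qed
qed

theorem theorem4p1:
  fixes d :: nat
  assumes "2 \<le> d"
  shows "(\<forall>k\<in>{1..d - 1}. is_ode d (E_eq d k)) \<and>
         (\<forall>k\<in>{1..d - 1}. E_eq d k (F_proj d) = 0)"
  using is_ode_E_eq[OF assms] E_eq_F_proj[OF assms] by blast

end
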